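(* Let $(S,d_S,\rho)$ be a rooted bcm space and $X$ a standard process on $S$ satisfying the DAC condition with heat kernel $p$. Suppose that (a) $X$ is conservative, the law map $\mathcal L_X\colon S\to\mathcal P(D_{L^0}(\mathbb R_{\ge0},S))$ is continuous, and $p(t,x,y)$ is finite and continuous in $(t,x,y)\in(0,\infty)\times S\times S$; (b) for all $r>0$ and $T>0$, $\displaystyle\lim_{R\to\infty}\sup_{x\in S^{(r)}}P^x(\breve\sigma_{S^{(R)}}<T)=0$. Let $\mu$ be a Radon measure on $S$ in the local Kato class of $X$, and let $\Pi$ be the associated STOM. For $R>1$ set $$\Pi^{( *,R)}(dx\,dt)=\Bigl(\int_{R-1}^R\mathbf 1_{S^{(r)}}(x)\,dr\Bigr)\Pi(dx\,dt).$$ Then: (i) the map $\mathcal L_{(X,\Pi)}\colon S\to\mathcal P(D_{L^0}(\mathbb R_{\ge0},S)\times\mathcal M_{( *,\mathrm{fin})}(S\times\mathbb R_{\ge0}))$ is continuous; (ii) for any $r>0$, $N\in\mathbb N$ and $R>1$, $$\hat d\bigl(\mathcal L_{(X,\Pi^{( *,R)})},\mathcal L_{(X,\Pi)}\bigr)\le e^{-r}+e^{-N}+\sup_{x\in S^{(r)}}P^x\bigl(\breve\sigma_{S^{(R-1)}}<N\bigr);$$ (iii) $\mathcal L_{(X,\Pi^{( *,R)})}\to\mathcal L_{(X,\Pi)}$ as $R\to\infty$ in $C\bigl(S,\mathcal P(D_{L^0}(\mathbb R_{\ge0},S)\times\mathcal M_{( *,\mathrm{fin})}(S\times\mathbb R_{\ge0}))\bigr)$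 with the compact-convergence topology.
   Context: **Spaces and metrics.** A bcm space is a nonempty metric space all of whose closed bounded subsets are compact; rooted means with a distinguished point $\rho$; $S^{(r)}=\{x:d_S(\rho,x)\le r\}$. $\mathbb R_{\ge0}=[0,\infty)$. Products of metric spaces carry the max metric. $L^0(\mathbb R_{\ge0},S)$: Borel functions $\mathbb R_{\ge0}\to S$ modulo a.e. equality, with metric $\int_0^\infty e^{-t}(1\wedge d_S(\xi(t),\eta(t)))\,dt$; $D_{L^0}(\mathbb R_{\ge0},S)$: the càdlàg paths with the topology inherited from $L^0$. $\mathcal P(E)$: Borel probability measures on a separable metric space $E$ with the weak topology, metrized by the Prohorov metric $d^P(\mu,\nu)=\inf\{\varepsilon>0:\mu(A)\le\nu(A^{\varepsilon})+\varepsilon,\ \nu(A)\le\mu(A^{\varepsilon})+\varepsilon\ \forall\text{ Borel }A\}$ with $A^\varepsilon=\{x:\exists y\in A,\ d_E(x,y)\le\varepsilon\}$ (also used for finite measures). $\mathcal M_{( *,\mathrm{fin})}(S\times\mathbb R_{\ge0})$: Borel measures $\Sigma$ on $S\times\mathbb R_{\ge0}$ with $\Sigma(S\times[0,t])<\infty$ for all $t$, with the metric $\int_0^\infty e^{-t}\bigl(1\wedge d^P(\Sigma_1|_{S\times[0,t]},\Sigma_2|_{S\times[0,t]})\bigr)dt$. Let $\Xi=\mathcal P(L^0(\mathbb R_{\ge0},S)\times\mathcal M_{( *,\mathrm{fin})}(S\times\mathbb R_{\ge0}))$ with its Prohorov metric (laws on $D_{L^0}$ are viewed as laws on $L^0$).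 For continuous $F_1,F_2\colon S\to\Xi$, $\hat d(F_1,F_2)=\int_0^\infty e^{-r}\bigl(1\wedge d^H(\mathrm{graph}(F_1|_{S^{(r)}}),\mathrm{graph}(F_2|_{S^{(r)}}))\bigr)dr$, where $d^H$ is the Hausdorff metric on compact subsets of $S\times\Xi$. Exit time: $\breve\sigma_B=\inf\{t>0:X_t\notin B\}$. **Processes.** Standard processes $X=((X_t)_{t\ge0},(P^x)_{x\in S})$ are in the sense of Blumenthal–Getoor, with lifetime $\zeta$; $X$ is conservative if $P^x(\zeta=\infty)=1$ for all $x\in S$. $X$ satisfies the DAC (duality and absolute continuity) condition if there are a standard process $\check X$ on $S$ (laws $\check P^y$), a $\sigma$-finite Borel measure $m$ on $S$ and a Borel function $p\colon(0,\infty)\times S\times S\to[0,\infty]$ (the heat kernel) with $P^x(X_t\in dy)=p(t,x,y)m(dy)$, $\check P^y(\check X_t\in dx)=p(t,x,y)m(dx)$ and $p(t+s,x,y)=\int p(t,x,z)p(s,z,y)m(dz)$ for all $s,t>0$, $x,y\in S$. For $\alpha>0$ and a Borel measure $\nu$, $\mathcal R_p^\alpha\nu(x)=\int\int_0^\infty e^{-\alpha t}p(t,x,y)\,dt\,\nu(dy)$. A Borel set $B$ is thin if $P^x(\inf\{t>0:X_t\in B\}=0)=0$ for all $x$, and semipolar if contained in a countable union of thin sets. A Radon measure $\mu$ is in the local Kato class of $X$ if it vanishes on semipolar Borel sets and $\lim_{\alpha\to\infty}\|\mathcal R_p^\alpha(\mu|_K)\|_\infty=0$ for every compact $K$. A PCAF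 (positive continuous additive functional) is an adapted $[0,\infty]$-valued process $A$ such that on an event $\Lambda$ with $P^x(\Lambda)=1$ for all $x$ and $\theta_t\Lambda\subseteq\Lambda$: $A_0=0$, $t\mapsto A_t$ is continuous, finite for $t<\zeta$, constant on $[\zeta,\infty)$, and $A_{t+s}=A_t+A_s\circ\theta_t$. For $\mu$ in the local Kato class there is (Revuz correspondence) a PCAF $A$, unique up to equivalence, with $E^x[\int_0^\infty e^{-\alpha t}f(X_t)\,dA_t]=\mathcal R_p^\alpha(f\mu)(x)$ for all $\alpha>0$, Borel $f\ge0$, $x$; the associated STOM is the random measure $\Pi=\int_0^\infty\mathbf 1_{(X_t,t)}(\cdot)\,dA_t$ on $S\times\mathbb R_{\ge0}$. Law maps: $\mathcal L_Y(x)=P^x(Y\in\cdot)$. *)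

theory Defs
  imports "HOL-Probability.Probability"
begin

section \<open>Boundedly compact metric spaces\<close>

text \<open>
  A bcm space is a type of class \<^class>\<open>heine_borel\<close>: a (nonempty) metric space in which closed
  bounded sets are compact, see \<open>compact_eq_bounded_closed\<close>. Such a space is automatically Polish;
  registering this makes the Borel measurability results for second countable spaces available.
\<close>

lemma heine_borel_countable_dense:
  "\<exists>D::'a::heine_borel set. countable D \<and> (\<forall>x. \<forall>e>0. \<exists>y\<in>D. dist x y < e)"
proof -
  fix a :: 'a
  have "\<exists>K. finite K \<and> cball a (real n) \<subseteq> (\<Union>x\<in>K. ball x (1 / real (Suc k)))" for n k :: nat
    using compact_cball[of a "real n"] unfolding compact_eq_totally_bounded
    by (meson of_nat_0_less_iff zero_less_Suc zero_less_divide_1_iff)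
  then obtain K where K: "\<And>n k. finite (K n k)"
      "\<And>n k. cball a (real n) \<subseteq> (\<Union>x\<in>K n k. ball x (1 / real (Suc k)))"
    by metis
  have "\<exists>y\<in>(\<Union>n k. K n k). dist x y < e" if "e > 0" for x e
  proof -
    obtain n where "dist a x \<le> real n" using real_arch_simple by blast
    moreover obtain k where k: "1 / real (Suc k) < e"
      using \<open>e > 0\<close> nat_approx_posE by blast
    ultimately obtain y where y: "y \<in> K n k" "dist y x < 1 / real (Suc k)"
      using K(2)[of n k] by (auto simp: subset_iff)
    then have "dist x y < e" using k by (simp add: dist_commute)
    then show ?thesis using y by blast
  qed
  moreover have "countable (\<Union>n k. K n k)"
    using K(1) by (intro countable_UN) (auto intro: countable_finite)
  ultimately show ?thesis by blast
qed

instance heine_borel \<subseteq> polish_space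
proof
  obtain D :: "'a set" where D: "countable D" "\<And>x e. e > 0 \<Longrightarrow> \<exists>y\<in>D. dist x y < e"
    using heine_borel_countable_dense by blast
  define B where "B = (\<lambda>(d::'a, k). ball d (1 / real (Suc k))) ` (D \<times> UNIV)"
  have "topological_basis B"
  proof (rule topological_basisI)
    show "open b" if "b \<in> B" for b using that by (auto simp: B_def)
    fix U :: "'a set" and x assume "open U" "x \<in> U"
    then obtain e where e: "e > 0" "ball x e \<subseteq> U" using open_contains_ball by blast
    obtain k where k: "1 / real (Suc k) < e / 2"
      using e(1) nat_approx_posE[of "e/2"] by auto
    obtain d where d: "d \<in> D" "dist x d < 1 / real (Suc k)" using D(2)[of "1 / real (Suc k)" x] by auto
    have "ball d (1 / real (Suc k)) \<subseteq> U"
    proof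
      fix z assume "z \<in> ball d (1 / real (Suc k))"
      then have "dist x z < e" using d k dist_triangle[of x z d] by auto
      then show "z \<in> U" using e by auto
    qed
    then show "\<exists>B'\<in>B. x \<in> B' \<and> B' \<subseteq> U"
      using d by (auto simp: B_def dist_commute intro!: bexI[of _ "(d,k)"])
  qed
  moreover have "countable B" unfolding B_def using D(1) by auto
  ultimately show "\<exists>B::'a set set. countable B \<and> open = generate_topology B"
    by (metis topological_basis_imp_subbasis)
qed

section \<open>Product and Hausdorff metrics\<close>

text \<open>
  The library metric on products (type class instance and \<open>prod_metric\<close>) is the Euclidean one; the
  maximum metric is needed here.
\<close>

definition max_metric :: "'a metric \<Rightarrow> 'b metric \<Rightarrow> ('a \<times> 'b) metric" where
  "max_metric m1 m2 = metric (mspace m1 \<times> mspace m2,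
     \<lambda>(x, y) (x', y'). max (mdist m1 x x') (mdist m2 y y'))"

lemma Metric_space_max_metric:
  "Metric_space (mspace m1 \<times> mspace m2) (\<lambda>(x, y) (x', y'). max (mdist m1 x x') (mdist m2 y y'))"
proof
  fix a b c assume "a \<in> mspace m1 \<times> mspace m2" "b \<in> mspace m1 \<times> mspace m2" "c \<in> mspace m1 \<times> mspace m2"
  then show "(case a of (x, y) \<Rightarrow> \<lambda>(x', y'). max (mdist m1 x x') (mdist m2 y y')) c
     \<le> (case a of (x, y) \<Rightarrow> \<lambda>(x', y'). max (mdist m1 x x') (mdist m2 y y')) b +
        (case b of (x, y) \<Rightarrow> \<lambda>(x', y'). max (mdist m1 x x') (mdist m2 y y')) c"
    using mdist_triangle[of "fst a" m1 "fst b" "fst c"] mdist_triangle[of "snd a" m2 "snd b" "snd c"]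
    by (auto split: prod.splits)
next
  fix a b assume "a \<in> mspace m1 \<times> mspace m2" "b \<in> mspace m1 \<times> mspace m2"
  then show "((case a of (x, y) \<Rightarrow> \<lambda>(x', y'). max (mdist m1 x x') (mdist m2 y y')) b = 0) = (a = b)"
    using mdist_zero[of "fst a" m1 "fst b"] mdist_zero[of "snd a" m2 "snd b"]
      mdist_nonneg[of m1 "fst a" "fst b"] mdist_nonneg[of m2 "snd a" "snd b"]
    by (auto simp del: mdist_zero mdist_nonneg split: prod.splits simp: max_def split: if_splits)
qed (auto simp: mdist_commute le_max_iff_disj split: prod.splits)

lemma mspace_max_metric [simp]: "mspace (max_metric m1 m2) = mspace m1 \<times> mspace m2"
  unfolding max_metric_def by (rule Metric_space.mspace_metric[OF Metric_space_max_metric])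

lemma mdist_max_metric [simp]:
  "mdist (max_metric m1 m2) (x, y) (x', y') = max (mdist m1 x x') (mdist m2 y y')"
  unfolding max_metric_def by (subst Metric_space.mdist_metric[OF Metric_space_max_metric]) simp

definition hausdorff_dist :: "'a metric \<Rightarrow> 'a set \<Rightarrow> 'a set \<Rightarrow> real" where
  "hausdorff_dist m A B =
     max (SUP a\<in>A. INF b\<in>B. mdist m a b) (SUP b\<in>B. INF a\<in>A. mdist m a b)"

section \<open>Path spaces\<close>

text \<open>
  A path on $[0,\infty)$ is represented by a function on the reals; the values at negative times are
  discarded by the quotient.
\<close>

quotient_type (overloaded) 's L0 = "real \<Rightarrow> 's::heine_borel" / partial:
  "\<lambda>f g. f \<in> borel_measurable (restrict_space lborel {0..}) \<and>
         g \<in> borel_measurable (restrict_space lborel {0..}) \<and>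
         (AE t in restrict_space lborel {0..}. f t = g t)"
proof (rule part_equivpI)
  show "\<exists>x. x \<in> borel_measurable (restrict_space lborel {0..}) \<and>
         x \<in> borel_measurable (restrict_space lborel {0..}) \<and>
         (AE t in restrict_space lborel {0..}. (x t::'s) = x t)"
    by (intro exI[of _ "\<lambda>_. undefined"]) auto
qed (auto intro!: sympI transpI elim: AE_mp)

lemma measurable_exp_halfline [measurable]:
  "(\<lambda>t::real. exp (- t)) \<in> borel_measurable (restrict_space lborel A)"
  by (rule measurable_restrict_space1) simp

lift_definition L0_dist :: "'s::heine_borel L0 \<Rightarrow> 's L0 \<Rightarrow> real" is
  "\<lambda>f g. \<integral>t. exp (- t) * min 1 (dist (f t) (g t)) \<partial>restrict_space lborel {0..}"
proof goal_cases
  case (1 f f' g g')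
  then have [measurable]: "f \<in> borel_measurable (restrict_space lborel {0..})"
    "f' \<in> borel_measurable (restrict_space lborel {0..})" "g \<in> borel_measurable (restrict_space lborel {0..})"
    "g' \<in> borel_measurable (restrict_space lborel {0..})" by auto
  have "AE t in restrict_space lborel {0..}. f t = f' t" "AE t in restrict_space lborel {0..}. g t = g' t"
    using 1 by auto
  then show ?case
    by (intro integral_cong_AE) auto
qed

lemma integrable_exp_halfline:
  "integrable (restrict_space lborel {0..}) (\<lambda>t::real. exp (- t))"
proof -
  have "set_integrable lborel {0..} (\<lambda>x. x ^ 0 * exp (- x :: real))"
    using nn_intergal_power_times_exp_Ici[of 0]
    unfolding set_integrable_def
    by (intro integrableI_nn_integral_finite[of _ _ 1])
       (auto simp: mult.commute indicator_def split: if_splits intro!: nn_integral_cong elim!: trans[rotated])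
  then show ?thesis
    by (simp add: integrable_restrict_space set_integrable_def)
qed

lemma integrable_exp_capped:
  assumes [measurable]: "f \<in> borel_measurable (restrict_space lborel {0..})" and "\<And>t. 0 \<le> f t"
  shows "integrable (restrict_space lborel {0..}) (\<lambda>t::real. exp (- t) * min 1 (f t))"
  by (rule Bochner_Integration.integrable_bound[OF integrable_exp_halfline])
     (use assms(2) in \<open>auto simp: abs_mult\<close>)

lemma AE_zero_of_exp_capped:
  assumes [measurable]: "f \<in> borel_measurable (restrict_space lborel {0..})" and f: "\<And>t. 0 \<le> f t"
    and 0: "(\<integral>t. exp (- t) * min 1 (f t) \<partial>restrict_space lborel {0..}) = 0"
  shows "AE t in restrict_space lborel {0::real..}. f t = 0"
proof -
  have "AE t in restrict_space lborel {0..}. exp (- t) * min 1 (f t) = 0"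
    using 0 f by (subst integral_nonneg_eq_0_iff_AE[symmetric]) (auto intro!: integrable_exp_capped)
  then show ?thesis
    by eventually_elim (auto simp: min_def split: if_splits)
qed

lemma exp_capped_triangle:
  fixes f g h :: "real \<Rightarrow> real"
  assumes [measurable]: "f \<in> borel_measurable (restrict_space lborel {0..})"
      "g \<in> borel_measurable (restrict_space lborel {0..})" "h \<in> borel_measurable (restrict_space lborel {0..})"
    and "\<And>t. 0 \<le> f t" "\<And>t. 0 \<le> g t" "\<And>t. 0 \<le> h t" and le: "\<And>t. 0 \<le> t \<Longrightarrow> f t \<le> g t + h t"
  shows "(\<integral>t. exp (- t) * min 1 (f t) \<partial>restrict_space lborel {0..}) \<le>
         (\<integral>t. exp (- t) * min 1 (g t) \<partial>restrict_space lborel {0..}) +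
         (\<integral>t. exp (- t) * min 1 (h t) \<partial>restrict_space lborel {0..})"
proof -
  have "(\<integral>t. exp (- t) * min 1 (f t) \<partial>restrict_space lborel {0..}) \<le>
      (\<integral>t. exp (- t) * min 1 (g t) + exp (- t) * min 1 (h t) \<partial>restrict_space lborel {0..})"
  proof (rule integral_mono_AE)
    show "AE t in restrict_space lborel {0..}.
        exp (- t) * min 1 (f t) \<le> exp (- t) * min 1 (g t) + exp (- t) * min 1 (h t)"
    proof (rule AE_I2)
      fix t assume "t \<in> space (restrict_space lborel {0::real..})"
      then have "min 1 (f t) \<le> min 1 (g t) + min 1 (h t)"
        using le[of t] assms(5,6)[of t] by (auto simp: space_restrict_space min_def)
      then show "exp (- t) * min 1 (f t) \<le> exp (- t) * min 1 (g t) + exp (- t) * min 1 (h t)"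
        by (metis distrib_left exp_ge_zero mult_left_mono)
    qed
  qed (use assms in \<open>auto intro!: integrable_exp_capped Bochner_Integration.integrable_add\<close>)
  also have "\<dots> = (\<integral>t. exp (- t) * min 1 (g t) \<partial>restrict_space lborel {0..}) +
         (\<integral>t. exp (- t) * min 1 (h t) \<partial>restrict_space lborel {0..})"
    by (intro Bochner_Integration.integral_add integrable_exp_capped) (use assms in auto)
  finally show ?thesis .
qed

lemma Metric_space_L0: "Metric_space (UNIV :: 's::heine_borel L0 set) L0_dist"
proof
  fix x y z :: "'s L0"
  show "0 \<le> L0_dist x y" by transfer (auto intro!: integral_nonneg_AE)
  show "L0_dist x y = L0_dist y x" by transfer (simp add: dist_commute)
  show "(L0_dist x y = 0) = (x = y)"
  proof (transfer, goal_cases)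
    case (1 f g)
    then have [measurable]: "f \<in> borel_measurable (restrict_space lborel {0..})"
      "g \<in> borel_measurable (restrict_space lborel {0..})" by auto
    show ?case
    proof
      assume "(\<integral>t. exp (- t) * min 1 (dist (f t) (g t)) \<partial>restrict_space lborel {0..}) = 0"
      then have "AE t in restrict_space lborel {0..}. dist (f t) (g t) = 0"
        by (intro AE_zero_of_exp_capped) auto
      with 1 show "f \<in> borel_measurable (restrict_space lborel {0..}) \<and>
        g \<in> borel_measurable (restrict_space lborel {0..}) \<and> (AE t in restrict_space lborel {0..}. f t = g t)"
        by auto
    next
      assume "f \<in> borel_measurable (restrict_space lborel {0..}) \<and>
        g \<in> borel_measurable (restrict_space lborel {0..}) \<and> (AE t in restrict_space lborel {0..}. f t = g t)"
      then have "AE t in restrict_space lborel {0..}. exp (- t) * min 1 (dist (f t) (g t)) = 0" by auto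
      then show "(\<integral>t. exp (- t) * min 1 (dist (f t) (g t)) \<partial>restrict_space lborel {0..}) = 0"
        by (rule integral_eq_zero_AE)
    qed
  qed
  show "L0_dist x z \<le> L0_dist x y + L0_dist y z"
  proof (transfer, goal_cases)
    case (1 f g h)
    then have [measurable]: "f \<in> borel_measurable (restrict_space lborel {0..})"
      "g \<in> borel_measurable (restrict_space lborel {0..})"
      "h \<in> borel_measurable (restrict_space lborel {0..})" by auto
    show ?case by (rule exp_capped_triangle) (auto intro: dist_triangle)
  qed
qed

definition L0_metric :: "'s::heine_borel L0 metric" where
  "L0_metric = metric (UNIV, L0_dist)"

lemma mspace_L0_metric [simp]: "mspace L0_metric = UNIV"
  and mdist_L0_metric [simp]: "mdist L0_metric = L0_dist"
  unfolding L0_metric_def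
  by (rule Metric_space.mspace_metric[OF Metric_space_L0] Metric_space.mdist_metric[OF Metric_space_L0])+

definition cadlag :: "(real \<Rightarrow> 's::topological_space) \<Rightarrow> bool" where
  "cadlag \<xi> \<longleftrightarrow> (\<forall>t\<ge>0. (\<xi> \<longlongrightarrow> \<xi> t) (at_right t)) \<and> (\<forall>t>0. \<exists>l. (\<xi> \<longlongrightarrow> l) (at_left t))"

definition DL0_metric :: "'s::heine_borel L0 metric" where
  "DL0_metric = submetric L0_metric (abs_L0 ` {\<xi>. cadlag \<xi>})"

section \<open>The Prohorov metric\<close>

definition borel_of :: "'a topology \<Rightarrow> 'a measure" where
  "borel_of T = sigma (topspace T) {U. openin T U}"

lemma space_borel_of [simp]: "space (borel_of T) = topspace T"
  unfolding borel_of_def by (rule space_measure_of) (auto dest: openin_subset)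

lemma sets_borel_of: "sets (borel_of T) = sigma_sets (topspace T) {U. openin T U}"
  unfolding borel_of_def by (rule sets_measure_of) (auto dest: openin_subset)

lemma openin_borel_of: "openin T U \<Longrightarrow> U \<in> sets (borel_of T)"
  by (auto simp: sets_borel_of)

lemma closedin_borel_of: "closedin T C \<Longrightarrow> C \<in> sets (borel_of T)"
  by (metis closedin_def openin_borel_of Diff_Diff_Int Int_absorb1 sets.compl_sets space_borel_of)

definition closed_nbhd :: "'a metric \<Rightarrow> real \<Rightarrow> 'a set \<Rightarrow> 'a set" where
  "closed_nbhd m \<epsilon> A = {x \<in> mspace m. \<exists>y\<in>A. mdist m x y \<le> \<epsilon>}"

text \<open>
  The closed neighbourhood of a Borel set need not be Borel. In the separable metric spaces used below
  it is analytic, hence universally measurable, and its (completed) measure is its outer measure;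
  \<^const>\<open>emeasure\<close> itself would return the junk value 0. On Borel sets the two agree.
\<close>

definition prohorov_bound :: "'a metric \<Rightarrow> 'a measure \<Rightarrow> 'a measure \<Rightarrow> real \<Rightarrow> bool" where
  "prohorov_bound m \<mu> \<nu> \<epsilon> \<longleftrightarrow> (\<forall>A\<in>sets (borel_of (mtopology_of m)).
     emeasure \<mu> A \<le> outer_measure_of \<nu> (closed_nbhd m \<epsilon> A) + ennreal \<epsilon> \<and>
     emeasure \<nu> A \<le> outer_measure_of \<mu> (closed_nbhd m \<epsilon> A) + ennreal \<epsilon>)"

text \<open>
  For finite measures the infimum is over a nonempty set and is finite; passing through
  \<^typ>\<open>ennreal\<close> only serves to make the value nonnegative for arbitrary arguments, as the library's
  \<^locale>\<open>Metric_space\<close> requires.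
\<close>

definition prohorov_dist :: "'a metric \<Rightarrow> 'a measure \<Rightarrow> 'a measure \<Rightarrow> real" where
  "prohorov_dist m \<mu> \<nu> = enn2real (INF \<epsilon>\<in>{\<epsilon>. 0 < \<epsilon> \<and> prohorov_bound m \<mu> \<nu> \<epsilon>}. ennreal \<epsilon>)"

definition finite_borel_measures :: "'a metric \<Rightarrow> 'a measure set" where
  "finite_borel_measures m = {\<mu>. finite_measure \<mu> \<and> sets \<mu> = sets (borel_of (mtopology_of m))}"

lemma prohorov_bound_sym: "prohorov_bound m \<mu> \<nu> \<epsilon> \<longleftrightarrow> prohorov_bound m \<nu> \<mu> \<epsilon>"
  by (auto simp: prohorov_bound_def)

lemma prohorov_dist_le:
  assumes "prohorov_bound m \<mu> \<nu> \<epsilon>" "0 < \<epsilon>"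
  shows "prohorov_dist m \<mu> \<nu> \<le> \<epsilon>"
proof -
  have "(INF \<epsilon>\<in>{\<epsilon>. 0 < \<epsilon> \<and> prohorov_bound m \<mu> \<nu> \<epsilon>}. ennreal \<epsilon>) \<le> ennreal \<epsilon>"
    using assms by (intro INF_lower) auto
  then show ?thesis using assms(2) unfolding prohorov_dist_def
    by (metis enn2real_ennreal enn2real_mono ennreal_less_top less_imp_le)
qed

lemma mdist_self: "x \<in> mspace m \<Longrightarrow> mdist m x x = 0"
  by simp

lemma sets_subset_closed_nbhd:
  assumes "A \<in> sets (borel_of (mtopology_of m))" "0 \<le> \<epsilon>"
  shows "A \<subseteq> closed_nbhd m \<epsilon> A"
proof
  fix x assume "x \<in> A"
  moreover from this have "x \<in> mspace m" using sets.sets_into_space[OF assms(1)] by auto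
  moreover from this have "mdist m x x \<le> \<epsilon>" using assms(2) mdist_self[of x m] by linarith
  ultimately show "x \<in> closed_nbhd m \<epsilon> A" unfolding closed_nbhd_def by blast
qed

lemma finite_prohorov_bound_exists:
  assumes "\<mu> \<in> finite_borel_measures m" "\<nu> \<in> finite_borel_measures m"
  shows "\<exists>\<epsilon>>0. prohorov_bound m \<mu> \<nu> \<epsilon>"
proof -
  interpret M: finite_measure \<mu> using assms by (simp add: finite_borel_measures_def)
  interpret N: finite_measure \<nu> using assms by (simp add: finite_borel_measures_def)
  let ?e = "measure \<mu> (space \<mu>) + measure \<nu> (space \<nu>) + 1"
  have "emeasure \<mu> A \<le> ennreal ?e" "emeasure \<nu> A \<le> ennreal ?e" for A
    using M.bounded_measure[of A] N.bounded_measure[of A]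
    unfolding M.emeasure_eq_measure N.emeasure_eq_measure
    by (intro ennreal_leI, smt (verit) measure_nonneg)+
  then have "prohorov_bound m \<mu> \<nu> ?e"
    unfolding prohorov_bound_def by (auto intro: order_trans[OF _ le_iff_add[THEN iffD2]] add_increasing)
  moreover have "0 < ?e" by (smt (verit) measure_nonneg)
  ultimately show ?thesis by blast
qed

lemma prohorov_dist_less:
  assumes "\<mu> \<in> finite_borel_measures m" "\<nu> \<in> finite_borel_measures m" and less: "prohorov_dist m \<mu> \<nu> < a"
  shows "\<exists>\<epsilon>>0. \<epsilon> < a \<and> prohorov_bound m \<mu> \<nu> \<epsilon>"
proof -
  let ?I = "INF \<epsilon>\<in>{\<epsilon>. 0 < \<epsilon> \<and> prohorov_bound m \<mu> \<nu> \<epsilon>}. ennreal \<epsilon>"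
  obtain e where "e > 0" "prohorov_bound m \<mu> \<nu> e"
    using finite_prohorov_bound_exists[OF assms(1,2)] by blast
  then have "?I \<le> ennreal e" by (intro INF_lower) auto
  then have fin: "?I < \<top>" by (simp add: order_le_less_trans)
  have "a > 0" using less by (smt (verit) enn2real_nonneg prohorov_dist_def)
  have "?I = ennreal (prohorov_dist m \<mu> \<nu>)"
    unfolding prohorov_dist_def by (rule ennreal_enn2real[OF fin, symmetric])
  then have "?I < ennreal a"
    using less \<open>a > 0\<close> by (simp add: ennreal_lessI)
  then show ?thesis unfolding INF_less_iff using \<open>a > 0\<close> by (auto simp: ennreal_less_iff)
qed

definition open_nbhd :: "'a metric \<Rightarrow> real \<Rightarrow> 'a set \<Rightarrow> 'a set" where
  "open_nbhd m \<epsilon> A = (\<Union>y\<in>A. mball_of m y \<epsilon>)"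

lemma openin_open_nbhd: "openin (mtopology_of m) (open_nbhd m \<epsilon> A)"
  unfolding open_nbhd_def mtopology_of_def mball_of_def
  by (intro openin_Union ballI) (auto simp: Metric_space.openin_mball)

lemma open_nbhd_sets: "open_nbhd m \<epsilon> A \<in> sets (borel_of (mtopology_of m))"
  by (intro openin_borel_of openin_open_nbhd)

lemma closed_nbhd_subset_open:
  assumes "A \<subseteq> mspace m" "\<delta> < \<epsilon>" shows "closed_nbhd m \<delta> A \<subseteq> open_nbhd m \<epsilon> A"
  using assms by (force simp: closed_nbhd_def open_nbhd_def mdist_commute)

lemma prohorov_bound_trans_aux:
  assumes b1: "prohorov_bound m \<mu> \<nu> \<epsilon>" and b2: "prohorov_bound m \<nu> \<kappa> \<delta>" and "0 < \<epsilon>" "0 < \<delta>" "0 < \<eta>"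
    and sets_eq: "sets \<nu> = sets (borel_of (mtopology_of m))"
    and A: "A \<in> sets (borel_of (mtopology_of m))"
  shows "emeasure \<mu> A \<le> outer_measure_of \<kappa> (closed_nbhd m (\<epsilon> + \<delta> + \<eta>) A) + ennreal (\<epsilon> + \<delta> + \<eta>)"
proof -
  let ?U = "open_nbhd m (\<epsilon> + \<eta>) A"
  have A_sub: "A \<subseteq> mspace m" using sets.sets_into_space[OF A] by simp
  have U: "?U \<in> sets (borel_of (mtopology_of m))" by (rule open_nbhd_sets)
  have sub: "closed_nbhd m \<delta> ?U \<subseteq> closed_nbhd m (\<epsilon> + \<delta> + \<eta>) A"
  proof
    fix x assume "x \<in> closed_nbhd m \<delta> ?U"
    then obtain u y where *: "x \<in> mspace m" "mdist m x u \<le> \<delta>" "y \<in> A" "u \<in> mspace m" "y \<in> mspace m"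
        "mdist m y u < \<epsilon> + \<eta>"
      by (auto simp: closed_nbhd_def open_nbhd_def)
    then have "mdist m x y \<le> \<epsilon> + \<delta> + \<eta>"
      using mdist_triangle[of x m u y] mdist_commute[of m u y] by auto
    with * show "x \<in> closed_nbhd m (\<epsilon> + \<delta> + \<eta>) A" by (auto simp: closed_nbhd_def)
  qed
  have "emeasure \<mu> A \<le> outer_measure_of \<nu> (closed_nbhd m \<epsilon> A) + ennreal \<epsilon>"
    using b1 A by (auto simp: prohorov_bound_def)
  also have "outer_measure_of \<nu> (closed_nbhd m \<epsilon> A) \<le> outer_measure_of \<nu> ?U"
    using assms(5) by (intro outer_measure_of_mono closed_nbhd_subset_open A_sub) auto
  also have "outer_measure_of \<nu> ?U = emeasure \<nu> ?U" using U sets_eq by simp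
  also have "\<dots> \<le> outer_measure_of \<kappa> (closed_nbhd m \<delta> ?U) + ennreal \<delta>"
    using b2 U by (auto simp: prohorov_bound_def)
  also have "outer_measure_of \<kappa> (closed_nbhd m \<delta> ?U) \<le> outer_measure_of \<kappa> (closed_nbhd m (\<epsilon> + \<delta> + \<eta>) A)"
    by (rule outer_measure_of_mono[OF sub])
  finally have "emeasure \<mu> A \<le> outer_measure_of \<kappa> (closed_nbhd m (\<epsilon> + \<delta> + \<eta>) A) + ennreal \<delta> + ennreal \<epsilon>"
    by (simp add: add_right_mono)
  also have "\<dots> \<le> outer_measure_of \<kappa> (closed_nbhd m (\<epsilon> + \<delta> + \<eta>) A) + ennreal (\<epsilon> + \<delta> + \<eta>)"
    using assms(3-5) by (simp add: add.assoc ennreal_plus[symmetric] ennreal_leI del: ennreal_plus)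
  finally show ?thesis .
qed

lemma prohorov_bound_trans:
  assumes "prohorov_bound m \<mu> \<nu> \<epsilon>" "prohorov_bound m \<nu> \<kappa> \<delta>" "0 < \<epsilon>" "0 < \<delta>" "0 < \<eta>"
    and "sets \<nu> = sets (borel_of (mtopology_of m))"
  shows "prohorov_bound m \<mu> \<kappa> (\<epsilon> + \<delta> + \<eta>)"
  unfolding prohorov_bound_def
proof (intro ballI conjI)
  fix A assume A: "A \<in> sets (borel_of (mtopology_of m))"
  show "emeasure \<mu> A \<le> outer_measure_of \<kappa> (closed_nbhd m (\<epsilon> + \<delta> + \<eta>) A) + ennreal (\<epsilon> + \<delta> + \<eta>)"
    by (rule prohorov_bound_trans_aux[OF assms A])
  have "prohorov_bound m \<kappa> \<nu> \<delta>" "prohorov_bound m \<nu> \<mu> \<epsilon>"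
    using assms(1,2) prohorov_bound_sym by blast+
  from prohorov_bound_trans_aux[OF this assms(4,3,5,6) A]
  show "emeasure \<kappa> A \<le> outer_measure_of \<mu> (closed_nbhd m (\<epsilon> + \<delta> + \<eta>) A) + ennreal (\<epsilon> + \<delta> + \<eta>)"
    by (simp add: add.commute[of \<delta> \<epsilon>])
qed

lemma prohorov_dist_triangle:
  assumes "\<mu> \<in> finite_borel_measures m" "\<nu> \<in> finite_borel_measures m" "\<kappa> \<in> finite_borel_measures m"
  shows "prohorov_dist m \<mu> \<kappa> \<le> prohorov_dist m \<mu> \<nu> + prohorov_dist m \<nu> \<kappa>"
proof (rule field_le_epsilon)
  fix e :: real assume "0 < e"
  obtain d1 where d1: "0 < d1" "d1 < prohorov_dist m \<mu> \<nu> + e/3" "prohorov_bound m \<mu> \<nu> d1"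
    using prohorov_dist_less[OF assms(1,2), of "prohorov_dist m \<mu> \<nu> + e/3"] \<open>0 < e\<close> by auto
  obtain d2 where d2: "0 < d2" "d2 < prohorov_dist m \<nu> \<kappa> + e/3" "prohorov_bound m \<nu> \<kappa> d2"
    using prohorov_dist_less[OF assms(2,3), of "prohorov_dist m \<nu> \<kappa> + e/3"] \<open>0 < e\<close> by auto
  have "prohorov_dist m \<mu> \<kappa> \<le> d1 + d2 + e/3"
  proof (rule prohorov_dist_le)
    show "prohorov_bound m \<mu> \<kappa> (d1 + d2 + e/3)"
      using assms(2) \<open>0 < e\<close>
      by (intro prohorov_bound_trans[OF d1(3) d2(3) d1(1) d2(1)]) (auto simp: finite_borel_measures_def)
  qed (use d1(1) d2(1) \<open>0 < e\<close> in simp)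
  then show "prohorov_dist m \<mu> \<kappa> \<le> prohorov_dist m \<mu> \<nu> + prohorov_dist m \<nu> \<kappa> + e"
    using d1(2) d2(2) by simp
qed

lemma prohorov_dist_eq_0_closed:
  assumes fin: "\<mu> \<in> finite_borel_measures m" "\<nu> \<in> finite_borel_measures m"
    and 0: "prohorov_dist m \<mu> \<nu> = 0" and C: "closedin (mtopology_of m) C"
  shows "emeasure \<mu> C \<le> emeasure \<nu> C"
proof -
  interpret N: finite_measure \<nu> using fin by (simp add: finite_borel_measures_def)
  have sets_eq: "sets \<nu> = sets (borel_of (mtopology_of m))" using fin by (simp add: finite_borel_measures_def)
  have C_sub: "C \<subseteq> mspace m" using closedin_subset[OF C] by simp
  define U where "U k = open_nbhd m (1 / real (Suc k)) C" for k
  have U: "range U \<subseteq> sets \<nu>" by (auto simp: U_def sets_eq open_nbhd_sets)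
  have dec: "decseq U"
  proof (rule antimonoI)
    fix j k :: nat assume "j \<le> k"
    then have "1 / real (Suc k) \<le> 1 / real (Suc j)" by (simp add: frac_le)
    then show "U k \<subseteq> U j"
      unfolding U_def open_nbhd_def by fastforce
  qed
  have Int: "(\<Inter>k. U k) = C"
  proof
    show "C \<subseteq> (\<Inter>k. U k)" using C_sub subsetD[OF C_sub] by (auto simp: U_def open_nbhd_def mdist_self intro!: bexI)
    show "(\<Inter>k. U k) \<subseteq> C"
    proof (rule ccontr)
      assume "\<not> (\<Inter>k. U k) \<subseteq> C"
      then obtain x where x: "\<And>k. x \<in> U k" "x \<notin> C" by auto
      have xm: "x \<in> mspace m" using x(1)[of 0] by (auto simp: U_def open_nbhd_def)
      have "openin (mtopology_of m) (mspace m - C)" using C by (simp add: closedin_def)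
      then obtain r where r: "r > 0" "mball_of m x r \<subseteq> mspace m - C"
        using xm x(2) unfolding mtopology_of_def mball_of_def
        by (auto simp: Metric_space.openin_mtopology)
      obtain k where k: "1 / real (Suc k) < r" using nat_approx_posE[OF r(1)] by blast
      obtain y where "y \<in> C" "mdist m y x < 1 / real (Suc k)" using x(1)[of k] by (auto simp: U_def open_nbhd_def)
      then have "y \<in> mball_of m x r" using C_sub xm k by (auto simp: mdist_commute)
      with r \<open>y \<in> C\<close> show False by auto
    qed
  qed
  have lim: "(\<lambda>k. emeasure \<nu> (U k)) \<longlonglongrightarrow> emeasure \<nu> C"
    using Lim_emeasure_decseq[OF U dec] N.emeasure_finite Int by auto
  have le: "emeasure \<mu> C \<le> emeasure \<nu> (U k) + ennreal (1 / real (Suc k))" for k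
  proof -
    obtain e where e: "0 < e" "e < 1 / real (Suc k)" "prohorov_bound m \<mu> \<nu> e"
      using prohorov_dist_less[OF fin, of "1 / real (Suc k)"] 0 by auto
    have "emeasure \<mu> C \<le> outer_measure_of \<nu> (closed_nbhd m e C) + ennreal e"
      using e(3) closedin_borel_of[OF C] by (auto simp: prohorov_bound_def)
    also have "\<dots> \<le> outer_measure_of \<nu> (U k) + ennreal (1 / real (Suc k))"
      unfolding U_def
      by (intro add_mono outer_measure_of_mono closed_nbhd_subset_open C_sub ennreal_leI) (use e in auto)
    also have "outer_measure_of \<nu> (U k) = emeasure \<nu> (U k)" using U by auto
    finally show ?thesis .
  qed
  have "(\<lambda>k. ennreal (1 / real (Suc k))) \<longlonglongrightarrow> 0"
    using tendsto_ennrealI[OF LIMSEQ_Suc[OF lim_1_over_n]] by simp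
  then have "(\<lambda>k. emeasure \<nu> (U k) + ennreal (1 / real (Suc k))) \<longlonglongrightarrow> emeasure \<nu> C + 0"
    by (intro tendsto_add lim)
  then show ?thesis
    using le by (intro LIMSEQ_le_const) auto
qed

lemma measure_eq_of_closed:
  assumes fin: "\<mu> \<in> finite_borel_measures m" "\<nu> \<in> finite_borel_measures m"
    and eq: "\<And>C. closedin (mtopology_of m) C \<Longrightarrow> emeasure \<mu> C = emeasure \<nu> C"
  shows "\<mu> = \<nu>"
proof (rule measure_eqI_generator_eq[where \<Omega>="mspace m" and E="{C. closedin (mtopology_of m) C}" and A="\<lambda>_. mspace m"])
  interpret M: finite_measure \<mu> using fin by (simp add: finite_borel_measures_def)
  show "Int_stable {C. closedin (mtopology_of m) C}" by (auto simp: Int_stable_def)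
  show "{C. closedin (mtopology_of m) C} \<subseteq> Pow (mspace m)" using closedin_subset by fastforce
  have *: "sigma_sets (mspace m) {C. closedin (mtopology_of m) C} = sets (borel_of (mtopology_of m))"
    unfolding sets_borel_of topspace_mtopology_of
  proof (intro sigma_sets_eqI)
    fix C assume "C \<in> {C. closedin (mtopology_of m) C}"
    then show "C \<in> sigma_sets (mspace m) {U. openin (mtopology_of m) U}"
      using closedin_borel_of[of "mtopology_of m" C] by (simp add: sets_borel_of)
  next
    fix U assume "U \<in> {U. openin (mtopology_of m) U}"
    then have U: "closedin (mtopology_of m) (mspace m - U)" "U \<subseteq> mspace m"
      using openin_subset[of "mtopology_of m" U] by (auto simp: openin_closedin_eq)
    have "mspace m - (mspace m - U) \<in> sigma_sets (mspace m) {C. closedin (mtopology_of m) C}"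
      using U(1) by (intro sigma_sets.Compl[OF sigma_sets.Basic]) simp
    then show "U \<in> sigma_sets (mspace m) {C. closedin (mtopology_of m) C}"
      using U(2) by (simp add: double_diff)
  qed
  show "sets \<mu> = sigma_sets (mspace m) {C. closedin (mtopology_of m) C}"
    "sets \<nu> = sigma_sets (mspace m) {C. closedin (mtopology_of m) C}"
    using fin by (auto simp: finite_borel_measures_def *)
  show "range (\<lambda>_. mspace m) \<subseteq> {C. closedin (mtopology_of m) C}"
    using closedin_topspace[of "mtopology_of m"] by auto
qed (use eq fin in \<open>auto simp: finite_borel_measures_def finite_measure.emeasure_finite\<close>)

lemma Metric_space_prohorov:
  "Metric_space (finite_borel_measures m) (prohorov_dist m)"
proof
  fix \<mu> \<nu> :: "'a measure"
  show "0 \<le> prohorov_dist m \<mu> \<nu>" by (simp add: prohorov_dist_def)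
  show "prohorov_dist m \<mu> \<nu> = prohorov_dist m \<nu> \<mu>"
    using prohorov_bound_sym[of m \<mu> \<nu>] by (simp add: prohorov_dist_def)
next
  fix \<mu> \<nu> :: "'a measure" assume fin: "\<mu> \<in> finite_borel_measures m" "\<nu> \<in> finite_borel_measures m"
  show "(prohorov_dist m \<mu> \<nu> = 0) = (\<mu> = \<nu>)"
  proof
    assume "prohorov_dist m \<mu> \<nu> = 0"
    moreover have "prohorov_dist m \<nu> \<mu> = prohorov_dist m \<mu> \<nu>"
      using prohorov_bound_sym[of m \<mu> \<nu>] by (simp add: prohorov_dist_def)
    ultimately show "\<mu> = \<nu>"
      using fin by (intro measure_eq_of_closed[OF fin] antisym prohorov_dist_eq_0_closed) auto
  next
    assume [simp]: "\<mu> = \<nu>"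
    have bound: "prohorov_bound m \<nu> \<nu> e" if "e > 0" for e
      unfolding prohorov_bound_def
    proof (intro ballI conjI)
      fix A assume A: "A \<in> sets (borel_of (mtopology_of m))"
      then have "emeasure \<nu> A = outer_measure_of \<nu> A" using fin by (simp add: finite_borel_measures_def)
      also have "\<dots> \<le> outer_measure_of \<nu> (closed_nbhd m e A) + ennreal e"
        using outer_measure_of_mono[OF sets_subset_closed_nbhd[OF A], of e \<nu>] that
        by (intro add_increasing2) auto
      finally show "emeasure \<nu> A \<le> outer_measure_of \<nu> (closed_nbhd m e A) + ennreal e"
        "emeasure \<nu> A \<le> outer_measure_of \<nu> (closed_nbhd m e A) + ennreal e" by this+
    qed
    have "prohorov_dist m \<nu> \<nu> \<le> 0"
      by (rule field_le_epsilon) (use prohorov_dist_le[OF bound] in simp)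
    moreover have "0 \<le> prohorov_dist m \<nu> \<nu>" by (simp add: prohorov_dist_def)
    ultimately show "prohorov_dist m \<mu> \<nu> = 0" by simp
  qed
qed (rule prohorov_dist_triangle)

definition prob_metric :: "'a metric \<Rightarrow> 'a measure metric" where
  "prob_metric m = metric ({\<mu>. prob_space \<mu> \<and> sets \<mu> = sets (borel_of (mtopology_of m))}, prohorov_dist m)"

lemma Metric_space_prob:
  "Metric_space {\<mu>. prob_space \<mu> \<and> sets \<mu> = sets (borel_of (mtopology_of m))} (prohorov_dist m)"
  by (rule Metric_space.subspace[OF Metric_space_prohorov])
     (auto simp: finite_borel_measures_def prob_space_def)

lemma mspace_prob_metric [simp]:
    "mspace (prob_metric m) = {\<mu>. prob_space \<mu> \<and> sets \<mu> = sets (borel_of (mtopology_of m))}"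
  and mdist_prob_metric [simp]: "mdist (prob_metric m) = prohorov_dist m"
  unfolding prob_metric_def
  by (rule Metric_space.mspace_metric[OF Metric_space_prob] Metric_space.mdist_metric[OF Metric_space_prob])+

section \<open>Measures on space-time\<close>

definition spacetime_metric :: "('s::heine_borel \<times> real) metric" where
  "spacetime_metric = max_metric euclidean_metric (submetric euclidean_metric {0..})"

abbreviation borel_spacetime :: "('s::heine_borel \<times> real) measure" where
  "borel_spacetime \<equiv> borel_of (mtopology_of spacetime_metric)"

definition measures_fin :: "('s::heine_borel \<times> real) measure set" where
  "measures_fin = {\<Sigma>. sets \<Sigma> = sets borel_spacetime \<and> (\<forall>t\<ge>0. emeasure \<Sigma> (UNIV \<times> {0..t}) < \<top>)}"

definition truncate_time :: "('s::heine_borel \<times> real) measure \<Rightarrow> real \<Rightarrow> ('s \<times> real) measure" where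
  "truncate_time \<Sigma> t = density \<Sigma> (indicator (UNIV \<times> {0..t}))"

definition measures_fin_dist :: "('s::heine_borel \<times> real) measure \<Rightarrow> ('s \<times> real) measure \<Rightarrow> real" where
  "measures_fin_dist \<Sigma>1 \<Sigma>2 =
     (\<integral>t. exp (- t) * min 1 (prohorov_dist spacetime_metric (truncate_time \<Sigma>1 t) (truncate_time \<Sigma>2 t))
       \<partial>restrict_space lborel {0..})"

lemma mspace_spacetime [simp]: "mspace spacetime_metric = UNIV \<times> {0..}"
  by (simp add: spacetime_metric_def)


lemma time_slab_sets [measurable]: "UNIV \<times> {0..t} \<in> sets (borel_spacetime :: ('s::heine_borel \<times> real) measure)"
proof -
  let ?m = "spacetime_metric :: ('s \<times> real) metric"
  have "openin (mtopology_of ?m) (mspace ?m - UNIV \<times> {0..t})"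
    unfolding mtopology_of_def Metric_space.openin_mtopology[OF Metric_space_mspace_mdist]
  proof (intro conjI allI impI)
    fix p assume p: "p \<in> mspace ?m - UNIV \<times> {0..t}"
    obtain x s where xs: "p = (x, s)" by force
    with p have "0 \<le> s" "t < s" by auto
    then have "Metric_space.mball (mspace ?m) (mdist ?m) p (s - t) \<subseteq> mspace ?m - UNIV \<times> {0..t}"
      unfolding xs spacetime_metric_def subset_iff Metric_space.in_mball[OF Metric_space_mspace_mdist]
      by (auto simp: dist_real_def)
    then show "\<exists>r>0. Metric_space.mball (mspace ?m) (mdist ?m) p r \<subseteq> mspace ?m - UNIV \<times> {0..t}"
      using \<open>t < s\<close> by (intro exI[of _ "s - t"]) auto
  qed auto
  then have "closedin (mtopology_of ?m) (UNIV \<times> {0..t})"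
    by (auto simp: closedin_def)
  then show ?thesis by (rule closedin_borel_of)
qed

lemma prohorov_dist_mono_le:
  assumes fin: "\<mu> \<in> finite_borel_measures m" "\<nu> \<in> finite_borel_measures m"
    and le: "\<And>A. A \<in> sets (borel_of (mtopology_of m)) \<Longrightarrow> emeasure \<mu> A \<le> emeasure \<nu> A"
  shows "prohorov_dist m \<mu> \<nu> \<le> measure \<nu> (space \<nu>) - measure \<mu> (space \<mu>)"
proof (rule field_le_epsilon)
  fix e :: real assume "0 < e"
  interpret M: finite_measure \<mu> using fin by (simp add: finite_borel_measures_def)
  interpret N: finite_measure \<nu> using fin by (simp add: finite_borel_measures_def)
  have sets_eq: "sets \<mu> = sets (borel_of (mtopology_of m))" "sets \<nu> = sets (borel_of (mtopology_of m))"
    using fin by (simp_all add: finite_borel_measures_def)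
  have sp: "space \<nu> = space \<mu>" using sets_eq sets_eq_imp_space_eq by metis
  let ?d = "measure \<nu> (space \<nu>) - measure \<mu> (space \<mu>) + e"
  have le': "measure \<mu> A \<le> measure \<nu> A" if "A \<in> sets (borel_of (mtopology_of m))" for A
    using le[OF that] by (simp add: M.emeasure_eq_measure N.emeasure_eq_measure)
  have "measure \<mu> (space \<mu>) \<le> measure \<nu> (space \<nu>)"
    using le'[of "space \<mu>"] sets_eq sp by (metis sets.top)
  then have d: "0 < ?d" using \<open>0 < e\<close> by simp
  have "prohorov_bound m \<mu> \<nu> ?d"
    unfolding prohorov_bound_def
  proof (intro ballI conjI)
    fix A assume A: "A \<in> sets (borel_of (mtopology_of m))"
    have "emeasure \<mu> A \<le> emeasure \<nu> A" by (rule le[OF A])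
    also have "\<dots> = outer_measure_of \<nu> A" using A sets_eq by simp
    also have "\<dots> \<le> outer_measure_of \<nu> (closed_nbhd m ?d A)"
      using d by (intro outer_measure_of_mono sets_subset_closed_nbhd[OF A]) auto
    finally show "emeasure \<mu> A \<le> outer_measure_of \<nu> (closed_nbhd m ?d A) + ennreal ?d"
      by (intro add_increasing2) auto
    have c: "space \<mu> - A \<in> sets (borel_of (mtopology_of m))" using A sets_eq by (metis sets.compl_sets)
    have "measure \<nu> A \<le> measure \<mu> A + ?d"
      using le'[OF c] M.finite_measure_compl[of A] N.finite_measure_compl[of A] A sets_eq sp \<open>0 < e\<close> by auto
    then have "emeasure \<nu> A \<le> ennreal (measure \<mu> A + ?d)"
      by (simp add: N.emeasure_eq_measure ennreal_leI)
    also have "\<dots> = emeasure \<mu> A + ennreal ?d"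
      using d by (simp add: M.emeasure_eq_measure ennreal_plus)
    also have "emeasure \<mu> A = outer_measure_of \<mu> A" using A sets_eq by simp
    also have "\<dots> \<le> outer_measure_of \<mu> (closed_nbhd m ?d A)"
      using d by (intro outer_measure_of_mono sets_subset_closed_nbhd[OF A]) auto
    finally show "emeasure \<nu> A \<le> outer_measure_of \<mu> (closed_nbhd m ?d A) + ennreal ?d"
      by (simp add: add_right_mono)
  qed
  then show "prohorov_dist m \<mu> \<nu> \<le> measure \<nu> (space \<nu>) - measure \<mu> (space \<mu>) + e"
    using d by (rule prohorov_dist_le)
qed

lemma emeasure_truncate_time:
  assumes "sets \<Sigma> = sets borel_spacetime" "A \<in> sets borel_spacetime"
  shows "emeasure (truncate_time \<Sigma> t) A = emeasure \<Sigma> ((UNIV \<times> {0..t}) \<inter> A)"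
  using assms unfolding truncate_time_def
  by (subst emeasure_density) (auto simp: indicator_inter_arith[symmetric])

lemma truncate_time_finite:
  assumes "\<Sigma> \<in> measures_fin" "0 \<le> t"
  shows "truncate_time \<Sigma> t \<in> finite_borel_measures spacetime_metric"
proof -
  have s: "sets \<Sigma> = sets borel_spacetime" "emeasure \<Sigma> (UNIV \<times> {0..t}) < \<top>"
    using assms by (auto simp: measures_fin_def)
  have sp: "space \<Sigma> = UNIV \<times> {0..}" using sets_eq_imp_space_eq[OF s(1)] by simp
  then have "space \<Sigma> \<in> sets borel_spacetime" using s by (metis sets.top)
  then have "emeasure (truncate_time \<Sigma> t) (space (truncate_time \<Sigma> t)) \<le> emeasure \<Sigma> (UNIV \<times> {0..t})"
    using s by (auto simp: emeasure_truncate_time truncate_time_def[THEN arg_cong[of _ _ space]] intro!: emeasure_mono)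
  then have "finite_measure (truncate_time \<Sigma> t)"
    using s(2) by (intro finite_measureI) (auto simp: top_unique)
  then show ?thesis using s(1) by (simp add: finite_borel_measures_def truncate_time_def)
qed

lemma prohorov_truncate_measurable:
  assumes S: "\<Sigma>1 \<in> measures_fin" "\<Sigma>2 \<in> measures_fin"
  shows "(\<lambda>t. prohorov_dist spacetime_metric (truncate_time \<Sigma>1 t) (truncate_time \<Sigma>2 t))
    \<in> borel_measurable (restrict_space lborel {0..})" (is "?g \<in> _")
proof -
  define V where "V \<Sigma> t = measure (truncate_time \<Sigma> t) (space (truncate_time \<Sigma> t))" for \<Sigma> :: "('a \<times> real) measure" and t
  have step: "prohorov_dist spacetime_metric (truncate_time \<Sigma> s) (truncate_time \<Sigma> t) \<le> V \<Sigma> t - V \<Sigma> s"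
    if "\<Sigma> \<in> measures_fin" "0 \<le> s" "s \<le> t" for \<Sigma> s t
    unfolding V_def
  proof (rule prohorov_dist_mono_le)
    fix A :: "('a \<times> real) set" assume A: "A \<in> sets borel_spacetime"
    have s: "sets \<Sigma> = sets borel_spacetime" using that(1) by (simp add: measures_fin_def)
    show "emeasure (truncate_time \<Sigma> s) A \<le> emeasure (truncate_time \<Sigma> t) A"
      unfolding emeasure_truncate_time[OF s A]
    proof (rule emeasure_mono)
      show "(UNIV \<times> {0..s}) \<inter> A \<subseteq> (UNIV \<times> {0..t}) \<inter> A" using that(3) by auto
      show "(UNIV \<times> {0..t}) \<inter> A \<in> sets \<Sigma>" unfolding s using A by (intro sets.Int time_slab_sets)
    qed
  qed (use that in \<open>auto intro!: truncate_time_finite\<close>)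
  interpret P: Metric_space "finite_borel_measures spacetime_metric" "prohorov_dist spacetime_metric"
    by (rule Metric_space_prohorov)
  let ?V = "\<lambda>t. V \<Sigma>1 t + V \<Sigma>2 t"
  have lip: "\<bar>?g s - ?g t\<bar> \<le> ?V t - ?V s" if "0 \<le> s" "s \<le> t" for s t
  proof -
    note f = truncate_time_finite[OF S(1), of s] truncate_time_finite[OF S(2), of s]
      truncate_time_finite[OF S(1), of t] truncate_time_finite[OF S(2), of t]
    have f': "truncate_time \<Sigma>1 s \<in> finite_borel_measures spacetime_metric"
      "truncate_time \<Sigma>2 s \<in> finite_borel_measures spacetime_metric"
      "truncate_time \<Sigma>1 t \<in> finite_borel_measures spacetime_metric"
      "truncate_time \<Sigma>2 t \<in> finite_borel_measures spacetime_metric" using f that by auto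
    show ?thesis
      using step[OF S(1) that] step[OF S(2) that]
        P.triangle[OF f'(1) f'(3) f'(2)] P.triangle[OF f'(3) f'(4) f'(2)]
        P.triangle[OF f'(3) f'(1) f'(4)] P.triangle[OF f'(1) f'(2) f'(4)]
        P.commute[of "truncate_time \<Sigma>1 s" "truncate_time \<Sigma>1 t"]
        P.commute[of "truncate_time \<Sigma>2 s" "truncate_time \<Sigma>2 t"]
      by linarith
  qed
  have V: "V \<Sigma> s \<le> V \<Sigma> t" if "\<Sigma> \<in> measures_fin" "0 \<le> s" "s \<le> t" for \<Sigma> s t
    using step[OF that] P.nonneg[of "truncate_time \<Sigma> s" "truncate_time \<Sigma> t"] by linarith
  have "(\<lambda>t. ?g (max 0 t) + ?V (max 0 t)) \<in> borel_measurable borel"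
    by (intro borel_measurable_mono monoI) (smt (verit) lip max.cobounded1 max.mono)
  moreover have "(\<lambda>t. ?V (max 0 t)) \<in> borel_measurable borel"
    by (intro borel_measurable_mono monoI add_mono V S) auto
  ultimately have "(\<lambda>t. (?g (max 0 t) + ?V (max 0 t)) - ?V (max 0 t)) \<in> borel_measurable (borel :: real measure)"
    by (rule borel_measurable_diff)
  then have "(\<lambda>t. ?g (max 0 t)) \<in> borel_measurable lborel" by simp
  then have "(\<lambda>t. ?g (max 0 t)) \<in> borel_measurable (restrict_space lborel {0..})"
    by (rule measurable_restrict_space1)
  then show ?thesis
    by (rule measurable_cong[THEN iffD1, rotated]) (simp add: space_restrict_space)
qed

lemma measures_fin_eqI:
  assumes S: "\<Sigma>1 \<in> measures_fin" "\<Sigma>2 \<in> measures_fin"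
    and eq: "AE t in restrict_space lborel {0..}. truncate_time \<Sigma>1 t = truncate_time \<Sigma>2 t"
  shows "\<Sigma>1 = \<Sigma>2"
proof -
  have s: "sets \<Sigma>1 = sets borel_spacetime" "sets \<Sigma>2 = sets borel_spacetime"
    using S by (auto simp: measures_fin_def)
  have "\<exists>t\<ge>real n. truncate_time \<Sigma>1 t = truncate_time \<Sigma>2 t" for n :: nat
  proof (rule ccontr)
    assume *: "\<not> ?thesis"
    have "AE t in lborel. 0 \<le> t \<longrightarrow> truncate_time \<Sigma>1 t = truncate_time \<Sigma>2 t"
      using eq by (simp add: AE_restrict_space_iff)
    then have "AE t in lborel. t \<notin> {real n..real n + 1}"
      by eventually_elim (use * in auto)
    then have "emeasure lborel {real n..real n + 1} = 0"
      by (subst (asm) AE_iff_measurable[of "{real n..real n + 1}"]) auto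
    then show False by simp
  qed
  then obtain t where t: "\<And>n. real n \<le> t n" "\<And>n. truncate_time \<Sigma>1 (t n) = truncate_time \<Sigma>2 (t n)" by metis
  show ?thesis
  proof (rule measure_eqI)
    show "sets \<Sigma>1 = sets \<Sigma>2" using s by simp
    fix A assume "A \<in> sets \<Sigma>1"
    then have A: "A \<in> sets borel_spacetime" using s by simp
    then have A_sub: "A \<subseteq> UNIV \<times> {0..}" using sets.sets_into_space[OF A] by simp
    have eq_n: "emeasure \<Sigma>1 ((UNIV \<times> {0..real n}) \<inter> A) = emeasure \<Sigma>2 ((UNIV \<times> {0..real n}) \<inter> A)" for n
    proof -
      have B: "(UNIV \<times> {0..real n}) \<inter> A \<in> sets borel_spacetime" using A by auto
      have "emeasure (truncate_time \<Sigma>1 (t n)) ((UNIV \<times> {0..real n}) \<inter> A)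
          = emeasure (truncate_time \<Sigma>2 (t n)) ((UNIV \<times> {0..real n}) \<inter> A)"
        using t(2) by simp
      moreover have "(UNIV \<times> {0..t n}) \<inter> ((UNIV \<times> {0..real n}) \<inter> A) = (UNIV \<times> {0..real n}) \<inter> A"
        using t(1)[of n] by auto
      ultimately show ?thesis
        using emeasure_truncate_time[OF s(1) B, of "t n"] emeasure_truncate_time[OF s(2) B, of "t n"] by simp
    qed
    have inc: "incseq (\<lambda>n::nat. (UNIV \<times> {0..real n}) \<inter> A)"
      by (auto simp: incseq_def)
    have un: "(\<Union>n::nat. (UNIV \<times> {0..real n}) \<inter> A) = A"
      using A_sub by (auto simp: real_arch_simple)
    have "emeasure \<Sigma> A = (SUP n::nat. emeasure \<Sigma> ((UNIV \<times> {0..real n}) \<inter> A))"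
      if "sets \<Sigma> = sets borel_spacetime" for \<Sigma>
      by (subst SUP_emeasure_incseq) (use that A inc un in auto)
    then show "emeasure \<Sigma>1 A = emeasure \<Sigma>2 A" using s eq_n by simp
  qed
qed

lemma Metric_space_measures_fin: "Metric_space measures_fin measures_fin_dist"
proof
  fix \<Sigma>1 \<Sigma>2 :: "('a \<times> real) measure"
  show "0 \<le> measures_fin_dist \<Sigma>1 \<Sigma>2"
    by (auto simp: measures_fin_dist_def prohorov_dist_def intro!: integral_nonneg_AE)
  show "measures_fin_dist \<Sigma>1 \<Sigma>2 = measures_fin_dist \<Sigma>2 \<Sigma>1"
    by (simp add: measures_fin_dist_def Metric_space.commute[OF Metric_space_prohorov, of _ "truncate_time \<Sigma>1 _"])
next
  fix \<Sigma>1 \<Sigma>2 :: "('a \<times> real) measure" assume S: "\<Sigma>1 \<in> measures_fin" "\<Sigma>2 \<in> measures_fin"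
  note zero = Metric_space.zero[OF Metric_space_prohorov truncate_time_finite[OF S(1)] truncate_time_finite[OF S(2)]]
  show "(measures_fin_dist \<Sigma>1 \<Sigma>2 = 0) = (\<Sigma>1 = \<Sigma>2)"
  proof
    assume "measures_fin_dist \<Sigma>1 \<Sigma>2 = 0"
    then have ae: "AE t in restrict_space lborel {0..}.
        prohorov_dist spacetime_metric (truncate_time \<Sigma>1 t) (truncate_time \<Sigma>2 t) = 0"
      using prohorov_truncate_measurable[OF S]
      by (intro AE_zero_of_exp_capped) (auto simp: measures_fin_dist_def prohorov_dist_def)
    have "AE t in restrict_space lborel {0..}. truncate_time \<Sigma>1 t = truncate_time \<Sigma>2 t"
      using ae AE_space by eventually_elim (use zero in \<open>auto simp: space_restrict_space\<close>)
    then show "\<Sigma>1 = \<Sigma>2" by (rule measures_fin_eqI[OF S])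
  next
    assume [simp]: "\<Sigma>1 = \<Sigma>2"
    have "prohorov_dist spacetime_metric (truncate_time \<Sigma>1 t) (truncate_time \<Sigma>2 t) = 0" if "0 \<le> t" for t
      using zero[OF that that] by simp
    then have "AE t in restrict_space lborel {0..}. exp (- t) * min 1 (prohorov_dist spacetime_metric
        (truncate_time \<Sigma>1 t) (truncate_time \<Sigma>2 t)) = 0"
      by (intro AE_I2) (simp add: space_restrict_space)
    then show "measures_fin_dist \<Sigma>1 \<Sigma>2 = 0"
      unfolding measures_fin_dist_def by (rule integral_eq_zero_AE)
  qed
next
  fix \<Sigma>1 \<Sigma>2 \<Sigma>3 :: "('a \<times> real) measure"
  assume S: "\<Sigma>1 \<in> measures_fin" "\<Sigma>2 \<in> measures_fin" "\<Sigma>3 \<in> measures_fin"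
  show "measures_fin_dist \<Sigma>1 \<Sigma>3 \<le> measures_fin_dist \<Sigma>1 \<Sigma>2 + measures_fin_dist \<Sigma>2 \<Sigma>3"
    unfolding measures_fin_dist_def
    using S by (intro exp_capped_triangle prohorov_truncate_measurable prohorov_dist_triangle truncate_time_finite)
      (auto simp: prohorov_dist_def)
qed

definition measures_fin_metric :: "('s::heine_borel \<times> real) measure metric" where
  "measures_fin_metric = metric (measures_fin, measures_fin_dist)"

lemma mspace_measures_fin_metric [simp]: "mspace measures_fin_metric = measures_fin"
  and mdist_measures_fin_metric [simp]: "mdist measures_fin_metric = measures_fin_dist"
  unfolding measures_fin_metric_def
  by (rule Metric_space.mspace_metric[OF Metric_space_measures_fin]
      Metric_space.mdist_metric[OF Metric_space_measures_fin])+

section \<open>Spaces of continuous maps\<close>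

definition d_hat :: "'s::heine_borel \<Rightarrow> 'b metric \<Rightarrow> ('s \<Rightarrow> 'b) \<Rightarrow> ('s \<Rightarrow> 'b) \<Rightarrow> real" where
  "d_hat \<rho> m F1 F2 =
     (\<integral>r. exp (- r) * min 1 (hausdorff_dist (max_metric euclidean_metric m)
          ((\<lambda>x. (x, F1 x)) ` cball \<rho> r) ((\<lambda>x. (x, F2 x)) ` cball \<rho> r))
       \<partial>restrict_space lborel {0..})"

definition compact_convergence :: "'b metric \<Rightarrow> ('s::heine_borel \<Rightarrow> 'b) topology" where
  "compact_convergence m = topology_generated_by
     {{G. continuous_map euclidean (mtopology_of m) G \<and> (\<forall>x\<in>K. mdist m (F x) (G x) < \<epsilon>)} | F K \<epsilon>.
       continuous_map euclidean (mtopology_of m) F \<and> compact K \<and> 0 < \<epsilon>}"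

section \<open>Standard processes\<close>

text \<open>
  Time is $[0,\infty]$, rendered by \<^typ>\<open>ennreal\<close>. The state space augmented by the cemetery is
  \<^typ>\<open>'s option\<close> with cemetery \<^term>\<open>None\<close>; in the one-point compactification the cemetery is the
  point at infinity, and it is isolated exactly if \<^typ>\<open>'s\<close> is compact.
\<close>

record ('w, 's) process =
  sample_space :: "'w set"
  state :: "ennreal \<Rightarrow> 'w \<Rightarrow> 's option"
  time_shift :: "ennreal \<Rightarrow> 'w \<Rightarrow> 'w"
  prob_from :: "'s option \<Rightarrow> 'w measure"

definition cemetery_topology :: "'s::heine_borel option topology" where
  "cemetery_topology = Alexandroff_compactification euclidean"

definition natural_filtration :: "('w, 's::heine_borel) process \<Rightarrow> ennreal \<Rightarrow> 'w measure" where
  "natural_filtration X t = sigma (sample_space X)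
     {state X s -` B \<inter> sample_space X | s B. s \<le> t \<and> B \<in> sets (borel_of cemetery_topology)}"

text \<open>
  The augmented filtration \<open>\<F>\<^sub>t\<close>: the intersection, over all initial laws \<open>\<nu>\<close> on the augmented state
  space, of the completions of the natural filtration by the null sets of \<open>P\<^sup>\<nu> = \<integral> P\<^sup>x \<nu>(dx)\<close>. At time
  \<open>\<top>\<close> it is the \<open>\<sigma>\<close>-algebra \<open>\<F>\<close> on which all the measures \<open>P\<^sup>x\<close> live.
\<close>

definition augmented_filtration :: "('w, 's::heine_borel) process \<Rightarrow> ennreal \<Rightarrow> 'w measure" where
  "augmented_filtration X t = sigma (sample_space X)
     {\<Lambda>. \<Lambda> \<subseteq> sample_space X \<and>
       (\<forall>\<nu>. prob_space \<nu> \<and> sets \<nu> = sets (borel_of cemetery_topology) \<longrightarrow>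
         (\<exists>A\<in>sets (natural_filtration X t). \<exists>N\<in>sets (natural_filtration X \<top>).
           (\<Lambda> - A) \<union> (A - \<Lambda>) \<subseteq> N \<and> (\<integral>\<^sup>+ x. emeasure (prob_from X x) N \<partial>\<nu>) = 0))}"

definition lifetime :: "('w, 's) process \<Rightarrow> 'w \<Rightarrow> ennreal" where
  "lifetime X \<omega> = Inf {t. state X t \<omega> = None}"

definition hitting_time :: "('w, 's) process \<Rightarrow> 's set \<Rightarrow> 'w \<Rightarrow> ennreal" where
  "hitting_time X B \<omega> = Inf {t. 0 < t \<and> state X t \<omega> \<in> Some ` B}"

definition exit_time :: "('w, 's) process \<Rightarrow> 's set \<Rightarrow> 'w \<Rightarrow> ennreal" where
  "exit_time X B \<omega> = Inf {t. 0 < t \<and> state X t \<omega> \<notin> Some ` B}"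

text \<open>
  Blumenthal and Getoor's definition, with their filtration taken to be the augmented natural one
  (a process that is standard for some filtration is standard for this one). The Markov property is
  the case of constant \<open>T\<close> in the strong Markov property, and on \<open>T = \<top>\<close> the latter is trivial because
  \<open>X\<^sub>\<infinity>\<close> is the cemetery. Left limits on \<open>(0, \<zeta>)\<close> are only required in the one-point compactification;
  quasi-left-continuity forces them into the state space.
\<close>

locale standard_process =
  fixes X :: "('w, 's::heine_borel) process"
  assumes prob_space_from: "prob_space (prob_from X x)"
    and sets_from: "sets (prob_from X x) = sets (augmented_filtration X \<top>)"
    and state_top: "\<omega> \<in> sample_space X \<Longrightarrow> state X \<top> \<omega> = None"
    and absorbing: "\<omega> \<in> sample_space X \<Longrightarrow> s \<le> t \<Longrightarrow> state X s \<omega> = None \<Longrightarrow> state X t \<omega> = None"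
    and shift_closed: "t < \<top> \<Longrightarrow> \<omega> \<in> sample_space X \<Longrightarrow> time_shift X t \<omega> \<in> sample_space X"
    and state_shift: "t < \<top> \<Longrightarrow> \<omega> \<in> sample_space X \<Longrightarrow> state X s (time_shift X t \<omega>) = state X (s + t) \<omega>"
    and measurable_start: "B \<in> sets (borel_of cemetery_topology) \<Longrightarrow>
      (\<lambda>x. emeasure (prob_from X (Some x)) {\<omega> \<in> sample_space X. state X t \<omega> \<in> B}) \<in> borel_measurable borel"
    and normal: "emeasure (prob_from X x) {\<omega> \<in> sample_space X. state X 0 \<omega> = x} = 1"
    and cadlag_paths: "\<exists>\<Lambda>\<in>sets (augmented_filtration X \<top>). (\<forall>x. emeasure (prob_from X x) \<Lambda> = 1) \<and>
      (\<forall>\<omega>\<in>\<Lambda>.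
        (\<forall>t<\<top>. limitin cemetery_topology (\<lambda>s. state X s \<omega>) (state X t \<omega>) (at_right t)) \<and>
        (\<forall>t. 0 < t \<and> t < lifetime X \<omega> \<longrightarrow>
          (\<exists>l. limitin cemetery_topology (\<lambda>s. state X s \<omega>) l (at_left t))))"
    and right_continuous_filtration:
      "t < \<top> \<Longrightarrow> (\<Inter>s\<in>{t<..}. sets (augmented_filtration X s)) = sets (augmented_filtration X t)"
    and strong_regularity: "stopping_time (augmented_filtration X) T \<Longrightarrow>
      (\<lambda>\<omega>. state X (T \<omega>) \<omega>) \<in> measurable
        (filtration.pre_sigma (sample_space X) (augmented_filtration X) T) (borel_of cemetery_topology)"
    and strong_markov: "stopping_time (augmented_filtration X) T \<Longrightarrow> t < \<top> \<Longrightarrow>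
      B \<in> sets (borel_of cemetery_topology) \<Longrightarrow>
      \<Lambda> \<in> sets (filtration.pre_sigma (sample_space X) (augmented_filtration X) T) \<Longrightarrow>
      emeasure (prob_from X x) {\<omega> \<in> \<Lambda>. state X (T \<omega> + t) \<omega> \<in> B} =
      (\<integral>\<^sup>+ \<omega>. indicator \<Lambda> \<omega> *
        emeasure (prob_from X (state X (T \<omega>) \<omega>)) {\<omega>' \<in> sample_space X. state X t \<omega>' \<in> B} \<partial>prob_from X x)"
    and quasi_left_continuous: "(\<And>n::nat. stopping_time (augmented_filtration X) (Tn n)) \<Longrightarrow>
      (\<And>n \<omega>. \<omega> \<in> sample_space X \<Longrightarrow> Tn n \<omega> \<le> Tn (Suc n) \<omega>) \<Longrightarrow>
      AE \<omega> in prob_from X x. (SUP n. Tn n \<omega>) < lifetime X \<omega> \<longrightarrow>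
        limitin cemetery_topology (\<lambda>n. state X (Tn n \<omega>) \<omega>) (state X (SUP n. Tn n \<omega>) \<omega>) sequentially"

definition conservative :: "('w, 's) process \<Rightarrow> bool" where
  "conservative X \<longleftrightarrow>
     (\<forall>x. emeasure (prob_from X (Some x)) {\<omega> \<in> sample_space X. lifetime X \<omega> = \<top>} = 1)"

section \<open>Duality, heat kernel and the local Kato class\<close>

text \<open>
  Existence of the dual process \<open>Y\<close> and of the reference measure is expressed by parameters: the dual
  may live on a sample space of any type, over which one cannot quantify inside a formula.
\<close>

definition dac_condition ::
  "('w, 's::heine_borel) process \<Rightarrow> ('v, 's) process \<Rightarrow> 's measure \<Rightarrow> (real \<Rightarrow> 's \<Rightarrow> 's \<Rightarrow> ennreal) \<Rightarrow> bool" where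
  "dac_condition X Y m p \<longleftrightarrow>
     standard_process X \<and> standard_process Y \<and> sigma_finite_measure m \<and> sets m = sets borel \<and>
     (\<lambda>(t, x, y). p t x y) \<in> borel_measurable (restrict_space borel ({0<..} \<times> UNIV)) \<and>
     (\<forall>t>0. \<forall>x. \<forall>B\<in>sets borel.
        emeasure (prob_from X (Some x)) {\<omega> \<in> sample_space X. state X (ennreal t) \<omega> \<in> Some ` B} =
        (\<integral>\<^sup>+ y. p t x y * indicator B y \<partial>m)) \<and>
     (\<forall>t>0. \<forall>y. \<forall>B\<in>sets borel.
        emeasure (prob_from Y (Some y)) {\<omega> \<in> sample_space Y. state Y (ennreal t) \<omega> \<in> Some ` B} =
        (\<integral>\<^sup>+ x. p t x y * indicator B x \<partial>m)) \<and>
     (\<forall>s>0. \<forall>t>0. \<forall>x y. p (t + s) x y = (\<integral>\<^sup>+ z. p t x z * p s z y \<partial>m))"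

definition potential :: "(real \<Rightarrow> 's \<Rightarrow> 's \<Rightarrow> ennreal) \<Rightarrow> real \<Rightarrow> 's measure \<Rightarrow> 's \<Rightarrow> ennreal" where
  "potential p \<alpha> \<nu> x =
     (\<integral>\<^sup>+ y. (\<integral>\<^sup>+ t. indicator {0<..} t * (ennreal (exp (- \<alpha> * t)) * p t x y) \<partial>lborel) \<partial>\<nu>)"

definition thin :: "('w, 's::heine_borel) process \<Rightarrow> 's set \<Rightarrow> bool" where
  "thin X B \<longleftrightarrow> B \<in> sets borel \<and>
     (\<forall>x. emeasure (prob_from X (Some x)) {\<omega> \<in> sample_space X. hitting_time X B \<omega> = 0} = 0)"

definition semipolar :: "('w, 's::heine_borel) process \<Rightarrow> 's set \<Rightarrow> bool" where
  "semipolar X B \<longleftrightarrow> (\<exists>C :: nat \<Rightarrow> 's set. (\<forall>n. thin X (C n)) \<and> B \<subseteq> (\<Union>n. C n))"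

definition radon_measure :: "'s::heine_borel measure \<Rightarrow> bool" where
  "radon_measure \<mu> \<longleftrightarrow> sets \<mu> = sets borel \<and> (\<forall>K. compact K \<longrightarrow> emeasure \<mu> K < \<top>) \<and>
     (\<forall>B\<in>sets borel. emeasure \<mu> B = (SUP K\<in>{K. compact K \<and> K \<subseteq> B}. emeasure \<mu> K))"

definition local_kato_class ::
  "('w, 's::heine_borel) process \<Rightarrow> (real \<Rightarrow> 's \<Rightarrow> 's \<Rightarrow> ennreal) \<Rightarrow> 's measure \<Rightarrow> bool" where
  "local_kato_class X p \<mu> \<longleftrightarrow> radon_measure \<mu> \<and>
     (\<forall>B\<in>sets borel. semipolar X B \<longrightarrow> emeasure \<mu> B = 0) \<and>
     (\<forall>K. compact K \<longrightarrow>
       ((\<lambda>\<alpha>. SUP x. potential p \<alpha> (density \<mu> (indicator K)) x) \<longlongrightarrow> 0) at_top)"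

section \<open>Additive functionals and space-time occupation measures\<close>

definition pcaf :: "('w, 's::heine_borel) process \<Rightarrow> (ennreal \<Rightarrow> 'w \<Rightarrow> ennreal) \<Rightarrow> bool" where
  "pcaf X A \<longleftrightarrow>
     (\<forall>t<\<top>. A t \<in> borel_measurable (augmented_filtration X t)) \<and>
     (\<exists>\<Lambda>\<in>sets (augmented_filtration X \<top>).
       (\<forall>x. emeasure (prob_from X (Some x)) \<Lambda> = 1) \<and>
       (\<forall>t<\<top>. time_shift X t ` \<Lambda> \<subseteq> \<Lambda>) \<and>
       (\<forall>\<omega>\<in>\<Lambda>.
         A 0 \<omega> = 0 \<and>
         continuous_on {..<\<top>} (\<lambda>t. A t \<omega>) \<and>
         (\<forall>t<lifetime X \<omega>. A t \<omega> < \<top>) \<and>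
         (\<forall>s t. lifetime X \<omega> \<le> s \<and> s \<le> t \<and> t < \<top> \<longrightarrow> A t \<omega> = A s \<omega>) \<and>
         (\<forall>s t. s < \<top> \<and> t < \<top> \<longrightarrow> A (t + s) \<omega> = A t \<omega> + A s (time_shift X t \<omega>))))"

text \<open>
  The Lebesgue--Stieltjes measure of a continuous nondecreasing function \<open>a\<close> with \<open>a 0 = 0\<close>, which may
  reach \<open>\<top>\<close> at a finite time: the increasing limit of the measures of \<open>a\<close> stopped at times where it
  is still finite. \<^const>\<open>ennreal\<close> maps negative times to 0, so negative times carry no mass.
\<close>

definition stieltjes_measure :: "(ennreal \<Rightarrow> ennreal) \<Rightarrow> real measure" where
  "stieltjes_measure a =
     (SUP t\<in>{t. t < \<top> \<and> a t < \<top>}. interval_measure (\<lambda>s. enn2real (a (min (ennreal s) t))))"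

text \<open>
  \<open>dA\<close> carries no mass on \<open>[\<zeta>, \<infinity>)\<close>; restricting it to \<open>[0, \<zeta>)\<close> makes \<open>X\<^sub>t\<close> a point of the state
  space at all times considered.
\<close>

definition additive_measure :: "('w, 's) process \<Rightarrow> (ennreal \<Rightarrow> 'w \<Rightarrow> ennreal) \<Rightarrow> 'w \<Rightarrow> real measure" where
  "additive_measure X A \<omega> =
     restrict_space (stieltjes_measure (\<lambda>t. A t \<omega>)) {t. 0 \<le> t \<and> ennreal t < lifetime X \<omega>}"

definition state_at :: "('w, 's) process \<Rightarrow> 'w \<Rightarrow> real \<Rightarrow> 's" where
  "state_at X \<omega> t = the (state X (ennreal t) \<omega>)"

definition revuz_correspondence :: "('w, 's::heine_borel) process \<Rightarrow> (real \<Rightarrow> 's \<Rightarrow> 's \<Rightarrow> ennreal) \<Rightarrow>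
    's measure \<Rightarrow> (ennreal \<Rightarrow> 'w \<Rightarrow> ennreal) \<Rightarrow> bool" where
  "revuz_correspondence X p \<mu> A \<longleftrightarrow>
     (\<forall>\<alpha>>0. \<forall>f\<in>borel_measurable borel. \<forall>x.
       (\<integral>\<^sup>+ \<omega>. (\<integral>\<^sup>+ t. ennreal (exp (- \<alpha> * t)) * f (state_at X \<omega> t) \<partial>additive_measure X A \<omega>)
          \<partial>prob_from X (Some x)) = potential p \<alpha> (density \<mu> f) x)"

definition stom :: "('w, 's::heine_borel) process \<Rightarrow> (ennreal \<Rightarrow> 'w \<Rightarrow> ennreal) \<Rightarrow> 'w \<Rightarrow> ('s \<times> real) measure" where
  "stom X A \<omega> = distr (additive_measure X A \<omega>) borel_spacetime (\<lambda>t. (state_at X \<omega> t, t))"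

definition radial_cutoff :: "'s::heine_borel \<Rightarrow> real \<Rightarrow> ('s \<times> real) measure \<Rightarrow> ('s \<times> real) measure" where
  "radial_cutoff \<rho> R \<Sigma> =
     density \<Sigma> (\<lambda>(x, t). \<integral>\<^sup>+ r. indicator {R - 1..R} r * indicator (cball \<rho> r) x \<partial>lborel)"

section \<open>Law maps\<close>

definition path_class :: "('w, 's::heine_borel) process \<Rightarrow> 'w \<Rightarrow> 's L0" where
  "path_class X \<omega> = abs_L0 (state_at X \<omega>)"

text \<open>
  The random elements below are specified only almost surely (off an exceptional event a path need
  not be cadlag and \<open>dA\<close> need not make sense), hence the completion.
\<close>

definition law_map :: "('w, 's) process \<Rightarrow> 'e metric \<Rightarrow> ('w \<Rightarrow> 'e) \<Rightarrow> 's \<Rightarrow> 'e measure" where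
  "law_map X E Y x = distr (completion (prob_from X (Some x))) (borel_of (mtopology_of E)) Y"

text \<open>
  The law map of \<open>(X, \<Theta>)\<close>, for a path metric \<open>E\<close>: either \<^const>\<open>DL0_metric\<close>, or \<^const>\<open>L0_metric\<close>
  when laws of cadlag paths are viewed as laws on all of the path space.
\<close>

definition joint_law :: "('w, 's::heine_borel) process \<Rightarrow> 's L0 metric \<Rightarrow>
    ('w \<Rightarrow> ('s \<times> real) measure) \<Rightarrow> 's \<Rightarrow> ('s L0 \<times> ('s \<times> real) measure) measure" where
  "joint_law X E \<Theta> = law_map X (max_metric E measures_fin_metric) (\<lambda>\<omega>. (path_class X \<omega>, \<Theta> \<omega>))"

text \<open>
  \<open>exit_prob X \<rho> R T x\<close> is the probability, starting at \<open>x\<close>, of leaving the closed ball of radius \<open>R\<close>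
  about \<open>\<rho>\<close> before time \<open>T\<close>.
\<close>

definition exit_prob :: "('w, 's::heine_borel) process \<Rightarrow> 's \<Rightarrow> real \<Rightarrow> real \<Rightarrow> 's \<Rightarrow> real" where
  "exit_prob X \<rho> R T x =
     measure (prob_from X (Some x)) {\<omega> \<in> sample_space X. exit_time X (cball \<rho> R) \<omega> < ennreal T}"

end

theory Submission
  imports Defs
begin

text \<open>
  The point is that the cut-off measure \<open>\<Pi>\<^sup>(\<^sup>*\<^sup>,\<^sup>R\<^sup>)\<close> is, uniformly over starting points in a ball, close in
  probability to a uniformly continuous functional of the path in \<open>L\<^sup>0\<close>; its joint law with \<open>X\<close> is
  then a locally uniform limit of push-forwards of the law of \<open>X\<close>, hence continuous. Discretizing
  space and time reduces this to the functionals \<open>\<integral>\<^sub>0\<^sup>t \<phi>(X\<^sub>s) dA\<^sub>s\<close> with \<open>\<phi>\<close> continuous of compact support.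
  Such a functional has \<open>\<alpha>\<close>-potential \<open>U = \<R>\<^sup>\<alpha>(\<phi>\<mu>)\<close>; truncating the time integral at \<open>1/T\<close> and \<open>T\<close>
  makes the potential continuous and, by the Kato condition, changes it little. By the Markov
  property the functional and \<open>\<integral>\<^sub>0\<^sup>t \<alpha> U(X\<^sub>s) ds\<close> have nearly the same mean from every starting point,
  and for continuous additive functionals this forces them to be close in \<open>L\<^sup>2\<close>. Finally \<open>\<Pi>\<^sup>(\<^sup>*\<^sup>,\<^sup>R\<^sup>)\<close> and
  \<open>\<Pi>\<close> agree up to time \<open>N\<close> unless \<open>X\<close> leaves the ball of radius \<open>R - 1\<close> before \<open>N\<close>.
\<close>

section \<open>Almost surely measurable maps into metric spaces\<close>

text \<open>The comparison of means is a resolvent identity. Let W be the integral of exp (-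
  \<alpha> w) \<phi>(X w) over dA. Then \<alpha> times the integral over u in (0, s] of W, shifted
  by u, weighs the mass at w \<le> s with 1 - exp (- \<alpha> w) and the mass at w > s with at most
  exp (- \<alpha> (w - s)). So it differs from the functional up to s only by discounted masses
  started at 0 and at s, whose means are at most the Kato norm at \<alpha>, from every starting
  point. Hence \<alpha> is fixed first and T afterwards. Two obstacles shape the rest. Push-forwards
  are compared in the Prohorov metric, and uniform continuity gives a modulus common to all
  measures; to have it, the density of the approximating occupation integral is cut off far out, at
  the price of an exit probability controlled by (b). Moreover, paths and random measures are
  specified only almost surely, and their behaviour on bad paths is arbitrary. Laws are therefore
  taken over completions, and the measurability of the random measures itself comes from
  approximation in probability.\<close>

abbreviation halfline :: "real measure" where
  "halfline \<equiv> restrict_space lborel {0..}"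

abbreviation mborel :: "'a metric \<Rightarrow> 'a measure" where
  "mborel m \<equiv> borel_of (mtopology_of m)"

text \<open>Over a complete \<open>M\<close> the preimages under such an \<open>f\<close> are
  measurable, but on a null set the values may leave \<open>space N\<close>, and then
  \<open>measurable\<close> itself fails. This is the situation of the random measures
  below.\<close>

definition ae_measurable :: "'a measure \<Rightarrow> 'b measure \<Rightarrow> ('a \<Rightarrow> 'b) \<Rightarrow> bool" where
  "ae_measurable M N f \<longleftrightarrow> (\<exists>f'\<in>measurable M N. AE x in M. f x = f' x)"

text \<open>\<open>distr\<close> is built from the set function of preimages and does not ask
  whether \<open>f\<close> is measurable. By completeness the preimages under \<open>f\<close> and
  \<open>f'\<close> are both measurable and differ by null sets, so the two set functions
  coincide.\<close>

lemma distr_cong_AE_complete: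
  assumes "complete_measure M" and f': "f' \<in> measurable M N" and ae: "AE x in M. f x = f' x"
  shows "distr M N f = distr M N f'"
proof -
  interpret complete_measure M by fact
  obtain Z where Z: "Z \<in> null_sets M" "{x \<in> space M. f x \<noteq> f' x} \<subseteq> Z"
    using ae by (auto elim!: AE_E simp: null_sets_def)
  have "emeasure M (f -` A \<inter> space M) = emeasure M (f' -` A \<inter> space M)" if A: "A \<in> sets N" for A
  proof (rule emeasure_eq_AE)
    show "AE x in M. (x \<in> f -` A \<inter> space M) = (x \<in> f' -` A \<inter> space M)"
      using ae by eventually_elim auto
    show m: "f' -` A \<inter> space M \<in> sets M" using measurable_sets[OF f' A] .
    have "f -` A \<inter> space M \<inter> Z \<in> sets M"
      by (rule complete[OF _ Z(1)]) auto
    moreover have "f -` A \<inter> space M = (f' -` A \<inter> space M - Z) \<union> (f -` A \<inter> space M \<inter> Z)"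
      using Z(2) by auto
    ultimately show "f -` A \<inter> space M \<in> sets M"
      using m Z(1) by (metis null_setsD2 sets.Diff sets.Un)
  qed
  then show ?thesis
    unfolding distr_def by (intro measure_of_eq sets.space_closed) (simp add: sets.sigma_sets_eq)
qed

lemma ae_measurable_comp:
  assumes "h \<in> measurable N K" "ae_measurable M N f"
  shows "ae_measurable M K (\<lambda>x. h (f x))"
proof -
  obtain f' where f': "f' \<in> measurable M N" "AE x in M. f x = f' x"
    using assms(2) unfolding ae_measurable_def by blast
  have "AE x in M. h (f x) = h (f' x)" using f'(2) by eventually_elim simp
  then show ?thesis
    using measurable_compose[OF f'(1) assms(1)] unfolding ae_measurable_def
    by (intro bexI[of _ "\<lambda>x. h (f' x)"])
qed

lemma ae_measurable_distr:
  assumes "complete_measure M" "prob_space M" "ae_measurable M N f"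
  shows "prob_space (distr M N f)" "sets (distr M N f) = sets N"
proof -
  obtain f' where f': "f' \<in> measurable M N" "AE x in M. f x = f' x"
    using assms(3) unfolding ae_measurable_def by blast
  show "prob_space (distr M N f)"
    unfolding distr_cong_AE_complete[OF assms(1) f'] by (rule prob_space.prob_space_distr[OF assms(2) f'(1)])
qed simp

lemma distr_comp_complete:
  assumes "complete_measure M" "ae_measurable M N f" "h \<in> measurable N K"
  shows "distr M K (\<lambda>x. h (f x)) = distr (distr M N f) K h"
proof -
  obtain f' where f': "f' \<in> measurable M N" "AE x in M. f x = f' x"
    using assms(2) unfolding ae_measurable_def by blast
  have "distr M K (\<lambda>x. h (f x)) = distr M K (\<lambda>x. h (f' x))"
    by (rule distr_cong_AE_complete[OF assms(1)])
       (use f' assms(3) in \<open>auto intro: measurable_compose\<close>)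
  also have "\<dots> = distr (distr M N f') K h"
    using distr_distr[OF assms(3) f'(1)] by (simp add: comp_def)
  finally show ?thesis unfolding distr_cong_AE_complete[OF assms(1) f'] .
qed

lemma measurable_mborelI:
  assumes "\<And>x. x \<in> space M \<Longrightarrow> f x \<in> mspace m"
    and "\<And>U. openin (mtopology_of m) U \<Longrightarrow> f -` U \<inter> space M \<in> sets M"
  shows "f \<in> measurable M (mborel m)"
  unfolding borel_of_def
  by (rule measurable_measure_of) (use assms openin_subset[of "mtopology_of m"] in auto)

lemma openin_mtopology_of:
  "openin (mtopology_of m) U \<longleftrightarrow> U \<subseteq> mspace m \<and> (\<forall>x\<in>U. \<exists>r>0. \<forall>y\<in>mspace m. mdist m x y < r \<longrightarrow> y \<in> U)"
proof -
  have "Metric_space.mball (mspace m) (mdist m) x r \<subseteq> U \<longleftrightarrow> (\<forall>y\<in>mspace m. mdist m x y < r \<longrightarrow> y \<in> U)"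
    if "x \<in> mspace m" for x r
    using that by (auto simp: Metric_space.in_mball[OF Metric_space_mspace_mdist])
  then show ?thesis
    unfolding mtopology_of_def Metric_space.openin_mtopology[OF Metric_space_mspace_mdist]
    by (auto simp: subset_eq)
qed

text \<open>\<open>f x\<close> lies in \<open>U\<close> iff for some \<open>k\<close> the
  approximants eventually lie in \<open>V k\<close>, the closed set of points whose open ball of
  radius 1/(k+1) stays in \<open>U\<close>. This writes the preimage of \<open>U\<close> with
  countable unions and intersections.\<close>

lemma measurable_metric_limit:
  assumes fn: "\<And>n::nat. fn n \<in> measurable M (mborel m)"
    and f: "\<And>x. x \<in> space M \<Longrightarrow> f x \<in> mspace m"
    and lim: "\<And>x. x \<in> space M \<Longrightarrow> (\<lambda>n. mdist m (fn n x) (f x)) \<longlonglongrightarrow> 0"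
  shows "f \<in> measurable M (mborel m)"
proof (rule measurable_mborelI[OF f])
  fix U assume U: "openin (mtopology_of m) U"
  define V where "V k = mspace m - open_nbhd m (1 / real (Suc k)) (mspace m - U)" for k
  have V: "V k \<in> sets (mborel m)" for k
    unfolding V_def using sets.top[of "mborel m"] open_nbhd_sets by auto
  have inV: "x \<in> V k \<longleftrightarrow> x \<in> mspace m \<and> (\<forall>y\<in>mspace m. mdist m x y < 1 / real (Suc k) \<longrightarrow> y \<in> U)" for x k
    by (auto simp: V_def open_nbhd_def mdist_commute)
  have "f -` U \<inter> space M = (\<Union>k. \<Union>m. \<Inter>n\<in>{m..}. fn n -` V k \<inter> space M)" (is "_ = ?R")
  proof (intro set_eqI iffI)
    fix x assume x: "x \<in> f -` U \<inter> space M"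
    then obtain r where r: "r > 0" "\<And>y. y \<in> mspace m \<Longrightarrow> mdist m (f x) y < r \<Longrightarrow> y \<in> U"
      using U by (auto simp: openin_mtopology_of)
    obtain k where k: "1 / real (Suc k) < r / 2" using r(1) nat_approx_posE[of "r/2"] by auto
    have "eventually (\<lambda>n. mdist m (fn n x) (f x) < r / 2) sequentially"
      using lim[of x] x r(1) by (intro order_tendstoD) auto
    then obtain N where N: "\<And>n. n \<ge> N \<Longrightarrow> mdist m (fn n x) (f x) < r / 2"
      by (auto simp: eventually_sequentially)
    have "fn n x \<in> V k" if "n \<ge> N" for n
      unfolding inV
    proof (intro conjI ballI impI)
      show fnx: "fn n x \<in> mspace m" using measurable_space[OF fn, of x n] x by auto
      fix y assume y: "y \<in> mspace m" "mdist m (fn n x) y < 1 / real (Suc k)"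
      have "mdist m (f x) y \<le> mdist m (f x) (fn n x) + mdist m (fn n x) y"
        using f x fnx y by (intro mdist_triangle) auto
      then show "y \<in> U" using N[OF that] k y by (intro r(2)) (auto simp: mdist_commute)
    qed
    then show "x \<in> ?R" using x by blast
  next
    fix x assume "x \<in> ?R"
    then obtain k N where *: "x \<in> space M" "\<And>n. n \<ge> N \<Longrightarrow> fn n x \<in> V k" by fastforce
    have "eventually (\<lambda>n. mdist m (fn n x) (f x) < 1 / real (Suc k)) sequentially"
      using lim[of x] * by (intro order_tendstoD) auto
    then obtain n where "n \<ge> N" "mdist m (fn n x) (f x) < 1 / real (Suc k)"
      unfolding eventually_sequentially by (metis linorder_linear)
    then show "x \<in> f -` U \<inter> space M" using * f[of x] by (auto simp: inV)
  qed
  also have "\<dots> \<in> sets M"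
    using measurable_sets[OF fn V] by (intro sets.countable_UN sets.countable_INT image_subsetI) auto
  finally show "f -` U \<inter> space M \<in> sets M" .
qed

lemma ae_measurable_limit:
  assumes ne: "space M \<noteq> {}" and fn: "\<And>n::nat. ae_measurable M (mborel m) (fn n)"
    and f: "AE x in M. f x \<in> mspace m"
    and lim: "AE x in M. (\<lambda>n. mdist m (fn n x) (f x)) \<longlonglongrightarrow> 0"
  shows "ae_measurable M (mborel m) f"
proof -
  obtain gn where gn: "\<And>n. gn n \<in> measurable M (mborel m)" "\<And>n. AE x in M. fn n x = gn n x"
    using fn unfolding ae_measurable_def by metis
  have "AE x in M. f x \<in> mspace m \<and> (\<lambda>n. mdist m (fn n x) (f x)) \<longlonglongrightarrow> 0 \<and> (\<forall>n. fn n x = gn n x)"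
    using f lim gn(2) by (simp add: AE_all_countable)
  then obtain Z where
      good: "\<And>x. x \<in> space M - Z \<Longrightarrow> f x \<in> mspace m \<and> (\<lambda>n. mdist m (fn n x) (f x)) \<longlonglongrightarrow> 0 \<and> (\<forall>n. fn n x = gn n x)"
      and Z: "Z \<in> null_sets M"
    by (rule AE_E3) blast
  \<comment> \<open>All maps get a common value \<open>c\<close> on the exceptional null set; it
    must be a point of the target space, and a value of \<open>gn 0\<close> is one.\<close>
  from ne obtain x0 where "x0 \<in> space M" by auto
  with measurable_space[OF gn(1)[of 0], of x0] obtain c where c: "c \<in> mspace m" by auto
  define g where "g n x = (if x \<in> Z then c else gn n x)" for n x
  define f' where "f' x = (if x \<in> Z then c else f x)" for x
  have [measurable]: "g n \<in> measurable M (mborel m)" for n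
    unfolding g_def using gn(1) c Z by (intro measurable_If_set) (auto intro: null_setsD2)
  have "f' \<in> measurable M (mborel m)"
  proof (rule measurable_metric_limit[of g])
    fix x assume x: "x \<in> space M"
    show "f' x \<in> mspace m" using good c x by (auto simp: f'_def)
    show "(\<lambda>n. mdist m (g n x) (f' x)) \<longlonglongrightarrow> 0"
      using good[of x] x c by (auto simp: g_def f'_def mdist_self)
  qed simp
  moreover have "AE x in M. f x = f' x"
    using AE_not_in[OF Z] by eventually_elim (simp add: f'_def)
  ultimately show ?thesis unfolding ae_measurable_def by blast
qed

text \<open>Closeness in probability in the manner of Ky Fan: one \<epsilon> bounds both the
  distance and the exceptional probability, which matches the single parameter of
  \<open>prohorov_bound\<close>. A measurable \<open>H\<close> is demanded, since the event that the
  distance is small need not be measurable for arbitrary \<open>f\<close> and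
  \<open>g\<close>.\<close>

definition close_maps :: "'a measure \<Rightarrow> 'b metric \<Rightarrow> real \<Rightarrow> ('a \<Rightarrow> 'b) \<Rightarrow> ('a \<Rightarrow> 'b) \<Rightarrow> bool" where
  "close_maps M m \<epsilon> f g \<longleftrightarrow> (\<exists>H\<in>sets M. emeasure M (space M - H) \<le> ennreal \<epsilon> \<and>
     (\<forall>x\<in>H. f x \<in> mspace m \<and> g x \<in> mspace m \<and> mdist m (f x) (g x) \<le> \<epsilon>))"

text \<open>Along \<epsilon> = 2^-n the exceptional probabilities are summable, so by Borel-Cantelli
  the approximants converge to \<open>f\<close> almost surely.\<close>

lemma close_maps_imp_ae_measurable:
  assumes "prob_space M"
    and close: "\<And>\<epsilon>. \<epsilon> > 0 \<Longrightarrow> \<exists>g. ae_measurable M (mborel m) g \<and> close_maps M m \<epsilon> g f"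
  shows "ae_measurable M (mborel m) f"
proof -
  interpret prob_space M by fact
  have "\<exists>g H. ae_measurable M (mborel m) g \<and> H \<in> sets M \<and> emeasure M (space M - H) \<le> ennreal ((1/2)^n) \<and>
    (\<forall>x\<in>H. f x \<in> mspace m \<and> g x \<in> mspace m \<and> mdist m (g x) (f x) \<le> (1/2)^n)" for n :: nat
    using close[of "(1/2)^n"] unfolding close_maps_def by force
  then obtain g H where g: "\<And>n. ae_measurable M (mborel m) (g n)" and H: "\<And>n. H n \<in> sets M"
    and small: "\<And>n. emeasure M (space M - H n) \<le> ennreal ((1/2)^n)"
    and d: "\<And>n x. x \<in> H n \<Longrightarrow> f x \<in> mspace m \<and> g n x \<in> mspace m \<and> mdist m (g n x) (f x) \<le> (1/2)^n"
    by metis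
  have "AE x in M. eventually (\<lambda>n. x \<in> space M - (space M - H n)) sequentially"
  proof (rule borel_cantelli_AE1)
    show "summable (\<lambda>n. measure M (space M - H n))"
      by (rule summable_comparison_test'[of "\<lambda>n. (1/2)^n" 0])
         (use small in \<open>auto simp: emeasure_eq_measure summable_geometric\<close>)
  qed (use H in \<open>auto simp: emeasure_eq_measure\<close>)
  then have ev: "AE x in M. eventually (\<lambda>n. x \<in> H n) sequentially"
    by eventually_elim (auto elim: eventually_mono)
  show ?thesis
  proof (rule ae_measurable_limit[OF not_empty g])
    show "AE x in M. f x \<in> mspace m"
      using ev by eventually_elim (auto simp: eventually_sequentially dest: d)
    show "AE x in M. (\<lambda>n. mdist m (g n x) (f x)) \<longlonglongrightarrow> 0"
      using ev
    proof eventually_elim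
      case (elim x)
      show ?case
        by (rule tendsto_sandwich[OF _ _ tendsto_const LIMSEQ_power_zero[of "1/2::real"]])
           (use elim in \<open>auto elim!: eventually_mono dest: d\<close>)
    qed
  qed
qed

section \<open>The Prohorov metric under couplings and push-forwards\<close>

text \<open>The easy direction of Strassen's theorem: on \<open>H\<close>, if \<open>f x\<close> is
  in \<open>A\<close> then \<open>g x\<close> is in the closed \<epsilon>-neighbourhood. That
  neighbourhood need not be Borel, so its outer measure is estimated through every Borel superset
  \<open>B\<close>.\<close>

lemma coupling_half:
  assumes [measurable]: "f \<in> measurable M (mborel m)" "g \<in> measurable M (mborel m)" "H \<in> sets M"
    and small: "emeasure M (space M - H) \<le> ennreal \<epsilon>"
    and d: "\<And>x. x \<in> H \<Longrightarrow> mdist m (f x) (g x) \<le> \<epsilon>"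
    and A[measurable]: "A \<in> sets (mborel m)"
  shows "emeasure (distr M (mborel m) f) A
    \<le> outer_measure_of (distr M (mborel m) g) (closed_nbhd m \<epsilon> A) + ennreal \<epsilon>"
proof -
  have "emeasure (distr M (mborel m) f) A = emeasure M (f -` A \<inter> space M)" by (simp add: emeasure_distr)
  also have "\<dots> \<le> emeasure M ((f -` A \<inter> space M \<inter> H) \<union> (space M - H))"
    by (intro emeasure_mono) auto
  also have "\<dots> \<le> emeasure M (f -` A \<inter> space M \<inter> H) + ennreal \<epsilon>"
    by (rule order_trans[OF emeasure_subadditive]) (use small in \<open>auto intro: add_left_mono\<close>)
  also have "emeasure M (f -` A \<inter> space M \<inter> H) \<le> outer_measure_of (distr M (mborel m) g) (closed_nbhd m \<epsilon> A)"
    unfolding outer_measure_of_def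
  proof (rule INF_greatest)
    fix B assume "B \<in> {B \<in> sets (distr M (mborel m) g). closed_nbhd m \<epsilon> A \<subseteq> B}"
    then have B: "B \<in> sets (mborel m)" "closed_nbhd m \<epsilon> A \<subseteq> B" by auto
    have sub: "f -` A \<inter> space M \<inter> H \<subseteq> g -` B \<inter> space M"
    proof
      fix x assume x: "x \<in> f -` A \<inter> space M \<inter> H"
      then have "g x \<in> closed_nbhd m \<epsilon> A"
        using d[of x] measurable_space[OF assms(2), of x] by (auto simp: closed_nbhd_def mdist_commute)
      then show "x \<in> g -` B \<inter> space M" using B x by auto
    qed
    have "emeasure M (f -` A \<inter> space M \<inter> H) \<le> emeasure M (g -` B \<inter> space M)"
      using B by (intro emeasure_mono sub measurable_sets[OF assms(2)]) auto
    then show "emeasure M (f -` A \<inter> space M \<inter> H) \<le> emeasure (distr M (mborel m) g) B"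
      using B by (simp add: emeasure_distr)
  qed
  finally show ?thesis by (simp add: add_right_mono)
qed

lemma prohorov_bound_coupling:
  assumes "f \<in> measurable M (mborel m)" "g \<in> measurable M (mborel m)" "H \<in> sets M"
    and "emeasure M (space M - H) \<le> ennreal \<epsilon>" and "\<And>x. x \<in> H \<Longrightarrow> mdist m (f x) (g x) \<le> \<epsilon>"
  shows "prohorov_bound m (distr M (mborel m) f) (distr M (mborel m) g) \<epsilon>"
  unfolding prohorov_bound_def
proof (intro ballI conjI)
  fix A assume A: "A \<in> sets (mborel m)"
  show "emeasure (distr M (mborel m) f) A
      \<le> outer_measure_of (distr M (mborel m) g) (closed_nbhd m \<epsilon> A) + ennreal \<epsilon>"
    by (rule coupling_half[OF assms A])
  have "mdist m (g x) (f x) \<le> \<epsilon>" if "x \<in> H" for x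
    using assms(5)[OF that] by (simp add: mdist_commute)
  from coupling_half[OF assms(2,1,3,4) this A]
  show "emeasure (distr M (mborel m) g) A
      \<le> outer_measure_of (distr M (mborel m) f) (closed_nbhd m \<epsilon> A) + ennreal \<epsilon>" .
qed

text \<open>Closeness in probability on one probability space bounds the Prohorov distance of the
  laws. Both maps are replaced by measurable versions, and \<open>H\<close> shrinks by the null set
  where the versions differ from them.\<close>

lemma prohorov_dist_close_maps:
  assumes "complete_measure M" "ae_measurable M (mborel m) f" "ae_measurable M (mborel m) g"
    and "close_maps M m \<epsilon> f g" "0 < \<epsilon>"
  shows "prohorov_dist m (distr M (mborel m) f) (distr M (mborel m) g) \<le> \<epsilon>"
proof -
  interpret complete_measure M by fact
  obtain f' g' where f': "f' \<in> measurable M (mborel m)" "AE x in M. f x = f' x"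
    and g': "g' \<in> measurable M (mborel m)" "AE x in M. g x = g' x"
    using assms(2,3) unfolding ae_measurable_def by blast
  obtain H where H: "H \<in> sets M" "emeasure M (space M - H) \<le> ennreal \<epsilon>"
    "\<And>x. x \<in> H \<Longrightarrow> mdist m (f x) (g x) \<le> \<epsilon>"
    using assms(4) by (auto simp: close_maps_def)
  have "AE x in M. f x = f' x \<and> g x = g' x" using f' g' by auto
  then obtain Z where Z: "\<And>x. x \<in> space M - Z \<Longrightarrow> f x = f' x \<and> g x = g' x" "Z \<in> null_sets M"
    by (rule AE_E3) blast
  have "prohorov_bound m (distr M (mborel m) f') (distr M (mborel m) g') \<epsilon>"
  proof (rule prohorov_bound_coupling[OF f'(1) g'(1)])
    show "H - Z \<in> sets M" using H Z by auto
    have "emeasure M (space M - (H - Z)) \<le> emeasure M ((space M - H) \<union> Z)"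
      using H Z by (intro emeasure_mono) auto
    also have "\<dots> = emeasure M (space M - H)"
      using H Z by (intro emeasure_Un_null_set) auto
    finally show "emeasure M (space M - (H - Z)) \<le> ennreal \<epsilon>" using H(2) by simp
    fix x assume "x \<in> H - Z"
    then show "mdist m (f' x) (g' x) \<le> \<epsilon>"
      using H Z(1)[of x] sets.sets_into_space[OF H(1)] by force
  qed
  then show ?thesis
    unfolding distr_cong_AE_complete[OF assms(1) f'] distr_cong_AE_complete[OF assms(1) g']
    using assms(5) by (rule prohorov_dist_le)
qed

definition uc_map :: "'a metric \<Rightarrow> 'b metric \<Rightarrow> ('a \<Rightarrow> 'b) \<Rightarrow> bool" where
  "uc_map m m' h \<longleftrightarrow> h ` mspace m \<subseteq> mspace m' \<and>
     (\<forall>\<epsilon>>0. \<exists>\<delta>>0. \<forall>x\<in>mspace m. \<forall>y\<in>mspace m. mdist m x y < \<delta> \<longrightarrow> mdist m' (h x) (h y) < \<epsilon>)"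

lemma uc_map_measurable:
  assumes "uc_map m m' h" shows "h \<in> measurable (mborel m) (mborel m')"
proof (rule measurable_mborelI)
  show "h x \<in> mspace m'" if "x \<in> space (mborel m)" for x
    using assms that by (auto simp: uc_map_def)
  fix U assume U: "openin (mtopology_of m') U"
  have "openin (mtopology_of m) (h -` U \<inter> mspace m)"
    unfolding openin_mtopology_of
  proof (intro conjI ballI)
    fix x assume x: "x \<in> h -` U \<inter> mspace m"
    then obtain r where "r > 0" "\<And>y. y \<in> mspace m' \<Longrightarrow> mdist m' (h x) y < r \<Longrightarrow> y \<in> U"
      using U by (auto simp: openin_mtopology_of)
    with assms x obtain \<delta> where "\<delta> > 0" "\<forall>y\<in>mspace m. mdist m x y < \<delta> \<longrightarrow> h y \<in> U"
      unfolding uc_map_def image_subset_iff by (metis Int_iff)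
    then show "\<exists>r>0. \<forall>y\<in>mspace m. mdist m x y < r \<longrightarrow> y \<in> h -` U \<inter> mspace m" by auto
  qed simp
  then show "h -` U \<inter> space (mborel m) \<in> sets (mborel m)" by (simp add: openin_borel_of)
qed

text \<open>The closed e-neighbourhood of the preimage of \<open>A\<close> lies in the preimage of
  the closed \<epsilon>-neighbourhood of \<open>A\<close>. As the modulus of \<open>h\<close> holds
  on the whole space, one \<delta> works for all pairs of measures, and no tightness argument
  enters.\<close>

lemma prohorov_dist_uc_map:
  assumes h: "uc_map m m' h" and "\<epsilon> > 0"
  shows "\<exists>\<delta>>0. \<forall>\<mu>\<in>mspace (prob_metric m). \<forall>\<nu>\<in>mspace (prob_metric m). prohorov_dist m \<mu> \<nu> < \<delta> \<longrightarrow>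
    prohorov_dist m' (distr \<mu> (mborel m') h) (distr \<nu> (mborel m') h) \<le> \<epsilon>"
proof -
  obtain \<delta>0 where \<delta>0: "\<delta>0 > 0"
    "\<And>x y. x \<in> mspace m \<Longrightarrow> y \<in> mspace m \<Longrightarrow> mdist m x y < \<delta>0 \<Longrightarrow> mdist m' (h x) (h y) < \<epsilon>"
    using assms by (auto simp: uc_map_def)
  \<comment> \<open>The minimum with \<epsilon> takes care of the additive term in
    \<open>prohorov_bound\<close>.\<close>
  define \<delta> where "\<delta> = min \<delta>0 \<epsilon>"
  have half: "emeasure (distr \<mu> (mborel m') h) A
        \<le> outer_measure_of (distr \<nu> (mborel m') h) (closed_nbhd m' \<epsilon> A) + ennreal \<epsilon>"
    if \<mu>: "sets \<mu> = sets (mborel m)" and \<nu>: "sets \<nu> = sets (mborel m)"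
      and b: "prohorov_bound m \<mu> \<nu> e" "e < \<delta>" and A: "A \<in> sets (mborel m')" for \<mu> \<nu> e A
  proof -
    have hm: "h \<in> measurable \<mu> (mborel m')" "h \<in> measurable \<nu> (mborel m')"
      using uc_map_measurable[OF h] \<mu> \<nu> by (simp_all cong: measurable_cong_sets)
    have sp: "space \<mu> = mspace m" "space \<nu> = mspace m"
      using sets_eq_imp_space_eq[OF \<mu>] sets_eq_imp_space_eq[OF \<nu>] by simp_all
    let ?A = "h -` A \<inter> mspace m"
    have "emeasure (distr \<mu> (mborel m') h) A = emeasure \<mu> ?A"
      using hm A sp by (simp add: emeasure_distr)
    also have "\<dots> \<le> outer_measure_of \<nu> (closed_nbhd m e ?A) + ennreal e"
      using b(1) measurable_sets[OF hm(1) A] \<mu> sp by (auto simp: prohorov_bound_def)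
    also have "\<dots> \<le> outer_measure_of (distr \<nu> (mborel m') h) (closed_nbhd m' \<epsilon> A) + ennreal \<epsilon>"
    proof (intro add_mono ennreal_leI)
      show "e \<le> \<epsilon>" using b(2) by (simp add: \<delta>_def)
      show "outer_measure_of \<nu> (closed_nbhd m e ?A) \<le> outer_measure_of (distr \<nu> (mborel m') h) (closed_nbhd m' \<epsilon> A)"
        unfolding outer_measure_of_def[of "distr _ _ _"]
      proof (rule INF_greatest)
        fix B assume "B \<in> {B \<in> sets (distr \<nu> (mborel m') h). closed_nbhd m' \<epsilon> A \<subseteq> B}"
        then have B: "B \<in> sets (mborel m')" "closed_nbhd m' \<epsilon> A \<subseteq> B" by auto
        have "closed_nbhd m e ?A \<subseteq> h -` B \<inter> mspace m"
        proof
          fix x assume "x \<in> closed_nbhd m e ?A"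
          then obtain y where y: "x \<in> mspace m" "y \<in> mspace m" "h y \<in> A" "mdist m x y \<le> e"
            by (auto simp: closed_nbhd_def)
          then have "mdist m' (h x) (h y) < \<epsilon>" using b(2) by (intro \<delta>0) (auto simp: \<delta>_def)
          then have "h x \<in> closed_nbhd m' \<epsilon> A"
            using y h by (auto simp: closed_nbhd_def uc_map_def intro!: bexI[of _ "h y"])
          then show "x \<in> h -` B \<inter> mspace m" using y B by auto
        qed
        then have "outer_measure_of \<nu> (closed_nbhd m e ?A) \<le> outer_measure_of \<nu> (h -` B \<inter> mspace m)"
          by (rule outer_measure_of_mono)
        also have "\<dots> = emeasure (distr \<nu> (mborel m') h) B"
          using measurable_sets[OF hm(2) B(1)] B hm sp by (simp add: emeasure_distr)
        finally show "outer_measure_of \<nu> (closed_nbhd m e ?A) \<le> emeasure (distr \<nu> (mborel m') h) B" .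
      qed
    qed
    finally show ?thesis .
  qed
  show ?thesis
  proof (intro exI[of _ \<delta>] conjI ballI impI)
    show "\<delta> > 0" using \<delta>0 assms(2) by (simp add: \<delta>_def)
    fix \<mu> \<nu> assume *: "\<mu> \<in> mspace (prob_metric m)" "\<nu> \<in> mspace (prob_metric m)" "prohorov_dist m \<mu> \<nu> < \<delta>"
    then have "\<mu> \<in> finite_borel_measures m" "\<nu> \<in> finite_borel_measures m"
      by (auto simp: finite_borel_measures_def prob_space_def)
    from prohorov_dist_less[OF this *(3)] obtain e where e: "e < \<delta>" "prohorov_bound m \<mu> \<nu> e" by auto
    then have e': "prohorov_bound m \<nu> \<mu> e" by (simp add: prohorov_bound_sym)
    have "prohorov_bound m' (distr \<mu> (mborel m') h) (distr \<nu> (mborel m') h) \<epsilon>"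
      unfolding prohorov_bound_def using half[OF _ _ e(2,1)] half[OF _ _ e' e(1)] * by simp
    then show "prohorov_dist m' (distr \<mu> (mborel m') h) (distr \<nu> (mborel m') h) \<le> \<epsilon>"
      using assms(2) by (rule prohorov_dist_le)
  qed
qed

section \<open>Continuous maps into metric spaces\<close>

lemma continuous_map_metric_iff:
  fixes F :: "'s::metric_space \<Rightarrow> 'b"
  shows "continuous_map euclidean (mtopology_of m) F \<longleftrightarrow>
    range F \<subseteq> mspace m \<and> (\<forall>x. \<forall>\<epsilon>>0. \<exists>\<delta>>0. \<forall>y. dist x y < \<delta> \<longrightarrow> mdist m (F x) (F y) < \<epsilon>)"
proof
  assume F: "continuous_map euclidean (mtopology_of m) F"
  then have r: "range F \<subseteq> mspace m"
    by (auto simp: continuous_map_def)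
  have "\<exists>\<delta>>0. \<forall>y. dist x y < \<delta> \<longrightarrow> mdist m (F x) (F y) < \<epsilon>" if "\<epsilon> > 0" for x \<epsilon>
  proof -
    have "open {y. F y \<in> mball_of m (F x) \<epsilon>}"
      using openin_continuous_map_preimage[OF F, of "mball_of m (F x) \<epsilon>"]
      by (simp add: mtopology_of_def mball_of_def Metric_space.openin_mball)
    moreover have "F x \<in> mspace m" using r by auto
    then have "x \<in> {y. F y \<in> mball_of m (F x) \<epsilon>}"
      using that by (simp add: mdist_self)
    ultimately obtain \<delta> where "\<delta> > 0" "ball x \<delta> \<subseteq> {y. F y \<in> mball_of m (F x) \<epsilon>}"
      using open_contains_ball by blast
    then show ?thesis by (intro exI[of _ \<delta>]) (auto simp: subset_iff)
  qed
  then show "range F \<subseteq> mspace m \<and> (\<forall>x. \<forall>\<epsilon>>0. \<exists>\<delta>>0. \<forall>y. dist x y < \<delta> \<longrightarrow> mdist m (F x) (F y) < \<epsilon>)"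
    using r by blast
next
  assume *: "range F \<subseteq> mspace m \<and> (\<forall>x. \<forall>\<epsilon>>0. \<exists>\<delta>>0. \<forall>y. dist x y < \<delta> \<longrightarrow> mdist m (F x) (F y) < \<epsilon>)"
  show "continuous_map euclidean (mtopology_of m) F"
    unfolding continuous_map_def
  proof (intro conjI allI impI)
    show "F \<in> topspace euclidean \<rightarrow> topspace (mtopology_of m)" using * by auto
    fix U assume U: "openin (mtopology_of m) U"
    have "open {x. F x \<in> U}"
      unfolding open_contains_ball
    proof
      fix x assume "x \<in> {x. F x \<in> U}"
      then obtain r where r: "r > 0" "\<And>z. z \<in> mspace m \<Longrightarrow> mdist m (F x) z < r \<Longrightarrow> z \<in> U"
        using U unfolding openin_mtopology_of by blast
      obtain \<delta> where "\<delta> > 0" "\<And>y. dist x y < \<delta> \<Longrightarrow> mdist m (F x) (F y) < r"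
        using * r(1) by blast
      then show "\<exists>e>0. ball x e \<subseteq> {x. F x \<in> U}"
        using r * by (intro exI[of _ \<delta>]) (auto simp: subset_iff image_subset_iff)
    qed
    then show "openin euclidean {x \<in> topspace euclidean. F x \<in> U}" by simp
  qed
qed

lemma continuous_map_local_uniform_limit:
  fixes F :: "'s::metric_space \<Rightarrow> 'b"
  assumes F: "range F \<subseteq> mspace m"
    and approx: "\<And>x \<epsilon>. \<epsilon> > 0 \<Longrightarrow> \<exists>G. continuous_map euclidean (mtopology_of m) G \<and>
      (\<exists>\<delta>>0. \<forall>y. dist x y < \<delta> \<longrightarrow> mdist m (G y) (F y) \<le> \<epsilon>)"
  shows "continuous_map euclidean (mtopology_of m) F"
  unfolding continuous_map_metric_iff
proof (intro conjI F allI impI)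
  fix x and \<epsilon> :: real assume "\<epsilon> > 0"
  then obtain G \<delta>1 where G: "continuous_map euclidean (mtopology_of m) G"
    and \<delta>1: "\<delta>1 > 0" "\<And>y. dist x y < \<delta>1 \<Longrightarrow> mdist m (G y) (F y) \<le> \<epsilon> / 4"
    using approx[of "\<epsilon>/4" x] by auto
  obtain \<delta>2 where \<delta>2: "\<delta>2 > 0" "\<And>y. dist x y < \<delta>2 \<Longrightarrow> mdist m (G x) (G y) < \<epsilon> / 4"
    using G[unfolded continuous_map_metric_iff, THEN conjunct2, rule_format, of "\<epsilon>/4" x] \<open>\<epsilon> > 0\<close> by auto
  have G': "G y \<in> mspace m" "F y \<in> mspace m" for y using G F by (auto simp: continuous_map_metric_iff)
  show "\<exists>\<delta>>0. \<forall>y. dist x y < \<delta> \<longrightarrow> mdist m (F x) (F y) < \<epsilon>"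
  proof (intro exI[of _ "min \<delta>1 \<delta>2"] conjI allI impI)
    fix y assume "dist x y < min \<delta>1 \<delta>2"
    then show "mdist m (F x) (F y) < \<epsilon>"
      using \<delta>1(1) \<delta>1(2)[of x] \<delta>1(2)[of y] \<delta>2(2)[of y] \<open>\<epsilon> > 0\<close>
        mdist_triangle[of "F x" m "G x" "F y"] mdist_triangle[of "G x" m "G y" "F y"] G' mdist_commute[of m "F x" "G x"]
      by (simp del: mdist_commute)
  qed (use \<delta>1 \<delta>2 in auto)
qed

text \<open>It suffices to treat subbasic sets. These are centred at an arbitrary \<open>H\<close>,
  not at the limit \<open>F\<close>, so closeness to \<open>F\<close> alone says nothing at once;
  but the continuous function \<open>mdist m (H x) (F x)\<close> attains its maximum on
  \<open>K\<close>, which stays below \<epsilon>, and the gap \<open>c\<close> is the accuracy to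
  ask for on a ball containing \<open>K\<close>.\<close>

lemma limitin_compact_convergence:
  fixes F :: "'s::heine_borel \<Rightarrow> 'b" and \<rho> :: 's
  assumes F: "continuous_map euclidean (mtopology_of m) F"
    and G: "\<forall>\<^sub>F R in net. continuous_map euclidean (mtopology_of m) (G R)"
    and lim: "\<And>r \<epsilon>. \<epsilon> > 0 \<Longrightarrow> \<forall>\<^sub>F R in net. \<forall>x\<in>cball \<rho> r. mdist m (G R x) (F x) \<le> \<epsilon>"
  shows "limitin (compact_convergence m) G F net"
proof -
  let ?S = "{{G. continuous_map euclidean (mtopology_of m) G \<and> (\<forall>x\<in>K. mdist m (F x) (G x) < \<epsilon>)} | F K \<epsilon>.
       continuous_map euclidean (mtopology_of m) F \<and> compact (K::'s set) \<and> 0 < \<epsilon>}"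
  have range: "H x \<in> mspace m" if "continuous_map euclidean (mtopology_of m) H" for H and x :: 's
    using that by (auto simp: continuous_map_metric_iff)
  have basic: "\<forall>\<^sub>F R in net. G R \<in> U" if U: "U \<in> ?S" and FU: "F \<in> U" for U
  proof -
    obtain H K \<epsilon> where H: "continuous_map euclidean (mtopology_of m) H" "compact K" "0 < \<epsilon>"
      and U_eq: "U = {G. continuous_map euclidean (mtopology_of m) G \<and> (\<forall>x\<in>K. mdist m (H x) (G x) < \<epsilon>)}"
      using U by auto
    have lt: "mdist m (H x) (F x) < \<epsilon>" if "x \<in> K" for x using FU that U_eq by auto
    have "continuous_on K (\<lambda>x. mdist m (H x) (F x))"
      unfolding continuous_on_iff
    proof (intro ballI allI impI)
      fix x and e :: real assume "e > 0"
      then obtain \<delta>1 \<delta>2 where \<delta>: "\<delta>1 > 0" "\<And>y. dist x y < \<delta>1 \<Longrightarrow> mdist m (H x) (H y) < e/2"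
        "\<delta>2 > 0" "\<And>y. dist x y < \<delta>2 \<Longrightarrow> mdist m (F x) (F y) < e/2"
        using H(1)[unfolded continuous_map_metric_iff, THEN conjunct2, rule_format, of "e/2" x]
          F[unfolded continuous_map_metric_iff, THEN conjunct2, rule_format, of "e/2" x] by auto
      have "\<bar>mdist m (H y) (F y) - mdist m (H x) (F x)\<bar> < e" if "dist x y < min \<delta>1 \<delta>2" for y
      proof -
        note r = range[OF H(1)] range[OF F]
        show ?thesis
          using \<delta>(2)[of y] \<delta>(4)[of y] that mdist_triangle[of "H y" m "H x" "F y"] mdist_triangle[of "H x" m "F x" "F y"]
            mdist_triangle[of "H x" m "H y" "F x"] mdist_triangle[of "H y" m "F y" "F x"] r
            mdist_commute[of m "H x" "H y"] mdist_commute[of m "F x" "F y"]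
          by (simp del: mdist_commute)
      qed
      then show "\<exists>d>0. \<forall>x'\<in>K. dist x' x < d \<longrightarrow> dist (mdist m (H x') (F x')) (mdist m (H x) (F x)) < e"
        using \<delta> by (intro exI[of _ "min \<delta>1 \<delta>2"]) (auto simp: dist_real_def dist_commute)
    qed
    then obtain c where c: "c > 0" "\<And>x. x \<in> K \<Longrightarrow> mdist m (H x) (F x) + c < \<epsilon>"
    proof (cases "K = {}")
      case False
      obtain x0 where x0: "x0 \<in> K" "\<And>x. x \<in> K \<Longrightarrow> mdist m (H x) (F x) \<le> mdist m (H x0) (F x0)"
        using continuous_attains_sup[OF H(2) False \<open>continuous_on K _\<close>] by blast
      show ?thesis
      proof (rule that[of "(\<epsilon> - mdist m (H x0) (F x0)) / 2"])
        fix x assume "x \<in> K"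
        then show "mdist m (H x) (F x) + (\<epsilon> - mdist m (H x0) (F x0)) / 2 < \<epsilon>"
          using x0(2)[of x] lt[OF x0(1)] by (simp add: field_simps)
      qed (use lt[OF x0(1)] in simp)
    qed (use that[of 1] in auto)
    obtain r where "\<forall>x\<in>K. dist \<rho> x \<le> r"
      using compact_imp_bounded[OF H(2)] unfolding bounded_any_center[of _ \<rho>] ..
    then have r: "K \<subseteq> cball \<rho> r" by auto
    show ?thesis
      using G lim[OF c(1), of r]
    proof eventually_elim
      case (elim R)
      have "mdist m (H x) (G R x) < \<epsilon>" if "x \<in> K" for x
      proof -
        have "mdist m (F x) (G R x) \<le> c"
          using elim(2) r that by (auto simp: mdist_commute[of m "F x"])
        moreover have "mdist m (H x) (G R x) \<le> mdist m (H x) (F x) + mdist m (F x) (G R x)"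
          by (rule mdist_triangle[OF range[OF H(1)] range[OF F] range[OF elim(1)]])
        ultimately show ?thesis using c(2)[OF that] by linarith
      qed
      then show ?case using elim(1) by (auto simp: U_eq)
    qed
  qed
  have gen: "\<forall>\<^sub>F R in net. G R \<in> U" if "generate_topology_on ?S U" "F \<in> U" for U
    using that
  proof induction
    case (UN K)
    then obtain U where "U \<in> K" "F \<in> U" by auto
    with UN have "\<forall>\<^sub>F R in net. G R \<in> U" by auto
    then show ?case by eventually_elim (use \<open>U \<in> K\<close> in auto)
  qed (use basic in \<open>auto simp: eventually_conj_iff\<close>)
  \<comment> \<open>\<open>F\<close> has to belong to the topological space, which is the union of
    the subbasis; the empty compact set imposes no condition and gives a subbasic set containing
    \<open>F\<close>.\<close>
  have "{G. continuous_map euclidean (mtopology_of m) G \<and> (\<forall>x\<in>{}. mdist m (F x) (G x) < 1)} \<in> ?S"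
    using F by (intro CollectI exI[of _ F] exI[of _ "{}"] exI[of _ 1]) auto
  then have "F \<in> \<Union>?S" using F by blast
  then show ?thesis
    unfolding compact_convergence_def limitin_def topology_generated_by_topspace openin_topology_generated_by_iff
    using gen by blast
qed

section \<open>Exponentially discounted distances\<close>

lemma integral_exp_tail:
  assumes "0 \<le> T"
  shows "(\<integral>t. exp (- t) * indicator {T..} t \<partial>halfline) = exp (- T :: real)"
proof -
  have "((\<lambda>a::real. - exp (- a)) \<longlongrightarrow> - 0) at_top"
    by (intro tendsto_minus filterlim_compose[OF exp_at_bot] filterlim_uminus_at_bot_at_top)
  then have "(\<integral>\<^sup>+ t. ennreal (exp (- t)) * indicator {T..} t \<partial>lborel) = ennreal (0 - - exp (- T))"
    by (intro nn_integral_FTC_atLeast) (auto intro!: derivative_eq_intros)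
  then have "(\<integral>t. exp (- t) * indicator {T..} t \<partial>lborel) = exp (- T)"
    by (intro integral_eq_nn_integral[THEN trans])
       (auto simp: ennreal_mult' ennreal_indicator)
  moreover have "(\<lambda>t. indicator {0..} t *\<^sub>R (exp (- t) * indicator {T..} t)) = (\<lambda>t::real. exp (- t) * indicator {T..} t :: real)"
    using assms by (auto simp: indicator_def)
  ultimately show ?thesis by (simp add: integral_restrict_space)
qed

text \<open>Times beyond \<open>T\<close> contribute at most exp (- T) because of the cap at 1.
  Nothing is assumed on the measurability of \<open>g\<close>: if the integrand is not integrable,
  the Bochner integral has the default value 0, which is below the bound. This covers the Hausdorff
  distances in \<open>d_hat\<close>.\<close>

lemma integral_exp_capped_le:
  assumes T: "0 \<le> T" and k: "integrable halfline (\<lambda>t. exp (- t) * k t)" "\<And>t. 0 \<le> t \<Longrightarrow> 0 \<le> k t"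
    and c: "(\<integral>t. exp (- t) * k t \<partial>halfline) \<le> c"
    and g: "\<And>t. 0 \<le> t \<Longrightarrow> t < T \<Longrightarrow> g t \<le> k t"
  shows "(\<integral>t. exp (- t) * min 1 (g t) \<partial>halfline) \<le> c + exp (- T :: real)"
proof (cases "integrable halfline (\<lambda>t. exp (- t) * min 1 (g t))")
  case True
  have int2: "integrable halfline (\<lambda>t. exp (- t) * indicator {T..} t :: real)"
    by (rule Bochner_Integration.integrable_bound[OF integrable_exp_halfline])
       (auto simp: abs_mult indicator_def intro: measurable_restrict_space1)
  have "(\<integral>t. exp (- t) * min 1 (g t) \<partial>halfline) \<le>
      (\<integral>t. exp (- t) * k t + exp (- t) * indicator {T..} t \<partial>halfline)"
  proof (rule integral_mono[OF True Bochner_Integration.integrable_add[OF k(1) int2]])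
    fix t assume "t \<in> space (restrict_space lborel {0::real..})"
    then have "0 \<le> t" by (simp add: space_restrict_space)
    then have "min 1 (g t) \<le> k t + indicator {T..} t"
      using g[of t] k(2)[of t] by (cases "t < T") (auto simp: indicator_def)
    then have "exp (- t) * min 1 (g t) \<le> exp (- t) * (k t + indicator {T..} t)"
      by (intro mult_left_mono) auto
    then show "exp (- t) * min 1 (g t) \<le> exp (- t) * k t + exp (- t) * indicator {T..} t"
      by (simp only: distrib_left)
  qed
  also have "\<dots> \<le> c + exp (- T)"
    using c by (subst Bochner_Integration.integral_add[OF k(1) int2]) (simp add: integral_exp_tail[OF T])
  finally show ?thesis .
next
  case False
  have "0 \<le> (\<integral>t. exp (- t) * k t \<partial>halfline)"
    using k(2) by (intro integral_nonneg_AE AE_I2) (auto simp: space_restrict_space)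
  then have "0 \<le> c" using c by simp
  then show ?thesis using False by (simp add: not_integrable_integral_eq)
qed

lemma integral_exp_halfline: "(\<integral>t. exp (- t) \<partial>halfline) = (1::real)"
proof -
  have "(\<integral>t. exp (- t) \<partial>halfline) = (\<integral>t. exp (- t) * indicator {0..} t \<partial>restrict_space lborel {0::real..})"
    by (rule Bochner_Integration.integral_cong) (auto simp: space_restrict_space)
  then show ?thesis using integral_exp_tail[of 0] by simp
qed

lemma integral_exp_capped_le_const:
  assumes "0 \<le> T" "0 \<le> c" "\<And>t. 0 \<le> t \<Longrightarrow> t < T \<Longrightarrow> g t \<le> c"
  shows "(\<integral>t. exp (- t) * min 1 (g t) \<partial>halfline) \<le> c + exp (- T :: real)"
proof (rule integral_exp_capped_le[where k="\<lambda>_. c"])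
  show "integrable halfline (\<lambda>t::real. exp (- t) * c)"
    by (rule integrable_mult_left) (rule integrable_exp_halfline)
  show "(\<integral>t. exp (- t) * c \<partial>halfline) \<le> c"
    using integral_exp_halfline by simp
qed (use assms in auto)

text \<open>Points of the two graphs over the same \<open>x\<close> are matched, so the first
  coordinates contribute distance 0.\<close>

lemma hausdorff_dist_graph_le:
  assumes c: "\<And>x. x \<in> K \<Longrightarrow> mdist m (F x) (G x) \<le> c" and "K \<noteq> {}" "0 \<le> c"
  shows "hausdorff_dist (max_metric euclidean_metric m) ((\<lambda>x. (x, F x)) ` K) ((\<lambda>x. (x, G x)) ` K) \<le> c"
proof -
  have bdd: "bdd_below ((\<lambda>b. mdist (max_metric euclidean_metric m) a b) ` S)"
    "bdd_below ((\<lambda>b. mdist (max_metric euclidean_metric m) b a) ` S)" for a S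
    by (rule bdd_belowI[of _ 0]; auto)+
  have 1: "(INF b\<in>(\<lambda>x. (x, G x)) ` K. mdist (max_metric euclidean_metric m) (x, F x) b) \<le> c" if "x \<in> K" for x
    using that c[OF that] \<open>0 \<le> c\<close> by (intro cINF_lower2[OF bdd(1), of "(x, G x)"]) auto
  have 2: "(INF a\<in>(\<lambda>x. (x, F x)) ` K. mdist (max_metric euclidean_metric m) a (x, G x)) \<le> c" if "x \<in> K" for x
    using that c[OF that] \<open>0 \<le> c\<close> by (intro cINF_lower2[OF bdd(2), of "(x, F x)"]) auto
  show ?thesis
    unfolding hausdorff_dist_def using 1 2 \<open>K \<noteq> {}\<close> by (auto intro!: cSUP_least)
qed

lemma d_hat_le:
  assumes "0 \<le> r" "0 \<le> c" "\<And>x. x \<in> cball \<rho> r \<Longrightarrow> mdist m (F x) (G x) \<le> c"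
  shows "d_hat \<rho> m F G \<le> c + exp (- r)"
  unfolding d_hat_def
proof (rule integral_exp_capped_le_const[OF assms(1,2)])
  fix t :: real assume t: "0 \<le> t" "t < r"
  show "hausdorff_dist (max_metric euclidean_metric m) ((\<lambda>x. (x, F x)) ` cball \<rho> t) ((\<lambda>x. (x, G x)) ` cball \<rho> t) \<le> c"
    using t assms(2) by (intro hausdorff_dist_graph_le assms(3)) auto
qed

section \<open>Measurability in the cemetery space\<close>

abbreviation cem :: "'s::heine_borel option measure" where
  "cem \<equiv> borel_of cemetery_topology"

lemma topspace_cemetery [simp]: "topspace cemetery_topology = UNIV"
  by (auto simp: cemetery_topology_def notin_range_Some)

lemma openin_cemetery:
  "openin cemetery_topology V \<longleftrightarrow>
    (\<exists>U. open U \<and> V = Some ` U) \<or> (\<exists>C. compact C \<and> V = insert None (Some ` (- C)))"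
  unfolding cemetery_topology_def openin_Alexandroff_compactification
  using compact_imp_closed by (simp add: Compl_eq_Diff_UNIV) blast

lemma Some_image_sets_cem:
  fixes C :: "'s::heine_borel set"
  assumes "C \<in> sets borel" shows "Some ` C \<in> sets cem"
proof -
  have range: "range Some \<in> sets (cem :: 's option measure)"
    by (intro openin_borel_of) (auto simp: openin_cemetery)
  have "C \<in> sigma_sets UNIV {S. open S}" using assms by (simp add: borel_def)
  then show ?thesis
  proof induction
    case (Basic U)
    then show ?case by (intro openin_borel_of) (auto simp: openin_cemetery)
  next
    case (Compl a)
    have "Some ` (UNIV - a) = range Some - Some ` a" by auto
    then show ?case using Compl range by auto
  next
    case (Union a)
    then show ?case by (simp add: image_UN)
  qed auto
qed

text \<open>The cemetery is a Borel point, being the complement of the open set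
  \<open>range Some\<close>, so a set is Borel iff its trace on the state space is. Measurability on
  the augmented space thereby reduces to measurability on the state space.\<close>

lemma sets_cem: "B \<in> sets (cem :: 's::heine_borel option measure) \<longleftrightarrow> Some -` B \<in> sets borel"
proof
  assume "B \<in> sets (cem :: 's option measure)"
  then have "B \<in> sigma_sets UNIV {V :: 's option set. openin cemetery_topology V}" by (simp add: sets_borel_of)
  then show "Some -` B \<in> sets borel"
  proof induction
    case (Basic V)
    have "Some -` insert None (Some ` D) = D" "Some -` (Some ` D) = D" for D :: "'s set" by auto
    with Basic show ?case by (auto simp: openin_cemetery dest!: compact_imp_closed)
  next
    case (Compl a)
    then show ?case by (simp add: vimage_Diff sets.compl_sets[of _ borel, simplified])
  next
    case (Union a)
    then show ?case by (simp add: vimage_UN)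
  qed auto
next
  assume B: "Some -` B \<in> sets borel"
  have none: "{None} \<in> sets (cem :: 's option measure)"
  proof -
    have "range Some \<in> sets (cem :: 's option measure)" by (rule Some_image_sets_cem) simp
    then have "space cem - range Some \<in> sets (cem :: 's option measure)" by (rule sets.compl_sets)
    moreover have "space (cem :: 's option measure) - range Some = {None}" by (auto simp: notin_range_Some)
    ultimately show ?thesis by simp
  qed
  have eq: "B = Some ` (Some -` B) \<union> (B \<inter> {None})"
  proof (intro set_eqI)
    fix y show "y \<in> B \<longleftrightarrow> y \<in> Some ` (Some -` B) \<union> (B \<inter> {None})" by (cases y) auto
  qed
  have "B \<inter> {None} = {} \<or> B \<inter> {None} = {None}" by auto
  then have "B \<inter> {None} \<in> sets cem" using none by (elim disjE) simp_all
  then have "Some ` (Some -` B) \<union> (B \<inter> {None}) \<in> sets cem"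
    by (rule sets.Un[OF Some_image_sets_cem[OF B]])
  then show "B \<in> sets (cem :: 's option measure)" by (simp only: eq[symmetric])
qed

lemma measurable_cemI:
  assumes "(\<lambda>x. h (Some x)) \<in> measurable borel N" "h None \<in> space N"
  shows "h \<in> measurable (cem :: 's::heine_borel option measure) N"
proof (rule measurableI)
  fix y :: "'s option" assume "y \<in> space cem"
  then show "h y \<in> space N"
    using assms measurable_space[OF assms(1)] by (cases y) auto
next
  fix A assume "A \<in> sets N"
  then have "(\<lambda>x. h (Some x)) -` A \<inter> space borel \<in> sets borel" by (rule measurable_sets[OF assms(1)])
  then show "h -` A \<inter> space (cem :: 's option measure) \<in> sets cem"
    unfolding sets_cem by (simp add: vimage_def)
qed

section \<open>The Markov property for functionals of the path\<close>

text \<open>The hypothesis says that the densities \<open>a\<close> and \<open>b\<close> give the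
  same measure once restricted to \<open>F\<close>, and an \<open>F\<close>-measurable
  \<open>Z\<close> is integrated against that restriction. No finiteness of the integrals is
  involved.\<close>

lemma nn_integral_mult_eq_of_sets:
  assumes sub: "space F = space M" "sets F \<subseteq> sets M"
    and [measurable]: "a \<in> borel_measurable M" "b \<in> borel_measurable M" and Z: "Z \<in> borel_measurable F"
    and eq: "\<And>\<Lambda>. \<Lambda> \<in> sets F \<Longrightarrow> (\<integral>\<^sup>+\<omega>. indicator \<Lambda> \<omega> * a \<omega> \<partial>M) = (\<integral>\<^sup>+\<omega>. indicator \<Lambda> \<omega> * b \<omega> \<partial>M)"
  shows "(\<integral>\<^sup>+\<omega>. Z \<omega> * a \<omega> \<partial>M) = (\<integral>\<^sup>+\<omega>. Z \<omega> * b \<omega> \<partial>M)"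
proof -
  have sa: "subalgebra (density M c) F" for c
    using sub by (simp add: subalgebra_def)
  have ZM: "Z \<in> borel_measurable M"
    using Z sub by (auto simp: measurable_def)
  have *: "(\<integral>\<^sup>+\<omega>. Z \<omega> * c \<omega> \<partial>M) = (\<integral>\<^sup>+\<omega>. Z \<omega> \<partial>restr_to_subalg (density M c) F)"
    if c: "c \<in> borel_measurable M" for c
  proof -
    have "(\<integral>\<^sup>+\<omega>. Z \<omega> \<partial>restr_to_subalg (density M c) F) = (\<integral>\<^sup>+\<omega>. Z \<omega> \<partial>density M c)"
      by (rule nn_integral_subalgebra)
         (use Z sub in \<open>auto simp: sets_restr_to_subalg[OF sa] space_restr_to_subalg emeasure_restr_to_subalg[OF sa]
            cong: measurable_cong_sets\<close>)
    then show ?thesis using ZM c by (simp add: nn_integral_density mult.commute)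
  qed
  have "restr_to_subalg (density M a) F = restr_to_subalg (density M b) F"
  proof (rule measure_eqI)
    fix A assume "A \<in> sets (restr_to_subalg (density M a) F)"
    then have A: "A \<in> sets F" "A \<in> sets M" using sub by (auto simp: sets_restr_to_subalg[OF sa])
    then show "emeasure (restr_to_subalg (density M a) F) A = emeasure (restr_to_subalg (density M b) F) A"
      using eq[of A] by (simp add: emeasure_restr_to_subalg[OF sa] emeasure_density mult.commute)
  qed (simp add: sets_restr_to_subalg[OF sa])
  then show ?thesis using * by simp
qed

section \<open>Cylinder sets described by time gaps\<close>

lemma ennreal_diff_less_top: "(e::ennreal) < \<top> \<Longrightarrow> e - d < \<top>"
  by (meson diff_le_self_ennreal le_less_trans)

text \<open>A cylinder is given by a list of pairs of a waiting time since the previous constraint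
  and a set. With gaps in place of absolute times the Markov property can be applied by recursion on
  the list. Merging interleaves two such lists, so that cylinders form a \<pi>-system.\<close>

fun merge_gaps :: "(ennreal \<times> 'b set) list \<Rightarrow> (ennreal \<times> 'b set) list \<Rightarrow> (ennreal \<times> 'b set) list" where
  "merge_gaps [] l = l"
| "merge_gaps (u # l) [] = u # l"
| "merge_gaps ((d, B) # l) ((e, C) # k) =
     (if d \<le> e then (d, B) # merge_gaps l ((e - d, C) # k) else (e, C) # merge_gaps ((d - e, B) # l) k)"

definition valid_gaps :: "(ennreal \<times> 's::heine_borel option set) list \<Rightarrow> bool" where
  "valid_gaps l \<longleftrightarrow> (\<forall>(d, B)\<in>set l. d < \<top> \<and> B \<in> sets cem)"

lemma valid_gaps_simps [simp]:
  "valid_gaps []" "valid_gaps ((d, B) # l) \<longleftrightarrow> d < \<top> \<and> B \<in> sets cem \<and> valid_gaps l"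
  by (auto simp: valid_gaps_def)

lemma valid_merge_gaps: "valid_gaps l \<Longrightarrow> valid_gaps k \<Longrightarrow> valid_gaps (merge_gaps l k)"
  by (induction l k rule: merge_gaps.induct) (auto intro: ennreal_diff_less_top)

fun cylinder :: "('w, 's::heine_borel) process \<Rightarrow> ennreal \<Rightarrow> (ennreal \<times> 's option set) list \<Rightarrow> 'w set" where
  "cylinder X s [] = sample_space X"
| "cylinder X s ((d, B) # l) = {\<omega> \<in> cylinder X (s + d) l. state X (s + d) \<omega> \<in> B}"

lemma cylinder_subset: "cylinder X s l \<subseteq> sample_space X"
proof (induction l arbitrary: s)
  case (Cons u l)
  obtain d B where "u = (d, B)" by (cases u)
  then show ?case using Cons[of "s + d"] by auto
qed simp

lemma cylinder_merge:
  assumes "valid_gaps l" "valid_gaps k"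
  shows "cylinder X s (merge_gaps l k) = cylinder X s l \<inter> cylinder X s k"
  using assms
proof (induction l k arbitrary: s rule: merge_gaps.induct)
  case (1 l)
  then show ?case using cylinder_subset[of X s l] by auto
next
  case (2 u l)
  then show ?case using cylinder_subset[of X s "u # l"] by auto
next
  case (3 d B l e C k)
  show ?case
  proof (cases "d \<le> e")
    case True
    have *: "s + d + (e - d) = s + e"
      using True by (simp add: add.assoc add_diff_inverse_ennreal)
    show ?thesis
      using 3 True ennreal_diff_less_top[of e d] by (auto simp: *)
  next
    case False
    then have *: "s + e + (d - e) = s + d"
      using add_diff_inverse_ennreal[of e d] by (simp add: add.assoc not_le less_imp_le)
    show ?thesis
      using 3 False ennreal_diff_less_top[of d e] by (auto simp: *)
  qed
qed

context standard_process
begin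

section \<open>The natural and the augmented filtration\<close>

lemma space_natural [simp]: "space (natural_filtration X t) = sample_space X"
  unfolding natural_filtration_def by (rule space_measure_of) auto

lemma sets_natural: "sets (natural_filtration X t) =
    sigma_sets (sample_space X) {state X s -` B \<inter> sample_space X | s B. s \<le> t \<and> B \<in> sets cem}"
  unfolding natural_filtration_def by (rule sets_measure_of) auto

lemma space_augmented [simp]: "space (augmented_filtration X t) = sample_space X"
  unfolding augmented_filtration_def by (rule space_measure_of) auto

lemma sets_augmented: "sets (augmented_filtration X t) = sigma_sets (sample_space X)
      {\<Lambda>. \<Lambda> \<subseteq> sample_space X \<and>
       (\<forall>\<nu>. prob_space \<nu> \<and> sets \<nu> = sets cem \<longrightarrow>
         (\<exists>A\<in>sets (natural_filtration X t). \<exists>N\<in>sets (natural_filtration X \<top>).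
           (\<Lambda> - A) \<union> (A - \<Lambda>) \<subseteq> N \<and> (\<integral>\<^sup>+ x. emeasure (prob_from X x) N \<partial>\<nu>) = 0))}"
  unfolding augmented_filtration_def by (rule sets_measure_of) auto

lemma natural_mono: "s \<le> t \<Longrightarrow> sets (natural_filtration X s) \<subseteq> sets (natural_filtration X t)"
  unfolding sets_natural by (rule sigma_sets_mono') force

lemma augmented_mono:
  assumes "s \<le> t" shows "sets (augmented_filtration X s) \<subseteq> sets (augmented_filtration X t)"
  unfolding sets_augmented
proof (intro sigma_sets_mono' subsetI CollectI conjI allI impI, goal_cases)
  case (1 \<Lambda>)
  then show ?case by auto
next
  case (2 \<Lambda> \<nu>)
  then obtain A N where "A \<in> sets (natural_filtration X s)" "N \<in> sets (natural_filtration X \<top>)"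
    "(\<Lambda> - A) \<union> (A - \<Lambda>) \<subseteq> N" "(\<integral>\<^sup>+ x. emeasure (prob_from X x) N \<partial>\<nu>) = 0"
    by blast
  then show ?case using natural_mono[OF assms] by (intro bexI[of _ A] bexI[of _ N]) auto
qed

lemma natural_subset_augmented: "sets (natural_filtration X t) \<subseteq> sets (augmented_filtration X t)"
proof
  fix A assume A: "A \<in> sets (natural_filtration X t)"
  then have "A \<subseteq> sample_space X" using sets.sets_into_space[OF A] by simp
  then show "A \<in> sets (augmented_filtration X t)"
    unfolding sets_augmented using A
    by (intro sigma_sets.Basic CollectI conjI allI impI bexI[of _ A] bexI[of _ "{}"]) auto
qed

sublocale filtration "sample_space X" "augmented_filtration X"
  by standard (simp_all add: augmented_mono)

lemma space_from [simp]: "space (prob_from X x) = sample_space X"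
  using sets_eq_imp_space_eq[OF sets_from[of x]] by simp

lemma state_natural: "s \<le> t \<Longrightarrow> state X s \<in> measurable (natural_filtration X t) cem"
  by (rule measurableI) (auto simp: sets_natural intro!: sigma_sets.Basic)

lemma natural_imp_augmented: "f \<in> measurable (natural_filtration X t) N \<Longrightarrow> f \<in> measurable (augmented_filtration X t) N"
  using natural_subset_augmented[of t] by (auto simp: measurable_def)

lemma augmented_imp_later: "f \<in> measurable (augmented_filtration X s) N \<Longrightarrow> s \<le> t \<Longrightarrow> f \<in> measurable (augmented_filtration X t) N"
  using augmented_mono[of s t] by (auto simp: measurable_def)

lemma state_augmented: "s \<le> t \<Longrightarrow> state X s \<in> measurable (augmented_filtration X t) cem"
  by (intro natural_imp_augmented state_natural)

lemma augmented_imp_from: "f \<in> measurable (augmented_filtration X t) N \<Longrightarrow> f \<in> measurable (prob_from X x) N"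
  using augmented_mono[of t \<top>] by (auto simp: measurable_def sets_from)

lemma natural_imp_from: "f \<in> measurable (natural_filtration X t) N \<Longrightarrow> f \<in> measurable (prob_from X x) N"
  by (intro augmented_imp_from natural_imp_augmented)

lemma state_from [measurable]: "state X s \<in> measurable (prob_from X x) cem"
  by (rule natural_imp_from[OF state_natural[OF order_refl]])

lemma shift_natural: "s < \<top> \<Longrightarrow> time_shift X s \<in> measurable (natural_filtration X \<top>) (natural_filtration X \<top>)"
proof (rule measurable_sigma_sets[OF sets_natural])
  assume s: "s < \<top>"
  show "time_shift X s \<in> space (natural_filtration X \<top>) \<rightarrow> sample_space X"
    using shift_closed[OF s] by simp
  fix A assume "A \<in> {state X r -` B \<inter> sample_space X | r B. r \<le> \<top> \<and> B \<in> sets cem}"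
  then obtain r B where A: "A = state X r -` B \<inter> sample_space X" "B \<in> sets cem" by auto
  have "time_shift X s -` A \<inter> sample_space X = state X (r + s) -` B \<inter> sample_space X"
    using shift_closed[OF s] state_shift[OF s] by (auto simp: A)
  then show "time_shift X s -` A \<inter> space (natural_filtration X \<top>) \<in> sets (natural_filtration X \<top>)"
    using measurable_sets[OF state_natural[of "r + s" \<top>] A(2)] by simp
qed auto

section \<open>Transition kernels and finite-dimensional distributions\<close>

definition transition :: "ennreal \<Rightarrow> 's option \<Rightarrow> 's option measure" where
  "transition t y = distr (prob_from X y) cem (state X t)"

lemma transition_kernel: "transition t \<in> measurable cem (prob_algebra cem)"
proof (intro measurable_prob_algebraI measurable_subprob_algebra)
  fix y :: "'s option"
  interpret prob_space "prob_from X y" by (rule prob_space_from)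
  show "prob_space (transition t y)"
    unfolding transition_def by (rule prob_space_distr) simp
  then show "subprob_space (transition t y)" by (rule prob_space_imp_subprob_space)
  show "sets (transition t y) = sets cem" by (simp add: transition_def)
next
  fix B :: "'s option set" assume B: "B \<in> sets cem"
  have "emeasure (transition t y) B = emeasure (prob_from X y) {\<omega> \<in> sample_space X. state X t \<omega> \<in> B}" for y
    using B unfolding transition_def by (subst emeasure_distr) (auto intro!: arg_cong[where f="emeasure _"])
  then show "(\<lambda>y. emeasure (transition t y) B) \<in> borel_measurable cem"
    using measurable_start[OF B, of t] by (intro measurable_cemI) auto
qed

lemma transition_subprob [measurable]: "transition t \<in> measurable cem (subprob_algebra cem)"
  by (rule measurable_prob_algebraD[OF transition_kernel])

text \<open>The strong Markov property at the constant time \<open>s\<close>. After weighting P^x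
  with the indicator of \<Lambda>, both sides come from measures on the state space, one of them a
  mixture of transition kernels; agreement on Borel sets then settles every nonnegative
  \<open>f\<close>.\<close>

lemma simple_markov_indicator:
  assumes s: "s < \<top>" and t: "t < \<top>" and \<Lambda>: "\<Lambda> \<in> sets (augmented_filtration X s)"
    and f[measurable]: "f \<in> borel_measurable cem"
  shows "(\<integral>\<^sup>+\<omega>. indicator \<Lambda> \<omega> * f (state X (s + t) \<omega>) \<partial>prob_from X x) =
    (\<integral>\<^sup>+\<omega>. indicator \<Lambda> \<omega> * (\<integral>\<^sup>+z. f z \<partial>transition t (state X s \<omega>)) \<partial>prob_from X x)"
proof -
  let ?P = "prob_from X x"
  let ?D = "density ?P (indicator \<Lambda>)"
  have \<Lambda>P[measurable]: "\<Lambda> \<in> sets ?P" using \<Lambda> augmented_mono[of s \<top>] by (auto simp: sets_from)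
  interpret prob_space ?P by (rule prob_space_from)
  have D_state[measurable]: "state X r \<in> measurable ?D cem" for r by simp
  have kern: "(\<lambda>\<omega>. transition t (state X s \<omega>)) \<in> measurable ?D (subprob_algebra cem)"
    by (rule measurable_compose[OF D_state transition_subprob])
  have ne: "space ?D \<noteq> {}" using not_empty by simp
  have "distr ?D cem (state X (s + t)) = ?D \<bind> (\<lambda>\<omega>. transition t (state X s \<omega>))"
  proof (rule measure_eqI)
    show "sets (distr ?D cem (state X (s + t))) = sets (?D \<bind> (\<lambda>\<omega>. transition t (state X s \<omega>)))"
      using sets_bind[of ?D "\<lambda>\<omega>. transition t (state X s \<omega>)" cem] ne by (simp add: transition_def)
    fix B assume "B \<in> sets (distr ?D cem (state X (s + t)))"
    then have B[measurable]: "B \<in> sets cem" by simp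
    have st: "stopping_time (augmented_filtration X) (\<lambda>_. s)" by (rule stopping_time_const)
    have \<Lambda>': "\<Lambda> \<in> sets (pre_sigma (\<lambda>_. s))"
    proof (rule sets_pre_sigmaI[OF st])
      fix r show "{\<omega> \<in> \<Lambda>. s \<le> r} \<in> sets (augmented_filtration X r)"
        using \<Lambda> augmented_mono[of s r] by (cases "s \<le> r") auto
    qed
    have "emeasure (distr ?D cem (state X (s + t))) B = emeasure ?D (state X (s + t) -` B \<inter> sample_space X)"
      by (subst emeasure_distr) auto
    also have "\<dots> = (\<integral>\<^sup>+\<omega>. indicator \<Lambda> \<omega> * indicator (state X (s + t) -` B \<inter> sample_space X) \<omega> \<partial>?P)"
      using measurable_sets[OF state_from[of "s+t" x] B] by (subst emeasure_density) auto
    also have "\<dots> = (\<integral>\<^sup>+\<omega>. indicator {\<omega> \<in> \<Lambda>. state X (s + t) \<omega> \<in> B} \<omega> \<partial>?P)"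
      by (intro nn_integral_cong) (auto simp: indicator_def)
    also have "\<dots> = emeasure ?P {\<omega> \<in> \<Lambda>. state X (s + t) \<omega> \<in> B}"
    proof (rule nn_integral_indicator)
      have "{\<omega> \<in> \<Lambda>. state X (s + t) \<omega> \<in> B} = \<Lambda> \<inter> (state X (s + t) -` B \<inter> space ?P)"
        using sets.sets_into_space[OF \<Lambda>P] by auto
      then show "{\<omega> \<in> \<Lambda>. state X (s + t) \<omega> \<in> B} \<in> sets ?P"
        using measurable_sets[OF state_from[of "s+t" x] B] by auto
    qed
    also have "\<dots> = (\<integral>\<^sup>+ \<omega>. indicator \<Lambda> \<omega> * emeasure (prob_from X (state X s \<omega>)) {\<omega>' \<in> sample_space X. state X t \<omega>' \<in> B} \<partial>?P)"
      by (rule strong_markov[OF st t B \<Lambda>'])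
    also have "\<dots> = (\<integral>\<^sup>+ \<omega>. emeasure (transition t (state X s \<omega>)) B \<partial>?D)"
    proof (subst nn_integral_density)
      have "emeasure (transition t y) B = emeasure (prob_from X y) {\<omega>' \<in> sample_space X. state X t \<omega>' \<in> B}" for y
        unfolding transition_def by (subst emeasure_distr) (auto intro!: arg_cong[where f="emeasure _"])
      then show "(\<integral>\<^sup>+ \<omega>. indicator \<Lambda> \<omega> * emeasure (prob_from X (state X s \<omega>)) {\<omega>' \<in> sample_space X. state X t \<omega>' \<in> B} \<partial>?P)
        = (\<integral>\<^sup>+ \<omega>. indicator \<Lambda> \<omega> * emeasure (transition t (state X s \<omega>)) B \<partial>?P)" by simp
      show "(\<lambda>\<omega>. emeasure (transition t (state X s \<omega>)) B) \<in> borel_measurable ?P"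
        using measurable_emeasure_kernel[OF kern B] by simp
    qed simp
    also have "\<dots> = emeasure (?D \<bind> (\<lambda>\<omega>. transition t (state X s \<omega>))) B"
      by (rule emeasure_bind[OF ne kern B, symmetric])
    finally show "emeasure (distr ?D cem (state X (s + t))) B = emeasure (?D \<bind> (\<lambda>\<omega>. transition t (state X s \<omega>))) B" .
  qed
  then have "(\<integral>\<^sup>+z. f z \<partial>distr ?D cem (state X (s + t))) = (\<integral>\<^sup>+\<omega>. (\<integral>\<^sup>+z. f z \<partial>transition t (state X s \<omega>)) \<partial>?D)"
    using nn_integral_bind[OF f kern] by simp
  moreover have "(\<lambda>\<omega>. \<integral>\<^sup>+z. f z \<partial>transition t (state X s \<omega>)) \<in> borel_measurable ?P"
    using measurable_compose[OF kern nn_integral_measurable_subprob_algebra[OF f]] by simp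
  ultimately show ?thesis
    by (simp add: nn_integral_distr nn_integral_density)
qed

lemma transition_integral:
  "f \<in> borel_measurable cem \<Longrightarrow> (\<lambda>y. \<integral>\<^sup>+z. f z \<partial>transition t y) \<in> borel_measurable cem"
  by (rule measurable_compose[OF transition_subprob nn_integral_measurable_subprob_algebra])

lemma simple_markov:
  assumes s: "s < \<top>" and t: "t < \<top>" and Z: "Z \<in> borel_measurable (augmented_filtration X s)"
    and f[measurable]: "f \<in> borel_measurable cem"
  shows "(\<integral>\<^sup>+\<omega>. Z \<omega> * f (state X (s + t) \<omega>) \<partial>prob_from X x) =
    (\<integral>\<^sup>+\<omega>. Z \<omega> * (\<integral>\<^sup>+z. f z \<partial>transition t (state X s \<omega>)) \<partial>prob_from X x)"
  by (rule nn_integral_mult_eq_of_sets[where F="augmented_filtration X s"])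
     (use augmented_mono[of s \<top>] measurable_compose[OF state_from transition_integral[OF f]] in
       \<open>auto simp: sets_from Z intro: simple_markov_indicator[OF s t _ f]\<close>)

fun cylinder_prob :: "(ennreal \<times> 's option set) list \<Rightarrow> 's option \<Rightarrow> ennreal" where
  "cylinder_prob [] y = 1"
| "cylinder_prob ((d, B) # l) y = (\<integral>\<^sup>+z. indicator B z * cylinder_prob l z \<partial>transition d y)"

lemma cylinder_prob_measurable [measurable]: "valid_gaps l \<Longrightarrow> cylinder_prob l \<in> borel_measurable cem"
proof (induction l)
  case (Cons u l)
  then obtain d B where u: "u = (d, B)" "B \<in> sets cem" "cylinder_prob l \<in> borel_measurable cem"
    by (cases u) auto
  then have "(\<lambda>z. indicator B z * cylinder_prob l z) \<in> borel_measurable cem"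
    by (intro borel_measurable_times_ennreal borel_measurable_indicator)
  moreover have "cylinder_prob (u # l) = (\<lambda>y. \<integral>\<^sup>+z. indicator B z * cylinder_prob l z \<partial>transition d y)"
    by (rule ext) (simp add: u)
  ultimately show ?case using transition_integral by metis
next
  case Nil
  have "cylinder_prob [] = (\<lambda>_. 1)" by (rule ext) simp
  then show ?case by simp
qed

lemma cylinder_sets: "valid_gaps l \<Longrightarrow> cylinder X s l \<in> sets (natural_filtration X \<top>)"
proof (induction l arbitrary: s)
  case Nil
  then show ?case using sets.top[of "natural_filtration X \<top>"] by simp
next
  case (Cons u l)
  obtain d B where u: "u = (d, B)" by (cases u)
  have B: "B \<in> sets cem" and l: "valid_gaps l" using Cons.prems by (auto simp: u)
  have eq: "cylinder X s (u # l) = cylinder X (s + d) l \<inter> (state X (s + d) -` B \<inter> space (natural_filtration X \<top>))"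
  proof (intro set_eqI iffI)
    fix \<omega> assume "\<omega> \<in> cylinder X s (u # l)"
    then have "\<omega> \<in> cylinder X (s + d) l" "state X (s + d) \<omega> \<in> B" by (simp_all add: u)
    moreover from this(1) have "\<omega> \<in> sample_space X" by (rule subsetD[OF cylinder_subset])
    ultimately show "\<omega> \<in> cylinder X (s + d) l \<inter> (state X (s + d) -` B \<inter> space (natural_filtration X \<top>))" by simp
  qed (simp add: u)
  show ?case
    unfolding eq by (rule sets.Int[OF Cons.IH[OF l] measurable_sets[OF state_natural B]]) simp
qed

text \<open>Induction on the list for all \<open>s\<close> and \<open>Z\<close>: the first
  constraint is absorbed into \<open>Z\<close>, which makes \<open>Z\<close> measurable at time
  \<open>s + d\<close>; the induction hypothesis applies there, and \<open>simple_markov\<close>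
  carries the result back over the gap \<open>d\<close>.\<close>

lemma cylinder_markov:
  assumes "s < \<top>" "Z \<in> borel_measurable (augmented_filtration X s)" "valid_gaps l"
  shows "(\<integral>\<^sup>+\<omega>. Z \<omega> * indicator (cylinder X s l) \<omega> \<partial>prob_from X x) =
    (\<integral>\<^sup>+\<omega>. Z \<omega> * cylinder_prob l (state X s \<omega>) \<partial>prob_from X x)"
  using assms
proof (induction l arbitrary: s Z)
  case Nil
  show ?case by (auto intro!: nn_integral_cong)
next
  case (Cons u l)
  obtain d B where u: "u = (d, B)" by (cases u)
  have d: "d < \<top>" and B[measurable]: "B \<in> sets cem" and l: "valid_gaps l" using Cons.prems by (auto simp: u)
  have sd: "s + d < \<top>" using d Cons.prems(1) by (simp add: less_top)
  let ?Z = "\<lambda>\<omega>. Z \<omega> * indicator B (state X (s + d) \<omega>)"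
  have [measurable]: "Z \<in> borel_measurable (augmented_filtration X (s + d))"
    by (rule augmented_imp_later[OF Cons.prems(2)]) simp
  have [measurable]: "state X (s + d) \<in> measurable (augmented_filtration X (s + d)) cem"
    by (rule state_augmented) simp
  have Z: "?Z \<in> borel_measurable (augmented_filtration X (s + d))" by measurable
  have "(\<integral>\<^sup>+\<omega>. Z \<omega> * indicator (cylinder X s (u # l)) \<omega> \<partial>prob_from X x) =
      (\<integral>\<^sup>+\<omega>. ?Z \<omega> * indicator (cylinder X (s + d) l) \<omega> \<partial>prob_from X x)"
    by (intro nn_integral_cong) (auto simp: u indicator_def)
  also have "\<dots> = (\<integral>\<^sup>+\<omega>. ?Z \<omega> * cylinder_prob l (state X (s + d) \<omega>) \<partial>prob_from X x)"
    by (rule Cons.IH[OF sd Z l])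
  also have "\<dots> = (\<integral>\<^sup>+\<omega>. Z \<omega> * (indicator B (state X (s + d) \<omega>) * cylinder_prob l (state X (s + d) \<omega>)) \<partial>prob_from X x)"
    by (simp add: mult.assoc)
  also have "\<dots> = (\<integral>\<^sup>+\<omega>. Z \<omega> * cylinder_prob (u # l) (state X s \<omega>) \<partial>prob_from X x)"
    unfolding u cylinder_prob.simps
    by (rule simple_markov[OF Cons.prems(1) d Cons.prems(2), of "\<lambda>z. indicator B z * cylinder_prob l z"])
       (use cylinder_prob_measurable[OF l] in measurable)
  finally show ?case .
qed

lemma AE_start: "AE \<omega> in prob_from X y. state X 0 \<omega> = y"
proof -
  interpret prob_space "prob_from X y" by (rule prob_space_from)
  have n: "emeasure (prob_from X y) {\<omega> \<in> sample_space X. state X 0 \<omega> = y} = 1" by (rule normal)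
  then have S: "{\<omega> \<in> sample_space X. state X 0 \<omega> = y} \<in> events"
    by (metis emeasure_notin_sets zero_neq_one)
  have "prob {\<omega> \<in> sample_space X. state X 0 \<omega> = y} = 1" unfolding measure_def n by simp
  then have "AE \<omega> in prob_from X y. \<omega> \<in> {\<omega> \<in> sample_space X. state X 0 \<omega> = y}"
    by (rule AE_in_set_eq_1[OF S, THEN iffD2])
  then show ?thesis by eventually_elim simp
qed

lemma emeasure_cylinder:
  assumes "valid_gaps l"
  shows "emeasure (prob_from X y) (cylinder X 0 l) = cylinder_prob l y"
proof -
  interpret prob_space "prob_from X y" by (rule prob_space_from)
  have C: "cylinder X 0 l \<in> sets (prob_from X y)"
    using cylinder_sets[OF assms] natural_subset_augmented by (auto simp: sets_from)
  have "emeasure (prob_from X y) (cylinder X 0 l) = (\<integral>\<^sup>+\<omega>. 1 * indicator (cylinder X 0 l) \<omega> \<partial>prob_from X y)"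
    using C by simp
  also have "\<dots> = (\<integral>\<^sup>+\<omega>. 1 * cylinder_prob l (state X 0 \<omega>) \<partial>prob_from X y)"
    by (rule cylinder_markov) (use assms in auto)
  also have "\<dots> = (\<integral>\<^sup>+\<omega>. cylinder_prob l y \<partial>prob_from X y)"
    using AE_start[of y] by (intro nn_integral_cong_AE) auto
  finally show ?thesis using emeasure_space_1 by simp
qed

lemma cylinder_shift:
  assumes "s < \<top>" "\<omega> \<in> sample_space X"
  shows "time_shift X s \<omega> \<in> cylinder X r l \<longleftrightarrow> \<omega> \<in> cylinder X (s + r) l"
  using shift_closed[OF assms] state_shift[OF assms] assms(2)
  by (induction l arbitrary: r) (auto simp: add_ac)

lemma natural_generated:
  "sets (natural_filtration X \<top>) = sigma_sets (sample_space X) {cylinder X 0 l | l. valid_gaps l}" (is "_ = sigma_sets _ ?G")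
proof
  show "sigma_sets (sample_space X) ?G \<subseteq> sets (natural_filtration X \<top>)"
    using sets.sigma_sets_subset[of ?G "natural_filtration X \<top>"] cylinder_sets by auto
  interpret S: sigma_algebra "sample_space X" "sigma_sets (sample_space X) ?G"
    by (rule sigma_algebra_sigma_sets) (use cylinder_subset[of X 0] in auto)
  show "sets (natural_filtration X \<top>) \<subseteq> sigma_sets (sample_space X) ?G"
    unfolding sets_natural
  proof (rule S.sigma_sets_subset, safe)
    fix s :: ennreal and B :: "'s option set" assume B: "B \<in> sets cem"
    show "state X s -` B \<inter> sample_space X \<in> sigma_sets (sample_space X) ?G"
    proof (cases "s = \<top>")
      \<comment> \<open>Gaps are finite, so no valid list reaches time \<top>; but there the state
        is always the cemetery and the event is trivial.\<close>
      case True
      then have "state X s -` B \<inter> sample_space X = (if None \<in> B then sample_space X else {})"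
        using state_top by auto
      then show ?thesis using S.top S.empty_sets by (cases "None \<in> B") simp_all
    next
      case False
      then have "state X s -` B \<inter> sample_space X = cylinder X 0 [(s, B)]" "valid_gaps [(s, B)]"
        using B by (auto simp: less_top)
      then show ?thesis by (intro sigma_sets.Basic CollectI exI[of _ "[(s, B)]"]) auto
    qed
  qed
qed

lemma Int_stable_cylinders: "Int_stable {cylinder X 0 l | l. valid_gaps l}"
  unfolding Int_stable_def
proof (safe, goal_cases)
  case (1 _ _ l k)
  then show ?case
    by (intro exI[of _ "merge_gaps l k"]) (simp add: cylinder_merge valid_merge_gaps)
qed

section \<open>The path law as a kernel in the starting point\<close>

definition natural_kernel :: "'s option \<Rightarrow> 'w measure" where
  "natural_kernel y = restr_to_subalg (prob_from X y) (natural_filtration X \<top>)"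

lemma subalgebra_natural: "subalgebra (prob_from X y) (natural_filtration X \<top>)"
  using natural_subset_augmented by (auto simp: subalgebra_def sets_from)

lemma sets_natural_kernel: "sets (natural_kernel y) = sets (natural_filtration X \<top>)"
  unfolding natural_kernel_def by (rule sets_restr_to_subalg[OF subalgebra_natural])

lemma space_natural_kernel: "space (natural_kernel y) = sample_space X"
  unfolding natural_kernel_def by (simp add: space_restr_to_subalg)

lemma emeasure_natural_kernel:
  "A \<in> sets (natural_filtration X \<top>) \<Longrightarrow> emeasure (natural_kernel y) A = emeasure (prob_from X y) A"
  unfolding natural_kernel_def by (rule emeasure_restr_to_subalg[OF subalgebra_natural])

lemma nn_integral_natural_kernel:
  assumes "f \<in> borel_measurable (natural_filtration X \<top>)"
  shows "(\<integral>\<^sup>+\<omega>. f \<omega> \<partial>natural_kernel y) = (\<integral>\<^sup>+\<omega>. f \<omega> \<partial>prob_from X y)"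
  by (rule nn_integral_subalgebra)
     (use assms natural_subset_augmented in \<open>auto simp: sets_natural_kernel space_natural_kernel
       emeasure_natural_kernel sets_from cong: measurable_cong_sets\<close>)

text \<open>On the natural sigma-algebra the cylinders are a generating \<pi>-system whose
  probabilities are Borel in the starting point. The restriction to that sigma-algebra is what makes
  the path law a measurable kernel.\<close>

lemma natural_kernel_measurable [measurable]:
  "natural_kernel \<in> measurable cem (subprob_algebra (natural_filtration X \<top>))"
proof (rule measurable_prob_algebraD, rule measurable_prob_algebra_generated[OF natural_generated Int_stable_cylinders])
  show "{cylinder X 0 l |l. valid_gaps l} \<subseteq> Pow (sample_space X)" using cylinder_subset[of X 0] by auto
  show "prob_space (natural_kernel a)" for a
    unfolding natural_kernel_def by (rule prob_space_restr_to_subalg[OF subalgebra_natural prob_space_from])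
  fix A assume "A \<in> {cylinder X 0 l |l. valid_gaps l}"
  then show "(\<lambda>a. emeasure (natural_kernel a) A) \<in> borel_measurable cem"
    using cylinder_prob_measurable
    by (auto simp: emeasure_natural_kernel cylinder_sets emeasure_cylinder)
qed (simp add: sets_natural_kernel)

text \<open>Two measures on path space are compared: the image of Z P^x under the shift, and the
  mixture of the path laws started from the state at \<open>s\<close>. They agree on the
  \<pi>-system of cylinders, and \<open>fin\<close> gives the finite total mass that uniqueness
  requires.\<close>

lemma natural_markov:
  assumes s: "s < \<top>" and Z: "Z \<in> borel_measurable (augmented_filtration X s)"
    and fin: "(\<integral>\<^sup>+\<omega>. Z \<omega> \<partial>prob_from X x) < \<top>"
    and W: "W \<in> borel_measurable (natural_filtration X \<top>)"
  shows "(\<integral>\<^sup>+\<omega>. Z \<omega> * W (time_shift X s \<omega>) \<partial>prob_from X x) =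
    (\<integral>\<^sup>+\<omega>. Z \<omega> * (\<integral>\<^sup>+\<omega>'. W \<omega>' \<partial>natural_kernel (state X s \<omega>)) \<partial>prob_from X x)"
proof -
  let ?P = "prob_from X x" and ?F = "natural_filtration X \<top>"
  interpret prob_space ?P by (rule prob_space_from)
  have ZP[measurable]: "Z \<in> borel_measurable ?P" by (rule augmented_imp_from[OF Z])
  let ?D = "density ?P Z"
  have sh[measurable]: "time_shift X s \<in> measurable ?P ?F" by (rule natural_imp_from[OF shift_natural[OF s]])
  then have shD: "time_shift X s \<in> measurable ?D ?F" by simp
  have kP: "(\<lambda>\<omega>. natural_kernel (state X s \<omega>)) \<in> measurable ?P (subprob_algebra ?F)"
    by (rule measurable_compose[OF state_from natural_kernel_measurable])
  then have kD: "(\<lambda>\<omega>. natural_kernel (state X s \<omega>)) \<in> measurable ?D (subprob_algebra ?F)" by simp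
  have ne: "space ?D \<noteq> {}" using not_empty by simp
  have "distr ?D ?F (time_shift X s) = ?D \<bind> (\<lambda>\<omega>. natural_kernel (state X s \<omega>))"
  proof (rule measure_eqI_generator_eq[OF Int_stable_cylinders])
    show "{cylinder X 0 l |l. valid_gaps l} \<subseteq> Pow (sample_space X)" using cylinder_subset[of X 0] by auto
    show "sets (distr ?D ?F (time_shift X s)) = sigma_sets (sample_space X) {cylinder X 0 l |l. valid_gaps l}"
      by (simp add: natural_generated)
    show "sets (?D \<bind> (\<lambda>\<omega>. natural_kernel (state X s \<omega>))) = sigma_sets (sample_space X) {cylinder X 0 l |l. valid_gaps l}"
      using sets_bind[of ?D "\<lambda>\<omega>. natural_kernel (state X s \<omega>)" ?F] ne by (simp add: sets_natural_kernel natural_generated)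
    show "range (\<lambda>_. sample_space X) \<subseteq> {cylinder X 0 l |l. valid_gaps l}"
      by (auto intro!: exI[of _ "[]"])
    show "(\<Union>i::nat. sample_space X) = sample_space X" by simp
    show "emeasure (distr ?D ?F (time_shift X s)) (sample_space X) \<noteq> \<infinity>"
    proof -
      have "sample_space X \<in> sets ?F" using sets.top[of ?F] by simp
      then have "emeasure (distr ?D ?F (time_shift X s)) (sample_space X) \<le> emeasure ?D (space ?D)"
        using sets.top[of ?P] by (subst emeasure_distr[OF shD]) (auto intro!: emeasure_mono)
      also have "\<dots> = (\<integral>\<^sup>+\<omega>. Z \<omega> \<partial>?P)"
        using sets.top[of ?P] by (subst emeasure_density) (auto intro!: nn_integral_cong simp: indicator_def)
      finally show ?thesis using fin by (auto simp: top_unique)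
    qed
    fix C assume "C \<in> {cylinder X 0 l |l. valid_gaps l}"
    then obtain l where l: "C = cylinder X 0 l" "valid_gaps l" by auto
    have C: "C \<in> sets ?F" using cylinder_sets l by simp
    have "emeasure (distr ?D ?F (time_shift X s)) C = emeasure ?D (time_shift X s -` C \<inter> sample_space X)"
      using C by (subst emeasure_distr[OF shD]) auto
    also have "\<dots> = (\<integral>\<^sup>+\<omega>. Z \<omega> * indicator (time_shift X s -` C \<inter> sample_space X) \<omega> \<partial>?P)"
      using measurable_sets[OF sh C] by (subst emeasure_density) auto
    also have "\<dots> = (\<integral>\<^sup>+\<omega>. Z \<omega> * indicator (cylinder X s l) \<omega> \<partial>?P)"
      using cylinder_shift[OF s] by (intro nn_integral_cong) (auto simp: indicator_def l)
    also have "\<dots> = (\<integral>\<^sup>+\<omega>. Z \<omega> * cylinder_prob l (state X s \<omega>) \<partial>?P)"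
      by (rule cylinder_markov[OF s Z l(2)])
    also have "\<dots> = (\<integral>\<^sup>+\<omega>. emeasure (natural_kernel (state X s \<omega>)) C \<partial>?D)"
    proof -
      have [measurable]: "cylinder_prob l \<in> borel_measurable cem" by (rule cylinder_prob_measurable[OF l(2)])
      show ?thesis
        unfolding emeasure_natural_kernel[OF C] unfolding l(1) emeasure_cylinder[OF l(2)]
        by (subst nn_integral_density) auto
    qed
    also have "\<dots> = emeasure (?D \<bind> (\<lambda>\<omega>. natural_kernel (state X s \<omega>))) C"
      by (rule emeasure_bind[OF ne kD C, symmetric])
    finally show "emeasure (distr ?D ?F (time_shift X s)) C = emeasure (?D \<bind> (\<lambda>\<omega>. natural_kernel (state X s \<omega>))) C" .
  qed
  then have "(\<integral>\<^sup>+\<omega>. W \<omega> \<partial>distr ?D ?F (time_shift X s)) = (\<integral>\<^sup>+\<omega>. (\<integral>\<^sup>+\<omega>'. W \<omega>' \<partial>natural_kernel (state X s \<omega>)) \<partial>?D)"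
    using nn_integral_bind[OF W kD] by simp
  moreover have "(\<lambda>\<omega>. \<integral>\<^sup>+\<omega>'. W \<omega>' \<partial>natural_kernel (state X s \<omega>)) \<in> borel_measurable ?P"
    by (rule measurable_compose[OF kP nn_integral_measurable_subprob_algebra[OF W]])
  moreover have "(\<lambda>\<omega>. W (time_shift X s \<omega>)) \<in> borel_measurable ?P"
    by (rule measurable_compose[OF sh W])
  ultimately show ?thesis
    using W shD by (simp add: nn_integral_distr nn_integral_density)
qed

text \<open>\<open>Q\<close> is the mixture of the laws P^y over \<nu>. The condition defining the
  augmented sigma-algebra, read for this \<nu>, places it inside the completion of \<open>Q\<close>,
  and functions measurable for a completion have versions. Both the version and the null set depend
  on \<nu>.\<close>

lemma augmented_version:
  fixes W :: "'w \<Rightarrow> ennreal"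
  assumes \<nu>: "prob_space \<nu>" and s\<nu>: "sets \<nu> = sets cem" and W: "W \<in> borel_measurable (augmented_filtration X \<top>)"
  obtains W' N where "W' \<in> borel_measurable (natural_filtration X \<top>)" "N \<in> sets (natural_filtration X \<top>)"
    "(\<integral>\<^sup>+y. emeasure (prob_from X y) N \<partial>\<nu>) = 0" "\<And>\<omega>. \<omega> \<in> sample_space X - N \<Longrightarrow> W \<omega> = W' \<omega>"
proof -
  let ?F = "natural_filtration X \<top>"
  interpret \<nu>: prob_space \<nu> by (rule \<nu>)
  define Q where "Q = \<nu> \<bind> natural_kernel"
  have k\<nu>: "natural_kernel \<in> measurable \<nu> (subprob_algebra ?F)"
    using natural_kernel_measurable by (simp cong: measurable_cong_sets add: s\<nu>)
  have sQ: "sets Q = sets ?F" and spQ: "space Q = sample_space X"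
    using sets_bind[of \<nu> natural_kernel ?F] space_bind[of \<nu> natural_kernel ?F] \<nu>.not_empty
    by (auto simp: Q_def sets_natural_kernel)
  have eQ: "emeasure Q N = (\<integral>\<^sup>+y. emeasure (prob_from X y) N \<partial>\<nu>)" if "N \<in> sets ?F" for N
    unfolding Q_def using emeasure_bind[OF \<nu>.not_empty k\<nu> that] by (simp add: emeasure_natural_kernel[OF that])
  have aug_sub: "sets (augmented_filtration X \<top>) \<subseteq> sets (completion Q)"
    unfolding sets_augmented
  proof (rule sets.sigma_sets_subset[of _ "completion Q", simplified spQ space_completion], safe)
    fix \<Lambda> assume *: "\<forall>\<nu>. prob_space \<nu> \<and> sets \<nu> = sets cem \<longrightarrow>
         (\<exists>A\<in>sets ?F. \<exists>N\<in>sets ?F. (\<Lambda> - A) \<union> (A - \<Lambda>) \<subseteq> N \<and> (\<integral>\<^sup>+ x. emeasure (prob_from X x) N \<partial>\<nu>) = 0)"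
    obtain A N where AN: "A \<in> sets ?F" "N \<in> sets ?F" "(\<Lambda> - A) \<union> (A - \<Lambda>) \<subseteq> N"
      "(\<integral>\<^sup>+ x. emeasure (prob_from X x) N \<partial>\<nu>) = 0"
      using *[rule_format, OF conjI[OF \<nu>.prob_space_axioms s\<nu>]] by blast
    then have "N \<in> null_sets Q" using eQ sQ by auto
    then show "\<Lambda> \<in> sets (completion Q)"
      by (intro sets_completionI[of \<Lambda> "A - N" "\<Lambda> \<inter> N" N]) (use AN sQ in auto)
  qed
  have "W \<in> borel_measurable (completion Q)"
    using W aug_sub by (auto simp: measurable_def spQ)
  from completion_ex_borel_measurable[OF this] obtain W' where W': "W' \<in> borel_measurable Q" "AE \<omega> in Q. W \<omega> = W' \<omega>"
    by auto
  then have W'F: "W' \<in> borel_measurable ?F" using sQ by (simp cong: measurable_cong_sets)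
  obtain N where N: "\<And>\<omega>. \<omega> \<in> sample_space X - N \<Longrightarrow> W \<omega> = W' \<omega>" "N \<in> null_sets Q"
    by (rule AE_E3[OF W'(2), unfolded spQ]) blast
  have NF: "N \<in> sets ?F" using N(2) sQ by auto
  show thesis by (rule that[OF W'F NF _ N(1)]) (use N(2) eQ[OF NF] in auto)
qed

text \<open>
  The conditional expectation \<open>k\<close> only agrees almost surely with \<open>x \<mapsto> E\<^sup>x W\<close>: the latter is merely
  universally measurable.
\<close>

lemma augmented_markov:
  assumes s: "s < \<top>" and W: "W \<in> borel_measurable (augmented_filtration X \<top>)"
  shows "\<exists>k\<in>borel_measurable cem.
    (AE \<omega> in prob_from X x. k (state X s \<omega>) = (\<integral>\<^sup>+\<omega>'. W \<omega>' \<partial>prob_from X (state X s \<omega>))) \<and>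
    (\<forall>Z\<in>borel_measurable (augmented_filtration X s). (\<integral>\<^sup>+\<omega>. Z \<omega> \<partial>prob_from X x) < \<top> \<longrightarrow>
      (\<integral>\<^sup>+\<omega>. Z \<omega> * W (time_shift X s \<omega>) \<partial>prob_from X x) = (\<integral>\<^sup>+\<omega>. Z \<omega> * k (state X s \<omega>) \<partial>prob_from X x))"
proof -
  let ?P = "prob_from X x" and ?F = "natural_filtration X \<top>"
  interpret prob_space ?P by (rule prob_space_from)
  \<comment> \<open>The version of \<open>W\<close> is taken for the law of the state at time
    \<open>s\<close> under P^x, because this is the initial law of the shifted path.\<close>
  define \<nu> where "\<nu> = distr ?P cem (state X s)"
  interpret \<nu>: prob_space \<nu> unfolding \<nu>_def by (rule prob_space_distr) simp
  have s\<nu>: "sets \<nu> = sets cem" by (simp add: \<nu>_def)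
  obtain W' N where W'F: "W' \<in> borel_measurable ?F" and NF: "N \<in> sets ?F"
    and N0': "(\<integral>\<^sup>+y. emeasure (prob_from X y) N \<partial>\<nu>) = 0" and N: "\<And>\<omega>. \<omega> \<in> sample_space X - N \<Longrightarrow> W \<omega> = W' \<omega>"
    by (rule augmented_version[OF \<nu>.prob_space_axioms s\<nu> W]) blast
  have NP: "N \<in> sets (prob_from X y)" for y using NF subalgebra_natural[of y] by (auto simp: subalgebra_def)
  have k\<nu>: "natural_kernel \<in> measurable \<nu> (subprob_algebra ?F)"
    using natural_kernel_measurable by (simp cong: measurable_cong_sets add: s\<nu>)
  have N0: "AE y in \<nu>. emeasure (natural_kernel y) N = 0"
    using N0' measurable_emeasure_kernel[OF k\<nu> NF] by (simp add: nn_integral_0_iff_AE emeasure_natural_kernel[OF NF])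
  define k where "k y = (\<integral>\<^sup>+\<omega>. W' \<omega> \<partial>natural_kernel y)" for y
  have k: "k \<in> borel_measurable cem"
    unfolding k_def by (rule measurable_compose[OF natural_kernel_measurable nn_integral_measurable_subprob_algebra[OF W'F]])
  have null: "AE \<omega> in ?P. emeasure (prob_from X (state X s \<omega>)) N = 0"
    using AE_distrD[OF state_from[of s x] N0[unfolded \<nu>_def]]
    by (simp add: emeasure_natural_kernel[OF NF])
  have "AE \<omega> in ?P. k (state X s \<omega>) = (\<integral>\<^sup>+\<omega>'. W \<omega>' \<partial>prob_from X (state X s \<omega>))"
    using null
  proof eventually_elim
    case (elim \<omega>)
    have "AE \<omega>' in prob_from X (state X s \<omega>). \<omega>' \<notin> N"
      using elim NP by (intro AE_not_in) auto
    then have "AE \<omega>' in prob_from X (state X s \<omega>). W' \<omega>' = W \<omega>'"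
      using AE_space by eventually_elim (use N in auto)
    then show ?case
      unfolding k_def nn_integral_natural_kernel[OF W'F] by (rule nn_integral_cong_AE)
  qed
  moreover have "(\<integral>\<^sup>+\<omega>. Z \<omega> * W (time_shift X s \<omega>) \<partial>?P) = (\<integral>\<^sup>+\<omega>. Z \<omega> * k (state X s \<omega>) \<partial>?P)"
    if Z: "Z \<in> borel_measurable (augmented_filtration X s)" "(\<integral>\<^sup>+\<omega>. Z \<omega> \<partial>?P) < \<top>" for Z
  proof -
    have sh: "time_shift X s \<in> measurable ?P ?F" by (rule natural_imp_from[OF shift_natural[OF s]])
    \<comment> \<open>The shifted path avoids \<open>N\<close> almost surely: this is
      \<open>natural_markov\<close> with \<open>Z\<close> = 1 for the indicator of \<open>N\<close>,
      which belongs to the natural sigma-algebra.\<close>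
    have "emeasure ?P (time_shift X s -` N \<inter> space ?P) = (\<integral>\<^sup>+\<omega>. 1 * indicator N (time_shift X s \<omega>) \<partial>?P)"
    proof -
      have "(\<integral>\<^sup>+\<omega>. 1 * indicator N (time_shift X s \<omega>) \<partial>?P) = (\<integral>\<^sup>+\<omega>. indicator (time_shift X s -` N \<inter> space ?P) \<omega> \<partial>?P)"
        by (intro nn_integral_cong) (auto simp: indicator_def)
      then show ?thesis using measurable_sets[OF sh NF] by simp
    qed
    also have "\<dots> = (\<integral>\<^sup>+\<omega>. 1 * (\<integral>\<^sup>+\<omega>'. indicator N \<omega>' \<partial>natural_kernel (state X s \<omega>)) \<partial>?P)"
      by (rule natural_markov[OF s]) (use NF in \<open>auto simp: emeasure_space_1[simplified]\<close>)
    also have "\<dots> = (\<integral>\<^sup>+\<omega>. 0 \<partial>?P)"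
      using null by (intro nn_integral_cong_AE) (auto simp: sets_natural_kernel NF emeasure_natural_kernel)
    finally have "time_shift X s -` N \<inter> space ?P \<in> null_sets ?P"
      using measurable_sets[OF sh NF] by auto
    from AE_not_in[OF this] have "AE \<omega> in ?P. W (time_shift X s \<omega>) = W' (time_shift X s \<omega>)"
      using AE_space by eventually_elim (use N shift_closed[OF s] in auto)
    then have "(\<integral>\<^sup>+\<omega>. Z \<omega> * W (time_shift X s \<omega>) \<partial>?P) = (\<integral>\<^sup>+\<omega>. Z \<omega> * W' (time_shift X s \<omega>) \<partial>?P)"
      by (intro nn_integral_cong_AE) auto
    also have "\<dots> = (\<integral>\<^sup>+\<omega>. Z \<omega> * k (state X s \<omega>) \<partial>?P)"
      unfolding k_def by (rule natural_markov[OF s Z W'F])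
    finally show ?thesis .
  qed
  ultimately show ?thesis using k by blast
qed

text \<open>A comparison of means from every starting point becomes a comparison of conditional
  means given the past at \<open>s\<close>. It is assumed only for starting points in the state
  space, hence the condition that the state at \<open>s\<close> is almost surely not the
  cemetery.\<close>

lemma markov_compare:
  assumes s: "s < \<top>" and W: "W1 \<in> borel_measurable (augmented_filtration X \<top>)" "W2 \<in> borel_measurable (augmented_filtration X \<top>)"
    and Z: "Z \<in> borel_measurable (augmented_filtration X s)" and fin: "(\<integral>\<^sup>+\<omega>. Z \<omega> \<partial>prob_from X x) < \<top>"
    and le: "\<And>y. (\<integral>\<^sup>+\<omega>. W1 \<omega> \<partial>prob_from X (Some y)) \<le> (\<integral>\<^sup>+\<omega>. W2 \<omega> \<partial>prob_from X (Some y)) + \<kappa>"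
    and alive: "AE \<omega> in prob_from X x. state X s \<omega> \<noteq> None"
  shows "(\<integral>\<^sup>+\<omega>. Z \<omega> * W1 (time_shift X s \<omega>) \<partial>prob_from X x) \<le>
    (\<integral>\<^sup>+\<omega>. Z \<omega> * W2 (time_shift X s \<omega>) \<partial>prob_from X x) + \<kappa> * (\<integral>\<^sup>+\<omega>. Z \<omega> \<partial>prob_from X x)"
proof -
  let ?P = "prob_from X x"
  obtain k1 where k1: "k1 \<in> borel_measurable cem"
      "AE \<omega> in ?P. k1 (state X s \<omega>) = (\<integral>\<^sup>+\<omega>'. W1 \<omega>' \<partial>prob_from X (state X s \<omega>))"
      "(\<integral>\<^sup>+\<omega>. Z \<omega> * W1 (time_shift X s \<omega>) \<partial>?P) = (\<integral>\<^sup>+\<omega>. Z \<omega> * k1 (state X s \<omega>) \<partial>?P)"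
    using augmented_markov[OF s W(1), of x] Z fin by blast
  obtain k2 where k2: "k2 \<in> borel_measurable cem"
      "AE \<omega> in ?P. k2 (state X s \<omega>) = (\<integral>\<^sup>+\<omega>'. W2 \<omega>' \<partial>prob_from X (state X s \<omega>))"
      "(\<integral>\<^sup>+\<omega>. Z \<omega> * W2 (time_shift X s \<omega>) \<partial>?P) = (\<integral>\<^sup>+\<omega>. Z \<omega> * k2 (state X s \<omega>) \<partial>?P)"
    using augmented_markov[OF s W(2), of x] Z fin by blast
  have [measurable]: "Z \<in> borel_measurable ?P" "k2 \<in> borel_measurable cem" by (fact augmented_imp_from[OF Z] k2)+
  have "(\<integral>\<^sup>+\<omega>. Z \<omega> * k1 (state X s \<omega>) \<partial>?P) \<le> (\<integral>\<^sup>+\<omega>. Z \<omega> * k2 (state X s \<omega>) + \<kappa> * Z \<omega> \<partial>?P)"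
  proof (rule nn_integral_mono_AE)
    show "AE \<omega> in ?P. Z \<omega> * k1 (state X s \<omega>) \<le> Z \<omega> * k2 (state X s \<omega>) + \<kappa> * Z \<omega>"
      using k1(2) k2(2) alive
    proof eventually_elim
      case (elim \<omega>)
      then obtain y where y: "state X s \<omega> = Some y" by auto
      then have "k1 (state X s \<omega>) \<le> k2 (state X s \<omega>) + \<kappa>" using elim le[of y] by simp
      then have "Z \<omega> * k1 (state X s \<omega>) \<le> Z \<omega> * (k2 (state X s \<omega>) + \<kappa>)" by (rule mult_left_mono) simp
      then show ?case by (simp add: distrib_left mult.commute)
    qed
  qed
  also have "\<dots> = (\<integral>\<^sup>+\<omega>. Z \<omega> * k2 (state X s \<omega>) \<partial>?P) + \<kappa> * (\<integral>\<^sup>+\<omega>. Z \<omega> \<partial>?P)"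
    by (subst nn_integral_add) (auto simp: nn_integral_cmult)
  finally show ?thesis using k1(3) k2(3) by simp
qed

text \<open>\<Lambda> itself is only augmented-measurable. For each initial law its indicator has a
  version \<open>W\<close> off a null set \<open>N\<close>, and \<open>K\<close>, where
  \<open>W\<close> differs from 1 or the version fails, is a null set of the natural sigma-algebra
  that contains all of \<open>B\<close>. So \<open>B\<close> is within \<open>K\<close> of the empty
  set.\<close>

lemma null_subset_augmented:
  assumes \<Lambda>: "\<Lambda> \<in> sets (augmented_filtration X \<top>)" "\<And>y. emeasure (prob_from X y) \<Lambda> = 1" and B: "B \<subseteq> sample_space X - \<Lambda>"
  shows "B \<in> sets (augmented_filtration X \<top>)"
  unfolding sets_augmented
proof (intro sigma_sets.Basic CollectI conjI allI impI)
  show "B \<subseteq> sample_space X" using B by auto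
  let ?F = "natural_filtration X \<top>"
  fix \<nu> :: "'s option measure" assume \<nu>: "prob_space \<nu> \<and> sets \<nu> = sets cem"
  have "indicator \<Lambda> \<in> borel_measurable (augmented_filtration X \<top>)" using \<Lambda>(1) by simp
  then obtain W N where W: "W \<in> borel_measurable ?F" and N: "N \<in> sets ?F" "(\<integral>\<^sup>+y. emeasure (prob_from X y) N \<partial>\<nu>) = 0"
    and eq: "\<And>\<omega>. \<omega> \<in> sample_space X - N \<Longrightarrow> indicator \<Lambda> \<omega> = (W \<omega> :: ennreal)"
    using \<nu> augmented_version[of \<nu> "indicator \<Lambda>"] by blast
  have "{\<omega> \<in> space ?F. W \<omega> \<noteq> 1} \<in> sets ?F" using W by measurable
  then have W1: "{\<omega> \<in> sample_space X. W \<omega> \<noteq> 1} \<in> sets ?F" by simp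
  define K where "K = N \<union> {\<omega> \<in> sample_space X. W \<omega> \<noteq> 1}"
  have K: "K \<in> sets ?F" unfolding K_def by (rule sets.Un[OF N(1) W1])
  have "B \<subseteq> K"
  proof
    fix \<omega> assume "\<omega> \<in> B"
    then show "\<omega> \<in> K" using B eq[of \<omega>] by (auto simp: K_def)
  qed
  have KP: "emeasure (prob_from X y) K \<le> emeasure (prob_from X y) N" for y
  proof -
    interpret P: prob_space "prob_from X y" by (rule prob_space_from)
    have sub: "sets ?F \<subseteq> sets (prob_from X y)" using subalgebra_natural[of y] by (simp add: subalgebra_def)
    have L: "\<Lambda> \<in> sets (prob_from X y)" using \<Lambda>(1) by (simp add: sets_from)
    have "P.prob \<Lambda> = 1" using \<Lambda>(2)[of y] by (simp add: measure_def)
    then have "P.prob (space (prob_from X y) - \<Lambda>) = 0" using P.prob_compl[OF L] by simp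
    then have null: "emeasure (prob_from X y) (sample_space X - \<Lambda>) = 0" by (simp add: P.emeasure_eq_measure)
    have "K \<subseteq> N \<union> (sample_space X - \<Lambda>)" using eq by (force simp: K_def)
    then have "emeasure (prob_from X y) K \<le> emeasure (prob_from X y) (N \<union> (sample_space X - \<Lambda>))"
      using N(1) L sub sets.compl_sets[OF L] by (intro emeasure_mono sets.Un) auto
    also have "\<dots> \<le> emeasure (prob_from X y) N + emeasure (prob_from X y) (sample_space X - \<Lambda>)"
      using N(1) L sub sets.compl_sets[OF L] by (intro emeasure_subadditive) auto
    finally show ?thesis by (simp add: null)
  qed
  have "(\<integral>\<^sup>+y. emeasure (prob_from X y) K \<partial>\<nu>) \<le> 0"
    unfolding N(2)[symmetric] by (rule nn_integral_mono[OF KP])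
  then show "\<exists>A\<in>sets ?F. \<exists>N\<in>sets ?F. (B - A) \<union> (A - B) \<subseteq> N \<and> (\<integral>\<^sup>+ x. emeasure (prob_from X x) N \<partial>\<nu>) = 0"
    using \<open>B \<subseteq> K\<close> K by (intro bexI[of _ "{}"] bexI[of _ K]) auto
qed

text \<open>
  Without measurability \<^const>\<open>exit_prob\<close> would be the junk value 0. Outside the set of cadlag paths
  nothing is known about the exit time, but all subsets of a set which is null for every initial law
  belong to the augmented filtration.
\<close>

lemma exit_event_sets:
  "{\<omega> \<in> sample_space X. exit_time X (cball \<rho> R) \<omega> < ennreal T} \<in> sets (prob_from X y)" (is "?E \<in> _")
proof -
  obtain \<Lambda> where \<Lambda>: "\<Lambda> \<in> sets (augmented_filtration X \<top>)" "\<And>x. emeasure (prob_from X x) \<Lambda> = 1"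
    and rc: "\<And>\<omega> t. \<omega> \<in> \<Lambda> \<Longrightarrow> t < \<top> \<Longrightarrow> limitin cemetery_topology (\<lambda>s. state X s \<omega>) (state X t \<omega>) (at_right t)"
    using cadlag_paths by blast
  let ?V = "- Some ` cball \<rho> R"
  have Veq: "?V = insert None (Some ` (- cball \<rho> R))"
  proof (rule set_eqI)
    fix u show "u \<in> ?V \<longleftrightarrow> u \<in> insert None (Some ` (- cball \<rho> R))" by (cases u) auto
  qed
  have V: "openin cemetery_topology ?V"
    unfolding Veq openin_cemetery by (intro disjI2 exI[of _ "cball \<rho> R"] conjI compact_cball refl)
  \<comment> \<open>\<open>?V\<close> is open: closed balls are compact, so their complements, with
    the cemetery added, are neighbourhoods of infinity. A right-continuous path that is in
    \<open>?V\<close> at some time before \<open>T\<close> is there also at a rational time before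
    \<open>T\<close>, which leaves a countable union.\<close>
  define Q where "Q = (\<Union>q::rat. if 0 < q \<and> ennreal (of_rat q) < ennreal T then state X (ennreal (of_rat q)) -` ?V \<inter> sample_space X else {})"
  have "state X t -` ?V \<inter> sample_space X \<in> sets (augmented_filtration X \<top>)" for t
    using measurable_sets[OF state_augmented[of t \<top>] openin_borel_of[OF V]] by simp
  then have Q: "Q \<in> sets (augmented_filtration X \<top>)" unfolding Q_def by (intro sets.countable_UN) auto
  have QE: "Q \<subseteq> ?E"
  proof
    fix \<omega> assume "\<omega> \<in> Q"
    then obtain q :: rat where q: "0 < q" "ennreal (of_rat q) < ennreal T" "state X (ennreal (of_rat q)) \<omega> \<in> ?V" "\<omega> \<in> sample_space X"
      unfolding Q_def by (auto split: if_splits)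
    have "exit_time X (cball \<rho> R) \<omega> \<le> ennreal (of_rat q)"
      unfolding exit_time_def using q by (intro Inf_lower) auto
    then show "\<omega> \<in> ?E" using q by (auto intro: le_less_trans)
  qed
  have "?E \<inter> \<Lambda> \<subseteq> Q"
  proof
    fix \<omega> assume \<omega>: "\<omega> \<in> ?E \<inter> \<Lambda>"
    then obtain t where t: "0 < t" "state X t \<omega> \<in> ?V" "t < ennreal T"
      unfolding exit_time_def by (auto simp: Inf_less_iff)
    have tt: "t < \<top>" using t(3) by (rule less_trans) simp
    have "eventually (\<lambda>s. state X s \<omega> \<in> ?V) (at_right t)"
      using rc[OF _ tt, of \<omega>] \<omega> V t(2) unfolding limitin_def by blast
    then obtain b where b: "t < b" "\<And>s. t < s \<Longrightarrow> s < b \<Longrightarrow> state X s \<omega> \<in> ?V"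
      using eventually_at_right[OF t(3)] by auto
    obtain q :: rat where q: "t < ennreal (of_rat q)" "ennreal (of_rat q) < min b (ennreal T)"
      using ennreal_rat_dense[of t "min b (ennreal T)"] b(1) t(3) by auto
    have "0 < ennreal (of_rat q)" using t(1) q(1) by (rule less_trans)
    then have "0 < q" by (simp add: ennreal_less_zero_iff)
    then show "\<omega> \<in> Q" unfolding Q_def using q b(2)[of "ennreal (of_rat q)"] \<omega> by (intro UN_I[of q]) auto
  qed
  then have E: "?E = Q \<union> (?E - \<Lambda>)" using QE by auto
  have "?E - \<Lambda> \<in> sets (augmented_filtration X \<top>)"
    by (rule null_subset_augmented[OF \<Lambda>]) auto
  from sets.Un[OF Q this] show ?thesis unfolding sets_from by (subst E)
qed

end

section \<open>Right-continuous functions and Riemann sums\<close>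

text \<open>The floor plus one is used in place of the ceiling so that the grid points lie strictly
  to the right of \<open>w\<close>, as limits from the right demand.\<close>

lemma dyadic_ceiling_tendsto: "(\<lambda>n. (of_int \<lfloor>2^n * w\<rfloor> + 1) / 2^n :: real) \<longlonglongrightarrow> w"
proof (rule tendsto_sandwich)
  have "w \<le> (of_int \<lfloor>2^n * w\<rfloor> + 1) / 2^n" for n
    using floor_correct[of "2^n * w"] by (simp add: field_simps)
  then show "\<forall>\<^sub>F n in sequentially. w \<le> (of_int \<lfloor>2^n * w\<rfloor> + 1) / 2^n" by simp
  have "(of_int \<lfloor>2^n * w\<rfloor> + 1) / 2^n \<le> w + (1/2)^n" for n
    using floor_correct[of "2^n * w"] by (simp add: field_simps)
  then show "\<forall>\<^sub>F n in sequentially. (of_int \<lfloor>2^n * w\<rfloor> + 1) / 2^n \<le> w + (1/2)^n" by simp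
  show "(\<lambda>n. w + (1/2)^n) \<longlonglongrightarrow> w"
    using tendsto_add[OF tendsto_const[of w] LIMSEQ_power_zero[of "1/2::real"]] by simp
qed simp

lemma dyadic_ceiling_gt: "w < (of_int \<lfloor>2^n * w\<rfloor> + 1) / 2^n" for w :: real
  using floor_correct[of "2^n * w"] by (simp add: field_simps)

lemma tendsto_at_right_sequence:
  fixes q :: "real \<Rightarrow> 'b::topological_space"
  assumes "(q \<longlongrightarrow> q w) (at_right w)" "z \<longlonglongrightarrow> w" "\<And>n::nat. w \<le> z n"
  shows "(\<lambda>n. q (z n)) \<longlonglongrightarrow> q w"
  unfolding tendsto_def
proof (intro allI impI)
  fix S assume S: "open S" "q w \<in> S"
  then have "eventually (\<lambda>x. q x \<in> S) (at_right w)" using assms(1) by (auto simp: tendsto_def)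
  then obtain b where b: "b > w" "\<And>x. w < x \<Longrightarrow> x < b \<Longrightarrow> q x \<in> S"
    unfolding eventually_at_right_field by auto
  have "eventually (\<lambda>n. z n < b) sequentially" using assms(2) b(1) by (rule order_tendstoD)
  then show "eventually (\<lambda>n. q (z n) \<in> S) sequentially"
  proof eventually_elim
    case (elim n)
    then show ?case using b(2)[of "z n"] assms(3)[of n] S(2) by (cases "z n = w") auto
  qed
qed

text \<open>Sampling at the next dyadic point, the approximant depends on \<open>t\<close> only
  through an integer, so it is jointly measurable as a countable composition; right-continuity
  identifies the limit. \<open>max 0\<close> fixes the values at negative times.\<close>

lemma right_continuous_borel_measurable:
  fixes f :: "real \<Rightarrow> 'w \<Rightarrow> 'b::metric_space"
  assumes m: "\<And>t. 0 \<le> t \<Longrightarrow> f t \<in> borel_measurable M"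
    and rc: "\<And>t \<omega>. 0 \<le> t \<Longrightarrow> \<omega> \<in> space M \<Longrightarrow> ((\<lambda>t. f t \<omega>) \<longlongrightarrow> f t \<omega>) (at_right t)"
  shows "(\<lambda>(t, \<omega>). f (max 0 t) \<omega>) \<in> borel_measurable (borel \<Otimes>\<^sub>M M)"
proof (rule borel_measurable_LIMSEQ_metric)
  fix n :: nat
  let ?g = "\<lambda>i::int. \<lambda>p::real \<times> 'w. f (max 0 ((of_int i + 1) / 2^n)) (snd p)"
  have "(\<lambda>p. ?g \<lfloor>2^n * max 0 (fst p)\<rfloor> p) \<in> borel_measurable (borel \<Otimes>\<^sub>M M)"
  proof (rule measurable_compose_countable[where f="?g" and g="\<lambda>p. \<lfloor>2^n * max 0 (fst p) :: real\<rfloor>"])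
    show "?g i \<in> borel_measurable (borel \<Otimes>\<^sub>M M)" for i
      by (rule measurable_compose[OF measurable_snd m]) simp
    show "(\<lambda>p. \<lfloor>2^n * max 0 (fst p) :: real\<rfloor>) \<in> (borel \<Otimes>\<^sub>M M) \<rightarrow>\<^sub>M count_space UNIV"
      using measurable_compose[OF measurable_fst, of "\<lambda>t::real. \<lfloor>2^n * max 0 t\<rfloor>" borel "count_space UNIV"] by simp
  qed
  then show "(\<lambda>p. ?g \<lfloor>2^n * max 0 (fst p)\<rfloor> p) \<in> borel_measurable (borel \<Otimes>\<^sub>M M)" .
next
  fix p :: "real \<times> 'w" assume "p \<in> space (borel \<Otimes>\<^sub>M M)"
  then obtain t \<omega> where p: "p = (t, \<omega>)" "\<omega> \<in> space M" by (cases p) (auto simp: space_pair_measure)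
  have "(\<lambda>n. f ((of_int \<lfloor>2^n * max 0 t\<rfloor> + 1) / 2^n) \<omega>) \<longlonglongrightarrow> f (max 0 t) \<omega>"
    by (rule tendsto_at_right_sequence[of "\<lambda>t. f t \<omega>", OF rc dyadic_ceiling_tendsto])
       (use p less_imp_le[OF dyadic_ceiling_gt[of "max 0 t"]] in simp_all)
  moreover have "max 0 ((of_int \<lfloor>2^n * max 0 t\<rfloor> + 1) / 2^n) = (of_int \<lfloor>2^n * max 0 t\<rfloor> + 1) / (2^n :: real)" for n
    using dyadic_ceiling_gt[of "max 0 t" n] by linarith
  ultimately show "(\<lambda>n. f (max 0 ((of_int \<lfloor>2^n * max 0 (fst p)\<rfloor> + 1) / 2^n)) (snd p)) \<longlonglongrightarrow> (case p of (t, \<omega>) \<Rightarrow> f (max 0 t) \<omega>)"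
    by (simp add: p)
qed

text \<open>Cells are open on the left and \<open>q\<close> is read at the right end point, so the
  sampling points approach \<open>w\<close> from the right and right-continuity suffices. The
  constant \<open>c\<close> on the finite-mass interval dominates. These sums make integrals along a
  path limits of adapted random variables.\<close>

lemma riemann_sum_tendsto:
  fixes q :: "real \<Rightarrow> real"
  assumes N: "sets N = sets borel" "emeasure N {0<..t} < \<top>" and t: "0 \<le> t"
    and q: "\<And>w. 0 \<le> q w" "\<And>w. q w \<le> c"
    and rc: "\<And>w. 0 \<le> w \<Longrightarrow> (q \<longlongrightarrow> q w) (at_right w)"
  shows "(\<lambda>n. \<Sum>k<2^n. ennreal (q (real (k + 1) * t / 2^n)) * emeasure N {real k * t / 2^n <.. real (k + 1) * t / 2^n})
    \<longlonglongrightarrow> (\<integral>\<^sup>+w. ennreal (q w) * indicator {0<..t} w \<partial>N)"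
proof -
  define I where "I n k = {real k * t / 2^n <.. real (k + 1) * t / 2^n}" for n k :: nat
  define qn where "qn n w = (\<Sum>k<2^n. ennreal (q (real (k + 1) * t / 2^n)) * indicator (I n k) w)" for n :: nat and w
  have Isets: "I n k \<in> sets N" for n k by (simp add: I_def N)
  have [measurable]: "I n k \<in> sets N" for n k by (rule Isets)
  have qn_meas[measurable]: "qn n \<in> borel_measurable N" for n unfolding qn_def by measurable
  have Isub: "I n k \<subseteq> {0<..t}" if "k < 2^n" for n k
  proof -
    have "real (k + 1) \<le> 2^n" using that by (metis Suc_eq_plus1 Suc_leI of_nat_le_iff of_nat_numeral of_nat_power)
    then have "real (k + 1) * t / 2^n \<le> t" using mult_right_mono[OF _ t, of "real (k + 1)" "2^n"] by (simp add: field_simps)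
    moreover have "0 \<le> real k * t / 2^n" using t by simp
    ultimately show ?thesis by (auto simp: I_def)
  qed
  have qn_eq: "qn n w = ennreal (q (real (k + 1) * t / 2^n))" if "k < 2^n" "w \<in> I n k" for n k w
  proof -
    have "w \<notin> I n j" if j: "j \<noteq> k" "j < 2^n" for j
    proof
      assume "w \<in> I n j"
      with \<open>w \<in> I n k\<close> have "real k * t < real (j + 1) * t" "real j * t < real (k + 1) * t"
        by (auto simp: I_def field_simps intro: le_less_trans less_le_trans)
      then have "real k < real (j + 1)" "real j < real (k + 1)"
        using t by (auto simp: mult_less_cancel_right)
      then show False using j by linarith
    qed
    then have "qn n w = (\<Sum>j<2^n. if j = k then ennreal (q (real (k + 1) * t / 2^n)) else 0)"
      unfolding qn_def using that by (intro sum.cong) auto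
    then show ?thesis using that(1) by simp
  qed
  have qn_out: "qn n w = 0" if "w \<notin> {0<..t}" for n w
  proof -
    have "w \<notin> I n k" if "k < 2^n" for k using Isub[OF that] \<open>w \<notin> {0<..t}\<close> by blast
    then show ?thesis unfolding qn_def by (intro sum.neutral) auto
  qed
  have cell: "\<exists>k<2^n. w \<in> I n k \<and> real (k + 1) * t / 2^n \<le> w + t / 2^n" if w: "w \<in> {0<..t}" for n w
  proof -
    have tpos: "0 < t" using w by auto
    define x where "x = w * 2^n / t"
    have x: "0 < x" "x \<le> 2^n" using w tpos by (auto simp: x_def field_simps)
    \<comment> \<open>For cells open on the left the index is the ceiling minus one, so a grid point
      belongs to the cell that ends there.\<close>
    define k where "k = nat (\<lceil>x\<rceil> - 1)"
    have cx: "1 \<le> \<lceil>x\<rceil>" "\<lceil>x\<rceil> \<le> 2^n" using x by (auto simp: ceiling_le_iff one_le_ceiling)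
    have rk: "real k = of_int \<lceil>x\<rceil> - 1" using cx by (simp add: k_def)
    have "int k < 2^n" using cx by (simp add: k_def)
    then have k2: "k < 2^n" by (metis of_nat_less_iff of_nat_numeral of_nat_power)
    have "real k < x" "x \<le> real k + 1" using ceiling_correct[of x] rk by linarith+
    then have "real k * t < w * 2^n" "w * 2^n \<le> real (k + 1) * t"
      using tpos by (auto simp: x_def field_simps)
    then have "w \<in> I n k" "real (k + 1) * t / 2^n \<le> w + t / 2^n"
      by (auto simp: I_def field_simps)
    then show ?thesis using k2 by blast
  qed
  have lim: "(\<lambda>n. qn n w) \<longlonglongrightarrow> ennreal (q w) * indicator {0<..t} w" for w
  proof (cases "w \<in> {0<..t}")
    case True
    obtain k where k: "\<And>n. k n < 2^n" "\<And>n. w \<in> I n (k n)" "\<And>n. real (k n + 1) * t / 2^n \<le> w + t / 2^n"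
      using cell[OF True] by metis
    have "(\<lambda>n. real (k n + 1) * t / 2^n) \<longlonglongrightarrow> w"
    proof (rule tendsto_sandwich)
      show "\<forall>\<^sub>F n in sequentially. w \<le> real (k n + 1) * t / 2^n" using k(2) by (auto simp: I_def)
      show "\<forall>\<^sub>F n in sequentially. real (k n + 1) * t / 2^n \<le> w + t / 2^n" using k(3) by simp
      have "(\<lambda>n. w + t * (1/2)^n) \<longlonglongrightarrow> w + t * 0"
        by (intro tendsto_intros LIMSEQ_power_zero) simp
      then show "(\<lambda>n. w + t / 2^n) \<longlonglongrightarrow> w" by (simp add: power_divide)
    qed simp
    then have "(\<lambda>n. q (real (k n + 1) * t / 2^n)) \<longlonglongrightarrow> q w"
      using True k(2) by (rule_tac tendsto_at_right_sequence[OF rc]) (auto simp: I_def less_imp_le)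
    then have "(\<lambda>n. ennreal (q (real (k n + 1) * t / 2^n))) \<longlonglongrightarrow> ennreal (q w)" by (rule tendsto_ennrealI)
    then show ?thesis using True qn_eq[OF k(1,2)] by simp
  next
    case False
    then show ?thesis by (simp add: qn_out)
  qed
  have "(\<lambda>n. \<integral>\<^sup>+w. qn n w \<partial>N) \<longlonglongrightarrow> (\<integral>\<^sup>+w. ennreal (q w) * indicator {0<..t} w \<partial>N)"
  proof (rule nn_integral_dominated_convergence[where w="\<lambda>w. ennreal c * indicator {0<..t} w"])
    show "(\<lambda>w. ennreal (q w) * indicator {0<..t} w) \<in> borel_measurable N"
      by (rule borel_measurable_LIMSEQ_order[OF lim]) measurable
    show "(\<lambda>w. ennreal c * indicator {0<..t} w) \<in> borel_measurable N" using N(1) by measurable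
    show "(\<integral>\<^sup>+w. ennreal c * indicator {0<..t} w \<partial>N) < \<infinity>"
      using N by (subst nn_integral_cmult_indicator) (auto simp: ennreal_mult_less_top)
    show "AE w in N. qn j w \<le> ennreal c * indicator {0<..t} w" for j
    proof (rule AE_I2)
      fix w
      show "qn j w \<le> ennreal c * indicator {0<..t} w"
        using cell[of w j] qn_eq[of _ j w] qn_out[of w j] q(2) by (cases "w \<in> {0<..t}") (auto simp: ennreal_leI[OF q(2)])
    qed
  qed (use lim in auto)
  moreover have "(\<integral>\<^sup>+w. qn n w \<partial>N) = (\<Sum>k<2^n. ennreal (q (real (k + 1) * t / 2^n)) * emeasure N (I n k))" for n
    unfolding qn_def using Isets by (subst nn_integral_sum) (auto simp: nn_integral_cmult_indicator)
  ultimately show ?thesis by (simp add: I_def)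
qed

lemma measure_eqI_Ioc:
  fixes M N :: "real measure"
  assumes "sets M = sets borel" "sets N = sets borel"
    and eq: "\<And>u v. u \<le> v \<Longrightarrow> emeasure M {u<..v} = emeasure N {u<..v}"
    and fin: "\<And>u v. u \<le> v \<Longrightarrow> emeasure M {u<..v} < \<top>"
  shows "M = N"
proof (rule measure_eqI_generator_eq[where E="range (\<lambda>(u, v). {u<..v::real})" and \<Omega>=UNIV and A="\<lambda>i. {- real i<..real i}"])
  show "Int_stable (range (\<lambda>(u, v). {u<..v::real}))"
  proof (rule Int_stableI)
    fix a b assume "a \<in> range (\<lambda>(u, v). {u<..v::real})" "b \<in> range (\<lambda>(u, v). {u<..v::real})"
    then obtain u v u' v' where "a = {u<..v}" "b = {u'<..v'}" by auto
    then have "a \<inter> b = (\<lambda>(u, v). {u<..v}) (max u u', min v v')" by auto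
    then show "a \<inter> b \<in> range (\<lambda>(u, v). {u<..v::real})" by (rule range_eqI)
  qed
  fix X assume "X \<in> range (\<lambda>(u, v). {u<..v::real})"
  then obtain u v where X: "X = {u<..v}" by auto
  show "emeasure M X = emeasure N X"
    unfolding X using eq[of u v] by (cases "u \<le> v") auto
next
  show "sets M = sigma_sets UNIV (range (\<lambda>(u, v). {u<..v::real}))"
    "sets N = sigma_sets UNIV (range (\<lambda>(u, v). {u<..v::real}))"
    using assms(1,2) by (simp_all add: borel_sigma_sets_Ioc)
  show "(\<Union>i. {- real i<..real i}) = UNIV"
  proof (intro equalityI subsetI)
    fix x :: real
    obtain n where "\<bar>x\<bar> < real n" using reals_Archimedean2 by blast
    then show "x \<in> (\<Union>i. {- real i<..real i})" by (intro UN_I[of n]) auto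
  qed simp
  show "emeasure M {- real i<..real i} \<noteq> \<infinity>" for i using fin[of "- real i" "real i"] by simp
qed auto

section \<open>The measure of an additive functional\<close>

text \<open>When \<open>a\<close> is finite at all finite times, the measure of \<open>a\<close>
  stopped at \<open>r\<close> is the Lebesgue-Stieltjes measure of \<open>a\<close> restricted to
  times at most \<open>r\<close>, and these restrictions increase to the full measure.\<close>

lemma stieltjes_measure_eq_interval_measure:
  assumes fin: "\<And>t. t < \<top> \<Longrightarrow> a t < \<top>" and mono: "\<And>s t. s \<le> t \<Longrightarrow> t < \<top> \<Longrightarrow> a s \<le> a t"
    and cont: "continuous_on {..<\<top>} a"
  shows "stieltjes_measure a = interval_measure (\<lambda>s. enn2real (a (ennreal s)))"
    and "continuous_on UNIV (\<lambda>s. enn2real (a (ennreal s)))"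
    and "mono (\<lambda>s. enn2real (a (ennreal s)))"
proof -
  define b where "b s = enn2real (a (ennreal s))" for s
  have bmono: "b s \<le> b t" if "s \<le> t" for s t
    unfolding b_def using that fin[of "ennreal t"] mono[of "ennreal s" "ennreal t"]
    by (intro enn2real_mono) (auto intro: ennreal_leI)
  then show "mono (\<lambda>s. enn2real (a (ennreal s)))" by (auto simp: mono_def b_def)
  have "continuous_on UNIV (\<lambda>s. a (ennreal s))"
    by (rule continuous_on_compose2[OF cont]) (auto intro: continuous_on_ennreal continuous_on_id)
  then have bcont: "continuous_on UNIV b"
    unfolding b_def continuous_on_def
    using fin by (auto intro!: tendsto_enn2real simp: less_top)
  then show "continuous_on UNIV (\<lambda>s. enn2real (a (ennreal s)))" by (simp add: b_def)
  have bright: "continuous (at_right s) b" for s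
    using bcont by (simp add: continuous_on_eq_continuous_at continuous_at_imp_continuous_within)
  let ?N = "interval_measure b"
  have N: "emeasure ?N {u<..v} = ennreal (b v - b u)" if "u \<le> v" for u v
    using that bmono bright by (intro emeasure_interval_measure_Ioc) auto
  let ?M = "\<lambda>t. interval_measure (\<lambda>s. enn2real (a (min (ennreal s) t)))"
  have M: "?M (ennreal r) = density ?N (indicator {..r})" if r: "0 \<le> r" for r
  proof (rule measure_eqI_Ioc)
    have eq: "(\<lambda>s. enn2real (a (min (ennreal s) (ennreal r)))) = (\<lambda>s. b (min s r))"
      using r by (auto simp: b_def min_def ennreal_le_iff2 not_le intro!: ext) 
    have cmin: "continuous (at_right s) (\<lambda>s. b (min s r))" for s
    proof -
      have "continuous_on UNIV (\<lambda>s. b (min s r))"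
        by (rule continuous_on_compose2[OF bcont]) (auto intro: continuous_intros)
      then show ?thesis by (simp add: continuous_on_eq_continuous_at continuous_at_imp_continuous_within)
    qed
    fix u v :: real assume uv: "u \<le> v"
    have M_uv: "emeasure (?M (ennreal r)) {u<..v} = ennreal (b (min v r) - b (min u r))"
      unfolding eq using uv cmin by (intro emeasure_interval_measure_Ioc) (auto intro: bmono)
    have "emeasure (density ?N (indicator {..r})) {u<..v} = emeasure ?N ({..r} \<inter> {u<..v})"
      by (subst emeasure_density) (auto simp: indicator_inter_arith[symmetric])
    also have "{..r} \<inter> {u<..v} = {min u r<..min v r}" by auto
    also have "emeasure ?N \<dots> = ennreal (b (min v r) - b (min u r))"
      using uv by (intro N) auto
    finally show "emeasure (?M (ennreal r)) {u<..v} = emeasure (density ?N (indicator {..r})) {u<..v}"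
      using M_uv by simp
    show "emeasure (?M (ennreal r)) {u<..v} < \<top>" using M_uv by simp
  qed auto
  have I: "{t. t < \<top> \<and> a t < \<top>} = ennreal ` {0..}"
  proof (intro set_eqI iffI)
    fix t assume "t \<in> {t. t < \<top> \<and> a t < \<top>}"
    then have "t = ennreal (enn2real t)" by simp
    then show "t \<in> ennreal ` {0..}" by (intro image_eqI[of _ _ "enn2real t"]) auto
  qed (use fin in auto)
  \<comment> \<open>A supremum of measures can be computed set by set along a chain, so the order of
    the stopped measures has to be established.\<close>
  have ch: "Complete_Partial_Order.chain (\<le>) (?M ` ennreal ` {0..})"
  proof (rule chainI)
    have le: "?M (ennreal r) \<le> ?M (ennreal r')" if "0 \<le> r" "r \<le> r'" for r r'
    proof (subst le_measure)
      show "\<forall>B\<in>sets (?M (ennreal r)). emeasure (?M (ennreal r)) B \<le> emeasure (?M (ennreal r')) B"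
      proof
        fix B assume "B \<in> sets (?M (ennreal r))"
        then have "B \<in> sets borel" by simp
        then show "emeasure (?M (ennreal r)) B \<le> emeasure (?M (ennreal r')) B"
          using that unfolding M[OF that(1)] M[OF order_trans[OF that]]
          by (subst (1 2) emeasure_density) (auto intro!: nn_integral_mono simp: indicator_def)
      qed
    qed simp
    fix x y assume "x \<in> ?M ` ennreal ` {0..}" "y \<in> ?M ` ennreal ` {0..}"
    then obtain r r' where "0 \<le> r" "0 \<le> r'" "x = ?M (ennreal r)" "y = ?M (ennreal r')" by auto
    then show "x \<le> y \<or> y \<le> x" using le[of r r'] le[of r' r] by (cases "r \<le> r'") auto
  qed
  show "stieltjes_measure a = interval_measure (\<lambda>s. enn2real (a (ennreal s)))"
  proof (rule measure_eqI)
    have sets: "sets (stieltjes_measure a) = sets borel"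
      unfolding stieltjes_measure_def I
      by (rule sets_SUP) (auto intro: exI[of _ "0::ennreal"])
    then show "sets (stieltjes_measure a) = sets (interval_measure (\<lambda>s. enn2real (a (ennreal s))))" by simp
    fix B assume "B \<in> sets (stieltjes_measure a)"
    then have B[measurable]: "B \<in> sets borel" using sets by simp
    have "emeasure (stieltjes_measure a) B = (SUP t\<in>ennreal ` {0..}. emeasure (?M t) B)"
      unfolding stieltjes_measure_def I by (rule emeasure_SUP_chain[where N=borel]) (use ch in auto)
    also have "\<dots> = (SUP r\<in>{0..}. emeasure ?N (B \<inter> {..r}))"
      unfolding image_image
      by (intro SUP_cong refl, subst M)
         (auto simp: emeasure_density indicator_inter_arith[symmetric] Int_commute)
    also have "\<dots> = emeasure ?N B"
    proof (rule antisym)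
      show "(SUP r\<in>{0..}. emeasure ?N (B \<inter> {..r})) \<le> emeasure ?N B"
        by (intro SUP_least emeasure_mono) auto
      have "emeasure ?N B = emeasure ?N (\<Union>n. B \<inter> {..real n})"
        by (rule arg_cong[where f="emeasure ?N"]) (auto simp: real_arch_simple)
      also have "\<dots> = (SUP n. emeasure ?N (B \<inter> {..real n}))"
        by (subst SUP_emeasure_incseq) (auto simp: incseq_def)
      also have "\<dots> \<le> (SUP r\<in>{0..}. emeasure ?N (B \<inter> {..r}))"
        by (rule SUP_mono) (auto intro!: bexI[of _ "real _"])
      finally show "emeasure ?N B \<le> (SUP r\<in>{0..}. emeasure ?N (B \<inter> {..r}))" .
    qed
    also have "b = (\<lambda>s. enn2real (a (ennreal s)))" by (simp add: b_def fun_eq_iff)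
    finally show "emeasure (stieltjes_measure a) B = emeasure (interval_measure (\<lambda>s. enn2real (a (ennreal s)))) B" .
  qed
qed

lemma tendsto_at_right_ennreal:
  assumes "(f \<longlongrightarrow> l) (at_right (ennreal t))" "0 \<le> t"
  shows "((\<lambda>s. f (ennreal s)) \<longlongrightarrow> l) (at_right t)"
proof (rule filterlim_compose[OF assms(1)])
  show "filterlim ennreal (at_right (ennreal t)) (at_right t)"
    unfolding filterlim_at
  proof
    show "\<forall>\<^sub>F s in at_right t. ennreal s \<in> {ennreal t<..} \<and> ennreal s \<noteq> ennreal t"
      using assms(2) by (auto simp: eventually_at_filter ennreal_less_iff)
    show "(ennreal \<longlongrightarrow> ennreal t) (at_right t)"
      by (intro tendsto_ennrealI tendsto_ident_at)
  qed
qed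

section \<open>Paths of a conservative process with an additive functional\<close>

locale additive_process = standard_process X
  for X :: "('w, 's::heine_borel) process" +
  fixes A :: "ennreal \<Rightarrow> 'w \<Rightarrow> ennreal" and \<Lambda> :: "'w set"
  assumes conservative_X: "conservative X"
    and A_adapted: "t < \<top> \<Longrightarrow> A t \<in> borel_measurable (augmented_filtration X t)"
    and \<Lambda>_sets: "\<Lambda> \<in> sets (augmented_filtration X \<top>)"
    and \<Lambda>_full: "emeasure (prob_from X (Some x)) \<Lambda> = 1"
    and \<Lambda>_shift: "t < \<top> \<Longrightarrow> \<omega> \<in> \<Lambda> \<Longrightarrow> time_shift X t \<omega> \<in> \<Lambda>"
    and A_zero: "\<omega> \<in> \<Lambda> \<Longrightarrow> A 0 \<omega> = 0"
    and A_continuous: "\<omega> \<in> \<Lambda> \<Longrightarrow> continuous_on {..<\<top>} (\<lambda>t. A t \<omega>)"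
    and A_finite: "\<omega> \<in> \<Lambda> \<Longrightarrow> t < lifetime X \<omega> \<Longrightarrow> A t \<omega> < \<top>"
    and A_additive: "\<omega> \<in> \<Lambda> \<Longrightarrow> s < \<top> \<Longrightarrow> t < \<top> \<Longrightarrow> A (t + s) \<omega> = A t \<omega> + A s (time_shift X t \<omega>)"
begin

abbreviation pos :: "'w \<Rightarrow> real \<Rightarrow> 's" where
  "pos \<equiv> state_at X"

abbreviation shifted :: "real \<Rightarrow> 'w \<Rightarrow> 'w" where
  "shifted s \<equiv> time_shift X (ennreal s)"

abbreviation EP :: "'s \<Rightarrow> ('w \<Rightarrow> ennreal) \<Rightarrow> ennreal" where
  "EP x \<equiv> nn_integral (prob_from X (Some x))"

definition good :: "'w \<Rightarrow> bool" where
  "good \<omega> \<longleftrightarrow> \<omega> \<in> \<Lambda> \<and> lifetime X \<omega> = \<top> \<and>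
    (\<forall>t<\<top>. limitin cemetery_topology (\<lambda>s. state X s \<omega>) (state X t \<omega>) (at_right t))"

lemma good_space: "good \<omega> \<Longrightarrow> \<omega> \<in> sample_space X"
  using sets.sets_into_space[OF \<Lambda>_sets] by (auto simp: good_def)

lemma AE_of_emeasure_1:
  assumes "emeasure (prob_from X y) S = 1"
  shows "AE \<omega> in prob_from X y. \<omega> \<in> S"
proof -
  interpret prob_space "prob_from X y" by (rule prob_space_from)
  have "S \<in> events" using assms by (metis emeasure_notin_sets zero_neq_one)
  moreover have "prob S = 1" unfolding measure_def assms by simp
  ultimately show ?thesis by (rule AE_in_set_eq_1[THEN iffD2])
qed

lemma AE_good: "AE \<omega> in prob_from X (Some x). good \<omega>"
proof -
  obtain \<Lambda>' where \<Lambda>': "\<And>x. emeasure (prob_from X x) \<Lambda>' = 1"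
      "\<And>\<omega>. \<omega> \<in> \<Lambda>' \<Longrightarrow> (\<forall>t<\<top>. limitin cemetery_topology (\<lambda>s. state X s \<omega>) (state X t \<omega>) (at_right t))"
    using cadlag_paths by blast
  have "emeasure (prob_from X (Some x)) {\<omega> \<in> sample_space X. lifetime X \<omega> = \<top>} = 1"
    using conservative_X by (simp add: conservative_def)
  from AE_of_emeasure_1[OF this] AE_of_emeasure_1[OF \<Lambda>_full] AE_of_emeasure_1[OF \<Lambda>'(1)]
  show ?thesis by eventually_elim (use \<Lambda>'(2) in \<open>auto simp: good_def\<close>)
qed

lemma good_state:
  assumes "good \<omega>" "t < \<top>" shows "state X t \<omega> \<noteq> None"
proof
  assume "state X t \<omega> = None"
  then have "lifetime X \<omega> \<le> t" unfolding lifetime_def by (intro Inf_lower) simp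
  then show False using assms by (auto simp: good_def top_unique)
qed

lemma good_state_at: "good \<omega> \<Longrightarrow> state X (ennreal t) \<omega> = Some (pos \<omega> t)"
  using good_state[of \<omega> "ennreal t"] by (auto simp: state_at_def)

lemma limitin_at_right_shift:
  assumes "s < \<top>" "limitin T f l (at_right (t + s))" "t < \<top>"
  shows "limitin T (\<lambda>u. f (u + s)) l (at_right (t::ennreal))"
  unfolding limitin_def
proof (intro conjI allI impI)
  show "l \<in> topspace T" using assms(2) by (simp add: limitin_def)
  fix U assume "openin T U \<and> l \<in> U"
  then have "eventually (\<lambda>u. f u \<in> U) (at_right (t + s))" using assms(2) by (simp add: limitin_def)
  moreover have "t + s < \<top>" using assms by (simp add: less_top)
  ultimately have "\<exists>b>t + s. \<forall>y>t + s. y < b \<longrightarrow> f y \<in> U"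
    by (simp add: eventually_at_right[of "t + s" \<top>])
  then obtain b where b: "b > t + s" "\<And>y. t + s < y \<Longrightarrow> y < b \<Longrightarrow> f y \<in> U"
    by blast
  have "f (y + s) \<in> U" if "t < y" "y < b - s" for y
  proof (rule b(2))
    show "t + s < y + s" using that(1) assms(1) by (simp add: add.commute[of _ s] ennreal_add_left_cancel_less)
    show "y + s < b" using that(2) by (simp add: less_diff_eq_ennreal assms(1) less_top)
  qed
  moreover have "t < b - s" using b(1) assms(1) by (simp add: less_diff_eq_ennreal less_top)
  ultimately show "eventually (\<lambda>u. f (u + s) \<in> U) (at_right t)"
    unfolding eventually_at_right[OF assms(3)] by blast
qed

text \<open>Stability under shifts is what allows facts about good paths to be applied to the
  shifted path inside the Markov property.\<close>

lemma good_shift: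
  assumes "good \<omega>" "s < \<top>" shows "good (time_shift X s \<omega>)"
proof -
  have \<omega>: "\<omega> \<in> sample_space X" by (rule good_space[OF assms(1)])
  have st: "state X r (time_shift X s \<omega>) = state X (r + s) \<omega>" for r by (rule state_shift[OF assms(2) \<omega>])
  have "t = \<top>" if "state X t (time_shift X s \<omega>) = None" for t
  proof -
    have "\<not> t + s < \<top>" using that good_state[OF assms(1), of "t + s"] unfolding st by blast
    then show ?thesis using assms(2) by (simp add: less_top[symmetric])
  qed
  then have "lifetime X (time_shift X s \<omega>) = \<top>"
    unfolding lifetime_def top_unique[symmetric] by (intro Inf_greatest) simp
  moreover have "limitin cemetery_topology (\<lambda>r. state X r (time_shift X s \<omega>)) (state X t (time_shift X s \<omega>)) (at_right t)"
    if "t < \<top>" for t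
    unfolding st using assms that by (intro limitin_at_right_shift) (auto simp: good_def less_top)
  ultimately show ?thesis using assms \<Lambda>_shift by (auto simp: good_def)
qed

lemma state_at_shift:
  assumes "good \<omega>" "0 \<le> s" "0 \<le> r"
  shows "pos (shifted s \<omega>) r = pos \<omega> (r + s)"
  using assms good_space[OF assms(1)] by (simp add: state_at_def state_shift ennreal_plus)

lemma good_right_continuous:
  assumes "good \<omega>" "0 \<le> t"
  shows "(pos \<omega> \<longlongrightarrow> pos \<omega> t) (at_right t)"
  unfolding tendsto_def
proof (intro allI impI)
  fix U assume U: "open U" "pos \<omega> t \<in> U"
  have "limitin cemetery_topology (\<lambda>s. state X s \<omega>) (state X (ennreal t) \<omega>) (at_right (ennreal t))"
    using assms(1) by (simp add: good_def)
  moreover have "openin cemetery_topology (Some ` U)" using U by (auto simp: openin_cemetery)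
  ultimately have ev: "eventually (\<lambda>s. state X s \<omega> \<in> Some ` U) (at_right (ennreal t))"
    using U good_state_at[OF assms(1), of t] by (auto simp: limitin_def)
  have "filterlim ennreal (at_right (ennreal t)) (at_right t)"
    using tendsto_at_right_ennreal[of "\<lambda>x. x"] assms(2)
    by (auto simp: filterlim_at eventually_at_filter ennreal_less_iff intro!: tendsto_ennrealI tendsto_ident_at)
  from eventually_compose_filterlim[OF ev this] show "eventually (\<lambda>s. pos \<omega> s \<in> U) (at_right t)"
    by eventually_elim (auto simp: good_state_at[OF assms(1)])
qed

lemma good_state_measurable:
  assumes "good \<omega>" shows "pos \<omega> \<in> borel_measurable borel"
proof -
  \<comment> \<open>Joint measurability over a one-point sample space. \<open>ennreal\<close> sends
    negative times to 0, so \<open>pos\<close> is constant there and \<open>max 0\<close> changes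
    nothing.\<close>
  have "(\<lambda>(t, _). pos \<omega> (max 0 t)) \<in> borel_measurable (borel \<Otimes>\<^sub>M count_space (UNIV::unit set))"
    by (rule right_continuous_borel_measurable[of "\<lambda>t _. pos \<omega> t"])
       (use good_right_continuous[OF assms] in auto)
  then have "(\<lambda>p. case p of (t, _) \<Rightarrow> pos \<omega> (max 0 t)) \<circ> (\<lambda>t. (t, ())) \<in> borel_measurable borel"
    by (intro measurable_comp[of "\<lambda>t. (t, ())"]) auto
  moreover have "(\<lambda>p. case p of (t, _) \<Rightarrow> pos \<omega> (max 0 t)) \<circ> (\<lambda>t. (t, ())) = pos \<omega>"
    by (auto simp: fun_eq_iff state_at_def max_def ennreal_neg)
  ultimately show ?thesis by simp
qed

section \<open>The additive functional as a random measure of time\<close>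

definition clock_value :: "'w \<Rightarrow> real \<Rightarrow> real" where
  "clock_value \<omega> s = enn2real (A (ennreal s) \<omega>)"

lemma good_A:
  assumes "good \<omega>"
  shows "t < \<top> \<Longrightarrow> A t \<omega> < \<top>" "s \<le> t \<Longrightarrow> t < \<top> \<Longrightarrow> A s \<omega> \<le> A t \<omega>"
    "A (ennreal r) \<omega> = ennreal (clock_value \<omega> r)" "clock_value \<omega> 0 = 0"
    "0 \<le> s' \<Longrightarrow> 0 \<le> r' \<Longrightarrow> clock_value \<omega> (s' + r') = clock_value \<omega> s' + clock_value (shifted s' \<omega>) r'"
proof -
  have \<omega>: "\<omega> \<in> \<Lambda>" "lifetime X \<omega> = \<top>" using assms by (auto simp: good_def)
  show fin: "A t \<omega> < \<top>" if "t < \<top>" for t using A_finite[OF \<omega>(1)] \<omega>(2) that by simp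
  show "A s \<omega> \<le> A t \<omega>" if "s \<le> t" "t < \<top>" for s t
    using A_additive[OF \<omega>(1), of "t - s" s] that
    by (simp add: add_diff_inverse_ennreal ennreal_diff_less_top le_less_trans[OF that])
  show "A (ennreal r) \<omega> = ennreal (clock_value \<omega> r)" for r
    using fin[of "ennreal r"] by (simp add: clock_value_def)
  show "clock_value \<omega> 0 = 0" using A_zero[OF \<omega>(1)] by (simp add: clock_value_def)
  assume "0 \<le> s'" "0 \<le> r'"
  then show "clock_value \<omega> (s' + r') = clock_value \<omega> s' + clock_value (shifted s' \<omega>) r'"
    using A_additive[OF \<omega>(1), of "ennreal r'" "ennreal s'"] fin[of "ennreal s' + ennreal r'"]
    by (simp add: clock_value_def ennreal_plus enn2real_plus less_top add.commute)
qed

definition dA :: "'w \<Rightarrow> real measure" where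
  "dA \<omega> = stieltjes_measure (\<lambda>t. A t \<omega>)"

lemma dA:
  assumes "good \<omega>"
  shows "dA \<omega> = interval_measure (clock_value \<omega>)"
    "continuous_on UNIV (clock_value \<omega>)" "mono (clock_value \<omega>)"
    "u \<le> v \<Longrightarrow> emeasure (dA \<omega>) {u<..v} = ennreal (clock_value \<omega> v - clock_value \<omega> u)"
proof -
  have cv: "clock_value \<omega> = (\<lambda>s. enn2real (A (ennreal s) \<omega>))" by (simp add: clock_value_def fun_eq_iff)
  have *: "continuous_on {..<\<top>} (\<lambda>t. A t \<omega>)" using assms A_continuous by (simp add: good_def)
  note s = stieltjes_measure_eq_interval_measure[OF good_A(1)[OF assms] good_A(2)[OF assms] *]
  show 1: "dA \<omega> = interval_measure (clock_value \<omega>)" "continuous_on UNIV (clock_value \<omega>)" "mono (clock_value \<omega>)"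
    unfolding cv dA_def using s by auto
  assume "u \<le> v"
  moreover have "continuous (at_right a) (clock_value \<omega>)" for a
    using 1(2) by (simp add: continuous_on_eq_continuous_at continuous_at_imp_continuous_within)
  ultimately show "emeasure (dA \<omega>) {u<..v} = ennreal (clock_value \<omega> v - clock_value \<omega> u)"
    unfolding 1(1) using 1(3) by (intro emeasure_interval_measure_Ioc) (auto simp: mono_def)
qed

lemma clock_value_neg: "s \<le> 0 \<Longrightarrow> clock_value \<omega> s = clock_value \<omega> 0"
  by (simp add: clock_value_def ennreal_neg)

text \<open>Adaptedness up to bad paths. Integrals against dA have no meaning on bad paths, and
  whether a path is good involves all times, so agreement with an adapted variable is asked on good
  paths only.\<close>

definition adapted_at :: "ennreal \<Rightarrow> ('w \<Rightarrow> ennreal) \<Rightarrow> bool" where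
  "adapted_at t W \<longleftrightarrow> (\<exists>V\<in>borel_measurable (augmented_filtration X t). \<forall>\<omega>. good \<omega> \<longrightarrow> W \<omega> = V \<omega>)"

text \<open>
  The random measures of time which are treated in parallel: the measure \<open>dA\<close> of the additive
  functional and Lebesgue measure.
\<close>

definition clock :: "('w \<Rightarrow> real measure) \<Rightarrow> bool" where
  "clock N \<longleftrightarrow>
    (\<forall>\<omega>. good \<omega> \<longrightarrow> sets (N \<omega>) = sets borel) \<and>
    (\<forall>\<omega>. good \<omega> \<longrightarrow> (\<exists>a. continuous_on {0..} a \<and> (\<forall>u\<ge>0. \<forall>v\<ge>u. emeasure (N \<omega>) {u<..v} = ennreal (a v - a u)))) \<and>
    (\<forall>\<omega> s. good \<omega> \<longrightarrow> 0 \<le> s \<longrightarrow> (\<forall>f\<in>borel_measurable borel.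
      (\<integral>\<^sup>+w. f w * indicator {0<..} w \<partial>N (shifted s \<omega>)) =
      (\<integral>\<^sup>+w. f (w - s) * indicator {s<..} w \<partial>N \<omega>))) \<and>
    (\<forall>u\<ge>0. \<forall>v\<ge>u. adapted_at (ennreal v) (\<lambda>\<omega>. emeasure (N \<omega>) {u<..v}))"

lemma clockD:
  assumes "clock N" "good \<omega>"
  shows clock_sets: "sets (N \<omega>) = sets borel"
    and clock_continuous: "\<exists>a. continuous_on {0..} a \<and> (\<forall>u\<ge>0. \<forall>v\<ge>u. emeasure (N \<omega>) {u<..v} = ennreal (a v - a u))"
    and clock_shift: "0 \<le> s \<Longrightarrow> f \<in> borel_measurable borel \<Longrightarrow>
      (\<integral>\<^sup>+w. f w * indicator {0<..} w \<partial>N (shifted s \<omega>)) =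
      (\<integral>\<^sup>+w. f (w - s) * indicator {s<..} w \<partial>N \<omega>)"
  using assms by (auto simp: clock_def)

lemma clock_finite:
  assumes "clock N" "good \<omega>" "0 \<le> t" shows "emeasure (N \<omega>) {0<..t} < \<top>"
  using clock_continuous[OF assms(1,2)] assms(3) by auto

lemma clock_adapted:
  assumes "clock N" "0 \<le> u" "u \<le> v"
  shows "adapted_at (ennreal v) (\<lambda>\<omega>. emeasure (N \<omega>) {u<..v})"
  using assms by (simp add: clock_def)

lemma clock_dA: "clock dA"
  unfolding clock_def
proof (intro conjI allI impI ballI)
  fix \<omega> assume g: "good \<omega>"
  show "sets (dA \<omega>) = sets borel" using dA(1)[OF g] by simp
  show "\<exists>a. continuous_on {0..} a \<and> (\<forall>u\<ge>0. \<forall>v\<ge>u. emeasure (dA \<omega>) {u<..v} = ennreal (a v - a u))"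
    using dA(4)[OF g] continuous_on_subset[OF dA(2)[OF g]]
    by (intro exI[of _ "clock_value \<omega>"]) auto
  fix s :: real assume s: "0 \<le> s"
  have g': "good (shifted s \<omega>)" by (rule good_shift[OF g]) simp
  have c: "clock_value (shifted s \<omega>) u = clock_value \<omega> (s + max 0 u) - clock_value \<omega> s" for u
    using good_A(5)[OF g s, of "max 0 u"] clock_value_neg[of u "shifted s \<omega>"] by (cases "0 \<le> u") auto
  \<comment> \<open>Additivity of the functional in terms of measures: \<open>dA\<close> of the
    shifted path is the part of \<open>dA\<close> after \<open>s\<close>, translated to start at 0.
    \<open>clock_value\<close> is constant on negative times, which is the origin of
    \<open>max 0 u\<close> in \<open>c\<close>.\<close>
  have eq: "dA (shifted s \<omega>)
      = distr (density (dA \<omega>) (indicator {s<..})) borel (\<lambda>w. w - s)"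
  proof (rule measure_eqI_Ioc)
    show "sets (dA (shifted s \<omega>)) = sets borel" using dA(1)[OF g'] by simp
    have sN: "sets (dA \<omega>) = sets borel" using dA(1)[OF g] by simp
    fix u v :: real assume uv: "u \<le> v"
    show "emeasure (dA (shifted s \<omega>)) {u<..v} < \<top>"
      using dA(4)[OF g' uv] by simp
    have m: "(\<lambda>w. w - s) \<in> measurable (density (dA \<omega>) (indicator {s<..})) borel"
      using sN by (simp cong: measurable_cong_sets)
    have sp: "space (dA \<omega>) = UNIV" using sets_eq_imp_space_eq[OF sN] by simp
    have "emeasure (distr (density (dA \<omega>) (indicator {s<..})) borel (\<lambda>w. w - s)) {u<..v}
        = emeasure (density (dA \<omega>) (indicator {s<..})) {u + s<..v + s}"
      by (subst emeasure_distr[OF m]) (auto intro!: arg_cong[where f="emeasure _"] simp: sp)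
    also have "\<dots> = emeasure (dA \<omega>) ({s<..} \<inter> {u + s<..v + s})"
      using sN by (subst emeasure_density) (auto simp: indicator_inter_arith[symmetric])
    also have "{s<..} \<inter> {u + s<..v + s} = {s + max 0 u<..s + max 0 v}" by auto
    also have "emeasure (dA \<omega>) \<dots> = ennreal (clock_value \<omega> (s + max 0 v) - clock_value \<omega> (s + max 0 u))"
      using uv by (intro dA(4)[OF g]) auto
    also have "\<dots> = emeasure (dA (shifted s \<omega>)) {u<..v}"
      using dA(4)[OF g' uv] by (simp add: c)
    finally show "emeasure (dA (shifted s \<omega>)) {u<..v}
        = emeasure (distr (density (dA \<omega>) (indicator {s<..})) borel (\<lambda>w. w - s)) {u<..v}" ..
  qed simp
  fix f :: "real \<Rightarrow> ennreal" assume [measurable]: "f \<in> borel_measurable borel"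
  have [measurable_cong]: "sets (dA \<omega>) = sets borel" using dA(1)[OF g] by simp
  have "(\<integral>\<^sup>+w. f w * indicator {0<..} w \<partial>dA (shifted s \<omega>)) =
      (\<integral>\<^sup>+w. indicator {s<..} w * (f (w - s) * indicator {0<..} (w - s)) \<partial>dA \<omega>)"
    unfolding eq by (subst nn_integral_distr) (auto simp: nn_integral_density)
  also have "\<dots> = (\<integral>\<^sup>+w. f (w - s) * indicator {s<..} w \<partial>dA \<omega>)"
    by (intro nn_integral_cong) (auto simp: indicator_def)
  finally show "(\<integral>\<^sup>+w. f w * indicator {0<..} w \<partial>dA (shifted s \<omega>)) =
      (\<integral>\<^sup>+w. f (w - s) * indicator {s<..} w \<partial>dA \<omega>)" .
next
  fix u v :: real assume uv: "0 \<le> u" "u \<le> v"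
  have "(\<lambda>\<omega>. A (ennreal v) \<omega> - A (ennreal u) \<omega>) \<in> borel_measurable (augmented_filtration X (ennreal v))"
    using A_adapted[of "ennreal v"] augmented_imp_later[OF A_adapted[of "ennreal u"], of "ennreal v"] uv
    by (intro borel_measurable_minus_ennreal) (auto intro: ennreal_leI)
  moreover have "emeasure (dA \<omega>) {u<..v} = A (ennreal v) \<omega> - A (ennreal u) \<omega>" if "good \<omega>" for \<omega>
    unfolding dA(4)[OF that uv(2)] good_A(3)[OF that] by (rule ennreal_minus[symmetric]) (simp add: clock_value_def)
  ultimately show "adapted_at (ennreal v) (\<lambda>\<omega>. emeasure (dA \<omega>) {u<..v})"
    unfolding adapted_at_def
    by (intro bexI[of _ "\<lambda>\<omega>. A (ennreal v) \<omega> - A (ennreal u) \<omega>"] allI impI)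
qed

lemma clock_lborel: "clock (\<lambda>_. lborel)"
  unfolding clock_def
proof (intro conjI allI impI ballI)
  show "\<exists>a. continuous_on {0..} a \<and> (\<forall>u\<ge>0. \<forall>v\<ge>u. emeasure lborel {u<..v::real} = ennreal (a v - a u))"
    by (intro exI[of _ "\<lambda>x::real. x"]) (auto intro: continuous_on_id)
  fix s :: real and f :: "real \<Rightarrow> ennreal" assume [measurable]: "f \<in> borel_measurable borel"
  have "(\<integral>\<^sup>+w. f (w - s) * indicator {s<..} w \<partial>lborel) = (\<integral>\<^sup>+w. f (s + 1 * w - s) * indicator {s<..} (s + 1 * w) \<partial>lborel)"
    by (subst nn_integral_real_affine[of _ 1 s]) auto
  then show "(\<integral>\<^sup>+w. f w * indicator {0<..} w \<partial>lborel) = (\<integral>\<^sup>+w. f (w - s) * indicator {s<..} w \<partial>lborel)"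
    by (simp add: indicator_def)
next
  fix u v :: real
  show "adapted_at (ennreal v) (\<lambda>\<omega>. emeasure lborel {u<..v})"
    unfolding adapted_at_def by (intro bexI[of _ "\<lambda>_. emeasure lborel {u<..v}"]) auto
qed simp

text \<open>The density may depend on time so that the discount factor can be included.\<close>

definition functional :: "('w \<Rightarrow> real measure) \<Rightarrow> (real \<Rightarrow> 's \<Rightarrow> real) \<Rightarrow> real \<Rightarrow> 'w \<Rightarrow> ennreal" where
  "functional N h t \<omega> = (\<integral>\<^sup>+w. ennreal (h w (pos \<omega> w)) * indicator {0<..t} w \<partial>N \<omega>)"

lemma adapted_state:
  assumes "h \<in> borel_measurable (borel :: 's measure)" "0 \<le> w" "ennreal w \<le> t"
  shows "adapted_at t (\<lambda>\<omega>. ennreal (h (pos \<omega> w)))"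
proof -
  have "(\<lambda>y. ennreal (h (the y))) \<in> borel_measurable cem"
    by (rule measurable_cemI) (use assms(1) in auto)
  then have "(\<lambda>\<omega>. ennreal (h (the (state X (ennreal w) \<omega>)))) \<in> borel_measurable (augmented_filtration X t)"
    by (rule measurable_compose[OF state_augmented[OF assms(3)]])
  then show ?thesis unfolding adapted_at_def by (intro bexI) (auto simp: state_at_def)
qed

text \<open>Every term of the Riemann sum reads the path and the clock no later than
  \<open>t\<close>. Each is replaced by an augmented-measurable version, and on good paths the sums
  converge to the functional.\<close>

lemma functional_adapted:
  assumes N: "clock N" and h: "continuous_on UNIV (\<lambda>(w, x). h w x)" "\<And>w x. 0 \<le> h w x" "\<And>w x. h w x \<le> c" and t: "0 \<le> t"
  shows "adapted_at (ennreal t) (functional N h t)"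
proof -
  define u where "u n k = real k * t / 2^n" for n k :: nat
  have u_le: "u n (k + 1) \<le> t" if "k < 2^n" for n k
  proof -
    have "real (k + 1) \<le> 2^n" using that by (metis Suc_eq_plus1 Suc_leI of_nat_le_iff of_nat_numeral of_nat_power)
    then show ?thesis using mult_right_mono[OF _ t, of "real (k + 1)" "2^n"] by (simp add: u_def field_simps)
  qed
  have u_mono: "0 \<le> u n k" "u n k \<le> u n (k + 1)" for n k
    using t by (auto simp: u_def intro!: divide_right_mono mult_right_mono)
  have meas: "h w \<in> borel_measurable borel" for w
  proof -
    have "continuous_on UNIV (\<lambda>x::'s. (w, x))"
      by (intro continuous_on_Pair continuous_on_const continuous_on_id)
    from continuous_on_compose2[OF h(1) this] have "continuous_on UNIV (\<lambda>x. h w x)" by simp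
    then show ?thesis by (rule borel_measurable_continuous_onI)
  qed
  have "\<exists>V\<in>borel_measurable (augmented_filtration X (ennreal t)). \<forall>\<omega>. good \<omega> \<longrightarrow>
      ennreal (h (u n (k + 1)) (pos \<omega> (u n (k + 1)))) * emeasure (N \<omega>) {u n k<..u n (k + 1)} = V \<omega>"
    if k: "k < 2^n" for n k
  proof -
    obtain V1 where V1: "V1 \<in> borel_measurable (augmented_filtration X (ennreal t))"
        "\<And>\<omega>. good \<omega> \<Longrightarrow> ennreal (h (u n (k + 1)) (pos \<omega> (u n (k + 1)))) = V1 \<omega>"
      using adapted_state[OF meas u_mono(1) ennreal_leI[OF u_le[OF k]], of "u n (k+1)"] by (auto simp: adapted_at_def)
    obtain V2 where V2: "V2 \<in> borel_measurable (augmented_filtration X (ennreal (u n (k + 1))))"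
        "\<And>\<omega>. good \<omega> \<Longrightarrow> emeasure (N \<omega>) {u n k<..u n (k + 1)} = V2 \<omega>"
      using clock_adapted[OF N u_mono[of n k]] unfolding adapted_at_def by blast
    have "V2 \<in> borel_measurable (augmented_filtration X (ennreal t))"
      by (rule augmented_imp_later[OF V2(1)]) (intro ennreal_leI u_le[OF k])
    then show ?thesis using V1 V2 by (intro bexI[of _ "\<lambda>\<omega>. V1 \<omega> * V2 \<omega>"]) auto
  qed
  note ex = this
  define V where "V n k = (SOME V. V \<in> borel_measurable (augmented_filtration X (ennreal t)) \<and> (\<forall>\<omega>. good \<omega> \<longrightarrow>
      ennreal (h (u n (k + 1)) (pos \<omega> (u n (k + 1)))) * emeasure (N \<omega>) {u n k<..u n (k + 1)} = V \<omega>))" for n k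
  have V: "V n k \<in> borel_measurable (augmented_filtration X (ennreal t))"
    "\<And>\<omega>. good \<omega> \<Longrightarrow>
      ennreal (h (u n (k + 1)) (pos \<omega> (u n (k + 1)))) * emeasure (N \<omega>) {u n k<..u n (k + 1)} = V n k \<omega>"
    if "k < 2^n" for n k
    using someI_ex[OF ex[OF that, unfolded Bex_def]] unfolding V_def by blast+
  show ?thesis
    unfolding adapted_at_def
  proof (intro bexI allI impI)
    \<comment> \<open>The upper limit is measurable whether or not the sums converge, and on good
      paths it is the limit.\<close>
    show "(\<lambda>\<omega>. limsup (\<lambda>n. \<Sum>k<2^n. V n k \<omega>)) \<in> borel_measurable (augmented_filtration X (ennreal t))"
      using V(1) by (intro borel_measurable_limsup borel_measurable_sum) auto
    fix \<omega> assume g: "good \<omega>"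
    have fin: "emeasure (N \<omega>) {0<..t} < \<top>" by (rule clock_finite[OF N g t])
    have "(\<lambda>n. \<Sum>k<2^n. ennreal (h (real (k + 1) * t / 2^n) (pos \<omega> (real (k + 1) * t / 2^n))) *
        emeasure (N \<omega>) {real k * t / 2^n <.. real (k + 1) * t / 2^n}) \<longlonglongrightarrow> functional N h t \<omega>"
      unfolding functional_def
    proof (rule riemann_sum_tendsto[where q="\<lambda>w. h w (pos \<omega> w)" and c=c])
      show "sets (N \<omega>) = sets borel" by (rule clock_sets[OF N g])
      fix w :: real assume w: "0 \<le> w"
      have "((\<lambda>v. (v, pos \<omega> v)) \<longlongrightarrow> (w, pos \<omega> w)) (at_right w)"
        by (intro tendsto_Pair tendsto_ident_at good_right_continuous[OF g w])
      from continuous_on_tendsto_compose[OF h(1) this]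
      show "((\<lambda>w. h w (pos \<omega> w)) \<longlongrightarrow> h w (pos \<omega> w)) (at_right w)" by simp
    qed (use fin t h in auto)
    moreover have "(\<Sum>k<2^n. ennreal (h (real (k + 1) * t / 2^n) (pos \<omega> (real (k + 1) * t / 2^n))) *
        emeasure (N \<omega>) {real k * t / 2^n <.. real (k + 1) * t / 2^n}) = (\<Sum>k<2^n. V n k \<omega>)" for n
      using V(2)[OF _ g] by (intro sum.cong) (auto simp: u_def)
    ultimately have "(\<lambda>n. \<Sum>k<2^n. V n k \<omega>) \<longlonglongrightarrow> functional N h t \<omega>" by simp
    then show "functional N h t \<omega> = limsup (\<lambda>n. \<Sum>k<2^n. V n k \<omega>)"
      by (intro lim_imp_Limsup[symmetric]) auto
  qed
qed

lemma functional_le: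
  assumes "clock N" "good \<omega>" "\<And>w x. h w x \<le> c"
  shows "functional N h t \<omega> \<le> ennreal c * emeasure (N \<omega>) {0<..t}"
proof -
  have "functional N h t \<omega> \<le> (\<integral>\<^sup>+w. ennreal c * indicator {0<..t} w \<partial>N \<omega>)"
    unfolding functional_def using assms(3) by (intro nn_integral_mono mult_right_mono ennreal_leI) auto
  then show ?thesis using clock_sets[OF assms(1,2)] by (simp add: nn_integral_cmult_indicator)
qed

lemma functional_finite:
  assumes "clock N" "good \<omega>" "\<And>w x. h w x \<le> c" "0 \<le> t"
  shows "functional N h t \<omega> < \<top>"
proof -
  have "ennreal c * emeasure (N \<omega>) {0<..t} < \<top>"
    using clock_finite[OF assms(1,2,4)] by (simp add: ennreal_mult_less_top)
  then show ?thesis using functional_le[OF assms(1-3)] by (rule le_less_trans[rotated])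
qed

lemma functional_measurable:
  assumes "good \<omega>" "continuous_on UNIV (\<lambda>(w, x). h w x)"
  shows "(\<lambda>w. ennreal (h w (pos \<omega> w))) \<in> borel_measurable borel"
proof -
  have 1: "(\<lambda>w. (w, pos \<omega> w)) \<in> borel_measurable borel"
    using good_state_measurable[OF assms(1)] by (intro borel_measurable_Pair) auto
  have "(\<lambda>p. ennreal (case p of (w, x) \<Rightarrow> h w x)) \<in> borel_measurable borel"
    using borel_measurable_continuous_onI[OF assms(2)] by measurable
  from measurable_compose[OF 1 this] show ?thesis by simp
qed

lemma functional_add:
  assumes N: "clock N" and g: "good \<omega>" and h: "continuous_on UNIV (\<lambda>x. h x)" and t: "0 \<le> s" "0 \<le> r"
  shows "functional N (\<lambda>_. h) (s + r) \<omega> = functional N (\<lambda>_. h) s \<omega> + functional N (\<lambda>_. h) r (shifted s \<omega>)"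
proof -
  have [measurable_cong]: "sets (N \<omega>) = sets borel" by (rule clock_sets[OF N g])
  have g': "good (shifted s \<omega>)" by (rule good_shift[OF g]) simp
  have hc: "continuous_on UNIV (\<lambda>(w::real, x). h x)"
    using continuous_on_compose2[OF h continuous_on_snd[OF continuous_on_id]] by (simp add: case_prod_beta)
  have [measurable]: "(\<lambda>w. ennreal (h (pos \<omega> w))) \<in> borel_measurable borel"
    "(\<lambda>w. ennreal (h (pos (shifted s \<omega>) w))) \<in> borel_measurable borel"
    using functional_measurable[OF g hc] functional_measurable[OF g' hc] by simp_all
  have "functional N (\<lambda>_. h) r (shifted s \<omega>) =
    (\<integral>\<^sup>+w. (ennreal (h (pos (shifted s \<omega>) w)) * indicator {..r} w) * indicator {0<..} w \<partial>N (shifted s \<omega>))"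
    unfolding functional_def by (intro nn_integral_cong) (auto simp: indicator_def)
  also have "\<dots> = (\<integral>\<^sup>+w. (ennreal (h (pos (shifted s \<omega>) (w - s))) * indicator {..r} (w - s)) * indicator {s<..} w \<partial>N \<omega>)"
  proof -
    have "(\<lambda>w. ennreal (h (pos (shifted s \<omega>) w)) * indicator {..r} w) \<in> borel_measurable borel"
      by measurable
    then show ?thesis by (rule clock_shift[OF N g t(1)])
  qed
  also have "\<dots> = (\<integral>\<^sup>+w. ennreal (h (pos \<omega> w)) * indicator {s<..s + r} w \<partial>N \<omega>)"
    using t by (intro nn_integral_cong) (auto simp: indicator_def state_at_shift[OF g])
  finally have "functional N (\<lambda>_. h) s \<omega> + functional N (\<lambda>_. h) r (shifted s \<omega>) =
    (\<integral>\<^sup>+w. ennreal (h (pos \<omega> w)) * indicator {0<..s} w + ennreal (h (pos \<omega> w)) * indicator {s<..s + r} w \<partial>N \<omega>)"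
    unfolding functional_def by (subst nn_integral_add) auto
  also have "\<dots> = functional N (\<lambda>_. h) (s + r) \<omega>"
    unfolding functional_def using t by (intro nn_integral_cong) (auto simp: indicator_def)
  finally show ?thesis ..
qed

text \<open>\<open>markov_compare\<close> for variables that are measurable only up to bad paths:
  versions may be substituted before and after the shift because shifts preserve good paths, and
  good paths never reach the cemetery at a finite time.\<close>

lemma adapted_markov_compare:
  assumes s: "0 \<le> s" and W: "adapted_at \<top> W1" "adapted_at \<top> W2"
    and Z: "adapted_at (ennreal s) Z" and fin: "EP x Z < \<top>"
    and le: "\<And>y. EP y W1 \<le> EP y W2 + \<kappa>"
  shows "EP x (\<lambda>\<omega>. Z \<omega> * W1 (shifted s \<omega>)) \<le>
    EP x (\<lambda>\<omega>. Z \<omega> * W2 (shifted s \<omega>)) + \<kappa> * EP x Z"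
proof -
  obtain V1 V2 Z' where V: "V1 \<in> borel_measurable (augmented_filtration X \<top>)" "\<And>\<omega>. good \<omega> \<Longrightarrow> W1 \<omega> = V1 \<omega>"
    "V2 \<in> borel_measurable (augmented_filtration X \<top>)" "\<And>\<omega>. good \<omega> \<Longrightarrow> W2 \<omega> = V2 \<omega>"
    and Z': "Z' \<in> borel_measurable (augmented_filtration X (ennreal s))" "\<And>\<omega>. good \<omega> \<Longrightarrow> Z \<omega> = Z' \<omega>"
    using W Z unfolding adapted_at_def by blast
  have 1: "EP y W1 = EP y V1"
    "EP y W2 = EP y V2"
    "EP y Z = EP y Z'" for y
    using AE_good[of y] V(2,4) Z'(2) by (auto intro!: nn_integral_cong_AE elim!: AE_mp)
  have 2: "EP x (\<lambda>\<omega>. Z \<omega> * W (shifted s \<omega>)) =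
      EP x (\<lambda>\<omega>. Z' \<omega> * V (shifted s \<omega>))"
    if "\<And>\<omega>. good \<omega> \<Longrightarrow> W \<omega> = V \<omega>" for W V
    using AE_good[of x] by (intro nn_integral_cong_AE) (auto elim!: AE_mp simp: that good_shift Z'(2))
  have e1: "EP x (\<lambda>\<omega>. Z \<omega> * W1 (shifted s \<omega>)) =
      EP x (\<lambda>\<omega>. Z' \<omega> * V1 (shifted s \<omega>))"
    by (rule 2) (rule V(2))
  have e2: "EP x (\<lambda>\<omega>. Z \<omega> * W2 (shifted s \<omega>)) =
      EP x (\<lambda>\<omega>. Z' \<omega> * V2 (shifted s \<omega>))"
    by (rule 2) (rule V(4))
  show ?thesis
    unfolding e1 e2 1(3)
    by (rule markov_compare[OF _ V(1,3) Z'(1)])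
       (use fin le AE_good[of x] good_state in \<open>auto simp: 1 elim!: AE_mp\<close>)
qed

end

section \<open>A second moment estimate for additive functionals\<close>

text \<open>Telescope \<open>(d n - d k)\<^sup>2\<close> in \<open>k\<close>. In each cross term an
  increment meets what remains after it, which is the form to which the Markov property at the right
  end point applies.\<close>

lemma square_sum_increments:
  fixes d :: "nat \<Rightarrow> real"
  assumes "d 0 = 0"
  shows "(d n)\<^sup>2 = (\<Sum>k<n. (d (Suc k) - d k)\<^sup>2) + 2 * (\<Sum>k<n. (d (Suc k) - d k) * (d n - d (Suc k)))"
proof -
  have "(\<Sum>k<n. (d n - d k)\<^sup>2 - (d n - d (Suc k))\<^sup>2) = (d n - d 0)\<^sup>2 - (d n - d n)\<^sup>2"
    using sum_lessThan_telescope'[of "\<lambda>k. (d n - d k)\<^sup>2" n] by simp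
  then have "(d n)\<^sup>2 = (\<Sum>k<n. (d n - d k)\<^sup>2 - (d n - d (Suc k))\<^sup>2)" using assms by simp
  also have "\<dots> = (\<Sum>k<n. (d (Suc k) - d k)\<^sup>2 + 2 * ((d (Suc k) - d k) * (d n - d (Suc k))))"
    by (intro sum.cong refl) (simp add: power2_eq_square algebra_simps)
  finally show ?thesis by (simp add: sum.distrib sum_distrib_left)
qed

lemma grid_facts:
  fixes n k :: nat assumes "0 \<le> (t::real)"
  shows "0 \<le> real k * t / real (Suc n)" "real k * t / real (Suc n) \<le> real (Suc k) * t / real (Suc n)"
    "k \<le> Suc n \<Longrightarrow> real k * t / real (Suc n) \<le> t" "real (Suc n) * t / real (Suc n) = t"
proof -
  show "0 \<le> real k * t / real (Suc n)" using assms by simp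
  show "real k * t / real (Suc n) \<le> real (Suc k) * t / real (Suc n)"
    using assms by (intro divide_right_mono mult_right_mono) auto
  show "real (Suc n) * t / real (Suc n) = t" by simp
  assume "k \<le> Suc n"
  then have "real k * t \<le> real (Suc n) * t" using assms by (intro mult_right_mono) auto
  then show "real k * t / real (Suc n) \<le> t" by (simp only: pos_divide_le_eq of_nat_0_less_iff zero_less_Suc mult.commute)
qed

text \<open>The difference of two continuous monotone functions is uniformly continuous on the
  interval and has total variation at most \<open>V\<close>; the sum of squares is at most the
  largest increment times \<open>V\<close>.\<close>

lemma quadratic_variation_tendsto_0:
  fixes f g :: "real \<Rightarrow> real"
  assumes t: "0 \<le> t" and cf: "continuous_on {0..t} f" and cg: "continuous_on {0..t} g"
    and mf: "\<And>u v. 0 \<le> u \<Longrightarrow> u \<le> v \<Longrightarrow> v \<le> t \<Longrightarrow> f u \<le> f v"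
    and mg: "\<And>u v. 0 \<le> u \<Longrightarrow> u \<le> v \<Longrightarrow> v \<le> t \<Longrightarrow> g u \<le> g v"
  defines "s \<equiv> \<lambda>n k. real k * t / real (Suc n)"
  shows "(\<lambda>n. \<Sum>k<Suc n. ((f (s n (Suc k)) - g (s n (Suc k))) - (f (s n k) - g (s n k)))\<^sup>2) \<longlonglongrightarrow> 0"
proof -
  let ?d = "\<lambda>x. f x - g x"
  define V where "V = (f t - f 0) + (g t - g 0)"
  have V: "0 \<le> V" using mf[of 0 t] mg[of 0 t] t by (simp add: V_def)
  have s_eq: "s n k = real k * t / real (Suc n)" for n k by (simp add: s_def)
  note s = grid_facts(1,2)[OF t, folded s_eq] and s_le = grid_facts(3)[OF t, folded s_eq]
  have s_diff: "s n (Suc k) - s n k = t / real (Suc n)" for n k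
  proof -
    have "real (Suc k) * t - real k * t = t" by (simp add: algebra_simps)
    then show ?thesis by (simp only: s_def diff_divide_distrib[symmetric])
  qed
  have uc: "uniformly_continuous_on {0..t} ?d"
    by (intro compact_uniformly_continuous continuous_on_diff cf cg) auto
  show ?thesis
  proof (rule LIMSEQ_I)
    fix e :: real assume "e > 0"
    define e' where "e' = e / (V + 1)"
    have e': "e' > 0" using \<open>e > 0\<close> V by (simp add: e'_def)
    obtain \<delta> where \<delta>: "\<delta> > 0" "\<And>x y. x \<in> {0..t} \<Longrightarrow> y \<in> {0..t} \<Longrightarrow> dist y x < \<delta> \<Longrightarrow> dist (?d y) (?d x) < e'"
      using uc e' unfolding uniformly_continuous_on_def by blast
    obtain N where N: "t / \<delta> < real N" using reals_Archimedean2 by blast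
    have "norm ((\<Sum>k<Suc n. (?d (s n (Suc k)) - ?d (s n k))\<^sup>2) - 0) < e" if "n \<ge> N" for n
    proof -
      have small: "t / real (Suc n) < \<delta>"
      proof -
        have "t < real N * \<delta>" using N \<delta>(1) by (simp add: pos_divide_less_eq)
        also have "\<dots> \<le> real (Suc n) * \<delta>" using that \<delta>(1) by (intro mult_right_mono) auto
        finally show ?thesis by (simp add: pos_divide_less_eq mult.commute)
      qed
      have "(\<Sum>k<Suc n. (?d (s n (Suc k)) - ?d (s n k))\<^sup>2)
          \<le> (\<Sum>k<Suc n. e' * ((f (s n (Suc k)) - f (s n k)) + (g (s n (Suc k)) - g (s n k))))"
      proof (rule sum_mono)
        fix k assume "k \<in> {..<Suc n}"
        then have "Suc k \<le> Suc n" by simp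
        then have k: "s n (Suc k) \<le> t" by (rule s_le)
        then have "dist (?d (s n (Suc k))) (?d (s n k)) < e'"
          using s(1)[of n k] s(1)[of n "Suc k"] s(2)[of n k] s_diff[of n k] small
          by (intro \<delta>(2)) (auto simp: dist_real_def)
        then have 1: "\<bar>?d (s n (Suc k)) - ?d (s n k)\<bar> \<le> e'" by (simp add: dist_real_def)
        have 2: "\<bar>?d (s n (Suc k)) - ?d (s n k)\<bar> \<le> (f (s n (Suc k)) - f (s n k)) + (g (s n (Suc k)) - g (s n k))"
          using mf[OF s(1,2) k] mg[OF s(1,2) k] by linarith
        have "(?d (s n (Suc k)) - ?d (s n k))\<^sup>2 = \<bar>?d (s n (Suc k)) - ?d (s n k)\<bar> * \<bar>?d (s n (Suc k)) - ?d (s n k)\<bar>"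
          by (simp add: power2_eq_square)
        also have "\<dots> \<le> e' * ((f (s n (Suc k)) - f (s n k)) + (g (s n (Suc k)) - g (s n k)))"
          using 1 2 by (intro mult_mono) auto
        finally show "(?d (s n (Suc k)) - ?d (s n k))\<^sup>2 \<le> e' * ((f (s n (Suc k)) - f (s n k)) + (g (s n (Suc k)) - g (s n k)))" .
      qed
      also have "\<dots> = e' * ((\<Sum>k<Suc n. f (s n (Suc k)) - f (s n k)) + (\<Sum>k<Suc n. g (s n (Suc k)) - g (s n k)))"
        by (simp only: sum_distrib_left[symmetric] sum.distrib)
      also have "\<dots> = e' * V"
      proof -
        have "s n (Suc n) = t" "s n 0 = 0" by (simp_all add: s_def)
        then show ?thesis unfolding V_def by (subst (1 2) sum_lessThan_telescope) simp
      qed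
      also have "\<dots> < e"
        using V \<open>e > 0\<close> by (simp add: e'_def pos_divide_less_eq)
      finally show ?thesis by (simp add: sum_nonneg del: sum.lessThan_Suc)
    qed
    then show "\<exists>N. \<forall>n\<ge>N. norm ((\<Sum>k<Suc n. (?d (s n (Suc k)) - ?d (s n k))\<^sup>2) - 0) < e" by blast
  qed
qed

lemma measurable_AE_complete:
  assumes "complete_measure M" and f': "f' \<in> measurable M N" and ae: "AE x in M. f x = f' x"
    and sp: "\<And>x. x \<in> space M \<Longrightarrow> f x \<in> space N"
  shows "f \<in> measurable M N"
proof (rule measurableI[OF sp])
  interpret complete_measure M by fact
  fix A assume A: "A \<in> sets N"
  obtain Z where Z: "\<And>x. x \<in> space M - Z \<Longrightarrow> f x = f' x" "Z \<in> null_sets M"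
    using AE_E3[OF ae] by blast
  have "f -` A \<inter> space M \<inter> Z \<in> sets M" by (rule complete[OF _ Z(2)]) auto
  moreover have "f' -` A \<inter> space M - Z \<in> sets M" using measurable_sets[OF f' A] Z(2) by auto
  moreover have "f -` A \<inter> space M = (f' -` A \<inter> space M - Z) \<union> (f -` A \<inter> space M \<inter> Z)"
    using Z(1) by auto
  ultimately show "f -` A \<inter> space M \<in> sets M" by (metis sets.Un)
qed simp

context additive_process
begin

abbreviation CP :: "'s \<Rightarrow> 'w measure" where "CP x \<equiv> completion (prob_from X (Some x))"

abbreviation EC :: "'s \<Rightarrow> ('w \<Rightarrow> ennreal) \<Rightarrow> ennreal" where
  "EC x \<equiv> nn_integral (CP x)"

abbreviation RE :: "'s \<Rightarrow> ('w \<Rightarrow> real) \<Rightarrow> real" where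
  "RE x \<equiv> integral\<^sup>L (CP x)"

lemma prob_space_CP: "prob_space (CP x)"
  using prob_space.prob_space_completion[OF prob_space_from] .

lemma space_CP [simp]: "space (CP x) = sample_space X" by simp

lemma complete_CP: "complete_measure (CP x)" ..

lemma AE_CP_good: "AE \<omega> in CP x. good \<omega>"
  by (rule AE_completion[OF AE_good])

text \<open>Bad paths lie in a null set, and the completed law absorbs whatever happens
  there.\<close>

lemma adapted_CP:
  assumes "adapted_at t W" shows "W \<in> borel_measurable (CP x)"
proof -
  obtain V where V: "V \<in> borel_measurable (augmented_filtration X t)" "\<And>\<omega>. good \<omega> \<Longrightarrow> W \<omega> = V \<omega>"
    using assms unfolding adapted_at_def by blast
  have ae: "AE \<omega> in CP x. W \<omega> = V \<omega>" using AE_CP_good[of x] by eventually_elim (rule V(2))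
  show ?thesis
    by (rule measurable_AE_complete[OF complete_CP measurable_completion[OF augmented_imp_from[OF V(1)]] ae]) simp
qed

lemma adapted_later:
  assumes "adapted_at s W" "s \<le> t" shows "adapted_at t W"
  using assms augmented_imp_later[OF _ assms(2)] unfolding adapted_at_def by blast

lemma adapted_minus:
  assumes "adapted_at t W1" "adapted_at t W2" shows "adapted_at t (\<lambda>\<omega>. W1 \<omega> - W2 \<omega>)"
proof -
  obtain V1 V2 where "V1 \<in> borel_measurable (augmented_filtration X t)" "V2 \<in> borel_measurable (augmented_filtration X t)"
    "\<And>\<omega>. good \<omega> \<Longrightarrow> W1 \<omega> = V1 \<omega>" "\<And>\<omega>. good \<omega> \<Longrightarrow> W2 \<omega> = V2 \<omega>"
    using assms unfolding adapted_at_def by blast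
  then show ?thesis
    unfolding adapted_at_def by (intro bexI[of _ "\<lambda>\<omega>. V1 \<omega> - V2 \<omega>"]) auto
qed

section \<open>Functionals with a bounded continuous density\<close>

definition density_fun :: "('s \<Rightarrow> real) \<Rightarrow> bool" where
  "density_fun h \<longleftrightarrow> continuous_on UNIV h \<and> (\<forall>x. 0 \<le> h x) \<and> (\<exists>c. \<forall>x. h x \<le> c)"

lemma density_fun_joint: "density_fun h \<Longrightarrow> continuous_on UNIV (\<lambda>(w::real, x). h x)"
  unfolding density_fun_def using continuous_on_compose2[OF _ continuous_on_snd[OF continuous_on_id], of UNIV h UNIV]
  by (auto simp: case_prod_beta)

abbreviation af :: "('w \<Rightarrow> real measure) \<Rightarrow> ('s \<Rightarrow> real) \<Rightarrow> real \<Rightarrow> 'w \<Rightarrow> ennreal" where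
  "af N h \<equiv> functional N (\<lambda>_. h)"

text \<open>The real-valued form, in which differences of two functionals make sense; on good paths
  the functional is finite and nothing is lost.\<close>

definition rf :: "('w \<Rightarrow> real measure) \<Rightarrow> ('s \<Rightarrow> real) \<Rightarrow> real \<Rightarrow> 'w \<Rightarrow> real" where
  "rf N h t \<omega> = enn2real (af N h t \<omega>)"

lemma af_adapted:
  assumes "clock N" "density_fun h" "0 \<le> t"
  shows "adapted_at (ennreal t) (af N h t)"
proof -
  obtain c where "\<And>x. h x \<le> c" using assms(2) unfolding density_fun_def by blast
  then show ?thesis
    using assms(2) by (intro functional_adapted[OF assms(1) density_fun_joint[OF assms(2)] _ _ assms(3)])
      (auto simp: density_fun_def)
qed

lemma af_increment:
  assumes N: "clock N" and g: "good \<omega>" and h: "density_fun h" and uv: "0 \<le> u" "u \<le> v"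
  shows "af N h v \<omega> = af N h u \<omega> + (\<integral>\<^sup>+w. ennreal (h (pos \<omega> w)) * indicator {u<..v} w \<partial>N \<omega>)"
proof -
  have [measurable_cong]: "sets (N \<omega>) = sets borel" by (rule clock_sets[OF N g])
  have [measurable]: "(\<lambda>w. ennreal (h (pos \<omega> w))) \<in> borel_measurable borel"
    using functional_measurable[OF g density_fun_joint[OF h]] by simp
  have "af N h v \<omega> = (\<integral>\<^sup>+w. ennreal (h (pos \<omega> w)) * indicator {0<..u} w
      + ennreal (h (pos \<omega> w)) * indicator {u<..v} w \<partial>N \<omega>)"
    unfolding functional_def using uv by (intro nn_integral_cong) (auto simp: indicator_def)
  then show ?thesis unfolding functional_def by (subst (asm) nn_integral_add) auto
qed

lemma af_eq_rf:
  assumes "clock N" "good \<omega>" "density_fun h" "0 \<le> t"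
  shows "af N h t \<omega> = ennreal (rf N h t \<omega>)"
proof -
  obtain c where "\<And>x. h x \<le> c" using assms(3) unfolding density_fun_def by blast
  then have "af N h t \<omega> < \<top>" using functional_finite[OF assms(1,2) _ assms(4), of "\<lambda>_. h" c] by simp
  then show ?thesis by (simp add: rf_def)
qed

lemma rf_nonneg: "0 \<le> rf N h t \<omega>" by (simp add: rf_def)

lemma rf_zero: "rf N h 0 \<omega> = 0" by (simp add: rf_def functional_def)

lemma rf_mono:
  assumes "clock N" "good \<omega>" "density_fun h" "0 \<le> u" "u \<le> v"
  shows "rf N h u \<omega> \<le> rf N h v \<omega>"
proof -
  have "ennreal (rf N h u \<omega>) \<le> ennreal (rf N h v \<omega>)"
    using af_increment[OF assms] assms by (simp add: af_eq_rf[symmetric])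
  then show ?thesis by (simp add: rf_nonneg ennreal_le_iff)
qed

text \<open>Increments are bounded by the bound of \<open>h\<close> times the increments of the
  continuous function \<open>a\<close> of the clock. The definition of a clock does not make
  \<open>a\<close> monotone, hence \<open>max 0\<close> and the absolute values.\<close>

lemma rf_continuous:
  assumes N: "clock N" and g: "good \<omega>" and h: "density_fun h"
  shows "continuous_on {0..t} (\<lambda>s. rf N h s \<omega>)"
proof -
  obtain a where a: "continuous_on {0..} a" "\<And>u v. 0 \<le> u \<Longrightarrow> u \<le> v \<Longrightarrow> emeasure (N \<omega>) {u<..v} = ennreal (a v - a u)"
    using clock_continuous[OF N g] by blast
  obtain c where c: "\<And>x. h x \<le> c" using h unfolding density_fun_def by blast
  have c0: "0 \<le> c" using c[of undefined] h unfolding density_fun_def by (meson order_trans)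
  have [measurable_cong]: "sets (N \<omega>) = sets borel" by (rule clock_sets[OF N g])
  have le: "rf N h v \<omega> - rf N h u \<omega> \<le> c * max 0 (a v - a u)" if uv: "0 \<le> u" "u \<le> v" for u v
  proof -
    have "(\<integral>\<^sup>+w. ennreal (h (pos \<omega> w)) * indicator {u<..v} w \<partial>N \<omega>) \<le> (\<integral>\<^sup>+w. ennreal c * indicator {u<..v} w \<partial>N \<omega>)"
      by (intro nn_integral_mono mult_right_mono ennreal_leI c) simp
    also have "\<dots> = ennreal c * ennreal (a v - a u)"
      using a(2)[OF uv] by (simp add: nn_integral_cmult_indicator)
    also have "\<dots> = ennreal (c * max 0 (a v - a u))"
      using c0 by (simp add: ennreal_mult[symmetric] max_def ennreal_neg)
    finally have "ennreal (rf N h v \<omega>) \<le> ennreal (rf N h u \<omega>) + ennreal (c * max 0 (a v - a u))"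
      using af_increment[OF N g h uv] uv by (simp add: af_eq_rf[OF N g h, symmetric] add_left_mono)
    then have "ennreal (rf N h v \<omega>) \<le> ennreal (rf N h u \<omega> + c * max 0 (a v - a u))"
      using c0 by (simp add: ennreal_plus rf_nonneg)
    then show ?thesis
      using c0 rf_nonneg[of N h u \<omega>] by (subst (asm) ennreal_le_iff) auto
  qed
  have lip: "\<bar>rf N h v \<omega> - rf N h u \<omega>\<bar> \<le> c * \<bar>a v - a u\<bar>" if "0 \<le> u" "0 \<le> v" for u v
  proof (cases "u \<le> v")
    case True
    have "c * max 0 (a v - a u) \<le> c * \<bar>a v - a u\<bar>" using c0 by (intro mult_left_mono) auto
    then show ?thesis using le[OF that(1) True] rf_mono[OF N g h that(1) True] by linarith
  next
    case False
    have "c * max 0 (a u - a v) \<le> c * \<bar>a v - a u\<bar>" using c0 by (intro mult_left_mono) auto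
    then show ?thesis using le[OF that(2), of u] rf_mono[OF N g h that(2), of u] False by linarith
  qed
  show ?thesis
    unfolding continuous_on_iff
  proof (intro ballI allI impI)
    fix x e :: real assume x: "x \<in> {0..t}" and e: "e > 0"
    have "e / (c + 1) > 0" using e c0 by simp
    then obtain d where d: "d > 0" "\<And>y. y \<in> {0..} \<Longrightarrow> dist y x < d \<Longrightarrow> dist (a y) (a x) < e / (c + 1)"
      using a(1) x unfolding continuous_on_iff by (metis atLeast_iff atLeastAtMost_iff)
    have "dist (rf N h y \<omega>) (rf N h x \<omega>) < e" if y: "y \<in> {0..t}" "dist y x < d" for y
    proof -
      have "\<bar>a y - a x\<bar> < e / (c + 1)" using d(2)[of y] y by (simp add: dist_real_def)
      then have "(c + 1) * \<bar>a y - a x\<bar> < e" using c0 by (simp add: pos_less_divide_eq mult.commute)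
      moreover have "c * \<bar>a y - a x\<bar> \<le> (c + 1) * \<bar>a y - a x\<bar>" by (intro mult_right_mono) auto
      moreover have "\<bar>rf N h y \<omega> - rf N h x \<omega>\<bar> \<le> c * \<bar>a y - a x\<bar>" using lip[of x y] x y by simp
      ultimately show ?thesis unfolding dist_real_def by linarith
    qed
    then show "\<exists>d>0. \<forall>x'\<in>{0..t}. dist x' x < d \<longrightarrow> dist (rf N h x' \<omega>) (rf N h x \<omega>) < e" using d(1) by blast
  qed
qed

lemma rf_add:
  assumes N: "clock N" and g: "good \<omega>" and h: "density_fun h" and t: "0 \<le> s" "0 \<le> r"
  shows "rf N h (s + r) \<omega> = rf N h s \<omega> + rf N h r (shifted s \<omega>)"
proof -
  have g': "good (shifted s \<omega>)" by (rule good_shift[OF g]) simp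
  have "continuous_on UNIV (\<lambda>x. h x)" using h by (simp add: density_fun_def)
  from functional_add[OF N g this t]
  have "ennreal (rf N h (s + r) \<omega>) = ennreal (rf N h s \<omega> + rf N h r (shifted s \<omega>))"
    using t by (simp add: af_eq_rf[OF N g h] af_eq_rf[OF N g' h] ennreal_plus rf_nonneg)
  then show ?thesis by (subst (asm) ennreal_inj) (auto simp: rf_nonneg)
qed

lemma rf_measurable:
  assumes "clock N" "density_fun h" "0 \<le> t" shows "rf N h t \<in> borel_measurable (CP x)"
  unfolding rf_def[abs_def] using adapted_CP[OF af_adapted[OF assms]] by measurable

lemma expectation_af:
  assumes "clock N" "density_fun h" "0 \<le> t"
  shows "EP x (af N h t) = EC x (\<lambda>\<omega>. ennreal (rf N h t \<omega>))"
  unfolding nn_integral_completion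
  by (rule nn_integral_cong_AE, use AE_good[of x] in eventually_elim) (rule af_eq_rf[OF assms(1) _ assms(2,3)])

text \<open>The increment over (u, v] is determined by time \<open>v\<close>, and by additivity the
  increment over (v, t] is the functional over length \<open>t - v\<close> of the path shifted by
  \<open>v\<close>. So a comparison of the means of \<open>Nb\<close> and \<open>Nc\<close> over
  that length holds conditionally.\<close>

lemma cross_compare:
  assumes N: "clock Na" "clock Nb" "clock Nc" and h: "density_fun ha" "density_fun hb" "density_fun hc"
    and uv: "0 \<le> u" "u \<le> v" "v \<le> t"
    and le: "\<And>y. EP y (af Nb hb (t - v)) \<le> EP y (af Nc hc (t - v)) + \<kappa>"
    and fin: "EC x (\<lambda>\<omega>. ennreal (rf Na ha v \<omega>)) < \<top>"
  shows "EC x (\<lambda>\<omega>. ennreal ((rf Na ha v \<omega> - rf Na ha u \<omega>) * (rf Nb hb t \<omega> - rf Nb hb v \<omega>))) \<le>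
    EC x (\<lambda>\<omega>. ennreal ((rf Na ha v \<omega> - rf Na ha u \<omega>) * (rf Nc hc t \<omega> - rf Nc hc v \<omega>))) +
    \<kappa> * EC x (\<lambda>\<omega>. ennreal (rf Na ha v \<omega> - rf Na ha u \<omega>))"
proof -
  define Z where "Z \<omega> = af Na ha v \<omega> - af Na ha u \<omega>" for \<omega>
  have v: "0 \<le> v" and tv: "0 \<le> t - v" using uv by auto
  have Z: "adapted_at (ennreal v) Z"
    unfolding Z_def[abs_def] using uv
    by (intro adapted_minus af_adapted[OF N(1) h(1) v] adapted_later[OF af_adapted[OF N(1) h(1) uv(1)]] ennreal_leI)
  have Zg: "Z \<omega> = ennreal (rf Na ha v \<omega> - rf Na ha u \<omega>)" if "good \<omega>" for \<omega>
    using uv that by (simp add: Z_def af_eq_rf[OF N(1) that h(1)] ennreal_minus rf_nonneg)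
  have Wg: "Z \<omega> * af Nd hd (t - v) (shifted v \<omega>) =
      ennreal ((rf Na ha v \<omega> - rf Na ha u \<omega>) * (rf Nd hd t \<omega> - rf Nd hd v \<omega>))"
    if "good \<omega>" "clock Nd" "density_fun hd" for \<omega> Nd hd
  proof -
    have g': "good (shifted v \<omega>)" by (rule good_shift[OF that(1)]) simp
    show ?thesis
      using rf_add[OF that(2,1,3) v tv] rf_mono[OF N(1) that(1) h(1) uv(1,2)]
      by (simp add: Zg[OF that(1)] af_eq_rf[OF that(2) g' that(3) tv] ennreal_mult rf_nonneg)
  qed
  have top: "adapted_at \<top> (af Nd hd (t - v))" if "clock Nd" "density_fun hd" for Nd hd
    by (rule adapted_later[OF af_adapted[OF that tv]]) simp
  have EZ: "EP x Z = EC x (\<lambda>\<omega>. ennreal (rf Na ha v \<omega> - rf Na ha u \<omega>))"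
    unfolding nn_integral_completion
    by (rule nn_integral_cong_AE, use AE_good[of x] in eventually_elim) (rule Zg)
  have EW: "EP x (\<lambda>\<omega>. Z \<omega> * af Nd hd (t - v) (shifted v \<omega>)) =
      EC x (\<lambda>\<omega>. ennreal ((rf Na ha v \<omega> - rf Na ha u \<omega>) * (rf Nd hd t \<omega> - rf Nd hd v \<omega>)))"
    if "clock Nd" "density_fun hd" for Nd hd
    unfolding nn_integral_completion
    by (rule nn_integral_cong_AE, use AE_good[of x] in eventually_elim) (rule Wg[OF _ that])
  have "EC x (\<lambda>\<omega>. ennreal (rf Na ha v \<omega> - rf Na ha u \<omega>)) \<le> EC x (\<lambda>\<omega>. ennreal (rf Na ha v \<omega>))"
    by (intro nn_integral_mono ennreal_leI) (simp add: rf_nonneg)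
  from le_less_trans[OF this fin] have "EP x Z < \<top>"
    by (simp only: EZ)
  from adapted_markov_compare[OF v top[OF N(2) h(2)] top[OF N(3) h(3)] Z this le]
  show ?thesis unfolding EZ EW[OF N(2) h(2)] EW[OF N(3) h(3)] .
qed

lemma first_moment_mono:
  assumes "clock N" "density_fun h" "0 \<le> s" "s \<le> t"
  shows "EP y (af N h s) \<le> EP y (af N h t)"
  unfolding functional_def using assms(4)
  by (intro nn_integral_mono mult_left_mono) (auto simp: indicator_def)

lemma density_fun_zero: "density_fun (\<lambda>_. 0)"
  unfolding density_fun_def by (auto intro: continuous_on_const)

text \<open>A Khasminskii-type estimate: if the mean is at most \<open>b\<close> from every starting
  point, then given the past the remaining increment has mean at most \<open>b\<close>, so the cross
  terms of the squared functional sum to at most \<open>b * b\<close>. The quadratic variation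
  disappears in the limit, leaving the factor 2.\<close>

lemma second_moment_bound:
  assumes N: "clock N" and h: "density_fun h" and t: "0 \<le> t"
    and b: "\<And>y. EP y (af N h t) \<le> b" "b < \<top>"
  shows "EC x (\<lambda>\<omega>. ennreal ((rf N h t \<omega>)\<^sup>2)) \<le> 2 * b * b"
proof -
  let ?\<beta> = "rf N h"
  define s where "s n k = real k * t / real (Suc n)" for n k :: nat
  note s = grid_facts[OF t, folded s_def]
  define f where "f n \<omega> = (\<Sum>k<Suc n. ennreal ((?\<beta> (s n (Suc k)) \<omega> - ?\<beta> (s n k) \<omega>) * (?\<beta> t \<omega> - ?\<beta> (s n (Suc k)) \<omega>)))" for n \<omega>
  have m[measurable]: "?\<beta> (s n k) \<in> borel_measurable (CP x)" "?\<beta> t \<in> borel_measurable (CP x)" for n k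
    by (intro rf_measurable N h s t)+
  have fm: "f n \<in> borel_measurable (CP x)" for n unfolding f_def by measurable
  have Eb: "EC x (\<lambda>\<omega>. ennreal (?\<beta> v \<omega>)) \<le> b" if "0 \<le> v" "v \<le> t" for v
    using expectation_af[OF N h that(1), of x] first_moment_mono[OF N h that, of x] b(1)[of x] by simp
  have Ef: "EC x (\<lambda>\<omega>. f n \<omega>) \<le> b * b" for n
  proof -
    have "EC x (\<lambda>\<omega>. f n \<omega>) = (\<Sum>k<Suc n. \<integral>\<^sup>+\<omega>. ennreal ((?\<beta> (s n (Suc k)) \<omega> - ?\<beta> (s n k) \<omega>) * (?\<beta> t \<omega> - ?\<beta> (s n (Suc k)) \<omega>)) \<partial>CP x)"
      unfolding f_def by (rule nn_integral_sum) measurable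
    also have "\<dots> \<le> (\<Sum>k<Suc n. b * EC x (\<lambda>\<omega>. ennreal (?\<beta> (s n (Suc k)) \<omega> - ?\<beta> (s n k) \<omega>)))"
    proof (rule sum_mono)
      fix k assume "k \<in> {..<Suc n}"
      then have k: "s n (Suc k) \<le> t" by (intro s(3)) simp
      \<comment> \<open>The remaining increment is compared with the zero functional, with \<kappa>
        = b; this turns a bound on means into an instance of \<open>cross_compare\<close>.\<close>
      have "EC x (\<lambda>\<omega>. ennreal ((?\<beta> (s n (Suc k)) \<omega> - ?\<beta> (s n k) \<omega>) * (?\<beta> t \<omega> - ?\<beta> (s n (Suc k)) \<omega>)))
        \<le> EC x (\<lambda>\<omega>. ennreal ((?\<beta> (s n (Suc k)) \<omega> - ?\<beta> (s n k) \<omega>) * (rf (\<lambda>_. lborel) (\<lambda>_. 0) t \<omega> - rf (\<lambda>_. lborel) (\<lambda>_. 0) (s n (Suc k)) \<omega>))) +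
          b * EC x (\<lambda>\<omega>. ennreal (?\<beta> (s n (Suc k)) \<omega> - ?\<beta> (s n k) \<omega>))"
      proof (rule cross_compare[OF N N clock_lborel h h density_fun_zero s(1,2) k])
        show "EP y (af N h (t - s n (Suc k))) \<le>
          EP y (af (\<lambda>_. lborel) (\<lambda>_. 0) (t - s n (Suc k))) + b" for y
          using first_moment_mono[OF N h, of "t - s n (Suc k)" t y] k s(1)[of n "Suc k"] b(1)[of y]
          by (intro add_increasing) (auto intro: order_trans)
        show "EC x (\<lambda>\<omega>. ennreal (?\<beta> (s n (Suc k)) \<omega>)) < \<top>"
          using Eb[OF s(1) k] b(2) by (rule le_less_trans)
      qed
      then show "EC x (\<lambda>\<omega>. ennreal ((?\<beta> (s n (Suc k)) \<omega> - ?\<beta> (s n k) \<omega>) * (?\<beta> t \<omega> - ?\<beta> (s n (Suc k)) \<omega>)))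
        \<le> b * EC x (\<lambda>\<omega>. ennreal (?\<beta> (s n (Suc k)) \<omega> - ?\<beta> (s n k) \<omega>))"
        by (simp add: rf_def functional_def)
    qed
    also have "\<dots> = b * EC x (\<lambda>\<omega>. (\<Sum>k<Suc n. ennreal (?\<beta> (s n (Suc k)) \<omega> - ?\<beta> (s n k) \<omega>)))"
      by (subst nn_integral_sum) (auto simp: sum_distrib_left simp del: sum.lessThan_Suc)
    also have "EC x (\<lambda>\<omega>. (\<Sum>k<Suc n. ennreal (?\<beta> (s n (Suc k)) \<omega> - ?\<beta> (s n k) \<omega>))) = EC x (\<lambda>\<omega>. ennreal (?\<beta> t \<omega>))"
    proof (rule nn_integral_cong_AE, use AE_CP_good[of x] in eventually_elim)
      fix \<omega> assume g: "good \<omega>"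
      have "(\<Sum>k<Suc n. ennreal (?\<beta> (s n (Suc k)) \<omega> - ?\<beta> (s n k) \<omega>)) = ennreal (\<Sum>k<Suc n. ?\<beta> (s n (Suc k)) \<omega> - ?\<beta> (s n k) \<omega>)"
        by (rule sum_ennreal) (use rf_mono[OF N g h s(1,2)] in simp)
      also have "(\<Sum>k<Suc n. ?\<beta> (s n (Suc k)) \<omega> - ?\<beta> (s n k) \<omega>) = ?\<beta> t \<omega>"
        by (subst sum_lessThan_telescope) (simp only: s(4), simp add: s_def rf_zero)
      finally show "(\<Sum>k<Suc n. ennreal (?\<beta> (s n (Suc k)) \<omega> - ?\<beta> (s n k) \<omega>)) = ennreal (?\<beta> t \<omega>)" .
    qed
    also have "b * \<dots> \<le> b * b" using Eb[OF t order_refl] by (intro mult_left_mono) auto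
    finally show ?thesis .
  qed
  \<comment> \<open>On good paths the quadratic variation tends to 0, so the doubled cross sums
    converge to the square, and Fatou's lemma passes their bound to the limit.\<close>
  have "EC x (\<lambda>\<omega>. ennreal ((?\<beta> t \<omega>)\<^sup>2)) = EC x (\<lambda>\<omega>. liminf (\<lambda>n. 2 * f n \<omega>))"
  proof (rule nn_integral_cong_AE, use AE_CP_good[of x] in eventually_elim)
    fix \<omega> assume g: "good \<omega>"
    have "(\<lambda>n. \<Sum>k<Suc n. ((?\<beta> (s n (Suc k)) \<omega> - 0) - (?\<beta> (s n k) \<omega> - 0))\<^sup>2) \<longlonglongrightarrow> 0"
      unfolding s_def
      by (rule quadratic_variation_tendsto_0[of t "\<lambda>v. ?\<beta> v \<omega>" "\<lambda>_. 0", OF t rf_continuous[OF N g h] continuous_on_const])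
         (auto intro: rf_mono[OF N g h])
    then have "(\<lambda>n. (?\<beta> t \<omega>)\<^sup>2 - (\<Sum>k<Suc n. (?\<beta> (s n (Suc k)) \<omega> - ?\<beta> (s n k) \<omega>)\<^sup>2)) \<longlonglongrightarrow> (?\<beta> t \<omega>)\<^sup>2 - 0"
      by (intro tendsto_diff tendsto_const) (simp del: sum.lessThan_Suc)
    moreover have "2 * f n \<omega> = ennreal ((?\<beta> t \<omega>)\<^sup>2 - (\<Sum>k<Suc n. (?\<beta> (s n (Suc k)) \<omega> - ?\<beta> (s n k) \<omega>)\<^sup>2))" for n
    proof -
      have "f n \<omega> = ennreal (\<Sum>k<Suc n. (?\<beta> (s n (Suc k)) \<omega> - ?\<beta> (s n k) \<omega>) * (?\<beta> t \<omega> - ?\<beta> (s n (Suc k)) \<omega>))"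
        unfolding f_def
        by (rule sum_ennreal, rule mult_nonneg_nonneg)
           (use rf_mono[OF N g h s(1,2)] rf_mono[OF N g h s(1) s(3)] in auto)
      moreover have "(?\<beta> t \<omega>)\<^sup>2 = (\<Sum>k<Suc n. (?\<beta> (s n (Suc k)) \<omega> - ?\<beta> (s n k) \<omega>)\<^sup>2) +
        2 * (\<Sum>k<Suc n. (?\<beta> (s n (Suc k)) \<omega> - ?\<beta> (s n k) \<omega>) * (?\<beta> t \<omega> - ?\<beta> (s n (Suc k)) \<omega>))"
        using square_sum_increments[of "\<lambda>k. ?\<beta> (s n k) \<omega>" "Suc n"] unfolding s(4)
        by (simp add: s_def rf_zero del: sum.lessThan_Suc)
      ultimately show ?thesis by (simp add: ennreal_mult' del: sum.lessThan_Suc)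
    qed
    ultimately have "(\<lambda>n. 2 * f n \<omega>) \<longlonglongrightarrow> ennreal ((?\<beta> t \<omega>)\<^sup>2)"
      by (simp add: tendsto_ennrealI del: sum.lessThan_Suc)
    then show "ennreal ((?\<beta> t \<omega>)\<^sup>2) = liminf (\<lambda>n. 2 * f n \<omega>)"
      by (intro lim_imp_Liminf[symmetric]) auto
  qed
  also have "\<dots> \<le> liminf (\<lambda>n. \<integral>\<^sup>+\<omega>. 2 * f n \<omega> \<partial>CP x)"
    using fm by (intro nn_integral_liminf) measurable
  also have "\<dots> \<le> 2 * (b * b)"
  proof (rule order_trans[OF Liminf_le_Limsup Limsup_bounded], simp, rule always_eventually, rule allI)
    fix n show "EC x (\<lambda>\<omega>. 2 * f n \<omega>) \<le> 2 * (b * b)"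
      using fm Ef[of n] by (subst nn_integral_cmult) (auto intro: mult_left_mono)
  qed
  finally show ?thesis by (simp add: mult.assoc)
qed

text \<open>
  Writing \<open>D\<close> for the difference, \<open>D\<^sub>t\<^sup>2\<close> is the quadratic variation along a grid, which vanishes in
  the limit by continuity, plus twice the sum of increments of \<open>D\<close> times the remaining \<open>D\<close>; by the
  Markov property the latter has conditional mean at most \<open>\<kappa>\<close> in absolute value.
\<close>

theorem second_moment_difference:
  assumes N: "clock N1" "clock N2" and h: "density_fun h1" "density_fun h2" and t: "0 \<le> t" and \<kappa>: "0 \<le> \<kappa>"
    and cmp: "\<And>s y. 0 \<le> s \<Longrightarrow> s \<le> t \<Longrightarrow> (EP y (af N1 h1 s)) \<le> EP y (af N2 h2 s) + ennreal \<kappa>"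
      "\<And>s y. 0 \<le> s \<Longrightarrow> s \<le> t \<Longrightarrow> (EP y (af N2 h2 s)) \<le> EP y (af N1 h1 s) + ennreal \<kappa>"
    and b: "\<And>y. EP y (af N1 h1 t) \<le> ennreal b"
      "\<And>y. EP y (af N2 h2 t) \<le> ennreal b" "0 \<le> b"
  shows "integrable (CP x) (\<lambda>\<omega>. (rf N1 h1 t \<omega> - rf N2 h2 t \<omega>)\<^sup>2)"
    and "RE x (\<lambda>\<omega>. (rf N1 h1 t \<omega> - rf N2 h2 t \<omega>)\<^sup>2) \<le> 4 * b * \<kappa>"
proof -
  let ?\<beta> = "rf N1 h1" and ?\<gamma> = "rf N2 h2"
  let ?d = "\<lambda>v \<omega>. ?\<beta> v \<omega> - ?\<gamma> v \<omega>"
  interpret prob_space "CP x" by (rule prob_space_CP)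
  define s where "s n k = real k * t / real (Suc n)" for n k :: nat
  let ?i = "\<lambda>f n k \<omega>. f (s n (Suc k)) \<omega> - f (s n k) \<omega> :: real" and ?r = "\<lambda>f n k \<omega>. f t \<omega> - f (s n (Suc k)) \<omega> :: real"
  note s = grid_facts[OF t, folded s_def]
  have s_t: "s n (Suc k) \<le> t" if "k < Suc n" for n k using that by (intro s(3)) simp
  have m\<beta>[measurable]: "?\<beta> v \<in> borel_measurable (CP x)" if "0 \<le> v" for v by (rule rf_measurable[OF N(1) h(1) that])
  have m\<gamma>[measurable]: "?\<gamma> v \<in> borel_measurable (CP x)" if "0 \<le> v" for v by (rule rf_measurable[OF N(2) h(2) that])
  note m[measurable] = m\<beta>[OF s(1)] m\<gamma>[OF s(1)] m\<beta>[OF t] m\<gamma>[OF t]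
  have E: "EC x (\<lambda>\<omega>. ennreal (?\<beta> t \<omega>)) \<le> ennreal b" "EC x (\<lambda>\<omega>. ennreal (?\<gamma> t \<omega>)) \<le> ennreal b"
    using expectation_af[OF N(1) h(1) t, of x] expectation_af[OF N(2) h(2) t, of x] b(1,2)[of x] by simp_all
  have sq_int: "integrable (CP x) (\<lambda>\<omega>. (?\<beta> t \<omega>)\<^sup>2)" "integrable (CP x) (\<lambda>\<omega>. (?\<gamma> t \<omega>)\<^sup>2)"
    using second_moment_bound[OF N(1) h(1) t b(1), of x] second_moment_bound[OF N(2) h(2) t b(2), of x]
    by (auto intro!: integrableI_nonneg elim!: le_less_trans simp: ennreal_mult_less_top)
  \<comment> \<open>\<open>S\<close> dominates the products of increments and the quadratic sums
    \<open>Q n\<close>, and it is integrable by \<open>second_moment_bound\<close>. It is the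
    majorant for the dominated convergence of \<open>Q\<close>.\<close>
  define S where "S \<omega> = (?\<beta> t \<omega> + ?\<gamma> t \<omega>)\<^sup>2" for \<omega>
  have S_meas[measurable]: "S \<in> borel_measurable (CP x)" unfolding S_def by measurable
  have S_int: "integrable (CP x) S"
  proof (rule Bochner_Integration.integrable_bound)
    show "integrable (CP x) (\<lambda>\<omega>. 2 * (?\<beta> t \<omega>)\<^sup>2 + 2 * (?\<gamma> t \<omega>)\<^sup>2)"
      using sq_int by (intro Bochner_Integration.integrable_add integrable_mult_right)
    have "(p + q)\<^sup>2 \<le> 2 * p\<^sup>2 + 2 * q\<^sup>2" for p q :: real
      using sum_squares_bound[of p q] by (simp add: power2_sum)
    then show "AE \<omega> in CP x. norm (S \<omega>) \<le> norm (2 * (?\<beta> t \<omega>)\<^sup>2 + 2 * (?\<gamma> t \<omega>)\<^sup>2)"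
      by (intro AE_I2) (simp add: S_def)
  qed simp
  have sq_le_S: "\<bar>p * q\<bar> \<le> (c + d)\<^sup>2" if "\<bar>p\<bar> \<le> c + d" "\<bar>q\<bar> \<le> c + d" for p q c d :: real
    using mult_mono[OF that] that by (simp add: abs_mult power2_eq_square)
  have bnd: "\<bar>?\<beta> v \<omega> - ?\<beta> u \<omega>\<bar> \<le> ?\<beta> t \<omega> + ?\<gamma> t \<omega>" "\<bar>?\<gamma> v \<omega> - ?\<gamma> u \<omega>\<bar> \<le> ?\<beta> t \<omega> + ?\<gamma> t \<omega>"
    if "good \<omega>" "0 \<le> u" "u \<le> v" "v \<le> t" for u v \<omega>
    using rf_mono[OF N(1) that(1) h(1) that(2,3)] rf_mono[OF N(2) that(1) h(2) that(2,3)]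
      rf_mono[OF N(1) that(1) h(1) order_trans[OF that(2,3)] that(4)] rf_mono[OF N(2) that(1) h(2) order_trans[OF that(2,3)] that(4)]
      rf_nonneg[of N1 h1 u \<omega>] rf_nonneg[of N2 h2 u \<omega>] rf_nonneg[of N1 h1 t \<omega>] rf_nonneg[of N2 h2 t \<omega>]
    by linarith+
  \<comment> \<open>Stands for "one of the two functionals", so that domination and integrability
    are proved once for all four combinations.\<close>
  define ok where "ok Na ha \<longleftrightarrow> Na = N1 \<and> ha = h1 \<or> Na = N2 \<and> ha = h2" for Na ha
  have ok12: "ok N1 h1" "ok N2 h2" by (auto simp: ok_def)
  have okD: "clock Na" "density_fun ha" if "ok Na ha" for Na ha
    using that N h by (auto simp: ok_def)
  have ok_bnd: "\<bar>rf Na ha v \<omega> - rf Na ha u \<omega>\<bar> \<le> ?\<beta> t \<omega> + ?\<gamma> t \<omega>"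
    if "ok Na ha" "good \<omega>" "0 \<le> u" "u \<le> v" "v \<le> t" for Na ha u v \<omega>
    using that(1) bnd[OF that(2-5)] unfolding ok_def by (elim disjE conjE) simp_all
  have ok_E: "EC x (\<lambda>\<omega>. ennreal (rf Na ha t \<omega>)) \<le> ennreal b" if "ok Na ha" for Na ha
    using that E unfolding ok_def by (elim disjE conjE) simp_all
  have int_prod: "integrable (CP x) (\<lambda>\<omega>. (?i (rf Na ha) n k \<omega>) * (?r (rf Nb hb) n k \<omega>))"
    if k: "k < Suc n" and ab: "ok Na ha" "ok Nb hb"
    for n k Na ha Nb hb
  proof (rule Bochner_Integration.integrable_bound[OF S_int])
    show "(\<lambda>\<omega>. (?i (rf Na ha) n k \<omega>) * (?r (rf Nb hb) n k \<omega>)) \<in> borel_measurable (CP x)"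
      by (intro borel_measurable_times borel_measurable_diff rf_measurable okD[OF ab(1)] okD[OF ab(2)] s(1) t)
    show "AE \<omega> in CP x. norm ((?i (rf Na ha) n k \<omega>) * (?r (rf Nb hb) n k \<omega>)) \<le> norm (S \<omega>)"
      using AE_CP_good[of x]
    proof eventually_elim
      case (elim \<omega>)
      have "\<bar>(?i (rf Na ha) n k \<omega>) * (?r (rf Nb hb) n k \<omega>)\<bar> \<le> (?\<beta> t \<omega> + ?\<gamma> t \<omega>)\<^sup>2"
        by (rule sq_le_S[OF ok_bnd[OF ab(1) elim s(1,2) s_t[OF k]] ok_bnd[OF ab(2) elim s(1) s_t[OF k] order_refl]])
      then show ?case by (simp add: S_def)
    qed
  qed
  have int_inc: "integrable (CP x) (\<lambda>\<omega>. ?i (rf Na ha) n k \<omega>)"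
    if k: "k < Suc n" and ab: "ok Na ha" for n k Na ha
  proof (rule Bochner_Integration.integrable_bound)
    show "integrable (CP x) (\<lambda>\<omega>. 1 + S \<omega>)" using S_int by simp
    show "(\<lambda>\<omega>. ?i (rf Na ha) n k \<omega>) \<in> borel_measurable (CP x)"
      by (intro borel_measurable_diff rf_measurable okD[OF ab] s(1))
    show "AE \<omega> in CP x. norm (?i (rf Na ha) n k \<omega>) \<le> norm (1 + S \<omega>)"
      using AE_CP_good[of x]
    proof eventually_elim
      case (elim \<omega>)
      have "\<bar>?i (rf Na ha) n k \<omega>\<bar> \<le> ?\<beta> t \<omega> + ?\<gamma> t \<omega>"
        by (rule ok_bnd[OF ab elim s(1,2) s_t[OF k]])
      also have "p \<le> 1 + p\<^sup>2" for p :: real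
      proof -
        have "2 * p \<le> 1 + p\<^sup>2" using sum_squares_bound[of 1 p] by simp
        then show ?thesis using zero_le_power2[of p] by (cases "0 \<le> p") linarith+
      qed
      finally show ?case by (simp add: S_def)
    qed
  qed
  have cross: "RE x (\<lambda>\<omega>. (?i (rf Na ha) n k \<omega>) * (?r (rf Nb hb) n k \<omega>)) \<le>
      RE x (\<lambda>\<omega>. (?i (rf Na ha) n k \<omega>) * (?r (rf Nc hc) n k \<omega>)) +
      \<kappa> * RE x (\<lambda>\<omega>. ?i (rf Na ha) n k \<omega>)"
    if k: "k < Suc n" and ab: "ok Na ha"
      "ok Nb hb" "ok Nc hc" "(Nb, hb, Nc, hc) = (N1, h1, N2, h2) \<or> (Nb, hb, Nc, hc) = (N2, h2, N1, h1)" for n k Na ha Nb hb Nc hc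
  proof -
    note cl = okD(1)[OF ab(1)] okD(1)[OF ab(2)] okD(1)[OF ab(3)] okD(2)[OF ab(1)] okD(2)[OF ab(2)] okD(2)[OF ab(3)]
    note cases = ab(4)
    have le: "EP y (af Nb hb (t - s n (Suc k))) \<le> EP y (af Nc hc (t - s n (Suc k))) + ennreal \<kappa>" for y
    proof -
      have "0 \<le> t - s n (Suc k)" "t - s n (Suc k) \<le> t" using s_t[OF k] s(1)[of n "Suc k"] by auto
      from cmp[OF this, of y] show ?thesis using cases by (elim disjE) simp_all
    qed
    have fin: "EC x (\<lambda>\<omega>. ennreal (rf Na ha (s n (Suc k)) \<omega>)) < \<top>"
    proof -
      have "EC x (\<lambda>\<omega>. ennreal (rf Na ha (s n (Suc k)) \<omega>)) \<le> EC x (\<lambda>\<omega>. ennreal (rf Na ha t \<omega>))"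
        by (rule nn_integral_mono_AE, use AE_CP_good[of x] in eventually_elim)
           (intro ennreal_leI rf_mono[OF cl(1) _ cl(4) s(1) s_t[OF k]])
      also have "\<dots> \<le> ennreal b" by (rule ok_E[OF ab(1)])
      finally show ?thesis by (rule le_less_trans) simp
    qed
    note ip = int_prod[OF k ab(1,2)] int_prod[OF k ab(1,3)] int_inc[OF k ab(1)]
    have nn1: "AE \<omega> in CP x. 0 \<le> ?i (rf Na ha) n k \<omega>"
      using AE_CP_good[of x] by eventually_elim (use rf_mono[OF cl(1) _ cl(4) s(1,2)] in simp)
    have nn2: "AE \<omega> in CP x. 0 \<le> (?i (rf Na ha) n k \<omega>) * (?r (rf Nd hd) n k \<omega>)"
      if "clock Nd" "density_fun hd" for Nd hd
      using AE_CP_good[of x]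
    proof eventually_elim
      case (elim \<omega>)
      show ?case
        using rf_mono[OF cl(1) elim cl(4) s(1,2)] rf_mono[OF that(1) elim that(2) s(1) s_t[OF k]] by simp
    qed
    have "ennreal (RE x (\<lambda>\<omega>. (?i (rf Na ha) n k \<omega>) * (?r (rf Nb hb) n k \<omega>))) \<le>
      ennreal (RE x (\<lambda>\<omega>. (?i (rf Na ha) n k \<omega>) * (?r (rf Nc hc) n k \<omega>))) +
      ennreal \<kappa> * ennreal (RE x (\<lambda>\<omega>. ?i (rf Na ha) n k \<omega>))"
      using cross_compare[OF cl s(1,2) s_t[OF k] le fin]
      unfolding nn_integral_eq_integral[OF ip(1) nn2[OF cl(2,5)]] nn_integral_eq_integral[OF ip(2) nn2[OF cl(3,6)]]
        nn_integral_eq_integral[OF ip(3) nn1] .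
    also have "\<dots> = ennreal (RE x (\<lambda>\<omega>. (?i (rf Na ha) n k \<omega>) * (?r (rf Nc hc) n k \<omega>)) +
      \<kappa> * RE x (\<lambda>\<omega>. ?i (rf Na ha) n k \<omega>))"
      using \<kappa> integral_nonneg_AE[OF nn1] integral_nonneg_AE[OF nn2[OF cl(3,6)]]
      by (simp add: ennreal_mult ennreal_plus)
    finally show ?thesis
      using \<kappa> integral_nonneg_AE[OF nn1] integral_nonneg_AE[OF nn2[OF cl(3,6)]]
      by (subst (asm) ennreal_le_iff) auto
  qed
  define inc where "inc f n k \<omega> = f (s n (Suc k)) \<omega> - f (s n k) \<omega>" for f :: "real \<Rightarrow> 'w \<Rightarrow> real" and n k \<omega>
  define rest where "rest f n k \<omega> = f t \<omega> - f (s n (Suc k)) \<omega>" for f :: "real \<Rightarrow> 'w \<Rightarrow> real" and n k \<omega>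
  \<comment> \<open>The increments of \<open>?d\<close> have no sign, so the product is regrouped:
    \<open>inc ?\<beta>\<close> multiplies \<open>rest ?\<beta> - rest ?\<gamma>\<close>, and
    \<open>inc ?\<gamma>\<close> multiplies \<open>rest ?\<gamma> - rest ?\<beta>\<close>. The first
    factors are nonnegative on good paths, and the Markov comparison bounds each mean by \<kappa>
    times the mean increment.\<close>
  have pair: "RE x (\<lambda>\<omega>. inc ?d n k \<omega> * rest ?d n k \<omega>) \<le> \<kappa> * (RE x (\<lambda>\<omega>. inc ?\<beta> n k \<omega>) + RE x (\<lambda>\<omega>. inc ?\<gamma> n k \<omega>))"
    and pair_int: "integrable (CP x) (\<lambda>\<omega>. inc ?d n k \<omega> * rest ?d n k \<omega>)"
    if k: "k < Suc n" for n k
  proof -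
    have ip: "integrable (CP x) (\<lambda>\<omega>. inc ?\<beta> n k \<omega> * rest ?\<beta> n k \<omega>)" "integrable (CP x) (\<lambda>\<omega>. inc ?\<gamma> n k \<omega> * rest ?\<gamma> n k \<omega>)"
       "integrable (CP x) (\<lambda>\<omega>. inc ?\<beta> n k \<omega> * rest ?\<gamma> n k \<omega>)" "integrable (CP x) (\<lambda>\<omega>. inc ?\<gamma> n k \<omega> * rest ?\<beta> n k \<omega>)"
      unfolding inc_def rest_def using ok12 by (auto intro!: int_prod[OF k])
    have eq: "(\<lambda>\<omega>. inc ?d n k \<omega> * rest ?d n k \<omega>) = (\<lambda>\<omega>. (inc ?\<beta> n k \<omega> * rest ?\<beta> n k \<omega> + inc ?\<gamma> n k \<omega> * rest ?\<gamma> n k \<omega>)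
        - (inc ?\<beta> n k \<omega> * rest ?\<gamma> n k \<omega> + inc ?\<gamma> n k \<omega> * rest ?\<beta> n k \<omega>))"
      by (rule ext) (simp add: inc_def rest_def algebra_simps)
    show "integrable (CP x) (\<lambda>\<omega>. inc ?d n k \<omega> * rest ?d n k \<omega>)" unfolding eq using ip by simp
    have "RE x (\<lambda>\<omega>. inc ?d n k \<omega> * rest ?d n k \<omega>) =
      (RE x (\<lambda>\<omega>. inc ?\<beta> n k \<omega> * rest ?\<beta> n k \<omega>) + RE x (\<lambda>\<omega>. inc ?\<gamma> n k \<omega> * rest ?\<gamma> n k \<omega>)) -
      (RE x (\<lambda>\<omega>. inc ?\<beta> n k \<omega> * rest ?\<gamma> n k \<omega>) + RE x (\<lambda>\<omega>. inc ?\<gamma> n k \<omega> * rest ?\<beta> n k \<omega>))"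
      unfolding eq using ip by simp
    moreover have "RE x (\<lambda>\<omega>. inc ?\<beta> n k \<omega> * rest ?\<beta> n k \<omega>) \<le> RE x (\<lambda>\<omega>. inc ?\<beta> n k \<omega> * rest ?\<gamma> n k \<omega>) + \<kappa> * RE x (\<lambda>\<omega>. inc ?\<beta> n k \<omega>)"
      "RE x (\<lambda>\<omega>. inc ?\<gamma> n k \<omega> * rest ?\<gamma> n k \<omega>) \<le> RE x (\<lambda>\<omega>. inc ?\<gamma> n k \<omega> * rest ?\<beta> n k \<omega>) + \<kappa> * RE x (\<lambda>\<omega>. inc ?\<gamma> n k \<omega>)"
    proof -
      show "RE x (\<lambda>\<omega>. inc ?\<gamma> n k \<omega> * rest ?\<gamma> n k \<omega>) \<le> RE x (\<lambda>\<omega>. inc ?\<gamma> n k \<omega> * rest ?\<beta> n k \<omega>) + \<kappa> * RE x (\<lambda>\<omega>. inc ?\<gamma> n k \<omega>)"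
        unfolding inc_def rest_def by (rule cross[OF k ok12(2,2,1)]) simp
      show "RE x (\<lambda>\<omega>. inc ?\<beta> n k \<omega> * rest ?\<beta> n k \<omega>) \<le> RE x (\<lambda>\<omega>. inc ?\<beta> n k \<omega> * rest ?\<gamma> n k \<omega>) + \<kappa> * RE x (\<lambda>\<omega>. inc ?\<beta> n k \<omega>)"
        unfolding inc_def rest_def by (rule cross[OF k ok12(1,1,2)]) simp
    qed
    ultimately show "RE x (\<lambda>\<omega>. inc ?d n k \<omega> * rest ?d n k \<omega>) \<le> \<kappa> * (RE x (\<lambda>\<omega>. inc ?\<beta> n k \<omega>) + RE x (\<lambda>\<omega>. inc ?\<gamma> n k \<omega>))"
      by (simp only: distrib_left)
  qed
  have sum_inc: "(\<Sum>k<Suc n. inc f n k \<omega>) = f t \<omega>" if "f 0 \<omega> = 0" for f n \<omega>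
  proof -
    have "s n (Suc n) = t" using s(4) by (simp add: s_def)
    moreover have "s n 0 = 0" by (simp add: s_def)
    ultimately show ?thesis unfolding inc_def by (subst sum_lessThan_telescope) (simp add: that)
  qed
  have mean: "RE x (\<lambda>\<omega>. rf Na ha t \<omega>) \<le> b" if "ok Na ha" for Na ha
  proof (rule integral_real_bounded[OF b(3)])
    show "EC x (\<lambda>\<omega>. ennreal (rf Na ha t \<omega>)) \<le> ennreal b" by (rule ok_E[OF that])
  qed
  define Q where "Q n \<omega> = (\<Sum>k<Suc n. (inc ?d n k \<omega>)\<^sup>2)" for n \<omega>
  have Q_meas: "Q n \<in> borel_measurable (CP x)" for n unfolding Q_def inc_def by measurable
  have Q_bound: "AE \<omega> in CP x. norm (Q n \<omega>) \<le> S \<omega>" for n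
    using AE_CP_good[of x]
  proof eventually_elim
    case (elim \<omega>)
    let ?V = "?\<beta> t \<omega> + ?\<gamma> t \<omega>"
    have "Q n \<omega> \<le> (\<Sum>k<Suc n. (inc ?\<beta> n k \<omega> + inc ?\<gamma> n k \<omega>) * ?V)"
      unfolding Q_def
    proof (rule sum_mono)
      fix k assume "k \<in> {..<Suc n}"
      then have k: "k < Suc n" by simp
      have 1: "0 \<le> inc ?\<beta> n k \<omega>" "0 \<le> inc ?\<gamma> n k \<omega>"
        using rf_mono[OF N(1) elim h(1) s(1,2)] rf_mono[OF N(2) elim h(2) s(1,2)] by (auto simp: inc_def)
      have d: "inc ?d n k \<omega> = inc ?\<beta> n k \<omega> - inc ?\<gamma> n k \<omega>" by (simp add: inc_def)
      have 2: "\<bar>inc ?d n k \<omega>\<bar> \<le> inc ?\<beta> n k \<omega> + inc ?\<gamma> n k \<omega>" unfolding d using 1 by linarith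
      have 3: "\<bar>inc ?d n k \<omega>\<bar> \<le> ?V"
        unfolding d using 1 bnd[OF elim s(1,2) s_t[OF k]] unfolding inc_def by linarith
      have "(inc ?d n k \<omega>)\<^sup>2 = \<bar>inc ?d n k \<omega>\<bar> * \<bar>inc ?d n k \<omega>\<bar>" by (simp add: power2_eq_square)
      also have "\<dots> \<le> (inc ?\<beta> n k \<omega> + inc ?\<gamma> n k \<omega>) * ?V" using 1 2 3 by (intro mult_mono) auto
      finally show "(inc ?d n k \<omega>)\<^sup>2 \<le> (inc ?\<beta> n k \<omega> + inc ?\<gamma> n k \<omega>) * ?V" .
    qed
    also have "\<dots> = ((\<Sum>k<Suc n. inc ?\<beta> n k \<omega>) + (\<Sum>k<Suc n. inc ?\<gamma> n k \<omega>)) * ?V"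
      by (simp only: sum_distrib_right[symmetric] sum.distrib)
    also have "\<dots> = S \<omega>" unfolding sum_inc[of ?\<beta>, OF rf_zero] sum_inc[of ?\<gamma>, OF rf_zero] S_def by (simp add: power2_eq_square)
    finally show ?case unfolding Q_def by (simp add: sum_nonneg del: sum.lessThan_Suc)
  qed
  have Q_int: "integrable (CP x) (Q n)" for n
    by (rule Bochner_Integration.integrable_bound[OF S_int Q_meas])
       (use Q_bound[of n] in eventually_elim, simp add: S_def)
  have Q_lim: "(\<lambda>n. \<integral>\<omega>. Q n \<omega> \<partial>CP x) \<longlonglongrightarrow> (RE x (\<lambda>\<omega>. 0))"
  proof (rule integral_dominated_convergence[OF _ Q_meas S_int _ Q_bound])
    show "AE \<omega> in CP x. (\<lambda>n. Q n \<omega>) \<longlonglongrightarrow> 0"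
      using AE_CP_good[of x]
    proof eventually_elim
      case (elim \<omega>)
      show ?case
        unfolding Q_def inc_def s_def
        by (rule quadratic_variation_tendsto_0[of t "\<lambda>v. ?\<beta> v \<omega>" "\<lambda>v. ?\<gamma> v \<omega>", OF t
              rf_continuous[OF N(1) elim h(1)] rf_continuous[OF N(2) elim h(2)]])
           (auto intro: rf_mono[OF N(1) elim h(1)] rf_mono[OF N(2) elim h(2)])
    qed
  qed simp
  have decomp: "(?d t \<omega>)\<^sup>2 = Q n \<omega> + 2 * (\<Sum>k<Suc n. inc ?d n k \<omega> * rest ?d n k \<omega>)" for n \<omega>
    using square_sum_increments[of "\<lambda>k. ?d (s n k) \<omega>" "Suc n"] unfolding s(4) Q_def inc_def rest_def
    by (simp add: s_def rf_zero del: sum.lessThan_Suc)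
  have R_int: "integrable (CP x) (\<lambda>\<omega>. \<Sum>k<Suc n. inc ?d n k \<omega> * rest ?d n k \<omega>)" for n
    by (intro Bochner_Integration.integrable_sum pair_int) simp
  show "integrable (CP x) (\<lambda>\<omega>. (?d t \<omega>)\<^sup>2)"
    unfolding decomp[of _ 0] using Q_int[of 0] R_int[of 0] by (intro Bochner_Integration.integrable_add integrable_mult_right)
  \<comment> \<open>The constant 4 b \<kappa> is the factor 2 of the cross terms times \<kappa>
    times the sum of the two mean totals, each at most \<open>b\<close>.\<close>
  have bound: "RE x (\<lambda>\<omega>. (?d t \<omega>)\<^sup>2) \<le> RE x (\<lambda>\<omega>. Q n \<omega>) + 4 * b * \<kappa>" for n
  proof -
    have "RE x (\<lambda>\<omega>. (?d t \<omega>)\<^sup>2) = RE x (\<lambda>\<omega>. Q n \<omega>) + 2 * (\<Sum>k<Suc n. \<integral>\<omega>. inc ?d n k \<omega> * rest ?d n k \<omega> \<partial>CP x)"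
      unfolding decomp[of _ n]
      by (subst Bochner_Integration.integral_add[OF Q_int integrable_mult_right[OF R_int]])
         (subst integral_mult_right_zero, subst Bochner_Integration.integral_sum, use pair_int in auto)
    also have "(\<Sum>k<Suc n. \<integral>\<omega>. inc ?d n k \<omega> * rest ?d n k \<omega> \<partial>CP x)
        \<le> (\<Sum>k<Suc n. \<kappa> * (RE x (\<lambda>\<omega>. inc ?\<beta> n k \<omega>) + RE x (\<lambda>\<omega>. inc ?\<gamma> n k \<omega>)))"
      by (intro sum_mono pair) simp
    also have "\<dots> = \<kappa> * (RE x (\<lambda>\<omega>. (\<Sum>k<Suc n. inc ?\<beta> n k \<omega>)) + RE x (\<lambda>\<omega>. (\<Sum>k<Suc n. inc ?\<gamma> n k \<omega>)))"
    proof -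
      have "integrable (CP x) (inc ?\<beta> n k)" "integrable (CP x) (inc ?\<gamma> n k)" if "k < Suc n" for k
        unfolding inc_def[abs_def] by (rule int_inc[OF that ok12(1)], rule int_inc[OF that ok12(2)])
      then show ?thesis
        by (subst (1 2) Bochner_Integration.integral_sum) (auto simp only: sum_distrib_left[symmetric] sum.distrib lessThan_iff)
    qed
    also have "\<dots> = \<kappa> * (RE x (\<lambda>\<omega>. ?\<beta> t \<omega>) + RE x (\<lambda>\<omega>. ?\<gamma> t \<omega>))"
      by (simp only: sum_inc[of ?\<beta>, OF rf_zero] sum_inc[of ?\<gamma>, OF rf_zero])
    also have "\<dots> \<le> \<kappa> * (b + b)" using mean[OF ok12(1)] mean[OF ok12(2)] \<kappa> by (intro mult_left_mono add_mono) auto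
    finally show ?thesis by (simp add: algebra_simps)
  qed
  have "(\<lambda>n. RE x (\<lambda>\<omega>. Q n \<omega>) + 4 * b * \<kappa>) \<longlonglongrightarrow> 0 + 4 * b * \<kappa>"
    using Q_lim by (intro tendsto_add tendsto_const) simp
  from LIMSEQ_le_const[OF this] show "RE x (\<lambda>\<omega>. (?d t \<omega>)\<^sup>2) \<le> 4 * b * \<kappa>"
    using bound by simp
qed

end

section \<open>Potentials of measures in the local Kato class\<close>

text \<open>The same dyadic sampling for values in \<open>ennreal\<close>, with right-continuity
  phrased by sequences strictly to the right, the form that dominated convergence delivers.\<close>

lemma right_continuous_ennreal_measurable:
  fixes f :: "real \<Rightarrow> 'w \<Rightarrow> ennreal"
  assumes m: "\<And>t. 0 \<le> t \<Longrightarrow> f t \<in> borel_measurable M"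
    and rc: "\<And>t \<omega> z. 0 \<le> t \<Longrightarrow> \<omega> \<in> space M \<Longrightarrow> z \<longlonglongrightarrow> t \<Longrightarrow> (\<And>n::nat. t < z n) \<Longrightarrow> (\<lambda>n. f (z n) \<omega>) \<longlonglongrightarrow> f t \<omega>"
  shows "(\<lambda>(t, \<omega>). f (max 0 t) \<omega>) \<in> borel_measurable (borel \<Otimes>\<^sub>M M)"
proof (rule borel_measurable_LIMSEQ_order)
  fix n :: nat
  let ?g = "\<lambda>i::int. \<lambda>p::real \<times> 'w. f (max 0 ((of_int i + 1) / 2^n)) (snd p)"
  have "(\<lambda>p. ?g \<lfloor>2^n * max 0 (fst p)\<rfloor> p) \<in> borel_measurable (borel \<Otimes>\<^sub>M M)"
  proof (rule measurable_compose_countable[where f="?g" and g="\<lambda>p. \<lfloor>2^n * max 0 (fst p) :: real\<rfloor>"])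
    show "?g i \<in> borel_measurable (borel \<Otimes>\<^sub>M M)" for i
      by (rule measurable_compose[OF measurable_snd m]) simp
    show "(\<lambda>p. \<lfloor>2^n * max 0 (fst p) :: real\<rfloor>) \<in> (borel \<Otimes>\<^sub>M M) \<rightarrow>\<^sub>M count_space UNIV"
      using measurable_compose[OF measurable_fst, of "\<lambda>t::real. \<lfloor>2^n * max 0 t\<rfloor>" borel "count_space UNIV"] by simp
  qed
  then show "(\<lambda>p. ?g \<lfloor>2^n * max 0 (fst p)\<rfloor> p) \<in> borel_measurable (borel \<Otimes>\<^sub>M M)" .
next
  fix p :: "real \<times> 'w" assume "p \<in> space (borel \<Otimes>\<^sub>M M)"
  then obtain t \<omega> where p: "p = (t, \<omega>)" "\<omega> \<in> space M" by (cases p) (auto simp: space_pair_measure)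
  have "(\<lambda>n. f ((of_int \<lfloor>2^n * max 0 t\<rfloor> + 1) / 2^n) \<omega>) \<longlonglongrightarrow> f (max 0 t) \<omega>"
    by (rule rc[OF _ p(2) dyadic_ceiling_tendsto dyadic_ceiling_gt]) simp
  moreover have "max 0 ((of_int \<lfloor>2^n * max 0 t\<rfloor> + 1) / 2^n) = (of_int \<lfloor>2^n * max 0 t\<rfloor> + 1) / (2^n :: real)" for n
    using dyadic_ceiling_gt[of "max 0 t" n] by linarith
  ultimately show "(\<lambda>n. f (max 0 ((of_int \<lfloor>2^n * max 0 (fst p)\<rfloor> + 1) / 2^n)) (snd p)) \<longlonglongrightarrow> (case p of (t, \<omega>) \<Rightarrow> f (max 0 t) \<omega>)"
    by (simp add: p)
qed

lemma nn_integral_exp_interval: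
  assumes "0 < \<alpha>" "0 \<le> v"
  shows "(\<integral>\<^sup>+u. ennreal (\<alpha> * exp (- \<alpha> * (w - u))) * indicator {0..v} u \<partial>lborel) =
    ennreal (exp (- \<alpha> * (w - v)) - exp (- \<alpha> * w))"
proof -
  have "(\<integral>\<^sup>+u. ennreal (\<alpha> * exp (- \<alpha> * (w - u))) * indicator {0..v} u \<partial>lborel) =
      ennreal (exp (- \<alpha> * (w - v)) - exp (- \<alpha> * (w - 0)))"
    by (rule nn_integral_FTC_Icc[where F="\<lambda>u. exp (- \<alpha> * (w - u))"])
       (use assms in \<open>auto intro!: derivative_eq_intros\<close>)
  then show ?thesis by simp
qed

locale kato_process = additive_process X A \<Lambda>
  for X :: "('w, 's::heine_borel) process" and A \<Lambda> +
  fixes p :: "real \<Rightarrow> 's \<Rightarrow> 's \<Rightarrow> ennreal" and \<mu> :: "'s measure"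
  assumes p_measurable: "(\<lambda>(t, x, y). p t x y) \<in> borel_measurable (restrict_space borel ({0<..} \<times> UNIV))"
    and p_finite: "0 < t \<Longrightarrow> p t x y < \<top>"
    and p_continuous: "continuous_on ({0<..} \<times> UNIV \<times> UNIV) (\<lambda>(t, x, y). p t x y)"
    and revuz: "revuz_correspondence X p \<mu> A"
    and kato: "local_kato_class X p \<mu>"
begin

lemma sets_\<mu> [measurable_cong]: "sets \<mu> = sets borel"
  using kato by (simp add: local_kato_class_def radon_measure_def)

lemma \<mu>_compact: "compact K \<Longrightarrow> emeasure \<mu> K < \<top>"
  using kato by (simp add: local_kato_class_def radon_measure_def)

lemma p_borel: "(\<lambda>(t, x, y). indicator {0<..} t * p t x y) \<in> borel_measurable (borel :: (real \<times> 's \<times> 's) measure)"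
proof -
  have "{0<..} \<times> UNIV \<in> sets (borel :: (real \<times> 's \<times> 's) measure)"
    by (intro borel_open open_Times) auto
  then have "(\<lambda>q. (case q of (t, x, y) \<Rightarrow> p t x y) * indicator ({0<..} \<times> UNIV) q) \<in> borel_measurable borel"
    using p_measurable by (subst (asm) borel_measurable_restrict_space_iff_ennreal) auto
  moreover have "(\<lambda>q. (case q of (t, x, y) \<Rightarrow> p t x y) * indicator ({0<..} \<times> UNIV) q) = (\<lambda>(t, x, y). indicator {0<..} t * p t x y)"
    by (auto simp: fun_eq_iff indicator_def)
  ultimately show ?thesis by simp
qed

lemma p_borel_pair:
  "(\<lambda>(y, t). indicator {0<..} t * p t x y) \<in> borel_measurable (borel \<Otimes>\<^sub>M borel)"
proof -
  have "(\<lambda>q::'s \<times> real. (snd q, x, fst q)) \<in> borel_measurable borel"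
    by (intro borel_measurable_continuous_onI continuous_intros)
  from measurable_compose[OF this p_borel] show ?thesis
    by (simp add: borel_prod case_prod_beta)
qed

definition time_kernel :: "(real \<Rightarrow> ennreal) \<Rightarrow> 's \<Rightarrow> 's \<Rightarrow> ennreal" where
  "time_kernel k x y = (\<integral>\<^sup>+t. k t * (indicator {0<..} t * p t x y) \<partial>lborel)"

lemma time_kernel_measurable:
  assumes [measurable]: "k \<in> borel_measurable borel"
  shows "time_kernel k x \<in> borel_measurable borel"
proof -
  have "(\<lambda>(y, t). k t * (indicator {0<..} t * p t x y)) \<in> borel_measurable (borel \<Otimes>\<^sub>M lborel)"
  proof -
    have "(\<lambda>q. k (snd q) * (case q of (y, t) \<Rightarrow> indicator {0<..} t * p t x y)) \<in> borel_measurable (borel \<Otimes>\<^sub>M borel)"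
      using p_borel_pair[of x] by measurable
    then show ?thesis by (simp add: case_prod_beta cong: measurable_cong_sets)
  qed
  from lborel.borel_measurable_nn_integral_fst[OF this] show ?thesis
    by (simp add: time_kernel_def[abs_def])
qed

text \<open>For k t = exp (- \<alpha> t) this is the \<alpha>-potential of \<phi>\<mu>. A general
  time weight \<open>k\<close> lets the truncated potential and the two error terms be treated by
  monotonicity and linearity in \<open>k\<close>.\<close>

definition kernel_potential :: "(real \<Rightarrow> ennreal) \<Rightarrow> ('s \<Rightarrow> real) \<Rightarrow> 's \<Rightarrow> ennreal" where
  "kernel_potential k \<phi> x = (\<integral>\<^sup>+y. ennreal (\<phi> y) * time_kernel k x y \<partial>\<mu>)"

lemma potential_eq:
  assumes [measurable]: "f \<in> borel_measurable borel"
  shows "potential p \<alpha> (density \<mu> f) x = (\<integral>\<^sup>+y. f y * time_kernel (\<lambda>t. ennreal (exp (- \<alpha> * t))) x y \<partial>\<mu>)"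
proof -
  have tk: "time_kernel (\<lambda>t. ennreal (exp (- \<alpha> * t))) x \<in> borel_measurable borel"
    by (rule time_kernel_measurable) measurable
  have "(\<integral>\<^sup>+ t. indicator {0<..} t * (ennreal (exp (- \<alpha> * t)) * p t x y) \<partial>lborel) = time_kernel (\<lambda>t. ennreal (exp (- \<alpha> * t))) x y" for y
    unfolding time_kernel_def by (intro nn_integral_cong) (simp add: ac_simps)
  then have "potential p \<alpha> (density \<mu> f) x = (\<integral>\<^sup>+y. time_kernel (\<lambda>t. ennreal (exp (- \<alpha> * t))) x y \<partial>density \<mu> f)"
    by (simp add: potential_def)
  also have "\<dots> = (\<integral>\<^sup>+y. f y * time_kernel (\<lambda>t. ennreal (exp (- \<alpha> * t))) x y \<partial>\<mu>)"
    by (rule nn_integral_density) (use tk in \<open>auto cong: measurable_cong_sets simp: sets_\<mu>\<close>)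
  finally show ?thesis .
qed

lemma kernel_potential_mono:
  assumes "\<And>t. 0 < t \<Longrightarrow> k t \<le> k' t"
  shows "kernel_potential k \<phi> x \<le> kernel_potential k' \<phi> x"
proof -
  have "k t * (indicator {0<..} t * p t x y) \<le> k' t * (indicator {0<..} t * p t x y)" for t y
    using assms[of t] by (cases "0 < t") (auto intro: mult_right_mono)
  then show ?thesis
    unfolding kernel_potential_def time_kernel_def by (intro nn_integral_mono mult_left_mono) auto
qed

lemma p_time: "(\<lambda>t. indicator {0<..} t * p t x y) \<in> borel_measurable borel"
proof -
  have "(\<lambda>t. (y, t)) \<in> borel \<rightarrow>\<^sub>M borel \<Otimes>\<^sub>M borel" by measurable
  from measurable_compose[OF this p_borel_pair] show ?thesis by simp
qed

lemma kernel_potential_add: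
  assumes k: "k \<in> borel_measurable borel" "k' \<in> borel_measurable borel" and [measurable]: "\<phi> \<in> borel_measurable borel"
  shows "kernel_potential (\<lambda>t. k t + k' t) \<phi> x = kernel_potential k \<phi> x + kernel_potential k' \<phi> x"
proof -
  have [measurable]: "time_kernel k x \<in> borel_measurable borel" "time_kernel k' x \<in> borel_measurable borel"
    by (rule time_kernel_measurable[OF k(1)], rule time_kernel_measurable[OF k(2)])
  have m: "(\<lambda>t. l t * (indicator {0<..} t * p t x y)) \<in> borel_measurable lborel" if "l \<in> borel_measurable borel" for l y
    using borel_measurable_times_ennreal[OF that p_time] by simp
  have eq: "time_kernel (\<lambda>t. k t + k' t) x y = time_kernel k x y + time_kernel k' x y" for y
    unfolding time_kernel_def distrib_right by (rule nn_integral_add[OF m[OF k(1)] m[OF k(2)]])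
  show ?thesis
    unfolding kernel_potential_def eq distrib_left by (rule nn_integral_add) measurable
qed

lemma kernel_potential_cmult:
  assumes k: "k \<in> borel_measurable borel" and [measurable]: "\<phi> \<in> borel_measurable borel"
  shows "kernel_potential (\<lambda>t. c * k t) \<phi> x = c * kernel_potential k \<phi> x"
proof -
  have [measurable]: "time_kernel k x \<in> borel_measurable borel" by (rule time_kernel_measurable[OF k])
  have m: "(\<lambda>t. k t * (indicator {0<..} t * p t x y)) \<in> borel_measurable lborel" for y
    using borel_measurable_times_ennreal[OF k p_time] by simp
  have eq: "time_kernel (\<lambda>t. c * k t) x y = c * time_kernel k x y" for y
    unfolding time_kernel_def mult.assoc by (rule nn_integral_cmult[OF m])
  show ?thesis
    unfolding kernel_potential_def eq mult.left_commute[of _ c] by (rule nn_integral_cmult) measurable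
qed

definition compact_weight :: "('s \<Rightarrow> real) \<Rightarrow> 's set \<Rightarrow> bool" where
  "compact_weight \<phi> K \<longleftrightarrow> continuous_on UNIV \<phi> \<and> (\<forall>x. 0 \<le> \<phi> x \<and> \<phi> x \<le> 1) \<and> compact K \<and> (\<forall>x. x \<notin> K \<longrightarrow> \<phi> x = 0)"

lemma compact_weightD:
  assumes "compact_weight \<phi> K"
  shows "continuous_on UNIV \<phi>" "0 \<le> \<phi> x" "\<phi> x \<le> 1" "compact K" "x \<notin> K \<Longrightarrow> \<phi> x = 0"
    "\<phi> \<in> borel_measurable borel" "density_fun \<phi>"
  using assms by (auto simp: compact_weight_def density_fun_def intro: borel_measurable_continuous_onI)

abbreviation discount :: "real \<Rightarrow> real \<Rightarrow> ennreal" where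
  "discount \<alpha> t \<equiv> ennreal (exp (- \<alpha> * t))"

definition kato_norm :: "'s set \<Rightarrow> real \<Rightarrow> ennreal" where
  "kato_norm K \<alpha> = (SUP x. potential p \<alpha> (density \<mu> (indicator K)) x)"

lemma kato_norm_tendsto: "compact K \<Longrightarrow> (kato_norm K \<longlongrightarrow> 0) at_top"
  unfolding kato_norm_def[abs_def] using kato by (simp add: local_kato_class_def)

lemma kernel_potential_le_kato_norm:
  assumes "compact_weight \<phi> K"
  shows "kernel_potential (discount \<alpha>) \<phi> x \<le> kato_norm K \<alpha>"
proof -
  have "kernel_potential (discount \<alpha>) \<phi> x \<le> (\<integral>\<^sup>+y. indicator K y * time_kernel (discount \<alpha>) x y \<partial>\<mu>)"
    unfolding kernel_potential_def
  proof (intro nn_integral_mono mult_right_mono)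
    fix y show "ennreal (\<phi> y) \<le> indicator K y"
      using compact_weightD(3,5)[OF assms, of y] by (cases "y \<in> K") (auto simp: indicator_def)
  qed simp
  also have "\<dots> = potential p \<alpha> (density \<mu> (indicator K)) x"
    using compact_weightD(4)[OF assms] by (intro potential_eq[symmetric] borel_measurable_indicator borel_compact)
  also have "\<dots> \<le> kato_norm K \<alpha>" unfolding kato_norm_def by (rule SUP_upper) simp
  finally show ?thesis .
qed

section \<open>Discounted functionals and the Revuz correspondence\<close>

lemma dA_atMost_0:
  assumes "good \<omega>" shows "emeasure (dA \<omega>) {-1<..0} = 0"
  using dA(4)[OF assms, of "-1" 0] clock_value_neg[of "-1" \<omega>] by simp

lemma nn_integral_additive_measure:
  assumes g: "good \<omega>" and f: "f \<in> borel_measurable borel"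
  shows "(\<integral>\<^sup>+t. f t \<partial>additive_measure X A \<omega>) = (\<integral>\<^sup>+t. f t * indicator {0<..} t \<partial>dA \<omega>)"
proof -
  have sb[measurable_cong]: "sets (dA \<omega>) = sets borel" by (rule clock_sets[OF clock_dA g])
  have "{t. 0 \<le> t \<and> ennreal t < lifetime X \<omega>} = {0..}" using g by (auto simp: good_def)
  then have "(\<integral>\<^sup>+t. f t \<partial>additive_measure X A \<omega>) = (\<integral>\<^sup>+t. f t * indicator {0..} t \<partial>dA \<omega>)"
    unfolding additive_measure_def dA_def[symmetric]
    by (subst nn_integral_restrict_space) (auto simp: sb sets_eq_imp_space_eq[OF sb])
  also have "\<dots> = (\<integral>\<^sup>+t. f t * indicator {0<..} t \<partial>dA \<omega>)"
  proof (rule nn_integral_cong_AE)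
    have "AE t in dA \<omega>. t \<notin> {-1<..0}"
      using dA_atMost_0[OF g] by (intro AE_not_in) (auto simp: null_sets_def sb)
    then show "AE t in dA \<omega>. f t * indicator {0..} t = f t * indicator {0<..} t"
      by eventually_elim (auto simp: indicator_def)
  qed
  finally show ?thesis .
qed

definition discounted :: "real \<Rightarrow> ('s \<Rightarrow> real) \<Rightarrow> 'w \<Rightarrow> ennreal" where
  "discounted \<alpha> \<phi> \<omega> = (\<integral>\<^sup>+w. discount \<alpha> w * ennreal (\<phi> (pos \<omega> w)) * indicator {0<..} w \<partial>dA \<omega>)"

lemma weight_state_measurable:
  assumes "compact_weight \<phi> K" "good \<omega>"
  shows "(\<lambda>w. ennreal (\<phi> (pos \<omega> w))) \<in> borel_measurable borel"
  using functional_measurable[OF assms(2) density_fun_joint[OF compact_weightD(7)[OF assms(1)]]] by simp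

lemma expectation_discounted:
  assumes \<phi>: "compact_weight \<phi> K" and "0 < \<alpha>"
  shows "EP x (\<lambda>\<omega>. discounted \<alpha> \<phi> \<omega>) = kernel_potential (discount \<alpha>) \<phi> x"
proof -
  have f: "(\<lambda>y. ennreal (\<phi> y)) \<in> borel_measurable borel" using compact_weightD(6)[OF \<phi>] by measurable
  have "EP x (\<lambda>\<omega>. discounted \<alpha> \<phi> \<omega>) =
    (\<integral>\<^sup>+ \<omega>. (\<integral>\<^sup>+ t. discount \<alpha> t * ennreal (\<phi> (pos \<omega> t)) \<partial>additive_measure X A \<omega>) \<partial>prob_from X (Some x))"
  proof (rule nn_integral_cong_AE, use AE_good[of x] in eventually_elim)
    fix \<omega> assume g: "good \<omega>"
    show "discounted \<alpha> \<phi> \<omega> = (\<integral>\<^sup>+ t. discount \<alpha> t * ennreal (\<phi> (pos \<omega> t)) \<partial>additive_measure X A \<omega>)"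
      unfolding discounted_def using weight_state_measurable[OF \<phi> g]
      by (subst nn_integral_additive_measure[OF g]) auto
  qed
  also have "\<dots> = potential p \<alpha> (density \<mu> (\<lambda>y. ennreal (\<phi> y))) x"
    by (rule revuz[unfolded revuz_correspondence_def, rule_format, OF assms(2) f])
  also have "\<dots> = kernel_potential (discount \<alpha>) \<phi> x"
    unfolding kernel_potential_def by (rule potential_eq[OF f])
  finally show ?thesis .
qed

text \<open>An increasing limit of functionals over (0, n] with the time-dependent density
  \<open>h\<close>. The exponent uses \<open>max 0 w\<close>, which keeps \<open>h\<close> bounded
  by 1 also at negative times, where it is never integrated.\<close>

lemma discounted_adapted:
  assumes \<phi>: "compact_weight \<phi> K" and \<alpha>: "0 < \<alpha>"
  shows "adapted_at \<top> (discounted \<alpha> \<phi>)"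
proof -
  define h where "h w x = exp (- \<alpha> * max 0 w) * \<phi> x" for w :: real and x
  have hc: "continuous_on UNIV (\<lambda>(w, x). h w x)"
    unfolding h_def case_prod_beta
    using continuous_on_compose2[OF compact_weightD(1)[OF \<phi>] continuous_on_snd[OF continuous_on_id], of UNIV]
    by (auto intro!: continuous_intros)
  have h0: "0 \<le> h w x" and h1: "h w x \<le> 1" for w x
    using compact_weightD(2,3)[OF \<phi>, of x] \<alpha> by (auto simp: h_def intro!: mult_le_one)
  have "\<exists>V\<in>borel_measurable (augmented_filtration X \<top>). \<forall>\<omega>. good \<omega> \<longrightarrow> functional dA h (real n) \<omega> = V \<omega>" for n :: nat
    using adapted_later[OF functional_adapted[OF clock_dA hc h0 h1, of "real n"], of \<top>]
    unfolding adapted_at_def by simp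
  then obtain V where V: "\<And>n. V n \<in> borel_measurable (augmented_filtration X \<top>)"
    "\<And>n \<omega>. good \<omega> \<Longrightarrow> functional dA h (real n) \<omega> = V n \<omega>" by metis
  have "discounted \<alpha> \<phi> \<omega> = (SUP n. V n \<omega>)" if g: "good \<omega>" for \<omega>
  proof -
    have sb[measurable_cong]: "sets (dA \<omega>) = sets borel" by (rule clock_sets[OF clock_dA g])
    have [measurable]: "(\<lambda>w. ennreal (\<phi> (pos \<omega> w))) \<in> borel_measurable borel" by (rule weight_state_measurable[OF \<phi> g])
    let ?F = "\<lambda>w. discount \<alpha> w * ennreal (\<phi> (pos \<omega> w))"
    have sup: "(SUP n::nat. ?F w * indicator {0<..real n} w) = ?F w * indicator {0<..} w" for w
    proof (rule antisym)
      show "(SUP n::nat. ?F w * indicator {0<..real n} w) \<le> ?F w * indicator {0<..} w"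
        by (intro SUP_least mult_left_mono) (auto simp: indicator_def)
      obtain n where "w \<le> real n" using real_arch_simple by blast
      then show "?F w * indicator {0<..} w \<le> (SUP n::nat. ?F w * indicator {0<..real n} w)"
        by (intro SUP_upper2[of n]) (auto simp: indicator_def)
    qed
    have "discounted \<alpha> \<phi> \<omega> = (\<integral>\<^sup>+w. (SUP n::nat. ?F w * indicator {0<..real n} w) \<partial>dA \<omega>)"
      unfolding discounted_def sup ..
    also have "\<dots> = (SUP n::nat. \<integral>\<^sup>+w. ?F w * indicator {0<..real n} w \<partial>dA \<omega>)"
      by (rule nn_integral_monotone_convergence_SUP)
         (auto simp: incseq_def le_fun_def indicator_def)
    also have "\<dots> = (SUP n. V n \<omega>)"
    proof (rule SUP_cong[OF refl])
      fix n
      have "(\<integral>\<^sup>+w. ?F w * indicator {0<..real n} w \<partial>dA \<omega>) = functional dA h (real n) \<omega>"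
        unfolding functional_def
        by (intro nn_integral_cong) (auto simp: indicator_def h_def ennreal_mult' max_def)
      then show "(\<integral>\<^sup>+w. ?F w * indicator {0<..real n} w \<partial>dA \<omega>) = V n \<omega>"
        using V(2)[OF g] by simp
    qed
    finally show ?thesis .
  qed
  then show ?thesis
    unfolding adapted_at_def using V(1) by (intro bexI[of _ "\<lambda>\<omega>. SUP n. V n \<omega>"]) auto
qed

lemma discounted_shift:
  assumes \<phi>: "compact_weight \<phi> K" and g: "good \<omega>" and s: "0 \<le> s"
  shows "discounted \<alpha> \<phi> (shifted s \<omega>) =
    (\<integral>\<^sup>+w. discount \<alpha> (w - s) * ennreal (\<phi> (pos \<omega> w)) * indicator {s<..} w \<partial>dA \<omega>)"
proof -
  have g': "good (shifted s \<omega>)" by (rule good_shift[OF g]) simp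
  have "(\<lambda>w. discount \<alpha> w * ennreal (\<phi> (pos (shifted s \<omega>) w))) \<in> borel_measurable borel"
    using weight_state_measurable[OF \<phi> g'] by measurable
  from clock_shift[OF clock_dA g s this]
  have "discounted \<alpha> \<phi> (shifted s \<omega>) =
    (\<integral>\<^sup>+w. discount \<alpha> (w - s) * ennreal (\<phi> (pos (shifted s \<omega>) (w - s))) * indicator {s<..} w \<partial>dA \<omega>)"
    by (simp add: discounted_def)
  also have "\<dots> = (\<integral>\<^sup>+w. discount \<alpha> (w - s) * ennreal (\<phi> (pos \<omega> w)) * indicator {s<..} w \<partial>dA \<omega>)"
    by (intro nn_integral_cong) (auto simp: indicator_def state_at_shift[OF g s])
  finally show ?thesis .
qed

text \<open>Up to time \<open>t\<close> the discount factor is at least exp (- \<alpha> t). Together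
  with the Revuz correspondence this bounds the mean of the functional by a Kato norm, uniformly in
  the starting point.\<close>

lemma af_le_discounted:
  assumes "0 \<le> \<alpha>" "good \<omega>" "compact_weight \<phi> K"
  shows "af dA \<phi> t \<omega> \<le> ennreal (exp (\<alpha> * t)) * discounted \<alpha> \<phi> \<omega>"
proof -
  note that = assms(2,3)
  have [measurable_cong]: "sets (dA \<omega>) = sets borel" by (rule clock_sets[OF clock_dA that(1)])
  have [measurable]: "(\<lambda>w. ennreal (\<phi> (pos \<omega> w))) \<in> borel_measurable borel"
    by (rule weight_state_measurable[OF that(2,1)])
  have "af dA \<phi> t \<omega> \<le> (\<integral>\<^sup>+w. ennreal (exp (\<alpha> * t)) * (discount \<alpha> w * ennreal (\<phi> (pos \<omega> w)) * indicator {0<..} w) \<partial>dA \<omega>)"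
    unfolding functional_def
  proof (rule nn_integral_mono)
    fix w
    have "1 \<le> ennreal (exp (\<alpha> * t)) * discount \<alpha> w" if "w \<le> t"
    proof -
      have "0 \<le> \<alpha> * t + - \<alpha> * w" using that assms by (simp add: mult_left_mono)
      then have "1 \<le> exp (\<alpha> * t) * exp (- \<alpha> * w)" by (simp only: exp_add[symmetric] one_le_exp_iff)
      then show ?thesis by (simp add: ennreal_mult[symmetric] del: ennreal_1 flip: ennreal_1)
    qed
    then have "1 * ennreal (\<phi> (pos \<omega> w)) \<le> (ennreal (exp (\<alpha> * t)) * discount \<alpha> w) * ennreal (\<phi> (pos \<omega> w))" if "w \<le> t"
      using that by (intro mult_right_mono) auto
    then show "ennreal (\<phi> (pos \<omega> w)) * indicator {0<..t} w \<le> ennreal (exp (\<alpha> * t)) * (discount \<alpha> w * ennreal (\<phi> (pos \<omega> w)) * indicator {0<..} w)"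
      by (auto simp: indicator_def mult.assoc)
  qed
  then show ?thesis unfolding discounted_def by (simp add: nn_integral_cmult)
qed

lemma expectation_af_le:
  assumes "compact_weight \<phi> K" "0 < \<alpha>"
  shows "EP x (af dA \<phi> t) \<le> ennreal (exp (\<alpha> * t)) * kato_norm K \<alpha>"
proof -
  have "EC x (af dA \<phi> t) \<le> EC x (\<lambda>\<omega>. ennreal (exp (\<alpha> * t)) * discounted \<alpha> \<phi> \<omega>)"
    by (rule nn_integral_mono_AE, use AE_CP_good[of x] in eventually_elim)
       (rule af_le_discounted[OF less_imp_le[OF assms(2)] _ assms(1)])
  also have "\<dots> = ennreal (exp (\<alpha> * t)) * EC x (\<lambda>\<omega>. discounted \<alpha> \<phi> \<omega>)"
    by (rule nn_integral_cmult[OF adapted_CP[OF discounted_adapted[OF assms]]])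
  also have "\<dots> \<le> ennreal (exp (\<alpha> * t)) * kato_norm K \<alpha>"
    using expectation_discounted[OF assms, of x] kernel_potential_le_kato_norm[OF assms(1)]
    by (intro mult_left_mono) (simp_all add: nn_integral_completion)
  finally show ?thesis by (simp add: nn_integral_completion)
qed

text \<open>The restriction of the time integral to a compact interval makes the potential continuous.\<close>

definition window :: "real \<Rightarrow> real \<Rightarrow> real \<Rightarrow> ennreal" where
  "window \<alpha> T t = discount \<alpha> t * indicator {1 / T..T} t"

lemma window_measurable [measurable]: "window \<alpha> T \<in> borel_measurable borel"
  unfolding window_def[abs_def] by measurable

text \<open>Both truncated parts are controlled by other discount factors: for t < 1/T one has 1
  \<le> exp (1 - T t), and for t > T the surplus rate \<alpha> - \<alpha>0 yields the small factor
  exp (- (\<alpha> - \<alpha>0) T). After integration the first error is e times the Kato norm at T,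
  the second a small multiple of the one at \<alpha>0.\<close>

lemma discount_le_window:
  assumes T: "1 \<le> T" and \<alpha>: "0 \<le> \<alpha>" "\<alpha>0 \<le> \<alpha>" and t: "0 < t"
  shows "discount \<alpha> t \<le> window \<alpha> T t + (ennreal (exp 1) * discount T t + ennreal (exp (- (\<alpha> - \<alpha>0) * T)) * discount \<alpha>0 t)"
proof -
  consider "t < 1 / T" | "1 / T \<le> t" "t \<le> T" | "T < t" by linarith
  then show ?thesis
  proof cases
    case 1
    have "T * t < 1" using 1 T by (simp add: pos_less_divide_eq mult.commute)
    moreover have "0 \<le> \<alpha> * t" using \<alpha> t by simp
    ultimately have "exp (- \<alpha> * t) \<le> exp 1 * exp (- T * t)" unfolding exp_add[symmetric] by simp
    then have "discount \<alpha> t \<le> ennreal (exp 1) * discount T t" by (simp add: ennreal_mult[symmetric] ennreal_leI)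
    then show ?thesis by (intro add_increasing[OF _ add_increasing2]) auto
  next
    case 2
    then show ?thesis by (simp add: window_def)
  next
    case 3
    have "(\<alpha> - \<alpha>0) * T \<le> (\<alpha> - \<alpha>0) * t" using 3 \<alpha> by (intro mult_left_mono) auto
    then have "- \<alpha> * t \<le> - (\<alpha> - \<alpha>0) * T + - \<alpha>0 * t" by (simp add: algebra_simps)
    then have "exp (- \<alpha> * t) \<le> exp (- (\<alpha> - \<alpha>0) * T) * exp (- \<alpha>0 * t)" unfolding exp_add[symmetric] by simp
    then have "discount \<alpha> t \<le> ennreal (exp (- (\<alpha> - \<alpha>0) * T)) * discount \<alpha>0 t" by (simp only: ennreal_mult[symmetric] exp_ge_zero ennreal_leI)
    then show ?thesis by (intro add_increasing) auto
  qed
qed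

lemma potential_le_window:
  assumes \<phi>: "compact_weight \<phi> K" and T: "1 \<le> T" and \<alpha>: "0 \<le> \<alpha>" "\<alpha>0 \<le> \<alpha>"
  shows "kernel_potential (discount \<alpha>) \<phi> x \<le> kernel_potential (window \<alpha> T) \<phi> x +
    (ennreal (exp 1) * kato_norm K T + ennreal (exp (- (\<alpha> - \<alpha>0) * T)) * kato_norm K \<alpha>0)"
proof -
  have [measurable]: "\<phi> \<in> borel_measurable borel" by (rule compact_weightD(6)[OF \<phi>])
  have "kernel_potential (discount \<alpha>) \<phi> x \<le> kernel_potential (\<lambda>t. window \<alpha> T t +
      (ennreal (exp 1) * discount T t + ennreal (exp (- (\<alpha> - \<alpha>0) * T)) * discount \<alpha>0 t)) \<phi> x"
    by (rule kernel_potential_mono) (rule discount_le_window[OF T \<alpha>])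
  also have "\<dots> = kernel_potential (window \<alpha> T) \<phi> x +
      (ennreal (exp 1) * kernel_potential (discount T) \<phi> x + ennreal (exp (- (\<alpha> - \<alpha>0) * T)) * kernel_potential (discount \<alpha>0) \<phi> x)"
    by (subst kernel_potential_add, measurable)+ (subst (1 2) kernel_potential_cmult, measurable)
  also have "\<dots> \<le> kernel_potential (window \<alpha> T) \<phi> x + (ennreal (exp 1) * kato_norm K T + ennreal (exp (- (\<alpha> - \<alpha>0) * T)) * kato_norm K \<alpha>0)"
    by (intro add_left_mono add_mono mult_left_mono kernel_potential_le_kato_norm[OF \<phi>]) auto
  finally show ?thesis .
qed

lemma window_le: "kernel_potential (window \<alpha> T) \<phi> x \<le> kernel_potential (discount \<alpha>) \<phi> x"
  by (rule kernel_potential_mono) (auto simp: window_def indicator_def)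

text \<open>On the compact set \<open>D\<close> of times in [1/T, T], of the points of the sequence
  with its limit, and of \<open>K\<close>, the continuous finite heat kernel is bounded. Dominated
  convergence applies first in time and then in space, where \<mu> has finite mass on
  \<open>K\<close>.\<close>

lemma window_sequentially_continuous:
  assumes \<phi>: "compact_weight \<phi> K" and T: "1 \<le> T" and \<alpha>: "0 \<le> \<alpha>" and lim: "xs \<longlonglongrightarrow> x"
  shows "(\<lambda>n. kernel_potential (window \<alpha> T) \<phi> (xs n)) \<longlonglongrightarrow> kernel_potential (window \<alpha> T) \<phi> x"
proof -
  have [measurable]: "\<phi> \<in> borel_measurable borel" by (rule compact_weightD(6)[OF \<phi>])
  have K: "compact K" by (rule compact_weightD(4)[OF \<phi>])
  have Kb[measurable]: "K \<in> sets borel" by (rule borel_compact[OF K])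
  \<comment> \<open>\<open>x\<close> is also inserted into the third factor, so that
    \<open>D\<close> is nonempty even if \<open>K\<close> is empty and the kernel attains its
    maximum.\<close>
  define D where "D = {1 / T..T} \<times> (insert x (range xs) \<times> insert x K)"
  have Dc: "compact D"
    unfolding D_def using K by (intro compact_Times compact_Icc compact_sequence_with_limit[OF lim]) auto
  have Dsub: "D \<subseteq> {0<..} \<times> UNIV \<times> UNIV" using T by (auto simp: D_def intro: less_le_trans[of 0 "1 / T"])
  have "1 / T \<le> 1" using T by simp
  then have T1: "1 / T \<le> T" using T by linarith
  then have Dne: "D \<noteq> {}" by (auto simp: D_def)
  obtain d where d: "d \<in> D" "\<And>e. e \<in> D \<Longrightarrow> (case e of (t, x, y) \<Rightarrow> p t x y) \<le> (case d of (t, x, y) \<Rightarrow> p t x y)"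
    using continuous_attains_sup[OF Dc Dne continuous_on_subset[OF p_continuous Dsub]] by blast
  define C where "C = (case d of (t, x, y) \<Rightarrow> p t x y)"
  have C: "C < \<top>" using d(1) Dsub p_finite by (cases d) (auto simp: C_def)
  have pC: "p t z y \<le> C" if "t \<in> {1 / T..T}" "z \<in> insert x (range xs)" "y \<in> K" for t z y
    using d(2)[of "(t, z, y)"] that by (auto simp: D_def C_def)
  have win: "window \<alpha> T t * (indicator {0<..} t * p t z y) \<le> C * indicator {1 / T..T} t"
    if "z \<in> insert x (range xs)" "y \<in> K" for t z y
  proof (cases "t \<in> {1 / T..T}")
    case True
    have "0 < t" using True T by (auto intro: less_le_trans[of 0 "1 / T"])
    then have "discount \<alpha> t \<le> 1" using \<alpha> by simp
    then have "discount \<alpha> t * p t z y \<le> 1 * C" using pC[OF True that] by (intro mult_mono) auto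
    then show ?thesis using True \<open>0 < t\<close> by (simp add: window_def)
  qed (simp add: window_def)
  have fin: "(\<integral>\<^sup>+t. C * indicator {1 / T..T} t \<partial>lborel) = C * ennreal (T - 1 / T)"
    using T1 by (subst nn_integral_cmult_indicator) auto
  have m: "(\<lambda>t. window \<alpha> T t * (indicator {0<..} t * p t z y)) \<in> borel_measurable lborel" for z y
    using borel_measurable_times_ennreal[OF window_measurable p_time] by simp
  have tk: "time_kernel (window \<alpha> T) z y \<le> C * ennreal (T - 1 / T)" if "z \<in> insert x (range xs)" "y \<in> K" for z y
    unfolding time_kernel_def fin[symmetric] by (intro nn_integral_mono win[OF that])
  have inner: "(\<lambda>n. time_kernel (window \<alpha> T) (xs n) y) \<longlonglongrightarrow> time_kernel (window \<alpha> T) x y" if y: "y \<in> K" for y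
    unfolding time_kernel_def
  proof (rule nn_integral_dominated_convergence[where w="\<lambda>t. C * indicator {1 / T..T} t"])
    show "(\<integral>\<^sup>+t. C * indicator {1 / T..T} t \<partial>lborel) < \<infinity>" unfolding fin using C by (simp add: ennreal_mult_less_top)
    show "AE t in lborel. window \<alpha> T t * (indicator {0<..} t * p t (xs j) y) \<le> C * indicator {1 / T..T} t" for j
      using y by (intro AE_I2 win) auto
    show "AE t in lborel. (\<lambda>i. window \<alpha> T t * (indicator {0<..} t * p t (xs i) y)) \<longlonglongrightarrow> window \<alpha> T t * (indicator {0<..} t * p t x y)"
    proof (rule AE_I2)
      fix t
      show "(\<lambda>i. window \<alpha> T t * (indicator {0<..} t * p t (xs i) y)) \<longlonglongrightarrow> window \<alpha> T t * (indicator {0<..} t * p t x y)"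
      proof (cases "t \<in> {1 / T..T}")
        case True
        have t: "0 < t" using True T by (auto intro: less_le_trans[of 0 "1 / T"])
        have "(\<lambda>n. (t, xs n, y)) \<longlonglongrightarrow> (t, x, y)" by (intro tendsto_Pair tendsto_const lim)
        from continuous_on_tendsto_compose[OF p_continuous this]
        have "(\<lambda>n. p t (xs n) y) \<longlonglongrightarrow> p t x y" using t by simp
        then have "(\<lambda>n. discount \<alpha> t * p t (xs n) y) \<longlonglongrightarrow> discount \<alpha> t * p t x y"
          by (intro ennreal_tendsto_cmult) auto
        then show ?thesis using t True by (simp add: window_def)
      qed (simp add: window_def)
    qed
  qed (use m in auto)
  show ?thesis
    unfolding kernel_potential_def
  proof (rule nn_integral_dominated_convergence[where w="\<lambda>y. (C * ennreal (T - 1 / T)) * indicator K y"])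
    show "(\<lambda>y. ennreal (\<phi> y) * time_kernel (window \<alpha> T) (xs i) y) \<in> borel_measurable \<mu>" for i
      using time_kernel_measurable[OF window_measurable, of \<alpha> T "xs i"] by measurable
    show "(\<lambda>y. ennreal (\<phi> y) * time_kernel (window \<alpha> T) x y) \<in> borel_measurable \<mu>"
      using time_kernel_measurable[OF window_measurable, of \<alpha> T x] by measurable
    show "(\<lambda>y. (C * ennreal (T - 1 / T)) * indicator K y) \<in> borel_measurable \<mu>" by measurable
    show "(\<integral>\<^sup>+y. (C * ennreal (T - 1 / T)) * indicator K y \<partial>\<mu>) < \<infinity>"
      using C \<mu>_compact[OF K] Kb sets_\<mu> by (subst nn_integral_cmult_indicator) (auto simp: ennreal_mult_less_top)
    show "AE y in \<mu>. ennreal (\<phi> y) * time_kernel (window \<alpha> T) (xs j) y \<le> (C * ennreal (T - 1 / T)) * indicator K y" for j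
    proof (rule AE_I2)
      fix y
      show "ennreal (\<phi> y) * time_kernel (window \<alpha> T) (xs j) y \<le> (C * ennreal (T - 1 / T)) * indicator K y"
      proof (cases "y \<in> K")
        case True
        have "ennreal (\<phi> y) * time_kernel (window \<alpha> T) (xs j) y \<le> 1 * (C * ennreal (T - 1 / T))"
          using compact_weightD(3)[OF \<phi>, of y] tk[of "xs j" y] True by (intro mult_mono) auto
        then show ?thesis using True by simp
      qed (simp add: compact_weightD(5)[OF \<phi>])
    qed
    show "AE y in \<mu>. (\<lambda>i. ennreal (\<phi> y) * time_kernel (window \<alpha> T) (xs i) y) \<longlonglongrightarrow> ennreal (\<phi> y) * time_kernel (window \<alpha> T) x y"
    proof (rule AE_I2)
      fix y
      show "(\<lambda>i. ennreal (\<phi> y) * time_kernel (window \<alpha> T) (xs i) y) \<longlonglongrightarrow> ennreal (\<phi> y) * time_kernel (window \<alpha> T) x y"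
        using inner[of y] by (cases "y \<in> K") (auto simp: compact_weightD(5)[OF \<phi>] intro!: ennreal_tendsto_cmult)
    qed
  qed
qed

text \<open>The Kato norm enters only as a bound: it makes the truncated potential finite, so that
  it may be read as a real function, and bounded by 1.\<close>

lemma window_density_fun:
  assumes \<phi>: "compact_weight \<phi> K" and T: "1 \<le> T" and \<alpha>: "0 \<le> \<alpha>" and fin: "kato_norm K \<alpha> \<le> 1"
  defines "J \<equiv> \<lambda>x. enn2real (kernel_potential (window \<alpha> T) \<phi> x)"
  shows "density_fun J" "ennreal (J x) = kernel_potential (window \<alpha> T) \<phi> x"
proof -
  have le: "kernel_potential (window \<alpha> T) \<phi> x \<le> 1" for x
    by (rule order_trans[OF window_le order_trans[OF kernel_potential_le_kato_norm[OF \<phi>] fin]])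
  then have lt: "kernel_potential (window \<alpha> T) \<phi> x < \<top>" for x
    using le_less_trans[OF le, of \<top> x] by simp
  show "ennreal (J x) = kernel_potential (window \<alpha> T) \<phi> x" using lt by (simp add: J_def)
  have "continuous_on UNIV J"
    unfolding continuous_on_sequentially comp_def
  proof (intro allI ballI impI, elim conjE)
    fix xs and a assume "(xs :: nat \<Rightarrow> 's) \<longlonglongrightarrow> a"
    from window_sequentially_continuous[OF \<phi> T \<alpha> this]
    show "(\<lambda>n. J (xs n)) \<longlonglongrightarrow> J a" unfolding J_def using lt[of a] by (intro tendsto_enn2real) (auto simp: less_top)
  qed
  moreover have "0 \<le> J x" "J x \<le> 1" for x
    using le[of x] enn2real_mono[OF le[of x]] by (auto simp: J_def)
  ultimately show "density_fun J" unfolding density_fun_def by blast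
qed

text \<open>The discounted mass of the shifted path is, up to the factor exp (\<alpha> u), what is
  left of the discounted mass after removing the part \<open>V\<close> up to \<open>u\<close>. This
  expresses a shifted variable through unshifted adapted ones; measurability of the shift is at hand
  only for the natural sigma-algebra.\<close>

lemma discounted_shift_eq:
  assumes \<phi>: "compact_weight \<phi> K" and \<alpha>: "0 < \<alpha>" and u: "0 \<le> u"
  obtains V where "adapted_at (ennreal u) V"
    "\<And>\<omega>. good \<omega> \<Longrightarrow> discounted \<alpha> \<phi> (shifted u \<omega>) = ennreal (exp (\<alpha> * u)) * (discounted \<alpha> \<phi> \<omega> - V \<omega>)"
proof -
  define h where "h w x = exp (- \<alpha> * max 0 w) * \<phi> x" for w :: real and x
  have hc: "continuous_on UNIV (\<lambda>(w, x). h w x)"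
    unfolding h_def case_prod_beta
    using continuous_on_compose2[OF compact_weightD(1)[OF \<phi>] continuous_on_snd[OF continuous_on_id], of UNIV]
    by (auto intro!: continuous_intros)
  have h0: "0 \<le> h w x" and h1: "h w x \<le> 1" for w x
    using compact_weightD(2,3)[OF \<phi>, of x] \<alpha> by (auto simp: h_def intro!: mult_le_one)
  show ?thesis
  proof (rule that[of "functional dA h u"])
    show "adapted_at (ennreal u) (functional dA h u)"
      by (rule functional_adapted[OF clock_dA hc h0 h1 u])
    fix \<omega> assume g: "good \<omega>"
    have [measurable_cong]: "sets (dA \<omega>) = sets borel" by (rule clock_sets[OF clock_dA g])
    have [measurable]: "(\<lambda>w. ennreal (\<phi> (pos \<omega> w))) \<in> borel_measurable borel" by (rule weight_state_measurable[OF \<phi> g])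
    let ?F = "\<lambda>w. discount \<alpha> w * ennreal (\<phi> (pos \<omega> w))"
    have V: "functional dA h u \<omega> = (\<integral>\<^sup>+w. ?F w * indicator {0<..u} w \<partial>dA \<omega>)"
      unfolding functional_def by (intro nn_integral_cong) (auto simp: indicator_def h_def ennreal_mult' max_def)
    have "discounted \<alpha> \<phi> \<omega> = (\<integral>\<^sup>+w. ?F w * indicator {0<..u} w + ?F w * indicator {u<..} w \<partial>dA \<omega>)"
      unfolding discounted_def using u by (intro nn_integral_cong) (auto simp: indicator_def)
    also have "\<dots> = functional dA h u \<omega> + (\<integral>\<^sup>+w. ?F w * indicator {u<..} w \<partial>dA \<omega>)"
      unfolding V by (rule nn_integral_add) measurable
    finally have "discounted \<alpha> \<phi> \<omega> - functional dA h u \<omega> = (\<integral>\<^sup>+w. ?F w * indicator {u<..} w \<partial>dA \<omega>)"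
      using functional_finite[OF clock_dA g h1 u] by (simp add: less_top)
    moreover have "discounted \<alpha> \<phi> (shifted u \<omega>) =
        (\<integral>\<^sup>+w. ennreal (exp (\<alpha> * u)) * (?F w * indicator {u<..} w) \<partial>dA \<omega>)"
      unfolding discounted_shift[OF \<phi> g u]
    proof (rule nn_integral_cong)
      fix w
      have "exp (- \<alpha> * (w - u)) = exp (\<alpha> * u) * exp (- \<alpha> * w)"
        unfolding exp_add[symmetric] by (simp add: algebra_simps)
      then have "discount \<alpha> (w - u) = ennreal (exp (\<alpha> * u)) * discount \<alpha> w" by (simp only: ennreal_mult[symmetric] exp_ge_zero)
      then show "discount \<alpha> (w - u) * ennreal (\<phi> (pos \<omega> w)) * indicator {u<..} w = ennreal (exp (\<alpha> * u)) * (?F w * indicator {u<..} w)"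
        by (simp only: mult.assoc)
    qed
    ultimately show "discounted \<alpha> \<phi> (shifted u \<omega>) = ennreal (exp (\<alpha> * u)) * (discounted \<alpha> \<phi> \<omega> - functional dA h u \<omega>)"
      by (simp add: nn_integral_cmult)
  qed
qed

section \<open>Interchange of expectation and time integral\<close>

lemma discounted_shift_measurable:
  assumes "compact_weight \<phi> K" "0 < \<alpha>" "0 \<le> u"
  shows "(\<lambda>\<omega>. discounted \<alpha> \<phi> (shifted u \<omega>)) \<in> borel_measurable (CP x)"
proof -
  obtain V where V: "adapted_at (ennreal u) V"
    "\<And>\<omega>. good \<omega> \<Longrightarrow> discounted \<alpha> \<phi> (shifted u \<omega>) = ennreal (exp (\<alpha> * u)) * (discounted \<alpha> \<phi> \<omega> - V \<omega>)"
    using discounted_shift_eq[OF assms] by blast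
  have [measurable]: "discounted \<alpha> \<phi> \<in> borel_measurable (CP x)" "V \<in> borel_measurable (CP x)"
    by (rule adapted_CP[OF discounted_adapted[OF assms(1,2)]], rule adapted_CP[OF V(1)])
  have ae: "AE \<omega> in CP x. discounted \<alpha> \<phi> (shifted u \<omega>) = ennreal (exp (\<alpha> * u)) * (discounted \<alpha> \<phi> \<omega> - V \<omega>)"
    using AE_CP_good[of x] by eventually_elim (rule V(2))
  show ?thesis by (rule measurable_AE_complete[OF complete_CP _ ae]) measurable
qed

lemma AE_set_CP:
  assumes "AE \<omega> in CP x. Q \<omega>" shows "{\<omega> \<in> sample_space X. Q \<omega>} \<in> sets (CP x)"
proof -
  obtain Z where Z: "\<And>\<omega>. \<omega> \<in> space (CP x) - Z \<Longrightarrow> Q \<omega>" "Z \<in> null_sets (CP x)" using AE_E3[OF assms] by blast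
  have "{\<omega> \<in> sample_space X. \<not> Q \<omega>} \<in> sets (CP x)"
    by (rule complete_measure.complete[OF complete_CP _ Z(2)]) (use Z(1) in auto)
  then have "space (CP x) - {\<omega> \<in> sample_space X. \<not> Q \<omega>} \<in> sets (CP x)" by (rule sets.compl_sets)
  moreover have "space (CP x) - {\<omega> \<in> sample_space X. \<not> Q \<omega>} = {\<omega> \<in> sample_space X. Q \<omega>}" by auto
  ultimately show ?thesis by simp
qed

lemma fubini_CP:
  assumes "f \<in> borel_measurable (borel \<Otimes>\<^sub>M CP x)"
  shows "EC x (\<lambda>\<omega>. (\<integral>\<^sup>+u. f (u, \<omega>) \<partial>lborel)) = (\<integral>\<^sup>+u. EC x (\<lambda>\<omega>. f (u, \<omega>)) \<partial>lborel)"
proof -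
  interpret P: prob_space "CP x" by (rule prob_space_CP)
  interpret pair_sigma_finite lborel "CP x" ..
  have "f \<in> borel_measurable (lborel \<Otimes>\<^sub>M CP x)" using assms by (simp cong: measurable_cong_sets)
  from Fubini[OF this] show ?thesis .
qed

text \<open>Fubini needs joint measurability in time and path. It comes from right-continuity of the
  discounted mass in the shift \<open>u\<close>, which is dominated convergence with a multiple of
  the unshifted discounted mass as majorant.\<close>

lemma expectation_discounted_integral:
  assumes \<phi>: "compact_weight \<phi> K" and \<alpha>: "0 < \<alpha>" and fin: "kato_norm K \<alpha> < \<top>" and s: "0 \<le> s"
  shows "EC x (\<lambda>\<omega>. (\<integral>\<^sup>+u. discounted \<alpha> \<phi> (shifted u \<omega>) * indicator {0<..s} u \<partial>lborel)) =
    (\<integral>\<^sup>+u. EC x (\<lambda>\<omega>. discounted \<alpha> \<phi> (shifted u \<omega>)) * indicator {0<..s} u \<partial>lborel)"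
    and "(\<lambda>\<omega>. \<integral>\<^sup>+u. discounted \<alpha> \<phi> (shifted u \<omega>) * indicator {0<..s} u \<partial>lborel) \<in> borel_measurable (CP x)"
    and "(\<lambda>u. EC x (\<lambda>\<omega>. discounted \<alpha> \<phi> (shifted u \<omega>)) * indicator {0<..s} u) \<in> borel_measurable lborel"
proof -
  let ?W = "\<lambda>u \<omega>. discounted \<alpha> \<phi> (shifted u \<omega>)"
  have E: "EC x (\<lambda>\<omega>. discounted \<alpha> \<phi> \<omega>) < \<top>"
    unfolding nn_integral_completion expectation_discounted[OF \<phi> \<alpha>]
    using kernel_potential_le_kato_norm[OF \<phi>] fin by (rule le_less_trans)
  have Wm[measurable]: "discounted \<alpha> \<phi> \<in> borel_measurable (CP x)" by (rule adapted_CP[OF discounted_adapted[OF \<phi> \<alpha>]])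
  have "AE \<omega> in CP x. discounted \<alpha> \<phi> \<omega> \<noteq> \<infinity>"
    using E by (intro nn_integral_noteq_infinite[OF Wm]) auto
  with AE_CP_good[of x] have ae: "AE \<omega> in CP x. good \<omega> \<and> discounted \<alpha> \<phi> \<omega> < \<top>"
    by eventually_elim (simp add: less_top)
  \<comment> \<open>The majorant is finite only where the discounted mass is; outside
    \<open>G\<close> the integrand is set to 0, and a finite Kato norm makes this exceptional set
    null.\<close>
  define G where "G = {\<omega> \<in> sample_space X. good \<omega> \<and> discounted \<alpha> \<phi> \<omega> < \<top>}"
  have G[measurable]: "G \<in> sets (CP x)" unfolding G_def by (rule AE_set_CP[OF ae])
  define f where "f u \<omega> = indicator G \<omega> * ?W u \<omega>" for u \<omega>
  have "(\<lambda>(u, \<omega>). f (max 0 u) \<omega>) \<in> borel_measurable (borel \<Otimes>\<^sub>M CP x)"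
  proof (rule right_continuous_ennreal_measurable)
    show "f u \<in> borel_measurable (CP x)" if "0 \<le> u" for u
      unfolding f_def[abs_def] using discounted_shift_measurable[OF \<phi> \<alpha> that] by measurable
    fix t \<omega> and z :: "nat \<Rightarrow> real" assume t: "0 \<le> t" and z: "z \<longlonglongrightarrow> t" "\<And>n. t < z n"
    show "(\<lambda>n. f (z n) \<omega>) \<longlonglongrightarrow> f t \<omega>"
    proof (cases "\<omega> \<in> G")
      case True
      then have g: "good \<omega>" and Wfin: "discounted \<alpha> \<phi> \<omega> < \<top>" by (auto simp: G_def)
      have [measurable_cong]: "sets (dA \<omega>) = sets borel" by (rule clock_sets[OF clock_dA g])
      have [measurable]: "(\<lambda>w. ennreal (\<phi> (pos \<omega> w))) \<in> borel_measurable borel" by (rule weight_state_measurable[OF \<phi> g])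
      have zn: "0 \<le> z n" for n using z(2)[of n] t by simp
      obtain M where M: "\<And>n. norm (z n) \<le> M" using convergent_imp_Bseq[OF convergentI[OF z(1)]] unfolding Bseq_def by blast
      have "(\<lambda>n. \<integral>\<^sup>+w. discount \<alpha> (w - z n) * ennreal (\<phi> (pos \<omega> w)) * indicator {z n<..} w \<partial>dA \<omega>)
        \<longlonglongrightarrow> (\<integral>\<^sup>+w. discount \<alpha> (w - t) * ennreal (\<phi> (pos \<omega> w)) * indicator {t<..} w \<partial>dA \<omega>)"
      proof (rule nn_integral_dominated_convergence[where
            w="\<lambda>w. ennreal (exp (\<alpha> * M)) * (discount \<alpha> w * ennreal (\<phi> (pos \<omega> w)) * indicator {0<..} w)"])
        show "(\<integral>\<^sup>+w. ennreal (exp (\<alpha> * M)) * (discount \<alpha> w * ennreal (\<phi> (pos \<omega> w)) * indicator {0<..} w) \<partial>dA \<omega>) < \<infinity>"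
          using Wfin by (subst nn_integral_cmult) (auto simp: discounted_def ennreal_mult_less_top)
        show "AE w in dA \<omega>. discount \<alpha> (w - z j) * ennreal (\<phi> (pos \<omega> w)) * indicator {z j<..} w \<le>
          ennreal (exp (\<alpha> * M)) * (discount \<alpha> w * ennreal (\<phi> (pos \<omega> w)) * indicator {0<..} w)" for j
        proof (rule AE_I2)
          fix w
          have "\<alpha> * z j \<le> \<alpha> * M" using M[of j] \<alpha> by (intro mult_left_mono) auto
          then have "exp (- \<alpha> * (w - z j)) \<le> exp (\<alpha> * M) * exp (- \<alpha> * w)"
            unfolding exp_add[symmetric] by (simp add: algebra_simps)
          then have "discount \<alpha> (w - z j) \<le> ennreal (exp (\<alpha> * M)) * discount \<alpha> w"
            by (simp only: ennreal_mult[symmetric] exp_ge_zero ennreal_leI)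
          moreover have "indicator {z j<..} w \<le> (indicator {0<..} w :: ennreal)"
            using zn[of j] by (auto simp: indicator_def)
          ultimately have "discount \<alpha> (w - z j) * ennreal (\<phi> (pos \<omega> w)) * indicator {z j<..} w \<le>
            (ennreal (exp (\<alpha> * M)) * discount \<alpha> w) * ennreal (\<phi> (pos \<omega> w)) * indicator {0<..} w"
            by (intro mult_mono) auto
          then show "discount \<alpha> (w - z j) * ennreal (\<phi> (pos \<omega> w)) * indicator {z j<..} w \<le>
            ennreal (exp (\<alpha> * M)) * (discount \<alpha> w * ennreal (\<phi> (pos \<omega> w)) * indicator {0<..} w)"
            by (simp only: mult.assoc)
        qed
        show "AE w in dA \<omega>. (\<lambda>n. discount \<alpha> (w - z n) * ennreal (\<phi> (pos \<omega> w)) * indicator {z n<..} w)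
          \<longlonglongrightarrow> discount \<alpha> (w - t) * ennreal (\<phi> (pos \<omega> w)) * indicator {t<..} w"
        proof (rule AE_I2)
          fix w
          show "(\<lambda>n. discount \<alpha> (w - z n) * ennreal (\<phi> (pos \<omega> w)) * indicator {z n<..} w)
            \<longlonglongrightarrow> discount \<alpha> (w - t) * ennreal (\<phi> (pos \<omega> w)) * indicator {t<..} w"
          proof (cases "t < w")
            case True
            have "(\<lambda>n. ennreal (exp (- \<alpha> * (w - z n)) * \<phi> (pos \<omega> w))) \<longlonglongrightarrow> ennreal (exp (- \<alpha> * (w - t)) * \<phi> (pos \<omega> w))"
              by (intro tendsto_ennrealI tendsto_intros z)
            moreover have "eventually (\<lambda>n. z n < w) sequentially" using z(1) True by (rule order_tendstoD)
            then have "eventually (\<lambda>n. ennreal (exp (- \<alpha> * (w - z n)) * \<phi> (pos \<omega> w)) =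
                discount \<alpha> (w - z n) * ennreal (\<phi> (pos \<omega> w)) * indicator {z n<..} w) sequentially"
              by eventually_elim (simp add: ennreal_mult')
            ultimately have "(\<lambda>n. discount \<alpha> (w - z n) * ennreal (\<phi> (pos \<omega> w)) * indicator {z n<..} w)
              \<longlonglongrightarrow> ennreal (exp (- \<alpha> * (w - t)) * \<phi> (pos \<omega> w))" by (rule Lim_transform_eventually)
            then show ?thesis using True by (simp add: ennreal_mult')
          next
            case False
            then have "\<not> z n < w" for n using z(2)[of n] by simp
            then show ?thesis using False by simp
          qed
        qed
      qed measurable
      then show ?thesis using True by (simp add: f_def discounted_shift[OF \<phi> g zn] discounted_shift[OF \<phi> g t])
    qed (simp add: f_def)
  qed
  then have fm: "(\<lambda>(u, \<omega>). f (max 0 u) \<omega> * indicator {0<..s} u) \<in> borel_measurable (borel \<Otimes>\<^sub>M CP x)"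
    by (simp add: case_prod_beta)
  have fW: "f (max 0 u) \<omega> * indicator {0<..s} u = ?W u \<omega> * indicator {0<..s} u" if "good \<omega> \<and> discounted \<alpha> \<phi> \<omega> < \<top>" for u \<omega>
    using that good_space by (auto simp: f_def G_def indicator_def max_def)
  have Fm: "(\<lambda>\<omega>. \<integral>\<^sup>+u. f (max 0 u) \<omega> * indicator {0<..s} u \<partial>lborel) \<in> borel_measurable (CP x)"
  proof -
    have "(\<lambda>(\<omega>, u). f (max 0 u) \<omega> * indicator {0<..s} u) \<in> borel_measurable (CP x \<Otimes>\<^sub>M lborel)"
      using measurable_compose[OF measurable_pair_swap' fm] by (simp add: case_prod_beta cong: measurable_cong_sets)
    from lborel.borel_measurable_nn_integral[OF this] show ?thesis by simp
  qed
  have "AE \<omega> in CP x. (\<integral>\<^sup>+u. ?W u \<omega> * indicator {0<..s} u \<partial>lborel) = (\<integral>\<^sup>+u. f (max 0 u) \<omega> * indicator {0<..s} u \<partial>lborel)"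
    using ae by eventually_elim (simp only: fW)
  note Fm_ae = this
  have inner: "EC x (\<lambda>\<omega>. f (max 0 u) \<omega> * indicator {0<..s} u) = EC x (\<lambda>\<omega>. ?W u \<omega>) * indicator {0<..s} u" for u
  proof -
    have "EC x (\<lambda>\<omega>. f (max 0 u) \<omega> * indicator {0<..s} u) = EC x (\<lambda>\<omega>. ?W u \<omega> * indicator {0<..s} u)"
      by (rule nn_integral_cong_AE, use ae in eventually_elim) (simp only: fW)
    then show ?thesis by (simp add: indicator_def)
  qed
  interpret P: prob_space "CP x" by (rule prob_space_CP)
  have "(\<lambda>(u, \<omega>). f (max 0 u) \<omega> * indicator {0<..s} u) \<in> borel_measurable (lborel \<Otimes>\<^sub>M CP x)"
    using fm by (simp cong: measurable_cong_sets)
  from P.borel_measurable_nn_integral[OF this]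
  show "(\<lambda>u. EC x (\<lambda>\<omega>. ?W u \<omega>) * indicator {0<..s} u) \<in> borel_measurable lborel"
    unfolding inner .
  from measurable_AE_complete[OF complete_CP Fm Fm_ae]
  show "(\<lambda>\<omega>. \<integral>\<^sup>+u. ?W u \<omega> * indicator {0<..s} u \<partial>lborel) \<in> borel_measurable (CP x)" by simp
  have "EC x (\<lambda>\<omega>. (\<integral>\<^sup>+u. ?W u \<omega> * indicator {0<..s} u \<partial>lborel)) = EC x (\<lambda>\<omega>. (\<integral>\<^sup>+u. f (max 0 u) \<omega> * indicator {0<..s} u \<partial>lborel))"
    by (rule nn_integral_cong_AE, use ae in eventually_elim) (simp only: fW)
  also have "\<dots> = (\<integral>\<^sup>+u. EC x (\<lambda>\<omega>. f (max 0 u) \<omega> * indicator {0<..s} u) \<partial>lborel)"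
    using fubini_CP[OF fm] by simp
  also have "\<dots> = (\<integral>\<^sup>+u. EC x (\<lambda>\<omega>. ?W u \<omega>) * indicator {0<..s} u \<partial>lborel)"
    by (simp only: inner)
  finally show "EC x (\<lambda>\<omega>. (\<integral>\<^sup>+u. ?W u \<omega> * indicator {0<..s} u \<partial>lborel)) =
    (\<integral>\<^sup>+u. EC x (\<lambda>\<omega>. ?W u \<omega>) * indicator {0<..s} u \<partial>lborel)" .
qed

lemma expectation_occupation:
  assumes g: "density_fun g" and s: "0 \<le> s"
  shows "EC x (af (\<lambda>_. lborel) g s) =
    (\<integral>\<^sup>+u. EC x (\<lambda>\<omega>. ennreal (g (pos \<omega> u))) * indicator {0<..s} u \<partial>lborel)"
    and "(\<lambda>u. EC x (\<lambda>\<omega>. ennreal (g (pos \<omega> u))) * indicator {0<..s} u) \<in> borel_measurable lborel"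
proof -
  define G where "G = {\<omega> \<in> sample_space X. good \<omega>}"
  have G[measurable]: "G \<in> sets (CP x)" unfolding G_def by (rule AE_set_CP[OF AE_CP_good])
  have gc: "continuous_on UNIV g" using g by (simp add: density_fun_def)
  have gb: "g \<in> borel_measurable borel" by (rule borel_measurable_continuous_onI[OF gc])
  \<comment> \<open>For g \<ge> 0 the passage through \<open>ennreal\<close> and back is the
    identity; it is written this way because \<open>adapted_state\<close> supplies measurability of
    the \<open>ennreal\<close> version.\<close>
  define f where "f u \<omega> = indicat_real G \<omega> * enn2real (ennreal (g (pos \<omega> u)))" for u \<omega>
  have fe: "ennreal (f u \<omega>) = ennreal (g (pos \<omega> u))" if "good \<omega>" for u \<omega>
    using that good_space[OF that] by (simp add: f_def G_def ennreal_enn2real_if)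
  have "(\<lambda>(u, \<omega>). f (max 0 u) \<omega>) \<in> borel_measurable (borel \<Otimes>\<^sub>M CP x)"
  proof (rule right_continuous_borel_measurable)
    fix u :: real assume u: "0 \<le> u"
    have "(\<lambda>\<omega>. ennreal (g (pos \<omega> u))) \<in> borel_measurable (CP x)"
      by (rule adapted_CP[OF adapted_state[OF gb u order_refl]])
    then show "f u \<in> borel_measurable (CP x)" unfolding f_def[abs_def] by measurable
    fix \<omega>
    show "((\<lambda>t. f t \<omega>) \<longlongrightarrow> f u \<omega>) (at_right u)"
    proof (cases "\<omega> \<in> G")
      case True
      then have "good \<omega>" by (simp add: G_def)
      from continuous_on_tendsto_compose[OF gc good_right_continuous[OF this u]]
      have "((\<lambda>t. g (pos \<omega> t)) \<longlongrightarrow> g (pos \<omega> u)) (at_right u)" by simp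
      moreover have "f t \<omega> = g (pos \<omega> t)" for t
        using True g by (simp add: f_def density_fun_def)
      ultimately show ?thesis by simp
    qed (simp add: f_def)
  qed
  then have fm: "(\<lambda>(u, \<omega>). ennreal (f (max 0 u) \<omega>) * indicator {0<..s} u) \<in> borel_measurable (borel \<Otimes>\<^sub>M CP x)"
    by (simp add: case_prod_beta)
  have fW: "ennreal (f (max 0 u) \<omega>) * indicator {0<..s} u = ennreal (g (pos \<omega> u)) * indicator {0<..s} u" if "good \<omega>" for u \<omega>
    using fe[OF that, of u] by (auto simp: indicator_def max_def)
  interpret P: prob_space "CP x" by (rule prob_space_CP)
  have inner: "EC x (\<lambda>\<omega>. ennreal (f (max 0 u) \<omega>) * indicator {0<..s} u) = EC x (\<lambda>\<omega>. ennreal (g (pos \<omega> u))) * indicator {0<..s} u" for u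
  proof -
    have "EC x (\<lambda>\<omega>. ennreal (f (max 0 u) \<omega>) * indicator {0<..s} u) = EC x (\<lambda>\<omega>. ennreal (g (pos \<omega> u)) * indicator {0<..s} u)"
      by (rule nn_integral_cong_AE, use AE_CP_good[of x] in eventually_elim) (simp only: fW)
    then show ?thesis by (simp add: indicator_def)
  qed
  have "(\<lambda>(u, \<omega>). ennreal (f (max 0 u) \<omega>) * indicator {0<..s} u) \<in> borel_measurable (lborel \<Otimes>\<^sub>M CP x)"
    using fm by (simp cong: measurable_cong_sets)
  from P.borel_measurable_nn_integral[OF this]
  show "(\<lambda>u. EC x (\<lambda>\<omega>. ennreal (g (pos \<omega> u))) * indicator {0<..s} u) \<in> borel_measurable lborel"
    unfolding inner .
  have "EC x (af (\<lambda>_. lborel) g s) = EC x (\<lambda>\<omega>. (\<integral>\<^sup>+u. ennreal (f (max 0 u) \<omega>) * indicator {0<..s} u \<partial>lborel))"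
    unfolding functional_def
    by (rule nn_integral_cong_AE, use AE_CP_good[of x] in eventually_elim) (simp only: fW)
  also have "\<dots> = (\<integral>\<^sup>+u. EC x (\<lambda>\<omega>. ennreal (f (max 0 u) \<omega>) * indicator {0<..s} u) \<partial>lborel)"
    using fubini_CP[OF fm] by simp
  also have "\<dots> = (\<integral>\<^sup>+u. EC x (\<lambda>\<omega>. ennreal (g (pos \<omega> u))) * indicator {0<..s} u \<partial>lborel)"
    by (simp only: inner)
  finally show "EC x (af (\<lambda>_. lborel) g s) =
    (\<integral>\<^sup>+u. EC x (\<lambda>\<omega>. ennreal (g (pos \<omega> u))) * indicator {0<..s} u \<partial>lborel)" .
qed

text \<open>By Fubini, \<open>P\<close> is the integral of \<phi>(X w) k(w) against dA. For w \<le>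
  s the weight is 1 - exp (- \<alpha> w), for w > s it is exp (- \<alpha> (w - s)) - exp (- \<alpha>
  w). Comparison with the indicator of (0, s] leaves the discounted mass after \<open>s\<close> in
  one direction and the discounted mass from 0 in the other.\<close>

lemma discounted_integral_bounds:
  assumes \<phi>: "compact_weight \<phi> K" and \<alpha>: "0 < \<alpha>" and s: "0 \<le> s" and g: "good \<omega>"
  defines "P \<equiv> ennreal \<alpha> * (\<integral>\<^sup>+u. discounted \<alpha> \<phi> (shifted u \<omega>) * indicator {0<..s} u \<partial>lborel)"
  shows "P \<le> af dA \<phi> s \<omega> + discounted \<alpha> \<phi> (shifted s \<omega>)"
    and "af dA \<phi> s \<omega> \<le> P + discounted \<alpha> \<phi> \<omega>"
proof -
  have sb[measurable_cong]: "sets (dA \<omega>) = sets borel" by (rule clock_sets[OF clock_dA g])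
  define F where "F w = ennreal (\<phi> (pos \<omega> w))" for w
  have [measurable]: "F \<in> borel_measurable borel"
    unfolding F_def[abs_def] by (rule weight_state_measurable[OF \<phi> g])
  interpret N: sigma_finite_measure "dA \<omega>"
    unfolding dA(1)[OF g]
    using dA(2,3)[OF g]
    by (intro sigma_finite_interval_measure)
       (auto simp: mono_def continuous_on_eq_continuous_at continuous_at_imp_continuous_within)
  interpret pair_sigma_finite lborel "dA \<omega>" ..
  \<comment> \<open>A mass at \<open>w\<close> is seen by shifts \<open>u\<close> below both
    \<open>s\<close> and \<open>w\<close>; the minimum covers the two cases by one formula.\<close>
  define k where "k w = ennreal (exp (- \<alpha> * (w - min s w)) - exp (- \<alpha> * w))" for w
  let ?D = "\<lambda>w. \<integral>\<^sup>+u. ennreal \<alpha> * (discount \<alpha> (w - u) * indicator {u<..} w * indicator {0<..s} u) \<partial>lborel"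
  have k: "?D w = k w" if "0 < w" for w
  proof -
    have "?D w =
      (\<integral>\<^sup>+u. ennreal (\<alpha> * exp (- \<alpha> * (w - u))) * indicator {0..min s w} u \<partial>lborel)"
    proof (rule nn_integral_cong_AE)
      have "AE u in lborel. u \<noteq> 0 \<and> u \<noteq> w" using AE_lborel_singleton[of 0] AE_lborel_singleton[of w] by auto
      then show "AE u in lborel. ennreal \<alpha> * (discount \<alpha> (w - u) * indicator {u<..} w * indicator {0<..s} u) =
        ennreal (\<alpha> * exp (- \<alpha> * (w - u))) * indicator {0..min s w} u"
        by eventually_elim (use \<alpha> in \<open>auto simp: indicator_def ennreal_mult'\<close>)
    qed
    also have "\<dots> = k w"
      unfolding k_def using that s by (intro nn_integral_exp_interval[OF \<alpha>]) auto
    finally show ?thesis .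
  qed
  have mpair: "(\<lambda>(u, w). discount \<alpha> (w - u) * F w * indicator {u<..} w * indicator {0<..s} u) \<in> borel_measurable (lborel \<Otimes>\<^sub>M dA \<omega>)"
  proof -
    have "(\<lambda>q. discount \<alpha> (snd q - fst q) * F (snd q) * (if fst q < snd q then 1 else 0) * indicator {0<..s} (fst q))
        \<in> borel_measurable (borel \<Otimes>\<^sub>M borel)" by measurable
    then have "(\<lambda>q. discount \<alpha> (snd q - fst q) * F (snd q) * (if fst q < snd q then 1 else 0) * indicator {0<..s} (fst q))
        \<in> borel_measurable (lborel \<Otimes>\<^sub>M dA \<omega>)" by (simp cong: measurable_cong_sets)
    then show ?thesis by (simp add: case_prod_beta indicator_def)
  qed
  have "P = (\<integral>\<^sup>+u. (\<integral>\<^sup>+w. ennreal \<alpha> * (discount \<alpha> (w - u) * F w * indicator {u<..} w * indicator {0<..s} u) \<partial>dA \<omega>) \<partial>lborel)"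
  proof -
    have eq: "discounted \<alpha> \<phi> (shifted u \<omega>) * indicator {0<..s} u =
      (\<integral>\<^sup>+w. discount \<alpha> (w - u) * F w * indicator {u<..} w * indicator {0<..s} u \<partial>dA \<omega>)" for u
    proof (cases "u \<in> {0<..s}")
      case True
      then show ?thesis using discounted_shift[OF \<phi> g, of u \<alpha>] by (simp add: F_def)
    qed simp
    have m: "(\<lambda>u. \<integral>\<^sup>+w. discount \<alpha> (w - u) * F w * indicator {u<..} w * indicator {0<..s} u \<partial>dA \<omega>) \<in> borel_measurable lborel"
      using N.borel_measurable_nn_integral[OF mpair] by simp
    show ?thesis
      unfolding P_def eq by (subst nn_integral_cmult[OF m, symmetric]) (intro nn_integral_cong nn_integral_cmult[symmetric], measurable)
  qed
  also have "\<dots> = (\<integral>\<^sup>+w. (\<integral>\<^sup>+u. ennreal \<alpha> * (discount \<alpha> (w - u) * F w * indicator {u<..} w * indicator {0<..s} u) \<partial>lborel) \<partial>dA \<omega>)"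
    by (rule Fubini'[symmetric]) (use mpair in \<open>simp add: case_prod_beta\<close>)
  also have "\<dots> = (\<integral>\<^sup>+w. F w * (k w * indicator {0<..} w) \<partial>dA \<omega>)"
  proof (rule nn_integral_cong)
    fix w
    have "(\<integral>\<^sup>+u. ennreal \<alpha> * (discount \<alpha> (w - u) * F w * indicator {u<..} w * indicator {0<..s} u) \<partial>lborel) =
      (\<integral>\<^sup>+u. F w * (ennreal \<alpha> * (discount \<alpha> (w - u) * indicator {u<..} w * indicator {0<..s} u)) \<partial>lborel)"
      by (intro nn_integral_cong) (simp only: ac_simps)
    also have "\<dots> = F w * ?D w"
    proof -
      have ind: "indicator {u<..} w = (indicator {..<w} u :: ennreal)" for u by (simp add: indicator_def)
      show ?thesis unfolding ind by (rule nn_integral_cmult) measurable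
    qed
    also have "?D w = k w * indicator {0<..} w"
    proof (cases "0 < w")
      case False
      have "?D w = (\<integral>\<^sup>+u. 0 \<partial>(lborel :: real measure))"
        by (rule nn_integral_cong) (use False in \<open>auto simp: indicator_def\<close>)
      also have "\<dots> = 0" by simp
      finally show ?thesis using False by (simp only:) simp
    qed (simp only: k, simp)
    finally show "(\<integral>\<^sup>+u. ennreal \<alpha> * (discount \<alpha> (w - u) * F w * indicator {u<..} w * indicator {0<..s} u) \<partial>lborel) = F w * (k w * indicator {0<..} w)" .
  qed
  finally have P: "P = (\<integral>\<^sup>+w. F w * (k w * indicator {0<..} w) \<partial>dA \<omega>)" .
  have km[measurable]: "k \<in> borel_measurable borel" unfolding k_def[abs_def] by measurable
  have "P \<le> (\<integral>\<^sup>+w. F w * indicator {0<..s} w + discount \<alpha> (w - s) * F w * indicator {s<..} w \<partial>dA \<omega>)"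
    unfolding P
  proof (rule nn_integral_mono)
    fix w
    have "k w * indicator {0<..} w \<le> indicator {0<..s} w + discount \<alpha> (w - s) * indicator {s<..} w"
    proof (cases "0 < w \<and> w \<le> s")
      case True
      then have "k w \<le> 1" using \<alpha> by (simp add: k_def)
      then show ?thesis using True by simp
    next
      case False
      then show ?thesis by (auto simp: k_def indicator_def min_def intro!: ennreal_leI)
    qed
    then have "F w * (k w * indicator {0<..} w) \<le> F w * (indicator {0<..s} w + discount \<alpha> (w - s) * indicator {s<..} w)"
      by (rule mult_left_mono) simp
    then show "F w * (k w * indicator {0<..} w) \<le> F w * indicator {0<..s} w + discount \<alpha> (w - s) * F w * indicator {s<..} w"
      by (simp only: distrib_left ac_simps)
  qed
  also have "\<dots> = af dA \<phi> s \<omega> + discounted \<alpha> \<phi> (shifted s \<omega>)"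
    unfolding functional_def discounted_shift[OF \<phi> g s] F_def[symmetric] by (rule nn_integral_add) measurable
  finally show "P \<le> af dA \<phi> s \<omega> + discounted \<alpha> \<phi> (shifted s \<omega>)" .
  have "af dA \<phi> s \<omega> \<le> (\<integral>\<^sup>+w. F w * (k w * indicator {0<..} w) + discount \<alpha> w * F w * indicator {0<..} w \<partial>dA \<omega>)"
    unfolding functional_def F_def[symmetric]
  proof (rule nn_integral_mono)
    fix w
    have "indicator {0<..s} w \<le> k w * indicator {0<..} w + discount \<alpha> w * indicator {0<..} w"
    proof (cases "0 < w \<and> w \<le> s")
      case True
      have "k w + discount \<alpha> w = ennreal ((1 - exp (- \<alpha> * w)) + exp (- \<alpha> * w))"
        unfolding k_def using True \<alpha> by (subst ennreal_plus) auto
      then show ?thesis using True by simp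
    qed (auto simp: indicator_def)
    then have "F w * indicator {0<..s} w \<le> F w * (k w * indicator {0<..} w + discount \<alpha> w * indicator {0<..} w)"
      by (rule mult_left_mono) simp
    then show "F w * indicator {0<..s} w \<le> F w * (k w * indicator {0<..} w) + discount \<alpha> w * F w * indicator {0<..} w"
      by (simp only: distrib_left ac_simps)
  qed
  also have "\<dots> = P + discounted \<alpha> \<phi> \<omega>"
    unfolding P discounted_def F_def[symmetric] by (rule nn_integral_add) measurable
  finally show "af dA \<phi> s \<omega> \<le> P + discounted \<alpha> \<phi> \<omega>" .
qed

text \<open>By the Markov property at \<open>u\<close>, the mean of the shifted discounted mass is
  that of the potential at the state at \<open>u\<close>, which lies between those of
  \<open>J\<close> and of \<open>J\<close> plus \<eta>. Integrating over (0, s] gives the error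
  \<alpha> \<eta> s; the boundary masses of \<open>discounted_integral_bounds\<close> have mean at
  most \<open>c\<close>.\<close>

lemma expectation_compare:
  assumes \<phi>: "compact_weight \<phi> K" and \<alpha>: "0 < \<alpha>" and s: "0 \<le> s"
    and c: "kato_norm K \<alpha> \<le> ennreal c" and \<eta>: "0 \<le> \<eta>" and c0: "0 \<le> c"
    and J: "density_fun J" "\<And>x. ennreal (J x) \<le> kernel_potential (discount \<alpha>) \<phi> x"
      "\<And>x. kernel_potential (discount \<alpha>) \<phi> x \<le> ennreal (J x) + ennreal \<eta>"
  defines "g \<equiv> \<lambda>x. \<alpha> * J x"
  shows "EP x (af (\<lambda>_. lborel) g s) \<le> EP x (af dA \<phi> s) + ennreal c"
    and "EP x (af dA \<phi> s) \<le> EP x (af (\<lambda>_. lborel) g s) + ennreal (c + \<alpha> * \<eta> * s)"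
proof -
  interpret P: prob_space "prob_from X (Some x)" by (rule prob_space_from)
  let ?W = "\<lambda>u \<omega>. discounted \<alpha> \<phi> (shifted u \<omega>)"
  have Jb: "J \<in> borel_measurable borel" using J(1) by (auto simp: density_fun_def intro: borel_measurable_continuous_onI)
  have gd: "density_fun g"
    using J(1) \<alpha> unfolding density_fun_def g_def
    by (auto intro!: continuous_intros exI[of _ "\<alpha> * _"] mult_left_mono)
  have aJ: "adapted_at \<top> (\<lambda>\<omega>. ennreal (J (pos \<omega> 0)))" by (rule adapted_state[OF Jb]) auto
  have aW: "adapted_at \<top> (discounted \<alpha> \<phi>)" by (rule discounted_adapted[OF \<phi> \<alpha>])
  have one: "adapted_at t (\<lambda>_. 1)" for t unfolding adapted_at_def by (intro bexI[of _ "\<lambda>_. 1"]) auto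
  have zero: "adapted_at t (\<lambda>_. 0)" for t unfolding adapted_at_def by (intro bexI[of _ "\<lambda>_. 0"]) auto
  have EJ: "EP y (\<lambda>\<omega>. ennreal (J (pos \<omega> 0))) = ennreal (J y)" for y
  proof -
    interpret Q: prob_space "prob_from X (Some y)" by (rule prob_space_from)
    have "EP y (\<lambda>\<omega>. ennreal (J (pos \<omega> 0))) = EP y (\<lambda>\<omega>. ennreal (J y))"
      by (rule nn_integral_cong_AE, use AE_start[of "Some y"] in eventually_elim) (simp add: state_at_def)
    then show ?thesis using Q.emeasure_space_1 by simp
  qed
  have fin: "EP x (\<lambda>\<omega>. 1) < \<top>" using P.emeasure_space_1 by simp
  have one_int: "EP x (\<lambda>\<omega>. 1) = 1" using P.emeasure_space_1 by simp
  have EJu: "EP x (\<lambda>\<omega>. ennreal (J (pos (shifted u \<omega>) 0))) = EP x (\<lambda>\<omega>. ennreal (J (pos \<omega> u)))"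
    if "0 \<le> u" for u
    by (rule nn_integral_cong_AE, use AE_good[of x] in eventually_elim) (use state_at_shift[OF _ that, of _ 0] in simp)
  have M1: "EC x (\<lambda>\<omega>. ennreal (J (pos \<omega> u))) \<le> EC x (\<lambda>\<omega>. ?W u \<omega>)" if u: "0 \<le> u" for u
    using adapted_markov_compare[OF u aJ aW one fin, of 0] J(2)
    by (simp add: EJ expectation_discounted[OF \<phi> \<alpha>] EJu[OF u] nn_integral_completion)
  have M2: "EC x (\<lambda>\<omega>. ?W u \<omega>) \<le> EC x (\<lambda>\<omega>. ennreal (J (pos \<omega> u))) + ennreal \<eta>" if u: "0 \<le> u" for u
    using adapted_markov_compare[OF u aW aJ one fin, of "ennreal \<eta>"] J(3) one_int
    by (simp add: EJ expectation_discounted[OF \<phi> \<alpha>] EJu[OF u] nn_integral_completion)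
  \<comment> \<open>Comparison with the zero variable: the discounted mass has mean at most
    \<open>c\<close> from every starting point, hence also after a shift.\<close>
  have M3: "EC x (\<lambda>\<omega>. ?W u \<omega>) \<le> ennreal c" if u: "0 \<le> u" for u
    using adapted_markov_compare[OF u aW zero one fin, of "ennreal c"] one_int
      order_trans[OF kernel_potential_le_kato_norm[OF \<phi>] c]
    by (simp add: expectation_discounted[OF \<phi> \<alpha>] nn_integral_completion)
  have W0: "EC x (\<lambda>\<omega>. discounted \<alpha> \<phi> \<omega>) \<le> ennreal c"
    unfolding nn_integral_completion expectation_discounted[OF \<phi> \<alpha>] by (rule order_trans[OF kernel_potential_le_kato_norm[OF \<phi>] c])
  define Q where "Q \<omega> = ennreal \<alpha> * (\<integral>\<^sup>+u. ?W u \<omega> * indicator {0<..s} u \<partial>lborel)" for \<omega>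
  have kfin: "kato_norm K \<alpha> < \<top>" using c by (rule le_less_trans) simp
  have Bm: "af dA \<phi> s \<in> borel_measurable (CP x)"
    by (rule adapted_CP[OF af_adapted[OF clock_dA compact_weightD(7)[OF \<phi>] s]])
  have Wm: "discounted \<alpha> \<phi> \<in> borel_measurable (CP x)" "?W u \<in> borel_measurable (CP x)" if "0 \<le> u" for u
    by (rule adapted_CP[OF aW], rule discounted_shift_measurable[OF \<phi> \<alpha> that])
  have gJ: "EC x (\<lambda>\<omega>. ennreal (g (pos \<omega> u))) = ennreal \<alpha> * EC x (\<lambda>\<omega>. ennreal (J (pos \<omega> u)))" if "0 \<le> u" for u
    unfolding g_def using \<alpha> adapted_CP[OF adapted_state[OF Jb that order_refl], of x]
    by (simp add: ennreal_mult' nn_integral_cmult)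
  note EC = expectation_occupation[OF gd s, of x]
  have EQ: "EC x (\<lambda>\<omega>. Q \<omega>) = ennreal \<alpha> * (\<integral>\<^sup>+u. EC x (\<lambda>\<omega>. ?W u \<omega>) * indicator {0<..s} u \<partial>lborel)"
    unfolding Q_def expectation_discounted_integral(1)[OF \<phi> \<alpha> kfin s, symmetric]
    by (rule nn_integral_cmult[OF expectation_discounted_integral(2)[OF \<phi> \<alpha> kfin s]])
  have Qm: "Q \<in> borel_measurable (CP x)"
    unfolding Q_def[abs_def] using expectation_discounted_integral(2)[OF \<phi> \<alpha> kfin s] by measurable
  have EQ': "EC x (\<lambda>\<omega>. Q \<omega>) = (\<integral>\<^sup>+u. ennreal \<alpha> * (EC x (\<lambda>\<omega>. ?W u \<omega>) * indicator {0<..s} u) \<partial>lborel)"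
  proof -
    have "(\<lambda>u. EC x (\<lambda>\<omega>. ?W u \<omega>) * indicator {0<..s} u) \<in> borel_measurable lborel"
      by (rule expectation_discounted_integral(3)[OF \<phi> \<alpha> kfin s])
    from nn_integral_cmult[OF this, of "ennreal \<alpha>"] show ?thesis unfolding EQ by simp
  qed
  have "EC x (af (\<lambda>_. lborel) g s) \<le> EC x (\<lambda>\<omega>. Q \<omega>)"
    unfolding EC(1) EQ'
  proof (rule nn_integral_mono)
    fix u
    show "EC x (\<lambda>\<omega>. ennreal (g (pos \<omega> u))) * indicator {0<..s} u \<le> ennreal \<alpha> * (EC x (\<lambda>\<omega>. ?W u \<omega>) * indicator {0<..s} u)"
      using M1[of u] gJ[of u] by (cases "u \<in> {0<..s}") (auto intro: mult_left_mono)
  qed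
  also have "\<dots> \<le> EC x (\<lambda>\<omega>. af dA \<phi> s \<omega> + ?W s \<omega>)"
    by (rule nn_integral_mono_AE, use AE_CP_good[of x] in eventually_elim)
       (unfold Q_def, rule discounted_integral_bounds(1)[OF \<phi> \<alpha> s])
  also have "\<dots> = EC x (af dA \<phi> s) + EC x (\<lambda>\<omega>. ?W s \<omega>)"
    by (rule nn_integral_add[OF Bm Wm(2)[OF s]])
  also have "\<dots> \<le> EC x (af dA \<phi> s) + ennreal c" by (rule add_left_mono[OF M3[OF s]])
  finally show "EP x (af (\<lambda>_. lborel) g s) \<le> EP x (af dA \<phi> s) + ennreal c"
    by (simp only: nn_integral_completion)
  have "EC x (af dA \<phi> s) \<le> EC x (\<lambda>\<omega>. Q \<omega> + discounted \<alpha> \<phi> \<omega>)"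
    by (rule nn_integral_mono_AE, use AE_CP_good[of x] in eventually_elim)
       (unfold Q_def, rule discounted_integral_bounds(2)[OF \<phi> \<alpha> s])
  also have "\<dots> = EC x (\<lambda>\<omega>. Q \<omega>) + EC x (\<lambda>\<omega>. discounted \<alpha> \<phi> \<omega>)"
    by (rule nn_integral_add[OF Qm Wm(1)[OF s]])
  also have "\<dots> \<le> (EC x (af (\<lambda>_. lborel) g s) + ennreal (\<alpha> * \<eta> * s)) + ennreal c"
  proof (rule add_mono[OF _ W0])
    have "EC x (\<lambda>\<omega>. Q \<omega>) \<le> (\<integral>\<^sup>+u. EC x (\<lambda>\<omega>. ennreal (g (pos \<omega> u))) * indicator {0<..s} u + ennreal (\<alpha> * \<eta>) * indicator {0<..s} u \<partial>lborel)"
      unfolding EQ'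
    proof (rule nn_integral_mono)
      fix u
      show "ennreal \<alpha> * (EC x (\<lambda>\<omega>. ?W u \<omega>) * indicator {0<..s} u) \<le>
        EC x (\<lambda>\<omega>. ennreal (g (pos \<omega> u))) * indicator {0<..s} u + ennreal (\<alpha> * \<eta>) * indicator {0<..s} u"
      proof (cases "u \<in> {0<..s}")
        case True
        have "ennreal \<alpha> * EC x (\<lambda>\<omega>. ?W u \<omega>) \<le> ennreal \<alpha> * (EC x (\<lambda>\<omega>. ennreal (J (pos \<omega> u))) + ennreal \<eta>)"
          using M2[of u] True by (intro mult_left_mono) auto
        then show ?thesis using True gJ[of u] \<alpha> \<eta> by (simp add: distrib_left ennreal_mult)
      qed simp
    qed
    also have "\<dots> = EC x (af (\<lambda>_. lborel) g s) + (\<integral>\<^sup>+u. ennreal (\<alpha> * \<eta>) * indicator {0<..s} u \<partial>lborel)"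
      unfolding EC(1) by (rule nn_integral_add[OF EC(2)]) measurable
    also have "(\<integral>\<^sup>+u. ennreal (\<alpha> * \<eta>) * indicator {0<..s} u \<partial>lborel) = ennreal (\<alpha> * \<eta> * s)"
      using s \<alpha> \<eta> by (subst nn_integral_cmult_indicator) (auto simp: ennreal_mult)
    finally show "EC x (\<lambda>\<omega>. Q \<omega>) \<le> EC x (af (\<lambda>_. lborel) g s) + ennreal (\<alpha> * \<eta> * s)" .
  qed
  also have "\<dots> = EC x (af (\<lambda>_. lborel) g s) + ennreal (c + \<alpha> * \<eta> * s)"
    using s \<alpha> \<eta> c0 by (simp add: ennreal_plus ac_simps)
  finally show "EP x (af dA \<phi> s) \<le> EP x (af (\<lambda>_. lborel) g s) + ennreal (c + \<alpha> * \<eta> * s)"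
    by (simp only: nn_integral_completion)
qed

text \<open>One density \<open>g\<close> serves all times up to \<open>t\<close> and all starting
  points. The constants depend on each other in the order \<open>\<alpha>0\<close> (finite first
  moments), \<open>\<kappa>\<close> (permitted difference of means), \<open>\<alpha>\<close>
  (boundary masses), \<open>\<eta>\<close> (error of the truncated potential),
  \<open>T\<close>.\<close>

theorem functional_approximation:
  assumes \<phi>: "compact_weight \<phi> K" and t: "0 \<le> t" and \<epsilon>: "0 < \<epsilon>"
  obtains g where "density_fun g"
    "\<And>s x. 0 \<le> s \<Longrightarrow> s \<le> t \<Longrightarrow> integrable (CP x) (\<lambda>\<omega>. (rf dA \<phi> s \<omega> - rf (\<lambda>_. lborel) g s \<omega>)\<^sup>2)"
    "\<And>s x. 0 \<le> s \<Longrightarrow> s \<le> t \<Longrightarrow> (RE x (\<lambda>\<omega>. (rf dA \<phi> s \<omega> - rf (\<lambda>_. lborel) g s \<omega>)\<^sup>2)) \<le> \<epsilon>"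
proof -
  have K: "compact K" by (rule compact_weightD(4)[OF \<phi>])
  have small: "eventually (\<lambda>\<alpha>. kato_norm K \<alpha> < ennreal e) at_top" if "0 < e" for e
    using order_tendstoD(2)[OF kato_norm_tendsto[OF K], of "ennreal e"] that by simp
  obtain \<alpha>0 where \<alpha>0: "\<alpha>0 \<ge> 1" "kato_norm K \<alpha>0 \<le> 1"
    using eventually_happens'[OF _ eventually_conj[OF small[of 1] eventually_ge_at_top[of 1]]] by (auto intro: less_imp_le)
  \<comment> \<open>A bound for both first moments: exp (\<alpha>0 t) for the functional of dA, and
    1 more for the occupation integral, whose mean exceeds the other by at most \<kappa> \<le>
    1.\<close>
  define b where "b = exp (\<alpha>0 * t) + 1"
  have b: "0 < b" by (simp add: b_def add_pos_pos)
  define \<kappa> where "\<kappa> = min 1 (\<epsilon> / (4 * b))"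
  have \<kappa>: "0 < \<kappa>" "\<kappa> \<le> 1" "4 * b * \<kappa> \<le> \<epsilon>"
  proof -
    show "0 < \<kappa>" "\<kappa> \<le> 1" using \<epsilon> b by (auto simp: \<kappa>_def)
    have "4 * b * \<kappa> \<le> 4 * b * (\<epsilon> / (4 * b))" using b by (intro mult_left_mono) (auto simp: \<kappa>_def)
    then show "4 * b * \<kappa> \<le> \<epsilon>" using b by simp
  qed
  \<comment> \<open>Half of \<kappa> is reserved for the boundary masses; \<alpha> \<ge> \<alpha>0 +
    1 makes the factor exp (- (\<alpha> - \<alpha>0) T) vanish as T grows.\<close>
  obtain \<alpha> where \<alpha>: "\<alpha> \<ge> \<alpha>0 + 1" "kato_norm K \<alpha> \<le> ennreal (\<kappa> / 2)"
    using eventually_happens'[OF _ eventually_conj[OF small[of "\<kappa> / 2"] eventually_ge_at_top[of "\<alpha>0 + 1"]]] \<kappa>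
    by (auto intro: less_imp_le)
  have \<alpha>pos: "0 < \<alpha>" using \<alpha> \<alpha>0 by simp
  \<comment> \<open>The other half of \<kappa>: \<alpha> \<eta> s \<le> \<kappa>/2 for all s \<le>
    t, with 1 added so that t = 0 is allowed.\<close>
  define \<eta> where "\<eta> = \<kappa> / (2 * (\<alpha> * t + 1))"
  have at: "0 \<le> \<alpha> * t" using \<alpha>pos t by simp
  have \<eta>: "0 < \<eta>" using \<kappa> at by (auto simp: \<eta>_def intro!: divide_pos_pos)
  have \<eta>t: "\<alpha> * \<eta> * s \<le> \<kappa> / 2" if "0 \<le> s" "s \<le> t" for s
  proof -
    have "\<alpha> * \<eta> * s \<le> \<alpha> * \<eta> * t" using that \<alpha>pos \<eta> by (intro mult_left_mono) auto
    also have "\<dots> = (\<kappa> / 2) * ((\<alpha> * t) / (\<alpha> * t + 1))" by (simp add: \<eta>_def)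
    also have "\<dots> \<le> (\<kappa> / 2) * 1" using at \<kappa> by (intro mult_left_mono) (auto simp: divide_le_eq)
    finally show ?thesis by simp
  qed
  have "eventually (\<lambda>T. exp (- (\<alpha> - \<alpha>0) * T) < \<eta> / 2) at_top"
  proof (rule order_tendstoD(2))
    have "filterlim (\<lambda>T. (\<alpha> - \<alpha>0) * T) at_top at_top"
      using \<alpha> by (intro filterlim_tendsto_pos_mult_at_top[OF tendsto_const]) (auto intro: filterlim_ident)
    then show "((\<lambda>T. exp (- (\<alpha> - \<alpha>0) * T)) \<longlongrightarrow> 0) at_top"
      unfolding minus_mult_left[symmetric]
      by (intro filterlim_compose[OF exp_at_bot]) (simp only: filterlim_uminus_at_bot minus_minus)
  qed (use \<eta> in simp)
  \<comment> \<open>The two errors in \<open>potential_le_window\<close> get half of \<eta> each;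
    the first carries the factor e, the second a Kato norm at \<alpha>0, which is at most 1.\<close>
  then have ev: "eventually (\<lambda>T. T \<ge> 1 \<and> exp (- (\<alpha> - \<alpha>0) * T) < \<eta> / 2 \<and> kato_norm K T < ennreal (\<eta> / 2 / exp 1)) at_top"
    by (intro eventually_conj eventually_ge_at_top small divide_pos_pos \<eta>) simp_all
  obtain T where T: "T \<ge> 1" "exp (- (\<alpha> - \<alpha>0) * T) < \<eta> / 2" "kato_norm K T < ennreal (\<eta> / 2 / exp 1)"
    using eventually_happens'[OF trivial_limit_at_top_linorder ev] by blast
  define J where "J x = enn2real (kernel_potential (window \<alpha> T) \<phi> x)" for x
  have "kato_norm K \<alpha> \<le> 1"
    using \<alpha>(2) \<kappa>(2) by (intro order_trans[OF \<alpha>(2)]) (simp add: ennreal_le_1)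
  note J = window_density_fun[OF \<phi> T(1) less_imp_le[OF \<alpha>pos] this, folded J_def]
  have JU: "ennreal (J x) \<le> kernel_potential (discount \<alpha>) \<phi> x" for x unfolding J(2) by (rule window_le)
  have UJ: "kernel_potential (discount \<alpha>) \<phi> x \<le> ennreal (J x) + ennreal \<eta>" for x
  proof -
    have "ennreal (exp 1) * kato_norm K T + ennreal (exp (- (\<alpha> - \<alpha>0) * T)) * kato_norm K \<alpha>0
        \<le> ennreal (exp 1) * ennreal (\<eta> / 2 / exp 1) + ennreal (\<eta> / 2) * 1"
      by (intro add_mono mult_mono ennreal_leI less_imp_le[OF T(2)] less_imp_le[OF T(3)] \<alpha>0(2)) auto
    also have "\<dots> = ennreal \<eta>"
      using \<eta> by (simp add: ennreal_mult[symmetric] ennreal_plus[symmetric] del: ennreal_plus)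
    finally show ?thesis
      using potential_le_window[OF \<phi> T(1) less_imp_le[OF \<alpha>pos], of \<alpha>0 x] \<alpha>(1)
      unfolding J(2) by (auto intro: order_trans add_left_mono)
  qed
  define g where "g x = \<alpha> * J x" for x
  have g: "density_fun g"
    using J(1) \<alpha>pos unfolding density_fun_def g_def
    by (auto intro!: continuous_intros exI[of _ "\<alpha> * _"] mult_left_mono)
  note cmp = expectation_compare[OF \<phi> \<alpha>pos _ \<alpha>(2) less_imp_le[OF \<eta>] _ J(1) JU UJ, folded g_def]
  have c1: "EP y (af (\<lambda>_. lborel) g s) \<le> EP y (af dA \<phi> s) + ennreal \<kappa>"
    if "0 \<le> s" for s y
    using \<kappa>(1) by (intro order_trans[OF cmp(1)[OF that]] add_left_mono ennreal_leI) auto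
  have c2: "EP y (af dA \<phi> s) \<le> EP y (af (\<lambda>_. lborel) g s) + ennreal \<kappa>"
    if "0 \<le> s" "s \<le> t" for s y
    using \<kappa>(1) \<eta>t[OF that] by (intro order_trans[OF cmp(2)[OF that(1)]] add_left_mono ennreal_leI) auto
  have B: "EP y (af dA \<phi> s) \<le> ennreal (exp (\<alpha>0 * t))" if "0 \<le> s" "s \<le> t" for s y
  proof -
    have "EP y (af dA \<phi> s) \<le> ennreal (exp (\<alpha>0 * s)) * kato_norm K \<alpha>0"
      using \<alpha>0 by (intro expectation_af_le[OF \<phi>]) auto
    also have "\<dots> \<le> ennreal (exp (\<alpha>0 * t)) * 1"
      using \<alpha>0 that by (intro mult_mono ennreal_leI) (auto intro: mult_left_mono)
    finally show ?thesis by simp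
  qed
  have b1: "EP y (af dA \<phi> s) \<le> ennreal b" if "0 \<le> s" "s \<le> t" for s y
    by (rule order_trans[OF B[OF that]]) (auto simp: b_def intro: ennreal_leI)
  have b2: "EP y (af (\<lambda>_. lborel) g s) \<le> ennreal b" if "0 \<le> s" "s \<le> t" for s y
  proof -
    have "EP y (af (\<lambda>_. lborel) g s) \<le> ennreal (exp (\<alpha>0 * t)) + ennreal 1"
      using \<kappa>(2) by (intro order_trans[OF c1[OF that(1)]] add_mono B[OF that] ennreal_leI)
    also have "\<dots> = ennreal b" unfolding b_def by (rule ennreal_plus[symmetric]) auto
    finally show ?thesis .
  qed
  note m = second_moment_difference[OF clock_dA clock_lborel compact_weightD(7)[OF \<phi>] g _ less_imp_le[OF \<kappa>(1)], where b=b]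
  show ?thesis
  proof (rule that[OF g])
    fix s x assume s: "0 \<le> s" "s \<le> t"
    have cc: "\<And>r y. 0 \<le> r \<Longrightarrow> r \<le> s \<Longrightarrow> (EP y (af dA \<phi> r)) \<le> EP y (af (\<lambda>_. lborel) g r) + ennreal \<kappa>"
      using c2 s by simp
    show "integrable (CP x) (\<lambda>\<omega>. (rf dA \<phi> s \<omega> - rf (\<lambda>_. lborel) g s \<omega>)\<^sup>2)"
      by (rule m(1)[OF s(1) cc c1 b1[OF s] b2[OF s] less_imp_le[OF b]])
    have "RE x (\<lambda>\<omega>. (rf dA \<phi> s \<omega> - rf (\<lambda>_. lborel) g s \<omega>)\<^sup>2) \<le> 4 * b * \<kappa>"
      by (rule m(2)[OF s(1) cc c1 b1[OF s] b2[OF s] less_imp_le[OF b]])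
    then show "RE x (\<lambda>\<omega>. (rf dA \<phi> s \<omega> - rf (\<lambda>_. lborel) g s \<omega>)\<^sup>2) \<le> \<epsilon>" using \<kappa>(3) by simp
  qed
qed

end

section \<open>Measures on space-time\<close>

lemma mdist_spacetime:
  "0 \<le> s \<Longrightarrow> 0 \<le> t \<Longrightarrow> mdist spacetime_metric (x, s) (y, t) = max (dist x y) (dist s t)"
  by (simp add: spacetime_metric_def)

lemma openin_spacetime:
  assumes "openin (mtopology_of (spacetime_metric :: ('s::heine_borel \<times> real) metric)) U"
  obtains V where "open V" "U = V \<inter> (UNIV \<times> {0..})"
proof
  let ?V = "\<Union>{W. open W \<and> W \<inter> (UNIV \<times> {0..}) \<subseteq> U}"
  have U: "U \<subseteq> UNIV \<times> {0..}"
    "\<forall>x\<in>U. \<exists>r>0. \<forall>y\<in>mspace spacetime_metric. mdist spacetime_metric x y < r \<longrightarrow> y \<in> U"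
    using assms unfolding openin_mtopology_of by auto
  show "open ?V" by (rule open_Union) auto
  show "U = ?V \<inter> (UNIV \<times> {0..})"
  proof (intro equalityI subsetI)
    fix u assume u: "u \<in> U"
    obtain a b where ab: "u = (a, b)" by (cases u)
    obtain r where r: "r > 0" "\<forall>y\<in>mspace spacetime_metric. mdist spacetime_metric u y < r \<longrightarrow> y \<in> U"
      using U(2) u by blast
    have b: "0 \<le> b" using U(1) u ab by auto
    have "open (ball a r \<times> ball b r)" by (intro open_Times) auto
    moreover have "(ball a r \<times> ball b r) \<inter> (UNIV \<times> {0..}) \<subseteq> U"
      using r(2) b by (auto simp: ab mdist_spacetime)
    moreover have "u \<in> ball a r \<times> ball b r" using r ab by simp
    ultimately show "u \<in> ?V \<inter> (UNIV \<times> {0..})" using b ab by blast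
  qed blast
qed

text \<open>\<open>max 0\<close> puts the time coordinate into the half-line for every real
  argument, so that measures on the real line can be pushed to space-time without restricting their
  domain.\<close>

lemma measurable_spacetime [measurable (raw)]:
  fixes q :: "'a \<Rightarrow> 's::heine_borel"
  assumes "q \<in> borel_measurable M" "c \<in> borel_measurable M"
  shows "(\<lambda>s. (q s, max 0 (c s))) \<in> measurable M borel_spacetime"
proof (rule measurable_mborelI)
  have m: "(\<lambda>s. (q s, max 0 (c s))) \<in> borel_measurable M" by (intro borel_measurable_Pair assms borel_measurable_max) auto
  fix U :: "('s \<times> real) set" assume "openin (mtopology_of spacetime_metric) U"
  then obtain V where V: "open V" "U = V \<inter> (UNIV \<times> {0..})" by (rule openin_spacetime)
  have "(\<lambda>s. (q s, max 0 (c s))) -` U \<inter> space M = (\<lambda>s. (q s, max 0 (c s))) -` V \<inter> space M"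
    by (auto simp: V)
  also have "\<dots> \<in> sets M" by (rule measurable_sets[OF m]) (use V in simp)
  finally show "(\<lambda>s. (q s, max 0 (c s))) -` U \<inter> space M \<in> sets M" .
qed simp

lemma fst_spacetime_measurable [measurable]: "fst \<in> borel_measurable (borel_spacetime :: ('s::heine_borel \<times> real) measure)"
proof (rule borel_measurableI)
  fix S :: "'s set" assume S: "open S"
  have "openin (mtopology_of spacetime_metric) (S \<times> {0::real..})"
    unfolding openin_mtopology_of
  proof (intro conjI ballI)
    fix u assume "u \<in> S \<times> {0::real..}"
    then obtain a b where ab: "u = (a, b)" "a \<in> S" "0 \<le> b" by auto
    obtain r where "r > 0" "ball a r \<subseteq> S" using S ab(2) by (auto simp: open_contains_ball)
    then show "\<exists>r>0. \<forall>y\<in>mspace spacetime_metric. mdist spacetime_metric u y < r \<longrightarrow> y \<in> S \<times> {0..}"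
      using ab by (intro exI[of _ r]) (auto simp: mdist_spacetime subset_iff)
  qed auto
  moreover have "fst -` S \<inter> space borel_spacetime = S \<times> {0::real..}" by auto
  ultimately show "fst -` S \<inter> space borel_spacetime \<in> sets borel_spacetime"
    using openin_borel_of by metis
qed

text \<open>The outer measure of a closed neighbourhood is attained at a measurable superset, so it
  is enough to test Borel sets \<open>U\<close> containing the neighbourhood.\<close>

lemma prohorov_boundI:
  assumes s: "sets \<mu> = sets (mborel m)" "sets \<nu> = sets (mborel m)"
    and le: "\<And>A U. A \<in> sets (mborel m) \<Longrightarrow> U \<in> sets (mborel m) \<Longrightarrow> closed_nbhd m \<epsilon> A \<subseteq> U \<Longrightarrow>
      emeasure \<mu> A \<le> emeasure \<nu> U + ennreal \<epsilon> \<and> emeasure \<nu> A \<le> emeasure \<mu> U + ennreal \<epsilon>"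
  shows "prohorov_bound m \<mu> \<nu> \<epsilon>"
  unfolding prohorov_bound_def
proof (intro ballI)
  fix A assume A: "A \<in> sets (mborel m)"
  have sp: "space \<mu> = mspace m" "space \<nu> = mspace m" using s[THEN sets_eq_imp_space_eq] by simp_all
  have sub: "closed_nbhd m \<epsilon> A \<subseteq> mspace m" by (auto simp: closed_nbhd_def)
  obtain U where U: "U \<in> sets \<nu>" "closed_nbhd m \<epsilon> A \<subseteq> U" "outer_measure_of \<nu> (closed_nbhd m \<epsilon> A) = emeasure \<nu> U"
    using outer_measure_of_attain[of "closed_nbhd m \<epsilon> A" \<nu>] sub sp by auto
  obtain V where V: "V \<in> sets \<mu>" "closed_nbhd m \<epsilon> A \<subseteq> V" "outer_measure_of \<mu> (closed_nbhd m \<epsilon> A) = emeasure \<mu> V"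
    using outer_measure_of_attain[of "closed_nbhd m \<epsilon> A" \<mu>] sub sp by auto
  show "emeasure \<mu> A \<le> outer_measure_of \<nu> (closed_nbhd m \<epsilon> A) + ennreal \<epsilon> \<and>
      emeasure \<nu> A \<le> outer_measure_of \<mu> (closed_nbhd m \<epsilon> A) + ennreal \<epsilon>"
    using le[OF A _ U(2)] le[OF A _ V(2)] U V s by simp
qed

text \<open>Every set is contained in its closed neighbourhoods, so a setwise difference of at most
  \<delta> bounds the Prohorov distance.\<close>

lemma prohorov_dist_setwise:
  assumes s: "sets \<mu> = sets (mborel m)" "sets \<nu> = sets (mborel m)" and "0 \<le> \<delta>"
    and le: "\<And>A. A \<in> sets (mborel m) \<Longrightarrow> emeasure \<mu> A \<le> emeasure \<nu> A + ennreal \<delta>"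
      "\<And>A. A \<in> sets (mborel m) \<Longrightarrow> emeasure \<nu> A \<le> emeasure \<mu> A + ennreal \<delta>"
  shows "prohorov_dist m \<mu> \<nu> \<le> \<delta>"
proof (rule field_le_epsilon)
  fix e :: real assume e: "0 < e"
  have "prohorov_bound m \<mu> \<nu> (\<delta> + e)"
  proof (rule prohorov_boundI[OF s], intro conjI)
    fix A U assume A: "A \<in> sets (mborel m)" and U: "U \<in> sets (mborel m)" "closed_nbhd m (\<delta> + e) A \<subseteq> U"
    have "A \<subseteq> U" using sets_subset_closed_nbhd[OF A, of "\<delta> + e"] U(2) e assms(3) by auto
    then have "emeasure \<mu> A \<le> emeasure \<mu> U" "emeasure \<nu> A \<le> emeasure \<nu> U"
      using U s by (auto intro: emeasure_mono)
    moreover have "ennreal \<delta> \<le> ennreal (\<delta> + e)" using e by (intro ennreal_leI) simp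
    ultimately show "emeasure \<mu> A \<le> emeasure \<nu> U + ennreal (\<delta> + e)" "emeasure \<nu> A \<le> emeasure \<mu> U + ennreal (\<delta> + e)"
      using le[OF A] by (auto intro: order_trans add_mono)
  qed
  then show "prohorov_dist m \<mu> \<nu> \<le> \<delta> + e" using e assms(3) by (intro prohorov_dist_le) auto
qed

lemma integral_exp_le_nn_integral:
  assumes m: "k \<in> borel_measurable borel" and k: "\<And>t. 0 \<le> k t" and c: "0 \<le> c"
    and le: "(\<integral>\<^sup>+t. ennreal (k t) \<partial>lborel) \<le> ennreal c"
  shows "integrable halfline (\<lambda>t. exp (- t) * k t)"
    and "(\<integral>t. exp (- t) * k t \<partial>halfline) \<le> c"
proof -
  have m': "(\<lambda>t. exp (- t) * k t) \<in> borel_measurable halfline"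
    using m by (intro measurable_restrict_space1) simp
  have "(\<integral>\<^sup>+t. ennreal (exp (- t) * k t) \<partial>halfline) = (\<integral>\<^sup>+t. ennreal (exp (- t) * k t) * indicator {0..} t \<partial>lborel)"
    by (rule nn_integral_restrict_space) simp
  also have "\<dots> \<le> (\<integral>\<^sup>+t. ennreal (k t) \<partial>lborel)"
  proof (rule nn_integral_mono)
    fix t show "ennreal (exp (- t) * k t) * indicator {0..} t \<le> ennreal (k t)"
      using mult_right_mono[of "exp (-t)" 1 "k t"] k[of t] by (cases "0 \<le> t") (auto intro: ennreal_leI)
  qed
  finally have nn: "(\<integral>\<^sup>+t. ennreal (exp (- t) * k t) \<partial>halfline) \<le> ennreal c" using le by (rule order_trans)
  show i: "integrable halfline (\<lambda>t. exp (- t) * k t)"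
    by (rule integrableI_nonneg[OF m']) (use k nn in \<open>auto simp: order_le_less_trans\<close>)
  show "(\<integral>t. exp (- t) * k t \<partial>halfline) \<le> c"
    using nn_integral_eq_integral[OF i] nn k c by (simp add: ennreal_le_iff)
qed

text \<open>
  Mass near time \<open>s\<close> and position \<open>q s\<close> is moved to the atom \<open>(y, c s)\<close>. Truncation at time \<open>t\<close>
  separates the two positions only if \<open>t - \<epsilon> < s \<le> t\<close>, which contributes at most \<open>\<epsilon>\<close> times the total
  mass after integration over \<open>t\<close>.
\<close>

lemma measures_fin_dist_coupling:
  fixes N :: "real measure" and q :: "real \<Rightarrow> 's::heine_borel" and h :: "'s \<Rightarrow> real \<Rightarrow> ennreal"
  assumes \<Sigma>: "\<Sigma> \<in> measures_fin" "\<Sigma>' \<in> measures_fin"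
    and N: "sets N = sets borel" "sigma_finite_measure N"
    and h: "\<And>y. h y \<in> borel_measurable borel" and q: "q \<in> borel_measurable borel"
    and close: "\<And>y s. y \<in> I \<Longrightarrow> h y s \<noteq> 0 \<Longrightarrow> dist (q s) y \<le> \<epsilon>"
    and c: "c \<in> borel_measurable borel" "\<And>s. s \<le> c s" "\<And>s. c s < s + \<epsilon>"
    and pos: "0 < \<epsilon>" "0 \<le> T" "0 \<le> b"
    and E: "\<And>B. B \<in> sets borel_spacetime \<Longrightarrow>
      emeasure \<Sigma> B = (\<Sum>y\<in>I. \<integral>\<^sup>+s. h y s * indicator {0<..} s * indicator B (q s, max 0 s) \<partial>N)"
    and E': "\<And>B. B \<in> sets borel_spacetime \<Longrightarrow>
      emeasure \<Sigma>' B = (\<Sum>y\<in>I. \<integral>\<^sup>+s. h y s * indicator {0<..T} s * indicator B (y, max 0 (c s)) \<partial>N)"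
    and mass: "(\<Sum>y\<in>I. \<integral>\<^sup>+s. h y s * indicator {0<..T} s \<partial>N) \<le> ennreal b"
  shows "measures_fin_dist \<Sigma> \<Sigma>' \<le> \<epsilon> + \<epsilon> * b + exp (- T)"
proof -
  note [measurable_cong] = N(1) and [measurable] = h q c(1)
  have measurable_N: "borel_measurable N = borel_measurable borel" by (simp cong: measurable_cong_sets add: N(1))
  interpret N: sigma_finite_measure N by (rule N(2))
  interpret pair_sigma_finite lborel N ..
  have s\<Sigma>: "sets \<Sigma> = sets borel_spacetime" "sets \<Sigma>' = sets borel_spacetime" using \<Sigma> by (auto simp: measures_fin_def)
  define \<beta> where "\<beta> t = (\<Sum>y\<in>I. \<integral>\<^sup>+s. h y s * indicator {0<..T} s * indicator {s..<s + \<epsilon>} t \<partial>N)" for t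
  have [measurable]: "Measurable.pred (borel \<Otimes>\<^sub>M borel) (\<lambda>x. fst x \<in> {snd x..<snd x + \<epsilon>})"
    unfolding atLeastLessThan_iff by measurable
  have \<beta>m[measurable]: "\<beta> \<in> borel_measurable borel" unfolding \<beta>_def[abs_def] by measurable
  have \<beta>_le: "\<beta> t \<le> ennreal b" for t
    unfolding \<beta>_def by (rule order_trans[OF _ mass]) (intro sum_mono nn_integral_mono, simp add: indicator_def)
  have \<beta>_fin: "\<beta> t < \<top>" for t by (rule le_less_trans[OF \<beta>_le]) simp
  have bound: "prohorov_dist spacetime_metric (truncate_time \<Sigma> t) (truncate_time \<Sigma>' t) \<le> \<epsilon> + enn2real (\<beta> t)"
    if t: "0 \<le> t" "t < T" for t
  proof (rule prohorov_dist_le)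
    let ?e = "\<epsilon> + enn2real (\<beta> t)" and ?L = "UNIV \<times> {0..t}"
    show "0 < ?e" using pos by (simp add: add_pos_nonneg)
    show "prohorov_bound spacetime_metric (truncate_time \<Sigma> t) (truncate_time \<Sigma>' t) ?e"
    proof (rule prohorov_boundI, goal_cases)
      case (3 B U)
      have [measurable]: "B \<in> sets borel_spacetime" "U \<in> sets borel_spacetime" by fact+
      have near: "z \<in> U" if "w \<in> B" "z \<in> UNIV \<times> {0..}" "mdist spacetime_metric z w \<le> \<epsilon>" for z w
      proof -
        have "mdist spacetime_metric z w \<le> ?e" using that(3) by (simp add: add_increasing2)
        then have "z \<in> closed_nbhd spacetime_metric ?e B" using that by (auto simp: closed_nbhd_def)
        then show ?thesis using 3(3) by blast
      qed
      have p1: "h y s * indicator {0<..} s * indicator (?L \<inter> B) (q s, max 0 s)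
          \<le> h y s * indicator {0<..T} s * indicator (?L \<inter> U) (y, max 0 (c s)) + h y s * indicator {0<..T} s * indicator {s..<s + \<epsilon>} t"
        if y: "y \<in> I" for y s
      proof (cases "h y s \<noteq> 0 \<and> 0 < s \<and> s \<le> t \<and> (q s, s) \<in> B")
        case True
        have d: "dist (q s) y \<le> \<epsilon>" using close[OF y] True by blast
        have cs: "s \<le> c s" "c s < s + \<epsilon>" by (rule c)+
        have "mdist spacetime_metric (y, c s) (q s, s) \<le> \<epsilon>"
          using d cs True by (subst mdist_spacetime) (auto simp: dist_commute dist_real_def)
        then have U: "(y, c s) \<in> U" using True cs by (intro near[of "(q s, s)"]) auto
        show ?thesis
        proof (cases "c s \<le> t")
          case True' : True
          then show ?thesis using True U cs t by (simp add: max_def indicator_def)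
        next
          case False
          then show ?thesis using True cs t by (simp add: max_def indicator_def)
        qed
      qed (auto simp: indicator_def max_def)
      \<comment> \<open>This direction has no error term: \<open>c\<close> never moves mass back in
        time, so an atom at time at most \<open>t\<close> comes from mass at time at most
        \<open>t\<close>.\<close>
      have p2: "h y s * indicator {0<..T} s * indicator (?L \<inter> B) (y, max 0 (c s))
          \<le> h y s * indicator {0<..} s * indicator (?L \<inter> U) (q s, max 0 s)" if y: "y \<in> I" for y s
      proof (cases "h y s \<noteq> 0 \<and> 0 < s \<and> s \<le> T \<and> c s \<le> t \<and> (y, c s) \<in> B")
        case True
        have d: "dist (q s) y \<le> \<epsilon>" using close[OF y] True by blast
        have cs: "s \<le> c s" "c s < s + \<epsilon>" by (rule c)+
        have "mdist spacetime_metric (q s, s) (y, c s) \<le> \<epsilon>"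
          using d cs True by (subst mdist_spacetime) (auto simp: dist_real_def)
        then have U: "(q s, s) \<in> U" using True cs by (intro near[of "(y, c s)"]) auto
        show ?thesis using True U cs by (simp add: max_def indicator_def)
      next
        case False
        have "s \<le> c s" by (rule c)
        then show ?thesis using False by (auto simp: indicator_def max_def)
      qed
      have mG: "(\<lambda>s. h y s * indicator {0<..T} s * indicator (?L \<inter> U) (y, max 0 (c s))) \<in> borel_measurable N" for y
        by (intro borel_measurable_times_ennreal measurable_compose[OF measurable_spacetime[OF measurable_const c(1)[folded measurable_N]] borel_measurable_indicator]
            h[folded measurable_N] borel_measurable_indicator) (simp_all add: N(1))
      have "indicator {s..<s + \<epsilon>} t = (indicator {t - \<epsilon><..t} s :: ennreal)" for s by (auto simp: indicator_def)
      then have mH: "(\<lambda>s. h y s * indicator {0<..T} s * indicator {s..<s + \<epsilon>} t) \<in> borel_measurable N" for y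
        by simp
      have e: "\<beta> t \<le> ennreal ?e" "(0::ennreal) \<le> ennreal ?e"
        using \<beta>_fin[of t] pos by (metis ennreal_enn2real ennreal_leI le_add_same_cancel2 less_imp_le, simp)
      have "emeasure (truncate_time \<Sigma> t) B = (\<Sum>y\<in>I. \<integral>\<^sup>+s. h y s * indicator {0<..} s * indicator (?L \<inter> B) (q s, max 0 s) \<partial>N)"
        by (subst emeasure_truncate_time[OF s\<Sigma>(1)]) (measurable, rule E, measurable)
      also have "\<dots> \<le> (\<Sum>y\<in>I. \<integral>\<^sup>+s. h y s * indicator {0<..T} s * indicator (?L \<inter> U) (y, max 0 (c s)) +
          h y s * indicator {0<..T} s * indicator {s..<s + \<epsilon>} t \<partial>N)"
        by (intro sum_mono nn_integral_mono p1)
      also have "\<dots> = (\<Sum>y\<in>I. \<integral>\<^sup>+s. h y s * indicator {0<..T} s * indicator (?L \<inter> U) (y, max 0 (c s)) \<partial>N) + \<beta> t"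
        unfolding \<beta>_def sum.distrib[symmetric] by (intro sum.cong refl nn_integral_add mG mH)
      also have "(\<Sum>y\<in>I. \<integral>\<^sup>+s. h y s * indicator {0<..T} s * indicator (?L \<inter> U) (y, max 0 (c s)) \<partial>N) = emeasure (truncate_time \<Sigma>' t) U"
        by (subst emeasure_truncate_time[OF s\<Sigma>(2)]) (measurable, rule E'[symmetric], measurable)
      finally have 1: "emeasure (truncate_time \<Sigma> t) B \<le> emeasure (truncate_time \<Sigma>' t) U + ennreal ?e"
        using e(1) by (rule order_trans[OF _ add_left_mono])
      have "emeasure (truncate_time \<Sigma>' t) B = (\<Sum>y\<in>I. \<integral>\<^sup>+s. h y s * indicator {0<..T} s * indicator (?L \<inter> B) (y, max 0 (c s)) \<partial>N)"
        by (subst emeasure_truncate_time[OF s\<Sigma>(2)]) (measurable, rule E', measurable)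
      also have "\<dots> \<le> (\<Sum>y\<in>I. \<integral>\<^sup>+s. h y s * indicator {0<..} s * indicator (?L \<inter> U) (q s, max 0 s) \<partial>N)"
        by (intro sum_mono nn_integral_mono p2)
      also have "\<dots> = emeasure (truncate_time \<Sigma> t) U"
        by (subst emeasure_truncate_time[OF s\<Sigma>(1)]) (measurable, rule E[symmetric], measurable)
      finally have "emeasure (truncate_time \<Sigma>' t) B \<le> emeasure (truncate_time \<Sigma> t) U + ennreal ?e"
        by (intro add_increasing2) simp
      with 1 show ?case by blast
    qed (simp_all add: truncate_time_def s\<Sigma>)
  qed
  have "(\<integral>\<^sup>+t. ennreal (enn2real (\<beta> t)) \<partial>lborel) = (\<integral>\<^sup>+t. \<beta> t \<partial>lborel)"
    using \<beta>_fin by (intro nn_integral_cong) simp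
  also have "\<dots> = (\<Sum>y\<in>I. \<integral>\<^sup>+t. (\<integral>\<^sup>+s. h y s * indicator {0<..T} s * indicator {s..<s + \<epsilon>} t \<partial>N) \<partial>lborel)"
    unfolding \<beta>_def by (rule nn_integral_sum) measurable
  also have "\<dots> = (\<Sum>y\<in>I. \<integral>\<^sup>+s. (\<integral>\<^sup>+t. h y s * indicator {0<..T} s * indicator {s..<s + \<epsilon>} t \<partial>lborel) \<partial>N)"
    by (intro sum.cong refl Fubini'[symmetric]) measurable
  also have "\<dots> = (\<Sum>y\<in>I. \<integral>\<^sup>+s. h y s * indicator {0<..T} s * ennreal \<epsilon> \<partial>N)"
    using pos by (intro sum.cong refl nn_integral_cong) (subst nn_integral_cmult_indicator, auto)
  also have "\<dots> = (\<Sum>y\<in>I. \<integral>\<^sup>+s. h y s * indicator {0<..T} s \<partial>N) * ennreal \<epsilon>"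
    unfolding sum_distrib_right by (intro sum.cong refl nn_integral_multc) measurable
  also have "\<dots> \<le> ennreal b * ennreal \<epsilon>" by (intro mult_right_mono mass) simp
  also have "\<dots> = ennreal (\<epsilon> * b)" using pos by (simp add: ennreal_mult mult.commute)
  finally have nn: "(\<integral>\<^sup>+t. ennreal (enn2real (\<beta> t)) \<partial>lborel) \<le> ennreal (\<epsilon> * b)" .
  note k = integral_exp_le_nn_integral[OF _ enn2real_nonneg _ nn]
  have i: "integrable halfline (\<lambda>t. exp (- t) * \<epsilon> + exp (- t) * enn2real (\<beta> t))"
    using pos by (intro Bochner_Integration.integrable_add k(1)) (auto intro!: integrable_mult_left integrable_exp_halfline)
  show ?thesis
    unfolding measures_fin_dist_def
  proof (rule integral_exp_capped_le[OF pos(2) _ _ _ bound])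
    show "integrable halfline (\<lambda>t. exp (- t) * (\<epsilon> + enn2real (\<beta> t)))"
      using i by (simp add: distrib_left)
    have "(\<integral>t. exp (- t) * \<epsilon> + exp (- t) * enn2real (\<beta> t) \<partial>halfline) =
        (\<integral>t. exp (- t) * \<epsilon> \<partial>halfline) + (\<integral>t. exp (- t) * enn2real (\<beta> t) \<partial>halfline)"
      using pos by (intro Bochner_Integration.integral_add k(1)) (auto intro!: integrable_mult_left integrable_exp_halfline)
    also have "\<dots> \<le> \<epsilon> + \<epsilon> * b"
      using k(2) pos by (intro add_mono) (auto simp: integral_exp_halfline)
    finally show "(\<integral>t. exp (- t) * (\<epsilon> + enn2real (\<beta> t)) \<partial>halfline) \<le> \<epsilon> + \<epsilon> * b"
      by (simp add: distrib_left)
  qed (use pos in auto)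
qed

text \<open>Atoms sit at the right ends of the time cells, the position to which rounding up moves
  the mass of a cell. \<open>ennreal\<close> counts negative weights as 0, so arbitrary real weights
  are allowed.\<close>

definition atomic_spacetime :: "real \<Rightarrow> ('s::heine_borel \<times> nat) set \<Rightarrow> ('s \<times> nat \<Rightarrow> real) \<Rightarrow> ('s \<times> real) measure" where
  "atomic_spacetime \<epsilon> J v = distr (point_measure J (\<lambda>j. ennreal (v j))) borel_spacetime (\<lambda>(y, l). (y, real (Suc l) * \<epsilon>))"

lemma emeasure_atomic_spacetime:
  assumes "finite J" "0 \<le> \<epsilon>" "B \<in> sets borel_spacetime"
  shows "emeasure (atomic_spacetime \<epsilon> J v) B = (\<Sum>(y, l)\<in>J. ennreal (v (y, l)) * indicator B (y, real (Suc l) * \<epsilon>))"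
proof -
  have m: "(\<lambda>(y, l). (y, real (Suc l) * \<epsilon>)) \<in> measurable (point_measure J (\<lambda>j. ennreal (v j))) borel_spacetime"
    using assms(2) by (auto simp: measurable_def sets_point_measure space_point_measure)
  have "emeasure (atomic_spacetime \<epsilon> J v) B = (\<integral>\<^sup>+z. indicator B z \<partial>atomic_spacetime \<epsilon> J v)"
    using assms(3) by (subst nn_integral_indicator) (auto simp: atomic_spacetime_def)
  also have "\<dots> = (\<integral>\<^sup>+j. indicator B (case j of (y, l) \<Rightarrow> (y, real (Suc l) * \<epsilon>)) \<partial>point_measure J (\<lambda>j. ennreal (v j)))"
    unfolding atomic_spacetime_def using assms(3) by (intro nn_integral_distr m) auto
  also have "\<dots> = (\<Sum>(y, l)\<in>J. ennreal (v (y, l)) * indicator B (y, real (Suc l) * \<epsilon>))"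
    using assms(1) by (subst nn_integral_point_measure_finite) (simp_all add: case_prod_beta)
  finally show ?thesis .
qed

lemma atomic_spacetime_measures_fin:
  assumes "finite J" "0 \<le> \<epsilon>" shows "atomic_spacetime \<epsilon> J v \<in> measures_fin"
proof -
  have "emeasure (atomic_spacetime \<epsilon> J v) (UNIV \<times> {0..t}) < \<top>" for t
    using assms by (subst emeasure_atomic_spacetime) (auto simp: time_slab_sets sum_Pinfty indicator_def less_top)
  then show ?thesis unfolding measures_fin_def by (simp add: atomic_spacetime_def)
qed

lemma measures_fin_dist_le_const:
  assumes "0 \<le> c" "\<And>t. 0 \<le> t \<Longrightarrow> prohorov_dist spacetime_metric (truncate_time \<Sigma>1 t) (truncate_time \<Sigma>2 t) \<le> c"
  shows "measures_fin_dist \<Sigma>1 \<Sigma>2 \<le> c"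
proof (rule field_le_epsilon)
  fix e :: real assume e: "0 < e"
  have "measures_fin_dist \<Sigma>1 \<Sigma>2 \<le> c + exp (- max 0 (- ln e))"
    unfolding measures_fin_dist_def using assms by (intro integral_exp_capped_le_const) auto
  also have "exp (- max 0 (- ln e)) \<le> e" using e by (auto simp: max_def)
  finally show "measures_fin_dist \<Sigma>1 \<Sigma>2 \<le> c + e" by simp
qed

text \<open>The atoms are at the same places and only their masses differ, so setwise differences
  are bounded by the l1 distance of the weights at every truncation time. Finitely many real
  functionals of the path thereby control a random measure.\<close>

lemma measures_fin_dist_atomic:
  assumes J: "finite J" and \<epsilon>: "0 \<le> \<epsilon>"
  shows "measures_fin_dist (atomic_spacetime \<epsilon> J v) (atomic_spacetime \<epsilon> J v') \<le> (\<Sum>j\<in>J. \<bar>v j - v' j\<bar>)"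
proof (rule measures_fin_dist_le_const)
  show "0 \<le> (\<Sum>j\<in>J. \<bar>v j - v' j\<bar>)" by (simp add: sum_nonneg)
  have s: "sets (atomic_spacetime \<epsilon> J v) = sets borel_spacetime" for v by (simp add: atomic_spacetime_def)
  have le: "emeasure (truncate_time (atomic_spacetime \<epsilon> J v) t) B \<le> emeasure (truncate_time (atomic_spacetime \<epsilon> J v') t) B + ennreal (\<Sum>j\<in>J. \<bar>v j - v' j\<bar>)"
    if B: "B \<in> sets borel_spacetime" for B t v v'
  proof -
    let ?D = "(UNIV \<times> {0..t}) \<inter> B"
    have D: "?D \<in> sets borel_spacetime" using B by auto
    have a: "ennreal (v j) \<le> ennreal (v' j) + ennreal \<bar>v j - v' j\<bar>" for j
    proof -
      have "ennreal (v j) \<le> ennreal (max 0 (v' j) + \<bar>v j - v' j\<bar>)" by (intro ennreal_leI) auto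
      also have "\<dots> = ennreal (v' j) + ennreal \<bar>v j - v' j\<bar>" by (subst ennreal_plus) (auto simp: max_def ennreal_neg)
      finally show ?thesis .
    qed
    have "(\<Sum>(y, l)\<in>J. ennreal (v (y, l)) * indicator ?D (y, real (Suc l) * \<epsilon>)) \<le>
      (\<Sum>(y, l)\<in>J. ennreal (v' (y, l)) * indicator ?D (y, real (Suc l) * \<epsilon>) + ennreal \<bar>v (y, l) - v' (y, l)\<bar>)"
      using a by (intro sum_mono) (auto simp: indicator_def)
    also have "\<dots> = (\<Sum>(y, l)\<in>J. ennreal (v' (y, l)) * indicator ?D (y, real (Suc l) * \<epsilon>)) + ennreal (\<Sum>j\<in>J. \<bar>v j - v' j\<bar>)"
      by (simp add: sum.distrib case_prod_beta)
    finally show ?thesis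
      unfolding emeasure_truncate_time[OF s B] emeasure_atomic_spacetime[OF J \<epsilon> D] .
  qed
  fix t :: real assume "0 \<le> t"
  have le': "emeasure (truncate_time (atomic_spacetime \<epsilon> J v') t) B \<le> emeasure (truncate_time (atomic_spacetime \<epsilon> J v) t) B + ennreal (\<Sum>j\<in>J. \<bar>v j - v' j\<bar>)"
    if B: "B \<in> sets borel_spacetime" for B
    using le[OF B, of v' t v] by (simp add: abs_minus_commute)
  show "prohorov_dist spacetime_metric (truncate_time (atomic_spacetime \<epsilon> J v) t) (truncate_time (atomic_spacetime \<epsilon> J v') t) \<le> (\<Sum>j\<in>J. \<bar>v j - v' j\<bar>)"
    by (rule prohorov_dist_setwise) (auto simp: truncate_time_def[THEN arg_cong[of _ _ sets]] s sum_nonneg le le')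
qed

section \<open>Discretization of space-time occupation measures\<close>

text \<open>Closed form of the radial average in the cut-off: 1 within radius R - 1, 0 beyond R and
  linear in between. In particular it is continuous with compact support.\<close>

definition radial_weight :: "'s::heine_borel \<Rightarrow> real \<Rightarrow> 's \<Rightarrow> real" where
  "radial_weight \<rho> R x = min 1 (max 0 (R - dist \<rho> x))"

lemma radial_weight_integral:
  "(\<integral>\<^sup>+r. indicator {R - 1..R} r * indicator (cball \<rho> r) x \<partial>lborel) = ennreal (radial_weight \<rho> R x)"
proof -
  have "(\<integral>\<^sup>+r. indicator {R - 1..R} r * indicator (cball \<rho> r) x \<partial>lborel) = (\<integral>\<^sup>+r. indicator {max (R - 1) (dist \<rho> x)..R} r \<partial>lborel)"
    by (intro nn_integral_cong) (auto simp: indicator_def)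
  also have "\<dots> = ennreal (radial_weight \<rho> R x)"
    by (cases "dist \<rho> x \<le> R") (auto simp: radial_weight_def max_def min_def ennreal_neg)
  finally show ?thesis .
qed

context kato_process
begin

lemma compact_weight_radial: "compact_weight (radial_weight \<rho> R) (cball \<rho> R)"
  unfolding compact_weight_def radial_weight_def by (auto intro!: continuous_intros compact_cball)

lemma nn_integral_stom:
  assumes g: "good \<omega>" and f[measurable]: "f \<in> borel_measurable borel_spacetime"
  shows "(\<integral>\<^sup>+z. f z \<partial>stom X A \<omega>) = (\<integral>\<^sup>+s. f (pos \<omega> s, max 0 s) * indicator {0<..} s \<partial>dA \<omega>)"
proof -
  have q[measurable]: "pos \<omega> \<in> borel_measurable borel" by (rule good_state_measurable[OF g])
  have sb: "sets (dA \<omega>) = sets borel" by (rule clock_sets[OF clock_dA g])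
  have "{t. 0 \<le> t \<and> ennreal t < lifetime X \<omega>} = {0..}" using g by (auto simp: good_def)
  then have am: "additive_measure X A \<omega> = restrict_space (dA \<omega>) {0..}"
    unfolding additive_measure_def dA_def by simp
  have sp: "space (additive_measure X A \<omega>) = {0..}" using sets_eq_imp_space_eq[OF sb] by (simp add: am space_restrict_space)
  have "(\<lambda>t. (pos \<omega> t, max 0 t)) \<in> measurable borel borel_spacetime" by measurable
  then have "(\<lambda>t. (pos \<omega> t, max 0 t)) \<in> measurable (additive_measure X A \<omega>) borel_spacetime"
    unfolding am by (intro measurable_restrict_space1) (simp cong: measurable_cong_sets add: sb)
  then have m: "(\<lambda>t. (pos \<omega> t, t)) \<in> measurable (additive_measure X A \<omega>) borel_spacetime"
    by (rule measurable_cong[THEN iffD1, rotated]) (simp add: sp)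
  have "(\<integral>\<^sup>+z. f z \<partial>stom X A \<omega>) = (\<integral>\<^sup>+t. f (pos \<omega> t, t) \<partial>additive_measure X A \<omega>)"
    unfolding stom_def by (rule nn_integral_distr[OF m]) (use f in simp)
  also have "\<dots> = (\<integral>\<^sup>+t. f (pos \<omega> t, max 0 t) \<partial>additive_measure X A \<omega>)"
    by (intro nn_integral_cong) (simp add: sp)
  also have "\<dots> = (\<integral>\<^sup>+s. f (pos \<omega> s, max 0 s) * indicator {0<..} s \<partial>dA \<omega>)"
    by (rule nn_integral_additive_measure[OF g]) measurable
  finally show ?thesis .
qed

lemma emeasure_stom:
  assumes g: "good \<omega>" and B[measurable]: "B \<in> sets borel_spacetime"
  shows "emeasure (stom X A \<omega>) B = (\<integral>\<^sup>+s. indicator {0<..} s * indicator B (pos \<omega> s, max 0 s) \<partial>dA \<omega>)"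
    and "emeasure (radial_cutoff \<rho> R (stom X A \<omega>)) B =
      (\<integral>\<^sup>+s. ennreal (radial_weight \<rho> R (pos \<omega> s)) * indicator {0<..} s * indicator B (pos \<omega> s, max 0 s) \<partial>dA \<omega>)"
proof -
  have s: "sets (stom X A \<omega>) = sets borel_spacetime" by (simp add: stom_def)
  have "emeasure (stom X A \<omega>) B = (\<integral>\<^sup>+z. indicator B z \<partial>stom X A \<omega>)" by (simp add: s)
  then show "emeasure (stom X A \<omega>) B = (\<integral>\<^sup>+s. indicator {0<..} s * indicator B (pos \<omega> s, max 0 s) \<partial>dA \<omega>)"
    by (simp add: nn_integral_stom[OF g] mult.commute)
  have rw[measurable]: "radial_weight \<rho> R \<in> borel_measurable borel" by (rule compact_weightD(6)[OF compact_weight_radial])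
  have m: "(\<lambda>z. ennreal (radial_weight \<rho> R (fst z))) \<in> borel_measurable borel_spacetime" by measurable
  have "radial_cutoff \<rho> R (stom X A \<omega>) = density (stom X A \<omega>) (\<lambda>z. ennreal (radial_weight \<rho> R (fst z)))"
    unfolding radial_cutoff_def radial_weight_integral by (simp add: case_prod_beta')
  then have "emeasure (radial_cutoff \<rho> R (stom X A \<omega>)) B = (\<integral>\<^sup>+z. ennreal (radial_weight \<rho> R (fst z)) * indicator B z \<partial>stom X A \<omega>)"
    using m by (simp add: emeasure_density s cong: measurable_cong_sets)
  also have "\<dots> = (\<integral>\<^sup>+s. (ennreal (radial_weight \<rho> R (fst (pos \<omega> s, max 0 s))) * indicator B (pos \<omega> s, max 0 s)) * indicator {0<..} s \<partial>dA \<omega>)"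
    by (rule nn_integral_stom[OF g]) (use m in measurable)
  finally show "emeasure (radial_cutoff \<rho> R (stom X A \<omega>)) B =
      (\<integral>\<^sup>+s. ennreal (radial_weight \<rho> R (pos \<omega> s)) * indicator {0<..} s * indicator B (pos \<omega> s, max 0 s) \<partial>dA \<omega>)"
    by (simp add: ac_simps)
qed

lemma stom_measures_fin:
  assumes g: "good \<omega>"
  shows "stom X A \<omega> \<in> measures_fin" "radial_cutoff \<rho> R (stom X A \<omega>) \<in> measures_fin"
proof -
  have sb: "sets (dA \<omega>) = sets borel" by (rule clock_sets[OF clock_dA g])
  have fin: "(\<integral>\<^sup>+s. indicator {0<..t} s \<partial>dA \<omega>) < \<top>" if "0 \<le> t" for t
    using clock_finite[OF clock_dA g that] sb by simp
  have "emeasure (stom X A \<omega>) (UNIV \<times> {0..t}) \<le> (\<integral>\<^sup>+s. indicator {0<..t} s \<partial>dA \<omega>)"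
    "emeasure (radial_cutoff \<rho> R (stom X A \<omega>)) (UNIV \<times> {0..t}) \<le> (\<integral>\<^sup>+s. indicator {0<..t} s \<partial>dA \<omega>)" for t
    unfolding emeasure_stom[OF g time_slab_sets]
    by (intro nn_integral_mono; auto simp: indicator_def radial_weight_def)+
  then show "stom X A \<omega> \<in> measures_fin" "radial_cutoff \<rho> R (stom X A \<omega>) \<in> measures_fin"
    using fin unfolding measures_fin_def by (auto simp: radial_cutoff_def stom_def intro: le_less_trans)
qed

definition grid_increment :: "('w \<Rightarrow> real measure) \<Rightarrow> real \<Rightarrow> ('s \<Rightarrow> 's \<Rightarrow> real) \<Rightarrow> 'w \<Rightarrow> 's \<times> nat \<Rightarrow> real" where
  "grid_increment N \<epsilon> h \<omega> = (\<lambda>(y, l). rf N (h y) (real (Suc l) * \<epsilon>) \<omega> - rf N (h y) (real l * \<epsilon>) \<omega>)"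

lemma ennreal_grid_increment:
  assumes N: "clock N" and g: "good \<omega>" and h: "density_fun (h y)" and \<epsilon>: "0 \<le> \<epsilon>"
  shows "ennreal (grid_increment N \<epsilon> h \<omega> (y, l)) =
    (\<integral>\<^sup>+s. ennreal (h y (pos \<omega> s)) * indicator {real l * \<epsilon><..real (Suc l) * \<epsilon>} s \<partial>N \<omega>)"
proof -
  have t: "0 \<le> real l * \<epsilon>" "real l * \<epsilon> \<le> real (Suc l) * \<epsilon>" using \<epsilon> by (auto intro!: mult_right_mono)
  then have t': "0 \<le> real (Suc l) * \<epsilon>" by simp
  have "ennreal (rf N (h y) (real (Suc l) * \<epsilon>) \<omega>) = ennreal (rf N (h y) (real l * \<epsilon>) \<omega>) +
      (\<integral>\<^sup>+s. ennreal (h y (pos \<omega> s)) * indicator {real l * \<epsilon><..real (Suc l) * \<epsilon>} s \<partial>N \<omega>)"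
    using af_increment[OF N g h t] unfolding af_eq_rf[OF N g h t'] af_eq_rf[OF N g h t(1)] .
  then show ?thesis
    unfolding grid_increment_def prod.case by (subst ennreal_minus[symmetric]) (simp_all add: rf_nonneg)
qed

text \<open>Space is discretized by a partition of the radial weight into pieces of radius
  \<epsilon>, time by rounding up to multiples of \<epsilon>. The three terms are the displacement,
  the mass caught by truncation while being moved in time, and the times beyond n
  \<epsilon>.\<close>

theorem stom_discretization:
  assumes \<epsilon>: "0 < \<epsilon>"
  obtains I \<phi> where "finite I" "\<And>y. compact_weight (\<phi> y) (cball \<rho> R)"
    "\<And>\<omega> n. good \<omega> \<Longrightarrow> measures_fin_dist (radial_cutoff \<rho> R (stom X A \<omega>))
      (atomic_spacetime \<epsilon> (I \<times> {..<n}) (grid_increment dA \<epsilon> \<phi> \<omega>))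
      \<le> \<epsilon> + \<epsilon> * rf dA (radial_weight \<rho> R) (real n * \<epsilon>) \<omega> + exp (- (real n * \<epsilon>))"
proof -
  have "x \<in> (\<Union>y\<in>UNIV. ball y (\<epsilon> / 2))" for x using \<epsilon> by (intro UN_I[of x]) auto
  then have "cball \<rho> R \<subseteq> (\<Union>y\<in>UNIV. ball y (\<epsilon> / 2))" by blast
  then obtain I where I: "finite I" "cball \<rho> R \<subseteq> (\<Union>y\<in>I. ball y (\<epsilon> / 2))"
    using compactE_image[OF compact_cball[of \<rho> R], of UNIV "\<lambda>y. ball y (\<epsilon> / 2)"] by auto
  define w where "w y x = max 0 (\<epsilon> - dist x y)" for y x :: 's
  \<comment> \<open>The lower bound \<epsilon>/2 keeps the quotients continuous everywhere. On the
    ball some centre is within \<epsilon>/2, so there the sum itself is at least \<epsilon>/2 and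
    the pieces add up to the radial weight exactly; outside, the radial weight vanishes.\<close>
  define W where "W x = max (\<epsilon> / 2) (\<Sum>y\<in>I. w y x)" for x
  define \<phi> where "\<phi> y x = (if y \<in> I then radial_weight \<rho> R x * (w y x / W x) else 0)" for y x
  have W: "0 < W x" for x using \<epsilon> by (simp add: W_def less_max_iff_disj)
  have w0: "0 \<le> w y x" for y x by (simp add: w_def)
  have wW: "w y x \<le> W x" if "y \<in> I" for y x
    unfolding W_def using member_le_sum[OF that, of "\<lambda>y. w y x"] I(1) w0 by (simp add: le_max_iff_disj)
  note rw = compact_weightD[OF compact_weight_radial[of \<rho> R]]
  have cont: "continuous_on UNIV (\<phi> y)" for y
  proof (cases "y \<in> I")
    case True
    have "continuous_on UNIV (\<lambda>x. radial_weight \<rho> R x * (w y x / W x))"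
      using W unfolding W_def w_def by (intro continuous_intros rw(1)) (metis less_irrefl)
    then show ?thesis using True by (simp add: \<phi>_def[abs_def])
  qed (simp add: \<phi>_def[abs_def])
  have \<phi>: "compact_weight (\<phi> y) (cball \<rho> R)" for y
    unfolding compact_weight_def
  proof (intro conjI allI cont compact_cball impI)
    fix x show "0 \<le> \<phi> y x" using rw(2)[of x] w0[of y x] W[of x] by (simp add: \<phi>_def)
    show "\<phi> y x \<le> 1"
    proof (cases "y \<in> I")
      case True
      then have "radial_weight \<rho> R x * (w y x / W x) \<le> 1 * 1"
        using rw(2,3)[of x] w0[of y x] W[of x] wW[OF True, of x] by (intro mult_mono) (auto simp: divide_le_eq)
      then show ?thesis using True by (simp add: \<phi>_def)
    qed (simp add: \<phi>_def)
    assume "x \<notin> cball \<rho> R" then show "\<phi> y x = 0" using rw(5)[of x] by (simp add: \<phi>_def)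
  qed
  have sum: "(\<Sum>y\<in>I. \<phi> y x) = radial_weight \<rho> R x" for x
  proof (cases "x \<in> cball \<rho> R")
    case True
    then obtain y where y: "y \<in> I" "dist y x < \<epsilon> / 2" using I(2) by auto
    have "\<epsilon> / 2 \<le> w y x" using y(2) by (auto simp: w_def dist_commute max_def)
    also have "\<dots> \<le> (\<Sum>y\<in>I. w y x)" using member_le_sum[OF y(1), of "\<lambda>y. w y x"] I(1) w0 by simp
    finally have "(\<Sum>y\<in>I. w y x) = W x" by (simp add: W_def)
    then have "(\<Sum>y\<in>I. radial_weight \<rho> R x * (w y x / W x)) = radial_weight \<rho> R x"
      using W[of x] by (simp add: sum_distrib_left[symmetric] sum_divide_distrib[symmetric])
    then show ?thesis by (simp add: \<phi>_def)
  qed (use rw(5)[of x] in \<open>simp add: \<phi>_def\<close>)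
  have close: "dist x y \<le> \<epsilon>" if "\<phi> y x \<noteq> 0" for x y
    using that by (auto simp: \<phi>_def w_def max_def split: if_splits)
  show ?thesis
  proof (rule that[OF I(1) \<phi>])
    fix \<omega> n assume g: "good \<omega>"
    let ?N = "dA \<omega>" and ?q = "pos \<omega>" and ?T = "real n * \<epsilon>"
    let ?J = "I \<times> {..<n}"
    \<comment> \<open>Rounding up to the right end of the cell, open on the left, that contains
      \<open>s\<close>.\<close>
    define c where "c s = of_int \<lceil>s / \<epsilon>\<rceil> * \<epsilon>" for s :: real
    define h where "h y s = ennreal (\<phi> y (?q s))" for y s
    have q[measurable]: "?q \<in> borel_measurable borel" by (rule good_state_measurable[OF g])
    have sb[measurable_cong]: "sets ?N = sets borel" by (rule clock_sets[OF clock_dA g])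
    have [measurable]: "\<phi> y \<in> borel_measurable borel" for y by (rule compact_weightD(6)[OF \<phi>])
    have hm[measurable]: "h y \<in> borel_measurable borel" for y unfolding h_def[abs_def] by measurable
    have cm[measurable]: "c \<in> borel_measurable borel" unfolding c_def[abs_def] by measurable
    have c1: "s \<le> c s" "c s < s + \<epsilon>" for s
      using \<epsilon> ceiling_correct[of "s / \<epsilon>"] le_of_int_ceiling[of "s / \<epsilon>"] unfolding pos_divide_le_eq[OF \<epsilon>]
      by (auto simp: c_def field_simps)
    have hsum: "(\<Sum>y\<in>I. h y s) = ennreal (radial_weight \<rho> R (?q s))" for s
      unfolding h_def sum[symmetric] using compact_weightD(2)[OF \<phi>] by (subst sum_ennreal) auto
    have split: "(\<integral>\<^sup>+s. h y s * indicator {0<..real n * \<epsilon>} s * indicator B (y, max 0 (c s)) \<partial>?N) =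
        (\<Sum>l<n. (\<integral>\<^sup>+s. h y s * indicator {real l * \<epsilon><..real (Suc l) * \<epsilon>} s \<partial>?N) * indicator B (y, real (Suc l) * \<epsilon>))"
      if [measurable]: "B \<in> sets borel_spacetime" for y n B
    proof (induction n)
      case (Suc n)
      have cs: "c s = real (Suc n) * \<epsilon>" if "s \<in> {real n * \<epsilon><..real (Suc n) * \<epsilon>}" for s
      proof -
        have "\<lceil>s / \<epsilon>\<rceil> = int (Suc n)" using that \<epsilon> by (intro ceiling_unique) (auto simp: field_simps)
        then show ?thesis by (simp add: c_def)
      qed
      have pw: "h y s * indicator {0<..real (Suc n) * \<epsilon>} s * indicator B (y, max 0 (c s)) =
          h y s * indicator {0<..real n * \<epsilon>} s * indicator B (y, max 0 (c s)) +
          h y s * indicator {real n * \<epsilon><..real (Suc n) * \<epsilon>} s * indicator B (y, real (Suc n) * \<epsilon>)" for s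
      proof (cases "s \<in> {real n * \<epsilon><..real (Suc n) * \<epsilon>}")
        case True
        have "0 \<le> real n * \<epsilon>" "0 \<le> real (Suc n) * \<epsilon>" using \<epsilon> by auto
        then have "0 < s" "max 0 (c s) = real (Suc n) * \<epsilon>" using True cs[OF True] by auto
        then show ?thesis using True by (simp only:) (simp add: indicator_def)
      next
        case False
        have "real n * \<epsilon> \<le> real (Suc n) * \<epsilon>" using \<epsilon> by (intro mult_right_mono) auto
        then have "indicator {0<..real (Suc n) * \<epsilon>} s = (indicator {0<..real n * \<epsilon>} s :: ennreal)"
          using False by (auto simp: indicator_def)
        then show ?thesis using False by simp
      qed
      have "(\<integral>\<^sup>+s. h y s * indicator {0<..real (Suc n) * \<epsilon>} s * indicator B (y, max 0 (c s)) \<partial>?N) =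
        (\<integral>\<^sup>+s. h y s * indicator {0<..real n * \<epsilon>} s * indicator B (y, max 0 (c s)) \<partial>?N) +
        (\<integral>\<^sup>+s. h y s * indicator {real n * \<epsilon><..real (Suc n) * \<epsilon>} s * indicator B (y, real (Suc n) * \<epsilon>) \<partial>?N)"
      proof -
        have "(\<lambda>s. indicator B (y, max 0 (c s)) :: ennreal) \<in> borel_measurable ?N"
          by (rule measurable_compose[OF measurable_spacetime[OF measurable_const] borel_measurable_indicator]) measurable
        then have "(\<lambda>s. h y s * indicator {0<..real n * \<epsilon>} s * indicator B (y, max 0 (c s))) \<in> borel_measurable ?N"
          by (intro borel_measurable_times_ennreal) measurable
        then show ?thesis unfolding pw by (rule nn_integral_add) measurable
      qed
      also have "(\<integral>\<^sup>+s. h y s * indicator {real n * \<epsilon><..real (Suc n) * \<epsilon>} s * indicator B (y, real (Suc n) * \<epsilon>) \<partial>?N) =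
        (\<integral>\<^sup>+s. h y s * indicator {real n * \<epsilon><..real (Suc n) * \<epsilon>} s \<partial>?N) * indicator B (y, real (Suc n) * \<epsilon>)"
        by (rule nn_integral_multc) measurable
      finally show ?case unfolding Suc.IH by simp
    qed simp
    have N': "sigma_finite_measure ?N"
      unfolding dA(1)[OF g] using dA(2,3)[OF g]
      by (intro sigma_finite_interval_measure) (auto simp: mono_def continuous_on_eq_continuous_at continuous_at_imp_continuous_within)
    have mass: "(\<Sum>y\<in>I. \<integral>\<^sup>+s. h y s * indicator {0<..?T} s \<partial>?N) = ennreal (rf dA (radial_weight \<rho> R) ?T \<omega>)"
    proof -
      have "(\<Sum>y\<in>I. \<integral>\<^sup>+s. h y s * indicator {0<..?T} s \<partial>?N) = (\<integral>\<^sup>+s. (\<Sum>y\<in>I. h y s * indicator {0<..?T} s) \<partial>?N)"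
        by (rule nn_integral_sum[symmetric]) measurable
      also have "\<dots> = af dA (radial_weight \<rho> R) ?T \<omega>"
        unfolding sum_distrib_right[symmetric] hsum functional_def ..
      finally show ?thesis using af_eq_rf[OF clock_dA g rw(7), of ?T] \<epsilon> by simp
    qed
    show "measures_fin_dist (radial_cutoff \<rho> R (stom X A \<omega>))
      (atomic_spacetime \<epsilon> ?J (grid_increment dA \<epsilon> \<phi> \<omega>))
      \<le> \<epsilon> + \<epsilon> * rf dA (radial_weight \<rho> R) ?T \<omega> + exp (- ?T)"
    proof (rule measures_fin_dist_coupling[OF stom_measures_fin(2)[OF g] _ sb N' hm q _ cm c1 \<epsilon> _ _ _ _ eq_refl[OF mass]])
      show "atomic_spacetime \<epsilon> ?J (grid_increment dA \<epsilon> \<phi> \<omega>) \<in> measures_fin"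
        using I(1) \<epsilon> by (intro atomic_spacetime_measures_fin) auto
      show "dist (?q s) y \<le> \<epsilon>" if "h y s \<noteq> 0" for y s using that close[of y "?q s"] unfolding h_def by (cases "\<phi> y (?q s) = 0") auto
      fix B :: "('s \<times> real) set" assume B[measurable]: "B \<in> sets borel_spacetime"
      show "emeasure (radial_cutoff \<rho> R (stom X A \<omega>)) B = (\<Sum>y\<in>I. \<integral>\<^sup>+s. h y s * indicator {0<..} s * indicator B (?q s, max 0 s) \<partial>?N)"
        unfolding emeasure_stom(2)[OF g B] hsum[symmetric] sum_distrib_right by (rule nn_integral_sum) measurable
      have "emeasure (atomic_spacetime \<epsilon> ?J (grid_increment dA \<epsilon> \<phi> \<omega>)) B =
        (\<Sum>(y, l)\<in>?J. ennreal (grid_increment dA \<epsilon> \<phi> \<omega> (y, l)) * indicator B (y, real (Suc l) * \<epsilon>))"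
        using I(1) \<epsilon> B by (intro emeasure_atomic_spacetime) auto
      also have "\<dots> = (\<Sum>(y, l)\<in>?J. (\<integral>\<^sup>+s. h y s * indicator {real l * \<epsilon><..real (Suc l) * \<epsilon>} s \<partial>?N) * indicator B (y, real (Suc l) * \<epsilon>))"
        unfolding h_def using \<epsilon> by (simp only: ennreal_grid_increment[OF clock_dA g compact_weightD(7)[OF \<phi>] less_imp_le])
      also have "\<dots> = (\<Sum>y\<in>I. \<integral>\<^sup>+s. h y s * indicator {0<..?T} s * indicator B (y, max 0 (c s)) \<partial>?N)"
        unfolding split[OF B] by (rule sum.cartesian_product[symmetric])
      finally show "emeasure (atomic_spacetime \<epsilon> ?J (grid_increment dA \<epsilon> \<phi> \<omega>)) B =
        (\<Sum>y\<in>I. \<integral>\<^sup>+s. h y s * indicator {0<..?T} s * indicator B (y, max 0 (c s)) \<partial>?N)" .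
    qed (use \<epsilon> in \<open>auto simp: rf_nonneg\<close>)
  qed
qed

text \<open>While the path stays within radius R - 1 the radial weight is 1, so the two measures
  agree when truncated at any time before \<open>T\<close>; later truncation times contribute exp (-
  T).\<close>

lemma radial_cutoff_stom_dist:
  assumes g: "good \<omega>" and T: "0 \<le> T" and stay: "\<And>s. 0 < s \<Longrightarrow> s < T \<Longrightarrow> dist \<rho> (pos \<omega> s) \<le> R - 1"
  shows "measures_fin_dist (radial_cutoff \<rho> R (stom X A \<omega>)) (stom X A \<omega>) \<le> exp (- T)"
proof -
  have "prohorov_dist spacetime_metric (truncate_time (radial_cutoff \<rho> R (stom X A \<omega>)) t) (truncate_time (stom X A \<omega>) t) \<le> 0"
    if t: "0 \<le> t" "t < T" for t
  proof -
    have s: "sets (radial_cutoff \<rho> R (stom X A \<omega>)) = sets borel_spacetime" "sets (stom X A \<omega>) = sets borel_spacetime"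
      using stom_measures_fin[OF g] by (auto simp: measures_fin_def)
    have eq: "emeasure (truncate_time (radial_cutoff \<rho> R (stom X A \<omega>)) t) B = emeasure (truncate_time (stom X A \<omega>) t) B"
      if B: "B \<in> sets borel_spacetime" for B
    proof -
      have D: "(UNIV \<times> {0..t}) \<inter> B \<in> sets borel_spacetime" using B by auto
      show ?thesis
        unfolding emeasure_truncate_time[OF s(1) B] emeasure_truncate_time[OF s(2) B] emeasure_stom[OF g D]
      proof (rule nn_integral_cong)
        fix u
        show "ennreal (radial_weight \<rho> R (pos \<omega> u)) * indicator {0<..} u * indicator ((UNIV \<times> {0..t}) \<inter> B) (pos \<omega> u, max 0 u)
          = indicator {0<..} u * indicator ((UNIV \<times> {0..t}) \<inter> B) (pos \<omega> u, max 0 u)"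
          using stay[of u] t(2) by (cases "0 < u \<and> u \<le> t") (auto simp: radial_weight_def indicator_def)
      qed
    qed
    show ?thesis
      by (rule prohorov_dist_setwise) (simp_all add: truncate_time_def[THEN arg_cong[of _ _ sets]] s eq)
  qed
  then have "measures_fin_dist (radial_cutoff \<rho> R (stom X A \<omega>)) (stom X A \<omega>) \<le> 0 + exp (- T)"
    unfolding measures_fin_dist_def using T by (intro integral_exp_capped_le_const) auto
  then show ?thesis by simp
qed

end

section \<open>Path functionals\<close>

abbreviation halfline_measurable :: "(real \<Rightarrow> 's::heine_borel) \<Rightarrow> bool" where
  "halfline_measurable f \<equiv> f \<in> borel_measurable halfline"

lemma rep_L0_measurable: "halfline_measurable (rep_L0 z)"
  using Quotient3_rep_reflp[OF Quotient3_L0, of z] by simp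

lemma rep_abs_L0:
  assumes "halfline_measurable f"
  shows "AE t in lborel. 0 \<le> t \<longrightarrow> rep_L0 (abs_L0 f) t = f t"
  using Quotient3_rep_abs[OF Quotient3_L0, of f] assms by (simp add: AE_restrict_space_iff)

lemma L0_dist_rep: "L0_dist z z' = (\<integral>t. exp (- t) * min 1 (dist (rep_L0 z t) (rep_L0 z' t)) \<partial>halfline)"
  by (simp add: L0_dist_def)

lemma L0_dist_abs:
  assumes "halfline_measurable f" "halfline_measurable g"
  shows "L0_dist (abs_L0 f) (abs_L0 g) = (\<integral>t. exp (- t) * min 1 (dist (f t) (g t)) \<partial>halfline)"
  by (rule L0_dist.abs_eq) (use assms in auto)

text \<open>For a \<ge> 0 a change on a Lebesgue null set does not alter the integral, so the choice
  of representative is immaterial.\<close>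

definition occupation :: "('s::heine_borel \<Rightarrow> real) \<Rightarrow> real \<Rightarrow> real \<Rightarrow> 's L0 \<Rightarrow> real" where
  "occupation g a b z = enn2real (\<integral>\<^sup>+s. ennreal (g (rep_L0 z s)) * indicator {a<..b} s \<partial>lborel)"

text \<open>Uniform continuity and boundedness of \<open>g\<close> give a bound on |g x - g y| by a
  small constant plus a multiple of the capped distance. Integrating the latter over a bounded
  interval is controlled by the metric of \<open>L0\<close>.\<close>

lemma occupation_uniformly_continuous:
  fixes g :: "'s::heine_borel \<Rightarrow> real"
  assumes g: "uniformly_continuous_on UNIV g" "\<And>x. 0 \<le> g x" "\<And>x. g x \<le> C" and ab: "0 \<le> a" "a \<le> b" and "0 < \<epsilon>"
  shows "\<exists>\<delta>>0. \<forall>z z'. L0_dist z z' < \<delta> \<longrightarrow> \<bar>occupation g a b z - occupation g a b z'\<bar> < \<epsilon>"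
proof -
  let ?H = "restrict_space lborel {0::real..}"
  define \<eta> where "\<eta> = \<epsilon> / (2 * (b + 1))"
  have \<eta>: "0 < \<eta>" "\<eta> * b < \<epsilon> / 2" using ab \<open>0 < \<epsilon>\<close> by (auto simp: \<eta>_def field_simps)
  obtain d0 where d0: "0 < d0" "\<And>x y. dist x y < d0 \<Longrightarrow> dist (g x) (g y) < \<eta>"
    using g(1) \<eta>(1) unfolding uniformly_continuous_on_def by (metis UNIV_I)
  \<comment> \<open>The metric of \<open>L0\<close> sees distances only up to 1, so the threshold is
    taken at most 1; then distances of at least \<open>d\<close> still count at least
    \<open>d\<close> after capping.\<close>
  define d where "d = min 1 d0"
  have d: "0 < d" "d \<le> 1" "\<And>x y. dist x y < d \<Longrightarrow> dist (g x) (g y) < \<eta>" using d0 by (auto simp: d_def)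
  have C: "0 \<le> C" using g(2,3) order_trans by blast
  have cg: "continuous_on UNIV g" by (rule uniformly_continuous_imp_continuous[OF g(1)])
  have gm: "g \<in> borel_measurable borel" by (rule borel_measurable_continuous_onI[OF cg])
  have pw: "\<bar>g x - g y\<bar> \<le> \<eta> + (C / d) * min 1 (dist x y)" for x y
  proof (cases "dist x y < d")
    case True
    then show ?thesis using d(3)[OF True] C d(1) by (simp add: dist_real_def add_increasing2)
  next
    case False
    have "\<bar>g x - g y\<bar> \<le> C" using g(2,3)[of x] g(2,3)[of y] by auto
    also have "C = (C / d) * d" using d by simp
    also have "\<dots> \<le> (C / d) * min 1 (dist x y)" using False d C by (intro mult_left_mono) auto
    finally show ?thesis using \<eta> by simp
  qed
  \<comment> \<open>The factor exp b compensates the weight exp (- t) of the metric on times up to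
    \<open>b\<close>.\<close>
  define \<delta> where "\<delta> = \<epsilon> / (2 * (C / d + 1) * exp b)"
  have \<delta>: "0 < \<delta>" using \<open>0 < \<epsilon>\<close> C d by (simp add: \<delta>_def add_nonneg_pos)
  have om: "(\<lambda>s. g (rep_L0 z s)) \<in> borel_measurable ?H" for z
    by (rule measurable_compose[OF rep_L0_measurable gm])
  have ind: "indicator {a<..b} \<in> borel_measurable ?H" "integrable ?H (indicator {a<..b} :: real \<Rightarrow> real)"
  proof -
    show "indicator {a<..b} \<in> borel_measurable ?H" by (rule measurable_restrict_space1) simp
    have "{0..} \<inter> {a<..b} = {a<..b}" using ab by auto
    then have "{a<..b} \<in> sets ?H" unfolding sets_restrict_space by (intro image_eqI[of _ _ "{a<..b}"]) simp_all
    moreover have "emeasure ?H {a<..b} < \<infinity>" using ab by (subst emeasure_restrict_space) auto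
    ultimately show "integrable ?H (indicator {a<..b} :: real \<Rightarrow> real)" by (rule integrable_real_indicator)
  qed
  have occ: "integrable ?H (\<lambda>s. indicator {a<..b} s * g (rep_L0 z s))"
    "occupation g a b z = (\<integral>s. indicator {a<..b} s * g (rep_L0 z s) \<partial>?H)" for z
  proof -
    have m: "(\<lambda>s. indicator {a<..b} s * g (rep_L0 z s)) \<in> borel_measurable ?H"
      by (rule borel_measurable_times[OF ind(1) om])
    have fin: "integrable ?H (\<lambda>s. indicator {a<..b} s * C)"
      by (rule integrable_mult_left[OF ind(2)])
    show i: "integrable ?H (\<lambda>s. indicator {a<..b} s * g (rep_L0 z s))"
      by (rule Bochner_Integration.integrable_bound[OF fin m]) (use g(2,3) C in \<open>auto simp: indicator_def\<close>)
    have "(\<integral>\<^sup>+s. ennreal (g (rep_L0 z s)) * indicator {a<..b} s \<partial>lborel) =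
      (\<integral>\<^sup>+s. ennreal (indicator {a<..b} s * g (rep_L0 z s)) * indicator {0..} s \<partial>lborel)"
      using ab by (intro nn_integral_cong) (auto simp: indicator_def)
    also have "\<dots> = (\<integral>\<^sup>+s. ennreal (indicator {a<..b} s * g (rep_L0 z s)) \<partial>?H)"
      by (rule nn_integral_restrict_space[symmetric]) simp
    also have "\<dots> = ennreal (\<integral>s. indicator {a<..b} s * g (rep_L0 z s) \<partial>?H)"
      using g(2) by (intro nn_integral_eq_integral i) auto
    finally show "occupation g a b z = (\<integral>s. indicator {a<..b} s * g (rep_L0 z s) \<partial>?H)"
      unfolding occupation_def using g(2) by (simp add: integral_nonneg_AE)
  qed
  show ?thesis
  proof (intro exI[of _ \<delta>] conjI allI impI \<delta>)
    fix z z' :: "'s L0" assume L: "L0_dist z z' < \<delta>"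
    let ?k = "\<lambda>t. exp (- t) * min 1 (dist (rep_L0 z t) (rep_L0 z' t))"
    have dm: "(\<lambda>t. dist (rep_L0 z t) (rep_L0 z' t)) \<in> borel_measurable ?H"
      by (intro borel_measurable_dist rep_L0_measurable)
    have ik: "integrable ?H ?k" by (rule integrable_exp_capped[OF dm]) simp
    have ii: "integrable ?H (\<lambda>t. indicator {a<..b} t * \<eta>)"
      by (rule integrable_mult_left[OF ind(2)])
    have "\<bar>occupation g a b z - occupation g a b z'\<bar> =
        \<bar>\<integral>s. indicator {a<..b} s * g (rep_L0 z s) - indicator {a<..b} s * g (rep_L0 z' s) \<partial>?H\<bar>"
      unfolding occ(2) by (simp add: Bochner_Integration.integral_diff[OF occ(1) occ(1)])
    also have "\<dots> \<le> (\<integral>s. \<bar>indicator {a<..b} s * g (rep_L0 z s) - indicator {a<..b} s * g (rep_L0 z' s)\<bar> \<partial>?H)"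
      by (rule integral_abs_bound)
    also have "\<dots> \<le> (\<integral>t. indicator {a<..b} t * \<eta> + (C / d * exp b) * ?k t \<partial>?H)"
    proof (rule integral_mono)
      fix t
      show "\<bar>indicator {a<..b} t * g (rep_L0 z t) - indicator {a<..b} t * g (rep_L0 z' t)\<bar> \<le> indicator {a<..b} t * \<eta> + (C / d * exp b) * ?k t"
      proof (cases "t \<in> {a<..b}")
        case True
        have "1 \<le> exp b * exp (- t)" using True by (simp add: exp_add[symmetric])
        then have "(C / d * min 1 (dist (rep_L0 z t) (rep_L0 z' t))) * 1 \<le> (C / d * min 1 (dist (rep_L0 z t) (rep_L0 z' t))) * (exp b * exp (- t))"
          using C d by (intro mult_left_mono) auto
        then show ?thesis using pw[of "rep_L0 z t" "rep_L0 z' t"] True by (simp add: ac_simps)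
      qed (use C d in simp)
    qed (intro integrable_abs Bochner_Integration.integrable_diff occ(1), intro Bochner_Integration.integrable_add ii integrable_mult_right ik)
    also have "\<dots> = (\<integral>t. indicator {a<..b} t * \<eta> \<partial>?H) + (C / d * exp b) * L0_dist z z'"
      unfolding L0_dist_rep Bochner_Integration.integral_add[OF ii integrable_mult_right[OF ik]] by (simp only: integral_mult_right_zero)
    also have "(\<integral>t. indicator {a<..b} t * \<eta> \<partial>?H) = (b - a) * \<eta>"
    proof -
      have "(\<integral>t. indicator {a<..b} t * \<eta> \<partial>?H) = (\<integral>t. indicator {0..} t *\<^sub>R (indicator {a<..b} t * \<eta>) \<partial>lborel)"
        by (rule integral_restrict_space) simp
      also have "\<dots> = (\<integral>t. indicator {a<..b} t * \<eta> \<partial>lborel)"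
        using ab by (intro Bochner_Integration.integral_cong) (auto simp: indicator_def)
      finally show ?thesis using ab by simp
    qed
    also have "(b - a) * \<eta> + (C / d * exp b) * L0_dist z z' < \<epsilon> / 2 + \<epsilon> / 2"
    proof (rule add_less_le_mono)
      show "(b - a) * \<eta> < \<epsilon> / 2" using \<eta> ab by (smt (verit) mult.commute mult_left_mono)
      have "(C / d * exp b) * L0_dist z z' \<le> ((C / d + 1) * exp b) * \<delta>"
        using L C d Metric_space.nonneg[OF Metric_space_L0, of z z'] by (intro mult_mono) auto
      also have "\<dots> = \<epsilon> / 2" using C d by (simp add: \<delta>_def field_simps add_nonneg_pos[THEN less_imp_neq[symmetric]])
      finally show "(C / d * exp b) * L0_dist z z' \<le> \<epsilon> / 2" .
    qed
    finally show "\<bar>occupation g a b z - occupation g a b z'\<bar> < \<epsilon>" by simp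
  qed
qed

text \<open>Only finitely many weights occur, so a common modulus exists; the l1 bound of
  \<open>measures_fin_dist_atomic\<close> then transfers it to the measures.\<close>

lemma uc_map_atomic:
  assumes J: "finite J" and \<epsilon>: "0 \<le> \<epsilon>"
    and v: "\<And>j e. j \<in> J \<Longrightarrow> 0 < e \<Longrightarrow> \<exists>\<delta>>0. \<forall>z z'. L0_dist z z' < \<delta> \<longrightarrow> \<bar>v z j - v z' j\<bar> < e"
  shows "uc_map (submetric L0_metric S) (max_metric (submetric L0_metric S) measures_fin_metric) (\<lambda>z. (z, atomic_spacetime \<epsilon> J (v z)))"
  unfolding uc_map_def
proof (intro conjI allI impI)
  show "(\<lambda>z. (z, atomic_spacetime \<epsilon> J (v z))) ` mspace (submetric L0_metric S) \<subseteq> mspace (max_metric (submetric L0_metric S) measures_fin_metric)"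
    using atomic_spacetime_measures_fin[OF J \<epsilon>] by auto
  fix e :: real assume e: "0 < e"
  define e' where "e' = e / (real (card J) + 1)"
  have e': "0 < e'" "real (card J) * e' < e" using e by (auto simp: e'_def field_simps)
  have "\<forall>j\<in>J. \<exists>\<delta>>0. \<forall>z z'. L0_dist z z' < \<delta> \<longrightarrow> \<bar>v z j - v z' j\<bar> < e'" using v e' by blast
  then obtain \<delta> where \<delta>: "\<And>j. j \<in> J \<Longrightarrow> 0 < \<delta> j" "\<And>j z z'. j \<in> J \<Longrightarrow> L0_dist z z' < \<delta> j \<Longrightarrow> \<bar>v z j - v z' j\<bar> < e'"
    by (auto dest!: bchoice)
  define d where "d = Min (insert e (\<delta> ` J))"
  have d: "0 < d" "d \<le> e" "\<And>j. j \<in> J \<Longrightarrow> d \<le> \<delta> j" using J e \<delta>(1) by (auto simp: d_def)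
  show "\<exists>d>0. \<forall>x\<in>mspace (submetric L0_metric S). \<forall>y\<in>mspace (submetric L0_metric S). mdist (submetric L0_metric S) x y < d \<longrightarrow>
      mdist (max_metric (submetric L0_metric S) measures_fin_metric) (x, atomic_spacetime \<epsilon> J (v x)) (y, atomic_spacetime \<epsilon> J (v y)) < e"
  proof (intro exI[of _ d] conjI ballI impI d(1))
    fix x y assume "mdist (submetric L0_metric S) x y < d"
    then have xy: "L0_dist x y < d" by simp
    have "measures_fin_dist (atomic_spacetime \<epsilon> J (v x)) (atomic_spacetime \<epsilon> J (v y)) \<le> (\<Sum>j\<in>J. \<bar>v x j - v y j\<bar>)"
      by (rule measures_fin_dist_atomic[OF J \<epsilon>])
    also have "\<dots> \<le> real (card J) * e'"
      using \<delta>(2) d(3) xy by (intro sum_bounded_above) (meson less_le_trans less_imp_le)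
    finally show "mdist (max_metric (submetric L0_metric S) measures_fin_metric) (x, atomic_spacetime \<epsilon> J (v x)) (y, atomic_spacetime \<epsilon> J (v y)) < e"
      using e' xy d(2) by simp
  qed
qed

section \<open>Measurability of the path class by step paths\<close>

definition step_path :: "nat \<Rightarrow> 's::heine_borel \<Rightarrow> (nat \<Rightarrow> 's) \<Rightarrow> real \<Rightarrow> 's" where
  "step_path n a z t = (if t < real n then z (nat \<lfloor>2^n * t\<rfloor>) else a)"

lemma step_path_measurable: "halfline_measurable (step_path n a z)"
proof -
  have "(\<lambda>t::real. z (nat \<lfloor>2^n * t\<rfloor>)) \<in> borel_measurable borel"
    by (rule measurable_compose[of "\<lambda>t. nat \<lfloor>2^n * t\<rfloor>" _ "count_space UNIV"]) auto
  then have "step_path n a z \<in> borel_measurable lborel" unfolding step_path_def[abs_def] by measurable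
  then show ?thesis by (rule measurable_restrict_space1)
qed

text \<open>The step path is constant from time \<open>n\<close> on, so it depends on finitely many
  coordinates of \<open>z\<close>, and neighbourhoods in the product topology control it uniformly
  in time.\<close>

lemma step_path_continuous:
  assumes U: "openin (mtopology_of L0_metric) U"
  shows "open {z. abs_L0 (step_path n a z) \<in> U}"
proof (subst open_subopen, rule ballI)
  fix z assume "z \<in> {z. abs_L0 (step_path n a z) \<in> U}"
  then obtain r where r: "r > 0" "\<And>y. L0_dist (abs_L0 (step_path n a z)) y < r \<Longrightarrow> y \<in> U"
    using U unfolding openin_mtopology_of by auto
  define m where "m = nat \<lfloor>2^n * real n\<rfloor>"
  define V where "V = (\<Inter>k\<in>{..m}. (\<lambda>z'. z' k) -` ball (z k) (r / 2))"
  have "open V" unfolding V_def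
    by (intro open_INT ballI open_vimage open_ball continuous_on_product_coordinates) auto
  moreover have "z \<in> V" using r by (simp add: V_def)
  moreover have "abs_L0 (step_path n a z') \<in> U" if "z' \<in> V" for z'
  proof (rule r(2))
    have d: "dist (step_path n a z t) (step_path n a z' t) \<le> r / 2" for t
    proof (cases "t < real n")
      case True
      then have "nat \<lfloor>2^n * t\<rfloor> \<in> {..m}" unfolding m_def by (auto intro!: nat_mono floor_mono)
      then show ?thesis using that True unfolding V_def step_path_def by (auto intro: less_imp_le)
    qed (use r in \<open>simp add: step_path_def\<close>)
    have "L0_dist (abs_L0 (step_path n a z)) (abs_L0 (step_path n a z')) \<le> (\<integral>t. exp (- t) * (r / 2) \<partial>halfline)"
      unfolding L0_dist_abs[OF step_path_measurable step_path_measurable]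
    proof (rule integral_mono)
      show "integrable halfline (\<lambda>t. exp (- t) * min 1 (dist (step_path n a z t) (step_path n a z' t)))"
        by (intro integrable_exp_capped borel_measurable_dist step_path_measurable) simp
      show "exp (- t) * min 1 (dist (step_path n a z t) (step_path n a z' t)) \<le> exp (- t) * (r / 2)" for t
        using d[of t] by (intro mult_left_mono) auto
    qed (intro integrable_mult_left integrable_exp_halfline)
    also have "\<dots> = r / 2" by (simp add: integral_exp_halfline)
    finally show "L0_dist (abs_L0 (step_path n a z)) (abs_L0 (step_path n a z')) < r" using r by simp
  qed
  ultimately show "\<exists>T. open T \<and> z \<in> T \<and> T \<subseteq> {z. abs_L0 (step_path n a z) \<in> U}" by blast
qed

text \<open>Open sets of the subspace are traces of open sets of the whole space, so their preimages
  agree up to a null set with measurable ones. A fixed point \<open>s\<close> of the subspace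
  replaces values outside it.\<close>

lemma ae_measurable_submetric:
  assumes M: "complete_measure M" "space M \<noteq> {}" and f: "ae_measurable M (mborel m) f" and S: "AE x in M. f x \<in> S" "S \<inter> mspace m \<noteq> {}"
  shows "ae_measurable M (mborel (submetric m S)) f"
proof -
  obtain f' where f': "f' \<in> measurable M (mborel m)" "AE x in M. f x = f' x" using f unfolding ae_measurable_def by blast
  obtain s where s: "s \<in> S" "s \<in> mspace m" using S(2) by blast
  define g where "g x = (if f x \<in> S \<and> f x \<in> mspace m then f x else s)" for x
  have fm: "AE x in M. f' x \<in> mspace m" using measurable_space[OF f'(1)] by (intro AE_I2) simp
  have ae: "AE x in M. f x = g x \<and> g x = f' x"
    using f'(2) S(1) fm by eventually_elim (auto simp: g_def)
  have "g \<in> measurable M (mborel (submetric m S))"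
  proof (rule measurable_mborelI)
    show "g x \<in> mspace (submetric m S)" for x using s by (auto simp: g_def)
    fix U assume "openin (mtopology_of (submetric m S)) U"
    then obtain V where V: "openin (mtopology_of m) V" "U = V \<inter> S"
      unfolding mtopology_of_submetric openin_subtopology by auto
    have "(\<lambda>x. g x \<in> U) \<in> measurable M (count_space UNIV)"
    proof (rule measurable_AE_complete[OF M(1)])
      show "(\<lambda>x. f' x \<in> V) \<in> measurable M (count_space UNIV)"
        by (rule pred_sets2[OF openin_borel_of[OF V(1)] f'(1)])
      have gS: "g x \<in> S" for x using s by (simp add: g_def)
      have gU: "g x \<in> U \<longleftrightarrow> g x \<in> V" for x using gS V(2) by auto
      show "AE x in M. (g x \<in> U) = (f' x \<in> V)"
        unfolding gU using ae by eventually_elim simp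
    qed simp
    then have "{x \<in> space M. g x \<in> U} \<in> sets M" by (simp add: pred_def)
    then show "g -` U \<inter> space M \<in> sets M" by (simp add: vimage_def Int_def conj_commute)
  qed
  moreover have "AE x in M. f x = g x" using ae by eventually_elim simp
  ultimately show ?thesis unfolding ae_measurable_def by blast
qed

context kato_process
begin

text \<open>An open set is where the distance to its complement is positive, which reduces the claim
  to the real functions covered by \<open>adapted_state\<close>.\<close>

lemma state_at_measurable_CP:
  assumes t: "0 \<le> t" shows "(\<lambda>\<omega>. pos \<omega> t) \<in> borel_measurable (CP x)"
proof (rule borel_measurableI)
  fix S :: "'s set" assume S: "open S"
  show "(\<lambda>\<omega>. pos \<omega> t) -` S \<inter> space (CP x) \<in> sets (CP x)"
  proof (cases "S = UNIV")
    case False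
    let ?h = "\<lambda>y. infdist y (- S)"
    have "(\<lambda>\<omega>. ennreal (?h (pos \<omega> t))) \<in> borel_measurable (CP x)"
      by (rule adapted_CP[OF adapted_state[OF _ t order_refl]])
         (intro borel_measurable_continuous_onI continuous_intros)
    then have "{\<omega> \<in> space (CP x). ennreal (?h (pos \<omega> t)) \<noteq> 0} \<in> sets (CP x)" by measurable
    moreover have "ennreal (?h y) \<noteq> 0 \<longleftrightarrow> y \<in> S" for y
      using in_closed_iff_infdist_zero[of "- S" y] S False infdist_nonneg[of y "- S"]
      by (auto simp: ennreal_eq_0_iff)
    ultimately show ?thesis by (simp add: vimage_def Int_def conj_commute)
  qed (use sets.top[of "CP x"] in simp)
qed

lemma good_halfline_measurable: "good \<omega> \<Longrightarrow> halfline_measurable (pos \<omega>)"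
  by (rule measurable_restrict_space1) (simp add: good_state_measurable)

text \<open>The path is sampled at the right ends of dyadic cells. The step path is a continuous
  function of countably many measurable states, and on good paths it converges pointwise by
  right-continuity, hence in \<open>L0\<close> by dominated convergence.\<close>

lemma path_class_ae_measurable: "ae_measurable (CP x) (mborel L0_metric) (path_class X)"
proof (rule ae_measurable_limit)
  show "space (CP x) \<noteq> {}" by (rule prob_space.not_empty[OF prob_space_CP])
  let ?Z = "\<lambda>n \<omega> k. pos \<omega> ((real k + 1) / 2^n)"
  fix n :: nat
  have Z: "?Z n \<in> borel_measurable (CP x)"
    by (rule measurable_coordinatewise_then_product, rule state_at_measurable_CP) simp
  have "(\<lambda>\<omega>. abs_L0 (step_path n x (?Z n \<omega>))) \<in> measurable (CP x) (mborel L0_metric)"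
  proof (rule measurable_mborelI)
    fix U :: "'s L0 set" assume "openin (mtopology_of L0_metric) U"
    then have "{z. abs_L0 (step_path n x z) \<in> U} \<in> sets borel" by (intro borel_open step_path_continuous)
    from measurable_sets[OF Z this]
    show "(\<lambda>\<omega>. abs_L0 (step_path n x (?Z n \<omega>))) -` U \<inter> space (CP x) \<in> sets (CP x)" by (simp add: vimage_def)
  qed simp
  then show "ae_measurable (CP x) (mborel L0_metric) (\<lambda>\<omega>. abs_L0 (step_path n x (?Z n \<omega>)))"
    by (auto simp: ae_measurable_def)
next
  let ?Z = "\<lambda>n \<omega> k. pos \<omega> ((real k + 1) / 2^n)"
  show "AE \<omega> in CP x. (\<lambda>n. mdist L0_metric (abs_L0 (step_path n x (?Z n \<omega>))) (path_class X \<omega>)) \<longlonglongrightarrow> 0"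
    using AE_CP_good
  proof eventually_elim
    case (elim \<omega>)
    let ?q = "pos \<omega>" and ?H = "restrict_space lborel {0::real..}"
    note qm = good_halfline_measurable[OF elim]
    have lim: "(\<lambda>n. step_path n x (?Z n \<omega>) t) \<longlonglongrightarrow> ?q t" if t: "0 \<le> t" for t
    proof (rule Lim_transform_eventually)
      show "(\<lambda>n. ?q ((of_int \<lfloor>2^n * t\<rfloor> + 1) / 2^n)) \<longlonglongrightarrow> ?q t"
        by (rule tendsto_at_right_sequence[OF good_right_continuous[OF elim t] dyadic_ceiling_tendsto])
           (rule less_imp_le[OF dyadic_ceiling_gt])
      have "eventually (\<lambda>n. t < real n) sequentially" using eventually_gt_at_top[of "nat \<lceil>t\<rceil>"]
        by eventually_elim linarith
      then show "eventually (\<lambda>n. ?q ((of_int \<lfloor>2^n * t\<rfloor> + 1) / 2^n) = step_path n x (?Z n \<omega>) t) sequentially"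
        by eventually_elim (use t in \<open>simp add: step_path_def\<close>)
    qed
    have "(\<lambda>n. \<integral>t. exp (- t) * min 1 (dist (step_path n x (?Z n \<omega>) t) (?q t)) \<partial>?H) \<longlonglongrightarrow> (\<integral>t. (0::real) \<partial>?H)"
    proof (rule integral_dominated_convergence[where w="\<lambda>t. exp (- t)"])
      show "(\<lambda>t. exp (- t) * min 1 (dist (step_path n x (?Z n \<omega>) t) (?q t))) \<in> borel_measurable ?H" for n
        by (intro borel_measurable_integrable integrable_exp_capped borel_measurable_dist step_path_measurable qm) simp
      show "AE t in ?H. (\<lambda>n. exp (- t) * min 1 (dist (step_path n x (?Z n \<omega>) t) (?q t))) \<longlonglongrightarrow> 0"
      proof (rule AE_I2)
        fix t assume "t \<in> space ?H"
        then have "(\<lambda>n. exp (- t) * min 1 (dist (step_path n x (?Z n \<omega>) t) (?q t))) \<longlonglongrightarrow> exp (- t) * min 1 (dist (?q t) (?q t))"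
          by (intro tendsto_intros lim) (simp add: space_restrict_space)
        then show "(\<lambda>n. exp (- t) * min 1 (dist (step_path n x (?Z n \<omega>) t) (?q t))) \<longlonglongrightarrow> 0" by simp
      qed
    qed (auto intro: integrable_exp_halfline)
    then show ?case
      unfolding path_class_def mdist_L0_metric L0_dist_abs[OF step_path_measurable qm] by simp
  qed
qed simp

lemma occupation_path:
  assumes g: "good \<omega>" and h: "density_fun h" and ab: "0 \<le> a" "a \<le> b"
  shows "occupation h a b (path_class X \<omega>) = rf (\<lambda>_. lborel) h b \<omega> - rf (\<lambda>_. lborel) h a \<omega>"
proof -
  note N = clock_lborel
  have b: "0 \<le> b" using ab by simp
  have "(\<integral>\<^sup>+s. ennreal (h (rep_L0 (path_class X \<omega>) s)) * indicator {a<..b} s \<partial>lborel) =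
      (\<integral>\<^sup>+s. ennreal (h (pos \<omega> s)) * indicator {a<..b} s \<partial>lborel)"
  proof (rule nn_integral_cong_AE)
    show "AE s in lborel. ennreal (h (rep_L0 (path_class X \<omega>) s)) * indicator {a<..b} s = ennreal (h (pos \<omega> s)) * indicator {a<..b} s"
      using rep_abs_L0[OF good_halfline_measurable[OF g]]
      by eventually_elim (use ab in \<open>auto simp: path_class_def indicator_def\<close>)
  qed
  moreover have "ennreal (rf (\<lambda>_. lborel) h b \<omega>) = ennreal (rf (\<lambda>_. lborel) h a \<omega>) +
      (\<integral>\<^sup>+s. ennreal (h (pos \<omega> s)) * indicator {a<..b} s \<partial>lborel)"
    using af_increment[OF N g h ab] unfolding af_eq_rf[OF N g h b] af_eq_rf[OF N g h ab(1)] .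
  then have "(\<integral>\<^sup>+s. ennreal (h (pos \<omega> s)) * indicator {a<..b} s \<partial>lborel) = ennreal (rf (\<lambda>_. lborel) h b \<omega> - rf (\<lambda>_. lborel) h a \<omega>)"
    by (subst ennreal_minus[symmetric]) (simp_all add: rf_nonneg)
  ultimately show ?thesis
    unfolding occupation_def using rf_mono[OF N g h ab] by simp
qed

end

section \<open>Continuity of the joint law\<close>

lemma close_maps_mono:
  assumes "close_maps M m \<epsilon> f g" "\<epsilon> \<le> \<epsilon>'" shows "close_maps M m \<epsilon>' f g"
proof -
  obtain H where H: "H \<in> sets M" "emeasure M (space M - H) \<le> ennreal \<epsilon>"
    "\<forall>x\<in>H. f x \<in> mspace m \<and> g x \<in> mspace m \<and> mdist m (f x) (g x) \<le> \<epsilon>"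
    using assms(1) unfolding close_maps_def by blast
  have "emeasure M (space M - H) \<le> ennreal \<epsilon>'" by (rule order_trans[OF H(2) ennreal_leI[OF assms(2)]])
  then show ?thesis using H assms(2) unfolding close_maps_def by (intro bexI[of _ H]) auto
qed

text \<open>Two points closer than 1 either both lie outside the ball, where the values vanish, or
  both lie in the ball enlarged by 1, which is compact.\<close>

lemma uniformly_continuous_vanishing:
  fixes g :: "'s::heine_borel \<Rightarrow> real"
  assumes g: "continuous_on UNIV g" and 0: "\<And>x. x \<notin> cball \<rho> M \<Longrightarrow> g x = 0"
  shows "uniformly_continuous_on UNIV g"
  unfolding uniformly_continuous_on_def
proof (intro allI impI)
  fix e :: real assume e: "0 < e"
  have "uniformly_continuous_on (cball \<rho> (M + 1)) g"
    by (rule compact_uniformly_continuous[OF continuous_on_subset[OF g] compact_cball]) simp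
  then obtain d where d: "0 < d" "\<And>x y. x \<in> cball \<rho> (M + 1) \<Longrightarrow> y \<in> cball \<rho> (M + 1) \<Longrightarrow> dist y x < d \<Longrightarrow> dist (g y) (g x) < e"
    using e unfolding uniformly_continuous_on_def by blast
  have "dist (g y) (g x) < e" if xy: "dist y x < min d 1" for x y
  proof (cases "x \<in> cball \<rho> M \<or> y \<in> cball \<rho> M")
    case True
    then have "x \<in> cball \<rho> (M + 1)" "y \<in> cball \<rho> (M + 1)"
      using xy dist_triangle[of \<rho> x y] dist_triangle[of \<rho> y x] by (auto simp: dist_commute)
    then show ?thesis using xy by (intro d(2)) auto
  qed (use 0 e in simp)
  then show "\<exists>d>0. \<forall>x\<in>UNIV. \<forall>x'\<in>UNIV. dist x' x < d \<longrightarrow> dist (g x') (g x) < e"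
    using d(1) by (intro exI[of _ "min d 1"]) auto
qed

lemma submetric_L0_UNIV: "submetric L0_metric UNIV = L0_metric"
  by (simp add: submetric_def) (simp add: L0_metric_def)

context additive_process
begin

lemma emeasure_exit_event:
  "emeasure (CP x) {\<omega> \<in> sample_space X. exit_time X (cball \<rho> R) \<omega> < ennreal T} = ennreal (exit_prob X \<rho> R T x)"
proof -
  interpret P: prob_space "prob_from X (Some x)" by (rule prob_space_from)
  show ?thesis unfolding exit_prob_def P.emeasure_eq_measure[symmetric] by (simp add: exit_event_sets)
qed

lemma good_not_exit:
  assumes g: "good \<omega>" and "\<not> exit_time X (cball \<rho> R) \<omega> < ennreal T" and s: "0 < s" "s < T"
  shows "dist \<rho> (pos \<omega> s) \<le> R"
proof (rule ccontr)
  assume "\<not> ?thesis"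
  then have "state X (ennreal s) \<omega> \<notin> Some ` cball \<rho> R" unfolding good_state_at[OF g] by auto
  then have "exit_time X (cball \<rho> R) \<omega> \<le> ennreal s" unfolding exit_time_def using s by (intro Inf_lower) auto
  also have "\<dots> < ennreal T" using s by (intro ennreal_lessI) auto
  finally show False using assms(2) by blast
qed

lemma exit_prob_le:
  assumes "x \<in> cball \<rho> r" shows "exit_prob X \<rho> R T x \<le> (SUP x\<in>cball \<rho> r. exit_prob X \<rho> R T x)"
proof (rule cSUP_upper[OF assms])
  have "exit_prob X \<rho> R T x \<le> 1" for x
    unfolding exit_prob_def by (rule prob_space.prob_le_1[OF prob_space_from])
  then show "bdd_above ((\<lambda>x. exit_prob X \<rho> R T x) ` cball \<rho> r)" by (intro bdd_aboveI2[of _ _ 1]) auto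
qed

lemma exit_prob_nonneg: "0 \<le> exit_prob X \<rho> R T x"
  by (simp add: exit_prob_def)

end

locale stom_process = kato_process X A \<Lambda> p \<mu>
  for X :: "('w, 's::heine_borel) process" and A \<Lambda> p \<mu> +
  fixes \<rho> :: 's
  assumes law_continuous:
      "continuous_map euclidean (mtopology_of (prob_metric DL0_metric)) (law_map X DL0_metric (path_class X))"
    and no_escape: "0 < r \<Longrightarrow> 0 < T \<Longrightarrow> ((\<lambda>R. SUP x\<in>cball \<rho> r. exit_prob X \<rho> R T x) \<longlongrightarrow> 0) at_top"
begin

abbreviation cut :: "real \<Rightarrow> 'w \<Rightarrow> ('s \<times> real) measure" where
  "cut R \<omega> \<equiv> radial_cutoff \<rho> R (stom X A \<omega>)"

text \<open>The set \<open>S\<close> is a parameter in order to treat the classes of cadlag paths in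
  (i) and (iii) together with the full path space in (ii).\<close>

abbreviation joint_metric :: "'s L0 set \<Rightarrow> ('s L0 \<times> ('s \<times> real) measure) metric" where
  "joint_metric S \<equiv> max_metric (submetric L0_metric S) measures_fin_metric"

lemma exit_prob_small:
  assumes "0 < r" "0 < T" "0 < \<epsilon>"
  shows "eventually (\<lambda>R. \<forall>x\<in>cball \<rho> r. exit_prob X \<rho> (R - 1) T x \<le> \<epsilon>) at_top"
proof -
  have "filterlim (\<lambda>R::real. - 1 + R) at_top at_top" by (rule filterlim_tendsto_add_at_top[OF tendsto_const filterlim_ident])
  then have "filterlim (\<lambda>R::real. R - 1) at_top at_top" by simp
  from eventually_compose_filterlim[OF order_tendstoD(2)[OF no_escape[OF assms(1,2)] assms(3)] this]
  show ?thesis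
  proof eventually_elim
    case (elim R)
    show ?case using order_trans[OF exit_prob_le less_imp_le[OF elim]] by blast
  qed
qed

lemma AE_CP_null:
  assumes "AE \<omega> in CP x. Q \<omega>"
  defines "G \<equiv> {\<omega> \<in> sample_space X. Q \<omega>}"
  shows "G \<in> sets (CP x)" "sample_space X - G \<in> sets (CP x)" "emeasure (CP x) (sample_space X - G) = 0"
proof -
  show G: "G \<in> sets (CP x)" unfolding G_def by (rule AE_set_CP[OF assms(1)])
  show c: "sample_space X - G \<in> sets (CP x)" using sets.compl_sets[OF G] by simp
  have "AE \<omega> in CP x. \<omega> \<notin> sample_space X - G"
    using assms(1) AE_space[of "CP x"] by eventually_elim (simp add: G_def)
  then have "(sample_space X - G) \<in> null_sets (CP x)"
    using AE_iff_null_sets[OF c] by simp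
  then show "emeasure (CP x) (sample_space X - G) = 0" by auto
qed

text \<open>Off the null set of bad paths there are three exceptional events, each of probability at
  most \<epsilon>/4: \<open>N1\<close>, too much mass for the discretization; \<open>N2\<close>, a
  functional far from its occupation integral at some grid time; \<open>N3\<close>, a path that
  leaves the region where the modified densities agree with the original ones.\<close>

theorem path_approximation:
  assumes r: "0 < r" and \<epsilon>: "0 < \<epsilon>"
  obtains \<Phi> where "\<And>S. uc_map (submetric L0_metric S) (joint_metric S) (\<lambda>z. (z, \<Phi> z))"
    "\<And>x. x \<in> cball \<rho> r \<Longrightarrow> \<exists>H\<in>sets (CP x). emeasure (CP x) (sample_space X - H) \<le> ennreal \<epsilon> \<and>
      (\<forall>\<omega>\<in>H. good \<omega> \<and> measures_fin_dist (cut R \<omega>) (\<Phi> (path_class X \<omega>)) \<le> \<epsilon>)"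
proof -
  let ?\<phi>0 = "radial_weight \<rho> R"
  note w0 = compact_weight_radial[of \<rho> R]
  \<comment> \<open>The horizon is an integer so that it is a multiple of the mesh 1/k.\<close>
  define T0 where "T0 = nat \<lceil>max 1 (- ln (\<epsilon> / 8))\<rceil>"
  have T0: "1 \<le> real T0" "exp (- real T0) \<le> \<epsilon> / 8"
  proof -
    have t: "max 1 (- ln (\<epsilon> / 8)) \<le> real T0" unfolding T0_def by (rule real_nat_ceiling_ge)
    then show "1 \<le> real T0" by simp
    have "exp (- real T0) \<le> exp (ln (\<epsilon> / 8))" using t by simp
    then show "exp (- real T0) \<le> \<epsilon> / 8" using \<epsilon> by simp
  qed
  have "eventually (\<lambda>\<alpha>. kato_norm (cball \<rho> R) \<alpha> < 1) at_top"
    by (rule order_tendstoD(2)[OF kato_norm_tendsto[OF compact_cball]]) simp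
  from eventually_happens'[OF trivial_limit_at_top_linorder eventually_conj[OF this eventually_gt_at_top[of 0]]]
  obtain \<alpha> where \<alpha>: "kato_norm (cball \<rho> R) \<alpha> < 1" "0 < \<alpha>" by blast
  define C where "C = exp (\<alpha> * real T0)"
  have C: "0 < C" by (simp add: C_def)
  have EB: "EC x (\<lambda>\<omega>. ennreal (rf dA ?\<phi>0 (real T0) \<omega>)) \<le> ennreal C" for x
  proof -
    have "EC x (\<lambda>\<omega>. ennreal (rf dA ?\<phi>0 (real T0) \<omega>)) \<le> ennreal C * kato_norm (cball \<rho> R) \<alpha>"
      using expectation_af_le[OF w0 \<alpha>(2), where t="real T0" and x=x]
        expectation_af[OF clock_dA compact_weightD(7)[OF w0], where t="real T0" and x=x] by (simp add: C_def)
    also have "\<dots> \<le> ennreal C * 1" by (rule mult_left_mono[OF less_imp_le[OF \<alpha>(1)]]) simp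
    finally show ?thesis by simp
  qed
  \<comment> \<open>8/\<epsilon> makes the mesh at most \<epsilon>/8. With 32 C/\<epsilon>^2,
    Markov's inequality bounds the probability that the total mass reaches \<epsilon>/(8 e0) by
    \<epsilon>/4.\<close>
  define k where "k = nat \<lceil>max 1 (max (8 / \<epsilon>) (32 * C / \<epsilon>\<^sup>2))\<rceil>"
  define e0 where "e0 = 1 / real k"
  have k: "max 1 (max (8 / \<epsilon>) (32 * C / \<epsilon>\<^sup>2)) \<le> real k" unfolding k_def by (rule real_nat_ceiling_ge)
  have k0: "0 < real k" using k by auto
  have e0: "0 < e0" "e0 \<le> \<epsilon> / 8" "8 * e0 / \<epsilon> * C \<le> \<epsilon> / 4" "real (k * T0) * e0 = real T0"
  proof -
    show "0 < e0" using k0 by (simp add: e0_def)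
    have "8 / \<epsilon> \<le> real k" "32 * C / \<epsilon>\<^sup>2 \<le> real k" using k by auto
    then show "e0 \<le> \<epsilon> / 8" "8 * e0 / \<epsilon> * C \<le> \<epsilon> / 4" using \<epsilon> k0 by (simp_all add: e0_def field_simps power2_eq_square)
    show "real (k * T0) * e0 = real T0" using k0 by (simp add: e0_def)
  qed
  define n where "n = k * T0"
  obtain I \<phi> where I: "finite I" and \<phi>: "\<And>y. compact_weight (\<phi> y) (cball \<rho> R)"
    and disc: "\<And>\<omega> n. good \<omega> \<Longrightarrow> measures_fin_dist (cut R \<omega>)
      (atomic_spacetime e0 (I \<times> {..<n}) (grid_increment dA e0 \<phi> \<omega>))
      \<le> e0 + e0 * rf dA ?\<phi>0 (real n * e0) \<omega> + exp (- (real n * e0))"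
    by (rule stom_discretization[OF e0(1), of \<rho> R]) blast
  define J where "J = I \<times> {..<n}"
  have J: "finite J" using I by (simp add: J_def)
  \<comment> \<open>A cell weight is a difference of two grid values, so its error is at most 2
    \<eta>; summed over all cells this stays below \<epsilon>/8.\<close>
  define \<eta> where "\<eta> = \<epsilon> / (16 * (real (card J) + 1))"
  have \<eta>: "0 < \<eta>" "real (card J) * (2 * \<eta>) \<le> \<epsilon> / 8" using \<epsilon> by (auto simp: \<eta>_def field_simps)
  define K where "K = I \<times> {..n}"
  have K: "finite K" using I by (simp add: K_def)
  \<comment> \<open>Chosen so that Chebyshev's inequality, summed over the finitely many pairs in
    \<open>K\<close>, gives at most \<epsilon>/4. \<open>K\<close> contains the final time index
    \<open>n\<close> as well, since it lists end points of cells.\<close>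
  define \<epsilon>2 where "\<epsilon>2 = (\<epsilon> / 4) * \<eta>\<^sup>2 / (real (card K) + 1)"
  have \<epsilon>2: "0 < \<epsilon>2" "real (card K) * (1 / \<eta>\<^sup>2 * \<epsilon>2) \<le> \<epsilon> / 4"
    using \<epsilon> \<eta>(1) by (auto simp: \<epsilon>2_def divide_simps)
  define D where "D h y s \<omega> = rf dA (\<phi> y) s \<omega> - rf (\<lambda>_. lborel) h s \<omega>" for h y s \<omega>
  have "\<exists>h. density_fun h \<and> (\<forall>s x. 0 \<le> s \<longrightarrow> s \<le> real T0 \<longrightarrow> integrable (CP x) (\<lambda>\<omega>. (D h y s \<omega>)\<^sup>2) \<and> (RE x (\<lambda>\<omega>. (D h y s \<omega>)\<^sup>2)) \<le> \<epsilon>2)" for y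
    by (rule functional_approximation[OF \<phi>[of y] _ \<epsilon>2(1), of "real T0"]) (simp, unfold D_def, blast)
  then obtain h where h: "\<And>y. density_fun (h y)"
    and hD: "\<And>y s x. 0 \<le> s \<Longrightarrow> s \<le> real T0 \<Longrightarrow> integrable (CP x) (\<lambda>\<omega>. (D (h y) y s \<omega>)\<^sup>2)"
      "\<And>y s x. 0 \<le> s \<Longrightarrow> s \<le> real T0 \<Longrightarrow> (RE x (\<lambda>\<omega>. (D (h y) y s \<omega>)\<^sup>2)) \<le> \<epsilon>2" by metis
  \<comment> \<open>With high probability the path stays within radius M - 1, where
    \<open>radial_weight \<rho> M\<close> is 1. The horizon is longer by 1 because
    \<open>good_not_exit\<close> covers only times strictly before it.\<close>
  have small: "eventually (\<lambda>M. \<forall>x\<in>cball \<rho> r. exit_prob X \<rho> (M - 1) (real T0 + 1) x \<le> \<epsilon> / 4) at_top"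
    using r \<epsilon> by (intro exit_prob_small) auto
  obtain M where M: "\<And>x. x \<in> cball \<rho> r \<Longrightarrow> exit_prob X \<rho> (M - 1) (real T0 + 1) x \<le> \<epsilon> / 4"
    using eventually_happens'[OF trivial_limit_at_top_linorder small] by blast
  \<comment> \<open>\<open>functional_approximation\<close> yields densities that are merely
    continuous and bounded; multiplied by a weight of compact support they become uniformly
    continuous.\<close>
  define h' where "h' y x = h y x * radial_weight \<rho> M x" for y x
  have h'c: "continuous_on UNIV (h' y)" and h'b: "\<exists>c. \<forall>x. 0 \<le> h' y x \<and> h' y x \<le> c" and h'0: "\<And>x. x \<notin> cball \<rho> M \<Longrightarrow> h' y x = 0" for y
  proof -
    note w = compact_weightD[OF compact_weight_radial[of \<rho> M]]
    obtain c where c: "continuous_on UNIV (h y)" "\<And>x. 0 \<le> h y x" "\<And>x. h y x \<le> c" using h[of y] by (auto simp: density_fun_def)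
    show "continuous_on UNIV (h' y)" unfolding h'_def[abs_def] by (intro continuous_intros c(1) w(1))
    have "0 \<le> h' y x \<and> h' y x \<le> c" for x
      using c(2,3)[of x] w(2,3)[of x] mult_mono[of "h y x" c "radial_weight \<rho> M x" 1] by (auto simp: h'_def intro: order_trans)
    then show "\<exists>c. \<forall>x. 0 \<le> h' y x \<and> h' y x \<le> c" by blast
    show "\<And>x. x \<notin> cball \<rho> M \<Longrightarrow> h' y x = 0" using w(5) by (simp add: h'_def)
  qed
  have h'd: "density_fun (h' y)" for y using h'c h'b unfolding density_fun_def by blast
  have h'u: "uniformly_continuous_on UNIV (h' y)" for y
    by (rule uniformly_continuous_vanishing[OF h'c h'0])
  define \<Phi> where "\<Phi> z = atomic_spacetime e0 J (\<lambda>(y, l). occupation (h' y) (real l * e0) (real (Suc l) * e0) z)" for z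
  have grid: "0 \<le> real l * e0" "real l * e0 \<le> real (Suc l) * e0" for l
    using e0(1) by (auto intro!: mult_right_mono)
  have grid': "real l * e0 \<le> real T0" if "l \<le> n" for l
    using that e0(1) unfolding e0(4)[symmetric] n_def[symmetric] by (intro mult_right_mono) auto
  show thesis
  proof (rule that[of \<Phi>])
    show "uc_map (submetric L0_metric S) (joint_metric S) (\<lambda>z. (z, \<Phi> z))" for S
      unfolding \<Phi>_def
    proof (rule uc_map_atomic[OF J less_imp_le[OF e0(1)]])
      fix j :: "'s \<times> nat" and e :: real assume "0 < e"
      obtain y l where j: "j = (y, l)" by (cases j)
      obtain c where c: "\<And>x. 0 \<le> h' y x" "\<And>x. h' y x \<le> c" using h'b[of y] by blast
      show "\<exists>\<delta>>0. \<forall>z z'. L0_dist z z' < \<delta> \<longrightarrow> \<bar>(case j of (y, l) \<Rightarrow> occupation (h' y) (real l * e0) (real (Suc l) * e0) z)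
          - (case j of (y, l) \<Rightarrow> occupation (h' y) (real l * e0) (real (Suc l) * e0) z')\<bar> < e"
        unfolding j prod.case by (rule occupation_uniformly_continuous[OF h'u c grid \<open>0 < e\<close>])
    qed
    fix x assume x: "x \<in> cball \<rho> r"
    interpret P: prob_space "CP x" by (rule prob_space_CP)
    let ?B = "\<lambda>\<omega>. rf dA ?\<phi>0 (real T0) \<omega>"
    define N1 where "N1 = {\<omega> \<in> space (CP x). \<epsilon> / (8 * e0) \<le> ?B \<omega>}"
    define N2 where "N2 = (\<lambda>(y, l). {\<omega> \<in> space (CP x). \<eta>\<^sup>2 \<le> (D (h y) y (real l * e0) \<omega>)\<^sup>2})"
    define N3 where "N3 = {\<omega> \<in> sample_space X. exit_time X (cball \<rho> (M - 1)) \<omega> < ennreal (real T0 + 1)}"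
    define G where "G = {\<omega> \<in> sample_space X. good \<omega>}"
    have Bm: "?B \<in> borel_measurable (CP x)" by (rule rf_measurable[OF clock_dA compact_weightD(7)[OF w0]]) simp
    have Bi: "integrable (CP x) ?B"
      by (rule integrableI_nonneg[OF Bm]) (use EB[of x] in \<open>auto simp: rf_nonneg intro: le_less_trans\<close>)
    have s1: "N1 \<in> sets (CP x)" unfolding N1_def using Bm by measurable
    have s2: "N2 j \<in> sets (CP x)" if j: "j \<in> K" for j
    proof -
      obtain y l where yl: "j = (y, l)" "l \<le> n" using j by (auto simp: K_def)
      note borel_measurable_integrable[OF hD(1)[OF grid(1) grid'[OF yl(2)], where y=y and x=x], measurable]
      show ?thesis unfolding N2_def yl prod.case by measurable
    qed
    have s3: "N3 \<in> sets (CP x)" unfolding N3_def by (rule sets_completionI_sets[OF exit_event_sets])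
    note sG = AE_CP_null(1)[OF AE_CP_good[of x], folded G_def] and cG = AE_CP_null(2)[OF AE_CP_good[of x], folded G_def]
      and eG = AE_CP_null(3)[OF AE_CP_good[of x], folded G_def]
    have m1: "emeasure (CP x) N1 \<le> ennreal (\<epsilon> / 4)"
    proof -
      have "emeasure (CP x) N1 \<le> ennreal (1 / (\<epsilon> / (8 * e0)) * RE x (\<lambda>\<omega>. ?B \<omega>))"
        unfolding N1_def using \<epsilon> e0 by (intro integral_Markov_inequality[OF Bi]) (auto simp: rf_nonneg)
      also have "\<dots> \<le> ennreal (\<epsilon> / 4)"
      proof (rule ennreal_leI)
        have "RE x (\<lambda>\<omega>. ?B \<omega>) \<le> C"
          using EB[of x] nn_integral_eq_integral[OF Bi] C by (simp add: rf_nonneg)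
        then have "8 * e0 / \<epsilon> * RE x (\<lambda>\<omega>. ?B \<omega>) \<le> 8 * e0 / \<epsilon> * C" using \<epsilon> e0 by (intro mult_left_mono) auto
        then show "1 / (\<epsilon> / (8 * e0)) * RE x (\<lambda>\<omega>. ?B \<omega>) \<le> \<epsilon> / 4" using e0(3) by simp
      qed
      finally show ?thesis .
    qed
    have m2: "emeasure (CP x) (\<Union>j\<in>K. N2 j) \<le> ennreal (\<epsilon> / 4)"
    proof -
      have "emeasure (CP x) (\<Union>j\<in>K. N2 j) \<le> (\<Sum>j\<in>K. emeasure (CP x) (N2 j))"
        using s2 K by (intro emeasure_subadditive_finite) auto
      also have "\<dots> \<le> (\<Sum>j\<in>K. ennreal (1 / \<eta>\<^sup>2 * \<epsilon>2))"
      proof (rule sum_mono)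
        fix j assume j: "j \<in> K"
        obtain y l where yl: "j = (y, l)" "l \<le> n" using j by (auto simp: K_def)
        have "emeasure (CP x) (N2 j) \<le> ennreal (1 / \<eta>\<^sup>2 * RE x (\<lambda>\<omega>. (D (h y) y (real l * e0) \<omega>)\<^sup>2))"
          unfolding N2_def yl prod.case using \<eta>
          by (intro integral_Markov_inequality[OF hD(1)[OF grid(1) grid'[OF yl(2)]]]) auto
        also have "\<dots> \<le> ennreal (1 / \<eta>\<^sup>2 * \<epsilon>2)"
          by (intro ennreal_leI mult_left_mono hD(2)[OF grid(1) grid'[OF yl(2)]]) simp
        finally show "emeasure (CP x) (N2 j) \<le> ennreal (1 / \<eta>\<^sup>2 * \<epsilon>2)" .
      qed
      also have "\<dots> = ennreal (real (card K) * (1 / \<eta>\<^sup>2 * \<epsilon>2))"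
        using \<epsilon>2 \<eta> by (simp add: ennreal_of_nat_eq_real_of_nat ennreal_mult[symmetric])
      also have "\<dots> \<le> ennreal (\<epsilon> / 4)" by (rule ennreal_leI[OF \<epsilon>2(2)])
      finally show ?thesis .
    qed
    have m3: "emeasure (CP x) N3 \<le> ennreal (\<epsilon> / 4)"
      unfolding N3_def emeasure_exit_event by (rule ennreal_leI[OF M[OF x]])
    have s2': "(\<Union>j\<in>K. N2 j) \<in> sets (CP x)" using K s2 by (intro sets.finite_UN) auto
    define H where "H = G - (N1 \<union> (\<Union>j\<in>K. N2 j) \<union> N3)"
    have sH: "H \<in> sets (CP x)" unfolding H_def by (intro sets.Diff sets.Un sG s1 s2' s3)
    have "emeasure (CP x) (sample_space X - H) \<le> emeasure (CP x) ((sample_space X - G) \<union> (N1 \<union> (\<Union>j\<in>K. N2 j) \<union> N3))"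
      by (intro emeasure_mono sets.Un cG s1 s2' s3) (auto simp: H_def)
    also have "\<dots> \<le> emeasure (CP x) (sample_space X - G) + emeasure (CP x) (N1 \<union> (\<Union>j\<in>K. N2 j) \<union> N3)"
      by (intro emeasure_subadditive sets.Un cG s1 s2' s3)
    also have "\<dots> \<le> 0 + (emeasure (CP x) (N1 \<union> (\<Union>j\<in>K. N2 j)) + emeasure (CP x) N3)"
      unfolding eG by (intro add_mono order_refl emeasure_subadditive sets.Un s1 s2' s3)
    also have "\<dots> \<le> 0 + ((emeasure (CP x) N1 + emeasure (CP x) (\<Union>j\<in>K. N2 j)) + emeasure (CP x) N3)"
      by (intro add_mono order_refl emeasure_subadditive s1 s2')
    also have "\<dots> \<le> 0 + ((ennreal (\<epsilon> / 4) + ennreal (\<epsilon> / 4)) + ennreal (\<epsilon> / 4))"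
      by (intro add_mono order_refl m1 m2 m3)
    also have "\<dots> = ennreal (3 * \<epsilon> / 4)" using \<epsilon> by (simp add: ennreal_plus[symmetric] del: ennreal_plus)
    also have "\<dots> \<le> ennreal \<epsilon>" using \<epsilon> by (intro ennreal_leI) simp
    finally have eH: "emeasure (CP x) (sample_space X - H) \<le> ennreal \<epsilon>" .
    have "good \<omega> \<and> measures_fin_dist (cut R \<omega>) (\<Phi> (path_class X \<omega>)) \<le> \<epsilon>" if \<omega>: "\<omega> \<in> H" for \<omega>
    proof
      show g: "good \<omega>" using \<omega> by (simp add: H_def G_def)
      have sp: "\<omega> \<in> sample_space X" by (rule good_space[OF g])
      have b1: "?B \<omega> < \<epsilon> / (8 * e0)" using \<omega> sp by (auto simp: H_def N1_def)
      have b2: "\<bar>D (h y) y (real l * e0) \<omega>\<bar> < \<eta>" if "y \<in> I" "l \<le> n" for y l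
      proof -
        have "\<omega> \<notin> N2 (y, l)" using \<omega> that by (auto simp: H_def K_def)
        then have "(D (h y) y (real l * e0) \<omega>)\<^sup>2 < \<eta>\<^sup>2" using sp by (simp add: N2_def)
        then have "\<bar>D (h y) y (real l * e0) \<omega>\<bar>\<^sup>2 < \<eta>\<^sup>2" by simp
        then show ?thesis by (rule power_less_imp_less_base) (use \<eta>(1) in simp)
      qed
      have b3: "\<not> exit_time X (cball \<rho> (M - 1)) \<omega> < ennreal (real T0 + 1)" using \<omega> sp by (auto simp: H_def N3_def)
      have same: "rf (\<lambda>_. lborel) (h' y) s \<omega> = rf (\<lambda>_. lborel) (h y) s \<omega>" if s: "s \<le> real T0" for y s
      proof -
        have "(\<integral>\<^sup>+u. ennreal (h' y (pos \<omega> u)) * indicator {0<..s} u \<partial>lborel) = (\<integral>\<^sup>+u. ennreal (h y (pos \<omega> u)) * indicator {0<..s} u \<partial>lborel)"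
        proof (rule nn_integral_cong)
          fix u
          show "ennreal (h' y (pos \<omega> u)) * indicator {0<..s} u = ennreal (h y (pos \<omega> u)) * indicator {0<..s} u"
          proof (cases "u \<in> {0<..s}")
            case True
            then have "dist \<rho> (pos \<omega> u) \<le> M - 1" using s by (intro good_not_exit[OF g b3]) auto
            then have "radial_weight \<rho> M (pos \<omega> u) = 1" by (simp add: radial_weight_def)
            then show ?thesis by (simp add: h'_def)
          qed simp
        qed
        then show ?thesis by (simp add: rf_def functional_def)
      qed
      let ?v = "grid_increment dA e0 \<phi> \<omega>"
      let ?v' = "\<lambda>(y, l). occupation (h' y) (real l * e0) (real (Suc l) * e0) (path_class X \<omega>)"
      have "\<bar>?v j - ?v' j\<bar> \<le> 2 * \<eta>" if j: "j \<in> J" for j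
      proof -
        obtain y l where yl: "j = (y, l)" "y \<in> I" "l < n" using j by (auto simp: J_def)
        have l: "l \<le> n" "Suc l \<le> n" using yl(3) by auto
        have "?v' j = rf (\<lambda>_. lborel) (h y) (real (Suc l) * e0) \<omega> - rf (\<lambda>_. lborel) (h y) (real l * e0) \<omega>"
          unfolding yl prod.case occupation_path[OF g h'd grid] same[OF grid'[OF l(1)]] same[OF grid'[OF l(2)]] ..
        then show ?thesis
          using b2[OF yl(2) l(1)] b2[OF yl(2) l(2)] unfolding D_def grid_increment_def yl prod.case by linarith
      qed
      then have "(\<Sum>j\<in>J. \<bar>?v j - ?v' j\<bar>) \<le> real (card J) * (2 * \<eta>)" by (rule sum_bounded_above)
      then have d2: "measures_fin_dist (atomic_spacetime e0 J ?v) (\<Phi> (path_class X \<omega>)) \<le> \<epsilon> / 8"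
        unfolding \<Phi>_def using \<eta>(2) measures_fin_dist_atomic[OF J less_imp_le[OF e0(1)], of ?v ?v'] by linarith
      have "e0 * ?B \<omega> \<le> e0 * (\<epsilon> / (8 * e0))" using b1 e0(1) by (intro mult_left_mono) auto
      also have "\<dots> = \<epsilon> / 8" using e0(1) by simp
      finally have "e0 * ?B \<omega> \<le> \<epsilon> / 8" .
      moreover have "measures_fin_dist (cut R \<omega>) (atomic_spacetime e0 J ?v) \<le> e0 + e0 * ?B \<omega> + exp (- real T0)"
        using disc[OF g, of n] unfolding J_def n_def e0(4) .
      ultimately have d1: "measures_fin_dist (cut R \<omega>) (atomic_spacetime e0 J ?v) \<le> 3 * \<epsilon> / 8"
        using e0(2) T0(2) by linarith
      have "measures_fin_dist (cut R \<omega>) (\<Phi> (path_class X \<omega>)) \<le>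
          measures_fin_dist (cut R \<omega>) (atomic_spacetime e0 J ?v) + measures_fin_dist (atomic_spacetime e0 J ?v) (\<Phi> (path_class X \<omega>))"
        unfolding \<Phi>_def using J e0(1)
        by (intro Metric_space.triangle[OF Metric_space_measures_fin] stom_measures_fin[OF g] atomic_spacetime_measures_fin) auto
      then show "measures_fin_dist (cut R \<omega>) (\<Phi> (path_class X \<omega>)) \<le> \<epsilon>" using d1 d2 \<epsilon> by linarith
    qed
    then show "\<exists>H\<in>sets (CP x). emeasure (CP x) (sample_space X - H) \<le> ennreal \<epsilon> \<and>
      (\<forall>\<omega>\<in>H. good \<omega> \<and> measures_fin_dist (cut R \<omega>) (\<Phi> (path_class X \<omega>)) \<le> \<epsilon>)"
      using sH eH by blast
  qed
qed

abbreviation with_path :: "('w \<Rightarrow> ('s \<times> real) measure) \<Rightarrow> 'w \<Rightarrow> 's L0 \<times> ('s \<times> real) measure" where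
  "with_path \<theta> \<equiv> \<lambda>\<omega>. (path_class X \<omega>, \<theta> \<omega>)"

definition carries_paths :: "'s L0 set \<Rightarrow> bool" where
  "carries_paths S \<longleftrightarrow> (\<forall>x. ae_measurable (CP x) (mborel (submetric L0_metric S)) (path_class X) \<and>
    (AE \<omega> in CP x. path_class X \<omega> \<in> S))"

lemma carries_paths_UNIV: "carries_paths UNIV"
  unfolding carries_paths_def submetric_L0_UNIV using path_class_ae_measurable by simp

text \<open>
  Measurability of \<^term>\<open>path_class X\<close> into \<^const>\<open>DL0_metric\<close> is hidden in the hypothesis that the law map
  takes values in the probability measures: \<^const>\<open>distr\<close> along a map for which the preimages do not define a
  measure is the zero measure.
\<close>

lemma carries_paths_cadlag: "carries_paths (abs_L0 ` {\<xi>. cadlag \<xi>})" (is "carries_paths ?S")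
  unfolding carries_paths_def
proof (intro allI conjI)
  fix x
  interpret P: prob_space "CP x" by (rule prob_space_CP)
  have D: "mspace DL0_metric = ?S" by (simp add: DL0_metric_def)
  have "prob_space (law_map X DL0_metric (path_class X) x)"
    using law_continuous unfolding continuous_map_metric_iff by auto
  from prob_space.emeasure_space_1[OF this]
  have "emeasure (distr (CP x) (mborel DL0_metric) (path_class X)) ?S = 1" unfolding law_map_def by (simp add: D)
  then have "emeasure (CP x) (path_class X -` ?S \<inter> space (CP x)) = 1"
    unfolding distr_def emeasure_measure_of_conv by (auto split: if_splits)
  then have "P.prob (path_class X -` ?S \<inter> space (CP x)) = 1" by (simp add: measure_def)
  from P.AE_prob_1[OF this] show S: "AE \<omega> in CP x. path_class X \<omega> \<in> ?S" by eventually_elim simp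
  have "?S \<inter> mspace L0_metric \<noteq> {}"
    by (auto simp: cadlag_def intro!: exI[of _ "\<lambda>_. x"])
  then show "ae_measurable (CP x) (mborel (submetric L0_metric ?S)) (path_class X)"
    by (rule ae_measurable_submetric[OF complete_CP P.not_empty path_class_ae_measurable S])
qed

text \<open>The path coordinate is the same on both sides, so only the distance of the measures
  counts; the null event that the path class lies outside \<open>S\<close> is added to the
  exceptional set.\<close>

lemma close_maps_path:
  assumes S: "carries_paths S" and H: "H \<in> sets (CP x)" "emeasure (CP x) (sample_space X - H) \<le> ennreal \<epsilon>"
    and \<theta>: "\<And>\<omega>. \<omega> \<in> H \<Longrightarrow> \<theta> \<omega> \<in> measures_fin \<and> \<theta>' \<omega> \<in> measures_fin \<and> measures_fin_dist (\<theta> \<omega>) (\<theta>' \<omega>) \<le> \<epsilon>"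
    and \<epsilon>: "0 \<le> \<epsilon>"
  shows "close_maps (CP x) (joint_metric S) \<epsilon> (\<lambda>\<omega>. (path_class X \<omega>, \<theta> \<omega>)) (\<lambda>\<omega>. (path_class X \<omega>, \<theta>' \<omega>))"
proof -
  have ae: "AE \<omega> in CP x. path_class X \<omega> \<in> S" using S by (simp add: carries_paths_def)
  define G where "G = {\<omega> \<in> sample_space X. path_class X \<omega> \<in> S}"
  note G = AE_CP_null(1)[OF ae, folded G_def] and eG = AE_CP_null(3)[OF ae, folded G_def]
  have c: "sample_space X - H \<in> sets (CP x)" "sample_space X - G \<in> sets (CP x)"
    using sets.compl_sets[OF H(1)] sets.compl_sets[OF G] by simp_all
  have "emeasure (CP x) (sample_space X - H \<inter> G) \<le> emeasure (CP x) ((sample_space X - H) \<union> (sample_space X - G))"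
    using c by (intro emeasure_mono) auto
  also have "\<dots> \<le> emeasure (CP x) (sample_space X - H) + emeasure (CP x) (sample_space X - G)"
    by (rule emeasure_subadditive[OF c])
  also have "\<dots> \<le> ennreal \<epsilon>" using H(2) eG by simp
  finally have e: "emeasure (CP x) (space (CP x) - H \<inter> G) \<le> ennreal \<epsilon>" by simp
  show ?thesis
    unfolding close_maps_def
  proof (intro bexI[of _ "H \<inter> G"] conjI ballI e)
    fix \<omega> assume \<omega>: "\<omega> \<in> H \<inter> G"
    then have m: "\<theta> \<omega> \<in> measures_fin" "\<theta>' \<omega> \<in> measures_fin" "measures_fin_dist (\<theta> \<omega>) (\<theta>' \<omega>) \<le> \<epsilon>" "path_class X \<omega> \<in> S"
      using \<theta>[of \<omega>] by (auto simp: G_def)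
    have "L0_dist (path_class X \<omega>) (path_class X \<omega>) = 0" by (simp add: Metric_space.zero[OF Metric_space_L0])
    then show "mdist (joint_metric S) (path_class X \<omega>, \<theta> \<omega>) (path_class X \<omega>, \<theta>' \<omega>) \<le> \<epsilon>"
      using m \<epsilon> by simp
  qed (use \<theta> H(1) G in \<open>auto simp: G_def\<close>)
qed

lemma path_approximation_close:
  assumes S: "carries_paths S" and r: "0 < r" and \<epsilon>: "0 < \<epsilon>"
  obtains \<Phi> where "uc_map (submetric L0_metric S) (joint_metric S) (\<lambda>z. (z, \<Phi> z))"
    "\<And>x. x \<in> cball \<rho> r \<Longrightarrow> close_maps (CP x) (joint_metric S) \<epsilon> (with_path (\<lambda>\<omega>. \<Phi> (path_class X \<omega>))) (with_path (cut R))"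
proof -
  obtain \<Phi> where \<Phi>: "\<And>S. uc_map (submetric L0_metric S) (joint_metric S) (\<lambda>z. (z, \<Phi> z))"
    and H: "\<And>x. x \<in> cball \<rho> r \<Longrightarrow> \<exists>H\<in>sets (CP x). emeasure (CP x) (sample_space X - H) \<le> ennreal \<epsilon> \<and>
      (\<forall>\<omega>\<in>H. good \<omega> \<and> measures_fin_dist (cut R \<omega>) (\<Phi> (path_class X \<omega>)) \<le> \<epsilon>)"
    by (rule path_approximation[OF r \<epsilon>, of R]) blast
  have \<Phi>_fin: "\<Phi> z \<in> measures_fin" for z using \<Phi>[of UNIV] by (auto simp: uc_map_def)
  show thesis
  proof (rule that[OF \<Phi>[of S]])
    fix x assume "x \<in> cball \<rho> r"
    then obtain H where H: "H \<in> sets (CP x)" "emeasure (CP x) (sample_space X - H) \<le> ennreal \<epsilon>"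
      "\<And>\<omega>. \<omega> \<in> H \<Longrightarrow> good \<omega> \<and> measures_fin_dist (cut R \<omega>) (\<Phi> (path_class X \<omega>)) \<le> \<epsilon>" using H by blast
    show "close_maps (CP x) (joint_metric S) \<epsilon> (with_path (\<lambda>\<omega>. \<Phi> (path_class X \<omega>))) (with_path (cut R))"
    proof (rule close_maps_path[OF S H(1,2)])
      fix \<omega> assume "\<omega> \<in> H"
      then show "\<Phi> (path_class X \<omega>) \<in> measures_fin \<and> cut R \<omega> \<in> measures_fin \<and> measures_fin_dist (\<Phi> (path_class X \<omega>)) (cut R \<omega>) \<le> \<epsilon>"
        using H(3)[of \<omega>] \<Phi>_fin stom_measures_fin(2) by (simp add: Metric_space.commute[OF Metric_space_measures_fin])
    qed (use \<epsilon> in simp)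
  qed
qed

text \<open>The random measure is not shown to be measurable directly: it is approximated in
  probability by measurable functionals of the path class, and limits in probability inherit
  measurability.\<close>

lemma cut_ae_measurable:
  assumes S: "carries_paths S"
  shows "ae_measurable (CP x) (mborel (joint_metric S)) (with_path (cut R))"
proof (rule close_maps_imp_ae_measurable[OF prob_space_CP])
  fix \<epsilon> :: real assume \<epsilon>: "0 < \<epsilon>"
  have r: "0 < dist \<rho> x + 1" by (simp add: add_nonneg_pos)
  obtain \<Phi> where \<Phi>: "uc_map (submetric L0_metric S) (joint_metric S) (\<lambda>z. (z, \<Phi> z))"
    "\<And>y. y \<in> cball \<rho> (dist \<rho> x + 1) \<Longrightarrow> close_maps (CP y) (joint_metric S) \<epsilon> (with_path (\<lambda>\<omega>. \<Phi> (path_class X \<omega>))) (with_path (cut R))"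
    by (rule path_approximation_close[OF S r \<epsilon>, of R]) blast
  have "ae_measurable (CP x) (mborel (joint_metric S)) (with_path (\<lambda>\<omega>. \<Phi> (path_class X \<omega>)))"
    using ae_measurable_comp[OF uc_map_measurable[OF \<Phi>(1)]] S unfolding carries_paths_def by blast
  then show "\<exists>g. ae_measurable (CP x) (mborel (joint_metric S)) g \<and> close_maps (CP x) (joint_metric S) \<epsilon> g (with_path (cut R))"
    using \<Phi>(2)[of x] by (intro exI conjI) auto
qed

text \<open>exp (- T) bounds the distance on paths that stay, the exit probability bounds the
  exceptional set; \<open>close_maps\<close> has one parameter, hence the sum, which is also the
  origin of the two terms in (ii).\<close>

lemma cut_close_stom:
  assumes S: "carries_paths S" and T: "0 \<le> T"
  shows "close_maps (CP x) (joint_metric S) (exp (- T) + exit_prob X \<rho> (R - 1) T x)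
    (with_path (cut R)) (with_path (stom X A))"
proof -
  define G where "G = {\<omega> \<in> sample_space X. good \<omega>}"
  define N where "N = {\<omega> \<in> sample_space X. exit_time X (cball \<rho> (R - 1)) \<omega> < ennreal T}"
  note G = AE_CP_null(1)[OF AE_CP_good[of x], folded G_def] and cG = AE_CP_null(2)[OF AE_CP_good[of x], folded G_def]
    and eG = AE_CP_null(3)[OF AE_CP_good[of x], folded G_def]
  have N: "N \<in> sets (CP x)" unfolding N_def by (rule sets_completionI_sets[OF exit_event_sets])
  have "emeasure (CP x) (sample_space X - (G - N)) \<le> emeasure (CP x) ((sample_space X - G) \<union> N)"
    using cG N by (intro emeasure_mono) auto
  also have "\<dots> \<le> emeasure (CP x) (sample_space X - G) + emeasure (CP x) N" by (rule emeasure_subadditive[OF cG N])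
  also have "\<dots> = ennreal (exit_prob X \<rho> (R - 1) T x)" unfolding eG N_def emeasure_exit_event by simp
  also have "\<dots> \<le> ennreal (exp (- T) + exit_prob X \<rho> (R - 1) T x)" by (rule ennreal_leI) simp
  finally have e: "emeasure (CP x) (sample_space X - (G - N)) \<le> ennreal (exp (- T) + exit_prob X \<rho> (R - 1) T x)" .
  show ?thesis
  proof (rule close_maps_path[OF S sets.Diff[OF G N] e])
    fix \<omega> assume \<omega>: "\<omega> \<in> G - N"
    then have g: "good \<omega>" "\<not> exit_time X (cball \<rho> (R - 1)) \<omega> < ennreal T" by (auto simp: G_def N_def)
    have "measures_fin_dist (cut R \<omega>) (stom X A \<omega>) \<le> exp (- T)"
      by (rule radial_cutoff_stom_dist[OF g(1) T good_not_exit[OF g]])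
    then show "cut R \<omega> \<in> measures_fin \<and> stom X A \<omega> \<in> measures_fin \<and>
        measures_fin_dist (cut R \<omega>) (stom X A \<omega>) \<le> exp (- T) + exit_prob X \<rho> (R - 1) T x"
      using stom_measures_fin[OF g(1)] exit_prob_nonneg[of \<rho> "R - 1" T x] by simp
  qed (simp add: exit_prob_nonneg)
qed

lemma cut_uniformly_close:
  assumes S: "carries_paths S" and r: "0 < r" and \<epsilon>: "0 < \<epsilon>"
  shows "eventually (\<lambda>R. \<forall>x\<in>cball \<rho> r. close_maps (CP x) (joint_metric S) \<epsilon>
    (with_path (cut R)) (with_path (stom X A))) at_top"
proof -
  define T where "T = max 1 (- ln (\<epsilon> / 2))"
  have T: "0 < T" by (simp add: T_def)
  have "exp (- T) \<le> exp (ln (\<epsilon> / 2))" by (simp add: T_def)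
  then have eT: "exp (- T) \<le> \<epsilon> / 2" using \<epsilon> by simp
  have "0 < \<epsilon> / 2" using \<epsilon> by simp
  from exit_prob_small[OF r T this] show ?thesis
  proof eventually_elim
    case (elim R)
    show ?case
    proof
      fix x assume "x \<in> cball \<rho> r"
      then have "exp (- T) + exit_prob X \<rho> (R - 1) T x \<le> \<epsilon>" using elim eT by fastforce
      then show "close_maps (CP x) (joint_metric S) \<epsilon> (with_path (cut R)) (with_path (stom X A))"
        by (rule close_maps_mono[OF cut_close_stom[OF S less_imp_le[OF T]]])
    qed
  qed
qed

lemma stom_ae_measurable:
  assumes S: "carries_paths S"
  shows "ae_measurable (CP x) (mborel (joint_metric S)) (with_path (stom X A))"
proof (rule close_maps_imp_ae_measurable[OF prob_space_CP])
  fix \<epsilon> :: real assume \<epsilon>: "0 < \<epsilon>"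
  have r: "0 < dist \<rho> x + 1" by (simp add: add_nonneg_pos)
  obtain R where R: "\<And>y. y \<in> cball \<rho> (dist \<rho> x + 1) \<Longrightarrow> close_maps (CP y) (joint_metric S) \<epsilon>
      (with_path (cut R)) (with_path (stom X A))"
    using eventually_happens'[OF trivial_limit_at_top_linorder cut_uniformly_close[OF S r \<epsilon>]] by blast
  have "close_maps (CP x) (joint_metric S) \<epsilon> (with_path (cut R)) (with_path (stom X A))"
    by (rule R) simp
  then show "\<exists>g. ae_measurable (CP x) (mborel (joint_metric S)) g \<and> close_maps (CP x) (joint_metric S) \<epsilon> g (with_path (stom X A))"
    using cut_ae_measurable[OF S] by blast
qed

section \<open>Continuity and convergence of the joint laws\<close>

lemma joint_law_eq: "joint_law X E \<Theta> x = distr (CP x) (mborel (max_metric E measures_fin_metric)) (\<lambda>\<omega>. (path_class X \<omega>, \<Theta> \<omega>))"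
  by (simp add: joint_law_def law_map_def)

lemma joint_law_dist:
  assumes S: "carries_paths S" and close: "close_maps (CP x) (joint_metric S) \<epsilon> (with_path (cut R)) (with_path (stom X A))"
    and \<epsilon>: "0 < \<epsilon>"
  shows "prohorov_dist (joint_metric S) (joint_law X (submetric L0_metric S) (cut R) x) (joint_law X (submetric L0_metric S) (stom X A) x) \<le> \<epsilon>"
  unfolding joint_law_eq
  by (rule prohorov_dist_close_maps[OF complete_CP cut_ae_measurable[OF S] stom_ae_measurable[OF S] close \<epsilon>])

lemma joint_law_prob:
  assumes S: "carries_paths S"
  shows "range (joint_law X (submetric L0_metric S) (cut R)) \<subseteq> mspace (prob_metric (joint_metric S))"
    "range (joint_law X (submetric L0_metric S) (stom X A)) \<subseteq> mspace (prob_metric (joint_metric S))"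
  using ae_measurable_distr[OF complete_CP prob_space_CP cut_ae_measurable[OF S]]
    ae_measurable_distr[OF complete_CP prob_space_CP stom_ae_measurable[OF S]]
  by (auto simp: joint_law_eq)

theorem cut_continuous:
  "continuous_map euclidean (mtopology_of (prob_metric (max_metric DL0_metric measures_fin_metric))) (joint_law X DL0_metric (cut R))"
proof -
  define S where "S = abs_L0 ` {\<xi>. cadlag (\<xi> :: real \<Rightarrow> 's)}"
  have D: "DL0_metric = submetric L0_metric S" by (simp add: DL0_metric_def S_def)
  have S: "carries_paths S" unfolding S_def by (rule carries_paths_cadlag)
  have pm: "ae_measurable (CP x) (mborel (submetric L0_metric S)) (path_class X)" for x using S by (simp add: carries_paths_def)
  let ?E = "submetric L0_metric S"
  note lc = law_continuous[unfolded D continuous_map_metric_iff]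
  show ?thesis
    unfolding D
  proof (rule continuous_map_local_uniform_limit[OF joint_law_prob(1)[OF S]])
    fix x and \<epsilon> :: real assume \<epsilon>: "0 < \<epsilon>"
    \<comment> \<open>The ball of this radius about \<rho> contains the unit ball about
      \<open>x\<close>, so the approximation is uniform near \<open>x\<close>.\<close>
    have r: "0 < dist \<rho> x + 1" by (simp add: add_nonneg_pos)
    obtain \<Phi> where uc: "uc_map ?E (joint_metric S) (\<lambda>z. (z, \<Phi> z))"
      and close: "\<And>y. y \<in> cball \<rho> (dist \<rho> x + 1) \<Longrightarrow> close_maps (CP y) (joint_metric S) \<epsilon> (with_path (\<lambda>\<omega>. \<Phi> (path_class X \<omega>))) (with_path (cut R))"
      by (rule path_approximation_close[OF S r \<epsilon>, of R]) blast
    \<comment> \<open>Written as a push-forward of the law of X, so that continuity of the law map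
      of X carries over; the fact \<open>F\<close> below identifies it with the law of a map on the
      sample space, to which closeness in probability applies.\<close>
    define F where "F y = distr (law_map X ?E (path_class X) y) (mborel (joint_metric S)) (\<lambda>z. (z, \<Phi> z))" for y
    note hm = uc_map_measurable[OF uc]
    have F: "F y = distr (CP y) (mborel (joint_metric S)) (with_path (\<lambda>\<omega>. \<Phi> (path_class X \<omega>)))" for y
      unfolding F_def law_map_def by (rule distr_comp_complete[OF complete_CP pm hm, symmetric])
    have Fm: "ae_measurable (CP y) (mborel (joint_metric S)) (with_path (\<lambda>\<omega>. \<Phi> (path_class X \<omega>)))" for y
      by (rule ae_measurable_comp[OF hm pm])
    have Fc: "continuous_map euclidean (mtopology_of (prob_metric (joint_metric S))) F"
      unfolding continuous_map_metric_iff
    proof (intro conjI allI impI)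
      show "range F \<subseteq> mspace (prob_metric (joint_metric S))"
        using ae_measurable_distr[OF complete_CP prob_space_CP Fm] by (auto simp: F)
      fix y and e :: real assume e: "0 < e"
      then have "0 < e / 2" by simp
      from prohorov_dist_uc_map[OF uc this] obtain d where d: "0 < d"
        "\<And>\<mu> \<nu>. \<mu> \<in> mspace (prob_metric ?E) \<Longrightarrow> \<nu> \<in> mspace (prob_metric ?E) \<Longrightarrow> prohorov_dist ?E \<mu> \<nu> < d \<Longrightarrow>
          prohorov_dist (joint_metric S) (distr \<mu> (mborel (joint_metric S)) (\<lambda>z. (z, \<Phi> z))) (distr \<nu> (mborel (joint_metric S)) (\<lambda>z. (z, \<Phi> z))) \<le> e / 2"
        by blast
      obtain d' where d': "0 < d'" "\<And>z. dist y z < d' \<Longrightarrow> mdist (prob_metric ?E) (law_map X ?E (path_class X) y) (law_map X ?E (path_class X) z) < d"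
        using lc d(1) by blast
      have "mdist (prob_metric (joint_metric S)) (F y) (F z) < e" if "dist y z < d'" for z
      proof -
        have l: "law_map X ?E (path_class X) w \<in> mspace (prob_metric ?E)" for w using lc by blast
        have "prohorov_dist (joint_metric S) (F y) (F z) \<le> e / 2"
          unfolding F_def by (rule d(2)[OF l l]) (use d'(2)[OF that] in simp)
        then show ?thesis using e by simp
      qed
      then show "\<exists>\<delta>>0. \<forall>z. dist y z < \<delta> \<longrightarrow> mdist (prob_metric (joint_metric S)) (F y) (F z) < e" using d'(1) by blast
    qed
    have "mdist (prob_metric (joint_metric S)) (F y) (joint_law X ?E (cut R) y) \<le> \<epsilon>" if y: "dist x y < 1" for y
    proof -
      have "y \<in> cball \<rho> (dist \<rho> x + 1)" using y dist_triangle[of \<rho> y x] by simp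
      from prohorov_dist_close_maps[OF complete_CP Fm cut_ae_measurable[OF S] close[OF this] \<epsilon>]
      show ?thesis by (simp add: F joint_law_eq)
    qed
    then show "\<exists>G. continuous_map euclidean (mtopology_of (prob_metric (joint_metric S))) G \<and>
      (\<exists>\<delta>>0. \<forall>y. dist x y < \<delta> \<longrightarrow> mdist (prob_metric (joint_metric S)) (G y) (joint_law X ?E (cut R) y) \<le> \<epsilon>)"
      using Fc by (intro exI[of _ F] conjI exI[of _ 1]) auto
  qed
qed

theorem stom_continuous:
  "continuous_map euclidean (mtopology_of (prob_metric (max_metric DL0_metric measures_fin_metric))) (joint_law X DL0_metric (stom X A))"
proof -
  define S where "S = abs_L0 ` {\<xi>. cadlag (\<xi> :: real \<Rightarrow> 's)}"
  have D: "DL0_metric = submetric L0_metric S" by (simp add: DL0_metric_def S_def)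
  have S: "carries_paths S" unfolding S_def by (rule carries_paths_cadlag)
  show ?thesis
    unfolding D
  proof (rule continuous_map_local_uniform_limit[OF joint_law_prob(2)[OF S]])
    fix x and \<epsilon> :: real assume \<epsilon>: "0 < \<epsilon>"
    have r: "0 < dist \<rho> x + 1" by (simp add: add_nonneg_pos)
    obtain R where R: "\<And>y. y \<in> cball \<rho> (dist \<rho> x + 1) \<Longrightarrow> close_maps (CP y) (joint_metric S) \<epsilon>
        (with_path (cut R)) (with_path (stom X A))"
      using eventually_happens'[OF trivial_limit_at_top_linorder cut_uniformly_close[OF S r \<epsilon>]] by blast
    have "mdist (prob_metric (joint_metric S)) (joint_law X (submetric L0_metric S) (cut R) y) (joint_law X (submetric L0_metric S) (stom X A) y) \<le> \<epsilon>"
      if y: "dist x y < 1" for y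
    proof -
      have "y \<in> cball \<rho> (dist \<rho> x + 1)" using y dist_triangle[of \<rho> y x] by simp
      from joint_law_dist[OF S R[OF this] \<epsilon>] show ?thesis by simp
    qed
    then show "\<exists>G. continuous_map euclidean (mtopology_of (prob_metric (joint_metric S))) G \<and>
      (\<exists>\<delta>>0. \<forall>y. dist x y < \<delta> \<longrightarrow> mdist (prob_metric (joint_metric S)) (G y) (joint_law X (submetric L0_metric S) (stom X A) y) \<le> \<epsilon>)"
      using cut_continuous[of R] unfolding D by (intro exI[of _ "joint_law X (submetric L0_metric S) (cut R)"] conjI exI[of _ 1]) auto
  qed
qed

theorem cut_converges:
  "limitin (compact_convergence (prob_metric (max_metric DL0_metric measures_fin_metric)))
    (\<lambda>R. joint_law X DL0_metric (cut R)) (joint_law X DL0_metric (stom X A)) at_top"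
proof (rule limitin_compact_convergence[OF stom_continuous, where \<rho>=\<rho>])
  show "\<forall>\<^sub>F R in at_top. continuous_map euclidean (mtopology_of (prob_metric (max_metric DL0_metric measures_fin_metric))) (joint_law X DL0_metric (cut R))"
    by (intro always_eventually allI cut_continuous)
  define S where "S = abs_L0 ` {\<xi>. cadlag (\<xi> :: real \<Rightarrow> 's)}"
  have D: "DL0_metric = submetric L0_metric S" by (simp add: DL0_metric_def S_def)
  have S: "carries_paths S" unfolding S_def by (rule carries_paths_cadlag)
  fix r \<epsilon> :: real assume \<epsilon>: "0 < \<epsilon>"
  have r: "0 < max r 1" by simp
  show "\<forall>\<^sub>F R in at_top. \<forall>x\<in>cball \<rho> r. mdist (prob_metric (max_metric DL0_metric measures_fin_metric))
      (joint_law X DL0_metric (cut R) x) (joint_law X DL0_metric (stom X A) x) \<le> \<epsilon>"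
    using cut_uniformly_close[OF S r \<epsilon>]
  proof eventually_elim
    case (elim R)
    show ?case
      unfolding D
    proof
      fix x assume "x \<in> cball \<rho> r"
      then have "x \<in> cball \<rho> (max r 1)" by simp
      with elim have "close_maps (CP x) (joint_metric S) \<epsilon> (with_path (cut R)) (with_path (stom X A))" by blast
      from joint_law_dist[OF S this \<epsilon>]
      show "mdist (prob_metric (joint_metric S)) (joint_law X (submetric L0_metric S) (cut R) x) (joint_law X (submetric L0_metric S) (stom X A) x) \<le> \<epsilon>"
        by simp
    qed
  qed
qed

text \<open>Within radius \<open>r\<close> the graphs are compared point by point with T = N in
  \<open>cut_close_stom\<close>; larger radii contribute exp (- r) because the integrand is capped
  at 1.\<close>

theorem d_hat_cut:
  assumes r: "0 < r"
  shows "d_hat \<rho> (prob_metric (max_metric L0_metric measures_fin_metric)) (joint_law X L0_metric (cut R)) (joint_law X L0_metric (stom X A))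
    \<le> exp (- r) + exp (- real N) + (SUP x\<in>cball \<rho> r. exit_prob X \<rho> (R - 1) (real N) x)"
proof -
  let ?s = "SUP x\<in>cball \<rho> r. exit_prob X \<rho> (R - 1) (real N) x"
  have c: "0 \<le> exp (- real N) + ?s"
    using exit_prob_le[of \<rho> \<rho> r "R - 1" "real N"] exit_prob_nonneg[of \<rho> "R - 1" "real N" \<rho>] r by (simp add: add_nonneg_nonneg)
  have le: "mdist (prob_metric (max_metric L0_metric measures_fin_metric)) (joint_law X L0_metric (cut R) x) (joint_law X L0_metric (stom X A) x)
      \<le> exp (- real N) + ?s" if x: "x \<in> cball \<rho> r" for x
  proof -
    have "prohorov_dist (joint_metric UNIV) (joint_law X (submetric L0_metric UNIV) (cut R) x) (joint_law X (submetric L0_metric UNIV) (stom X A) x)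
        \<le> exp (- real N) + exit_prob X \<rho> (R - 1) (real N) x"
      by (rule joint_law_dist[OF carries_paths_UNIV cut_close_stom[OF carries_paths_UNIV]]) (simp_all add: add_pos_nonneg exit_prob_nonneg)
    also have "\<dots> \<le> exp (- real N) + ?s" by (rule add_left_mono[OF exit_prob_le[OF x]])
    finally show ?thesis by (simp add: submetric_L0_UNIV)
  qed
  have "d_hat \<rho> (prob_metric (max_metric L0_metric measures_fin_metric)) (joint_law X L0_metric (cut R)) (joint_law X L0_metric (stom X A))
      \<le> (exp (- real N) + ?s) + exp (- r)"
    by (rule d_hat_le[OF less_imp_le[OF r] c le])
  then show ?thesis by simp
qed

end

theorem theorem5p30:
  fixes X :: "('w, 's::heine_borel) process" and Y :: "('v, 's) process"
    and \<rho> :: 's and m \<mu> :: "'s measure" and p :: "real \<Rightarrow> 's \<Rightarrow> 's \<Rightarrow> ennreal"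
    and A :: "ennreal \<Rightarrow> 'w \<Rightarrow> ennreal"
  assumes standard: "standard_process X"
    and dac: "dac_condition X Y m p"
    and conservative: "conservative X"
    and law_continuous:
      "continuous_map euclidean (mtopology_of (prob_metric DL0_metric)) (law_map X DL0_metric (path_class X))"
    and kernel_finite: "\<forall>t>0. \<forall>x y. p t x y < \<top>"
    and kernel_continuous: "continuous_on ({0<..} \<times> UNIV \<times> UNIV) (\<lambda>(t, x, y). p t x y)"
    and no_escape: "\<forall>r>0. \<forall>T>0. ((\<lambda>R. SUP x\<in>cball \<rho> r. exit_prob X \<rho> R T x) \<longlongrightarrow> 0) at_top"
    and kato: "local_kato_class X p \<mu>"
    and pcaf: "pcaf X A"
    and revuz: "revuz_correspondence X p \<mu> A"
  shows "continuous_map euclidean (mtopology_of (prob_metric (max_metric DL0_metric measures_fin_metric)))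
      (joint_law X DL0_metric (stom X A)) \<and>
    (\<forall>r>0. \<forall>N::nat. \<forall>R>1.
      d_hat \<rho> (prob_metric (max_metric L0_metric measures_fin_metric))
        (joint_law X L0_metric (\<lambda>\<omega>. radial_cutoff \<rho> R (stom X A \<omega>)))
        (joint_law X L0_metric (stom X A))
      \<le> exp (- r) + exp (- real N) + (SUP x\<in>cball \<rho> r. exit_prob X \<rho> (R - 1) (real N) x)) \<and>
    ((\<forall>R>1. continuous_map euclidean
          (mtopology_of (prob_metric (max_metric DL0_metric measures_fin_metric)))
          (joint_law X DL0_metric (\<lambda>\<omega>. radial_cutoff \<rho> R (stom X A \<omega>)))) \<and>
      limitin (compact_convergence (prob_metric (max_metric DL0_metric measures_fin_metric)))
        (\<lambda>R. joint_law X DL0_metric (\<lambda>\<omega>. radial_cutoff \<rho> R (stom X A \<omega>)))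
        (joint_law X DL0_metric (stom X A)) at_top)"
proof -
  obtain \<Lambda> where \<Lambda>: "\<Lambda> \<in> sets (augmented_filtration X \<top>)" "\<forall>x. emeasure (prob_from X (Some x)) \<Lambda> = 1"
      "\<forall>t<\<top>. time_shift X t ` \<Lambda> \<subseteq> \<Lambda>"
    and A: "\<forall>\<omega>\<in>\<Lambda>. A 0 \<omega> = 0 \<and> continuous_on {..<\<top>} (\<lambda>t. A t \<omega>) \<and> (\<forall>t<lifetime X \<omega>. A t \<omega> < \<top>) \<and>
        (\<forall>s t. lifetime X \<omega> \<le> s \<and> s \<le> t \<and> t < \<top> \<longrightarrow> A t \<omega> = A s \<omega>) \<and>
        (\<forall>s t. s < \<top> \<and> t < \<top> \<longrightarrow> A (t + s) \<omega> = A t \<omega> + A s (time_shift X t \<omega>))"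
    by (rule pcaf[unfolded pcaf_def, THEN conjunct2, THEN bexE]) (elim conjE, rule that; assumption)
  interpret standard_process X by (rule standard)
  interpret stom_process X A \<Lambda> p \<mu> \<rho>
  proof unfold_locales
    show "conservative X" by (rule conservative)
    show "t < \<top> \<Longrightarrow> A t \<in> borel_measurable (augmented_filtration X t)" for t using pcaf by (simp add: pcaf_def)
    show "t < \<top> \<Longrightarrow> \<omega> \<in> \<Lambda> \<Longrightarrow> time_shift X t \<omega> \<in> \<Lambda>" for t \<omega> using \<Lambda>(3) by blast
    show "(\<lambda>(t, x, y). p t x y) \<in> borel_measurable (restrict_space borel ({0<..} \<times> UNIV))"
      using dac by (simp add: dac_condition_def)
    show "0 < r \<Longrightarrow> 0 < T \<Longrightarrow> ((\<lambda>R. SUP x\<in>cball \<rho> r. exit_prob X \<rho> R T x) \<longlongrightarrow> 0) at_top" for r T using no_escape by blast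
  qed (use \<Lambda> A kernel_finite kernel_continuous revuz kato law_continuous in auto)
  show ?thesis
    by (intro conjI allI impI stom_continuous d_hat_cut cut_continuous cut_converges)
qed

end
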